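(* Let $\mathcal{H}$ be an admissible affine hyperplane arrangement in $E$ and let $L$ be a flat. The stratum $X=X(\mathcal{H},L)$ in $E_{\mathbb{C}}/\mathcal{W}_{\mathcal{H}}$ is smooth if and only if it is normal.
   Context: $E$ is a finite-dimensional Euclidean affine space with direction vector space $V$, and $E_{\mathbb{C}}=E+iV$ is its complexification. $\mathcal{H}$ is a (possibly infinite) set of affine hyperplanes of $E$, and $\mathcal{W}_{\mathcal{H}}$ is the group generated by the orthogonal reflections in the elements of $\mathcal{H}$. $\mathcal{H}$ is admissible if $\mathcal{W}_{\mathcal{H}}$, with the discrete topology, acts properly on $E$ and preserves $\mathcal{H}$. A flat is a nonempty intersection of elements of $\mathcal{H}$ ($E$ included); if $V(L)$ is the direction of $L$, then $L_{\mathbb{C}}=L+iV(L)$. The stratum $X(\mathcal{H},L):=\mathcal{W}_{\mathcal{H}}L_{\mathbb{C}}/\mathcal{W}_{\mathcal{H}}$ is a closed (reduced) analytic subvariety of $E_{\mathbb{C}}/\mathcal{W}_{\mathcal{H}}$, whose functions are the $\mathcal{W}_{\mathcal{H}}$-invariant analytic functions on $\mathcal{W}_{\mathcal{H}}L_{\mathbb{C}}$ (it carries a structure of affine algebraic variety). *)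

theory Defs
  imports
    "HOL-Analysis.Analysis"
    "HOL-Algebra.Bij"
    "HOL-Algebra.Generated_Groups"
    "HOL-Algebra.QuotRing"
begin

section \<open>Admissible arrangements and flats\<close>

text \<open>The Euclidean affine space \<open>E\<close> is a type \<open>'a\<close> of class \<open>euclidean_space\<close>; choosing an
  origin identifies it with its space \<open>V\<close> of directions, but nothing below depends on the origin.\<close>

definition affine_hyperplane :: "'a::euclidean_space set \<Rightarrow> bool" where
  "affine_hyperplane H \<longleftrightarrow> (\<exists>a b. a \<noteq> 0 \<and> H = {x. a \<bullet> x = b})"

text \<open>The midpoint of \<open>x\<close> and its mirror image is the orthogonal projection of \<open>x\<close> to \<open>H\<close>.\<close>

definition orth_reflection :: "'a::euclidean_space set \<Rightarrow> 'a \<Rightarrow> 'a" where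
  "orth_reflection H x = 2 *\<^sub>R closest_point H x - x"

definition refl_group :: "'a::euclidean_space set set \<Rightarrow> ('a \<Rightarrow> 'a) set" where
  "refl_group \<H> = generate (BijGroup UNIV) (orth_reflection ` \<H>)"

text \<open>A topological group acts properly if the map \<open>(w, x) \<mapsto> (w x, x)\<close> is proper.\<close>

definition admissible :: "'a::euclidean_space set set \<Rightarrow> bool" where
  "admissible \<H> \<longleftrightarrow>
     (\<forall>H\<in>\<H>. affine_hyperplane H) \<and>
     proper_map (prod_topology (discrete_topology (refl_group \<H>)) euclidean)
                (prod_topology euclidean euclidean) (\<lambda>(w, x). (w x, x)) \<and>
     (\<forall>w\<in>refl_group \<H>. \<forall>H\<in>\<H>. w ` H \<in> \<H>)"

text \<open>The empty subfamily gives \<open>E\<close> itself, since \<open>\<Inter>{} = UNIV\<close>.\<close>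

definition flat :: "'a::euclidean_space set set \<Rightarrow> 'a set \<Rightarrow> bool" where
  "flat \<H> L \<longleftrightarrow> L \<noteq> {} \<and> (\<exists>\<G>\<subseteq>\<H>. L = \<Inter>\<G>)"


section \<open>Complexification and analytic functions\<close>

text \<open>The point \<open>x + iy\<close> of \<open>E + iV\<close> is the pair \<open>(x, y)\<close>; multiplication by \<open>i\<close> on
  \<open>V + iV\<close> is then \<open>(x, y) \<mapsto> (-y, x)\<close>.\<close>

definition direction :: "'a::euclidean_space set \<Rightarrow> 'a set" where
  "direction L = {x - y | x y. x \<in> L \<and> y \<in> L}"

definition complexify :: "'a::euclidean_space set \<Rightarrow> ('a \<times> 'a) set" where
  "complexify L = L \<times> direction L"

text \<open>An affine map \<open>w\<close> of \<open>E\<close> acts on \<open>E + iV\<close> by \<open>w (x + iy) = w x + i (dw) y\<close>, where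
  \<open>dw = (\<lambda>y. w y - w 0)\<close> is its linear part.\<close>

definition complex_action :: "('a::euclidean_space \<Rightarrow> 'a) \<Rightarrow> 'a \<times> 'a \<Rightarrow> 'a \<times> 'a" where
  "complex_action w = (\<lambda>(x, y). (w x, w y - w 0))"

text \<open>Holomorphic on an open set: Frechet differentiable with complex-linear derivative.\<close>

definition holomorphic_EC :: "('a::euclidean_space \<times> 'a \<Rightarrow> complex) \<Rightarrow> ('a \<times> 'a) set \<Rightarrow> bool" where
  "holomorphic_EC f U \<longleftrightarrow>
     (\<forall>z\<in>U. \<exists>f'. (f has_derivative f') (at z) \<and> (\<forall>x y. f' (- y, x) = \<i> * f' (x, y)))"

text \<open>Functions on a (reduced) analytic subset, or on an open part \<open>S\<close> of one: local restrictions
  of holomorphic functions on the ambient space. It is not enough that \<open>f\<close> be analytic on each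
  irreducible component.\<close>

definition analytic_fun :: "('a::euclidean_space \<times> 'a) set \<Rightarrow> ('a \<times> 'a \<Rightarrow> complex) \<Rightarrow> bool" where
  "analytic_fun S f \<longleftrightarrow>
     (\<forall>z\<in>S. \<exists>U g. open U \<and> z \<in> U \<and> holomorphic_EC g U \<and> (\<forall>u\<in>U \<inter> S. f u = g u))"


section \<open>The stratum as a topological space with a sheaf of functions\<close>

definition refl_orbit :: "'a::euclidean_space set set \<Rightarrow> 'a \<times> 'a \<Rightarrow> ('a \<times> 'a) set" where
  "refl_orbit \<H> z = (\<lambda>w. complex_action w z) ` refl_group \<H>"

definition translates :: "'a::euclidean_space set set \<Rightarrow> 'a set \<Rightarrow> ('a \<times> 'a) set" where
  "translates \<H> L = (\<Union>w\<in>refl_group \<H>. complex_action w ` complexify L)"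

text \<open>The points of the stratum are orbits, and it carries the quotient topology.\<close>

definition stratum :: "'a::euclidean_space set set \<Rightarrow> 'a set \<Rightarrow> ('a \<times> 'a) set topology" where
  "stratum \<H> L = topology (\<lambda>U. U \<subseteq> refl_orbit \<H> ` translates \<H> L \<and>
     openin (top_of_set (translates \<H> L)) {z \<in> translates \<H> L. refl_orbit \<H> z \<in> U})"

lemma openin_stratum:
  "openin (stratum \<H> L) U \<longleftrightarrow> U \<subseteq> refl_orbit \<H> ` translates \<H> L \<and>
     openin (top_of_set (translates \<H> L)) {z \<in> translates \<H> L. refl_orbit \<H> z \<in> U}"
proof -
  let ?T = "top_of_set (translates \<H> L)"
  let ?P = "\<lambda>U. {z \<in> translates \<H> L. refl_orbit \<H> z \<in> U}"
  have Int: "?P (S \<inter> T) = ?P S \<inter> ?P T" for S T by auto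
  have Un: "?P (\<Union>\<K>) = \<Union>(?P ` \<K>)" for \<K> by auto
  have "istopology (\<lambda>U. U \<subseteq> refl_orbit \<H> ` translates \<H> L \<and> openin ?T (?P U))"
    unfolding istopology_def
  proof (intro conjI allI impI)
    fix S T
    assume "S \<subseteq> refl_orbit \<H> ` translates \<H> L \<and> openin ?T (?P S)"
      and "T \<subseteq> refl_orbit \<H> ` translates \<H> L \<and> openin ?T (?P T)"
    then show "S \<inter> T \<subseteq> refl_orbit \<H> ` translates \<H> L" "openin ?T (?P (S \<inter> T))"
      unfolding Int by (auto intro: openin_Int)
  next
    fix \<K>
    assume *: "\<forall>K\<in>\<K>. K \<subseteq> refl_orbit \<H> ` translates \<H> L \<and> openin ?T (?P K)"
    then show "\<Union>\<K> \<subseteq> refl_orbit \<H> ` translates \<H> L" by blast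
    show "openin ?T (?P (\<Union>\<K>))"
      unfolding Un using * by (intro openin_Union) auto
  qed
  then show ?thesis
    unfolding stratum_def by simp
qed

lemma topspace_stratum: "topspace (stratum \<H> L) = refl_orbit \<H> ` translates \<H> L"
proof -
  have "{z \<in> translates \<H> L. refl_orbit \<H> z \<in> refl_orbit \<H> ` translates \<H> L} = translates \<H> L"
    by auto
  then have "openin (stratum \<H> L) (refl_orbit \<H> ` translates \<H> L)"
    by (simp add: openin_stratum)
  then show ?thesis
    by (meson openin_stratum openin_subset openin_topspace subset_antisym)
qed

lemma quotient_map_stratum:
  "quotient_map (top_of_set (translates \<H> L)) (stratum \<H> L) (refl_orbit \<H>)"
  by (auto simp: quotient_map_def topspace_stratum openin_stratum)

text \<open>A function on an open set \<open>U\<close> of the stratum is the same as an invariant function on the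
  preimage of \<open>U\<close>. Values outside \<open>U\<close> are irrelevant.\<close>

definition stratum_sheaf ::
    "'a::euclidean_space set set \<Rightarrow> 'a set \<Rightarrow> ('a \<times> 'a) set set \<Rightarrow> (('a \<times> 'a) set \<Rightarrow> complex) set" where
  "stratum_sheaf \<H> L U =
     {f. analytic_fun {z \<in> translates \<H> L. refl_orbit \<H> z \<in> U} (\<lambda>z. f (refl_orbit \<H> z))}"


section \<open>Local rings, normality and smoothness\<close>

text \<open>In this section \<open>X\<close> is a topological space and \<open>F U\<close> is the set of regular functions on an
  open set \<open>U\<close>, with functions extended arbitrarily outside \<open>U\<close>.\<close>

definition near_ring :: "'p topology \<Rightarrow> ('p set \<Rightarrow> ('p \<Rightarrow> complex) set) \<Rightarrow> 'p \<Rightarrow> ('p \<Rightarrow> complex) ring" where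
  "near_ring X F p =
     \<lparr>carrier = {f. \<exists>U. openin X U \<and> p \<in> U \<and> f \<in> F U},
      mult = (\<lambda>f g x. f x * g x), one = (\<lambda>x. 1),
      zero = (\<lambda>x. 0), add = (\<lambda>f g x. f x + g x)\<rparr>"

definition vanishing_near :: "'p topology \<Rightarrow> 'p \<Rightarrow> ('p \<Rightarrow> complex) set" where
  "vanishing_near X p = {f. \<exists>U. openin X U \<and> p \<in> U \<and> (\<forall>x\<in>U. f x = 0)}"

text \<open>The ring of germs at \<open>p\<close>: two functions have the same germ iff their difference vanishes
  near \<open>p\<close>.\<close>

definition local_ring ::
    "'p topology \<Rightarrow> ('p set \<Rightarrow> ('p \<Rightarrow> complex) set) \<Rightarrow> 'p \<Rightarrow> ('p \<Rightarrow> complex) set ring" where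
  "local_ring X F p = near_ring X F p Quot vanishing_near X p"

text \<open>The fraction \<open>a / b\<close> (with \<open>b \<noteq> 0\<close>) of a domain \<open>R\<close> is a root of the monic polynomial
  \<open>T ^ n + (\<Sum>i<n. c i * T ^ i)\<close> over \<open>R\<close>; the equation in the field of fractions is written
  after multiplication by \<open>b ^ n\<close>.\<close>

definition integral_fraction :: "('r, 'm) ring_scheme \<Rightarrow> 'r \<Rightarrow> 'r \<Rightarrow> bool" where
  "integral_fraction R a b \<longleftrightarrow>
     (\<exists>(n::nat) c. c \<in> {..<n} \<rightarrow> carrier R \<and>
        a [^]\<^bsub>R\<^esub> n \<oplus>\<^bsub>R\<^esub> (\<Oplus>\<^bsub>R\<^esub>i\<in>{..<n}. c i \<otimes>\<^bsub>R\<^esub> a [^]\<^bsub>R\<^esub> i \<otimes>\<^bsub>R\<^esub> b [^]\<^bsub>R\<^esub> (n - i)) = \<zero>\<^bsub>R\<^esub>)"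

text \<open>Every fraction \<open>a / b\<close> integral over \<open>R\<close> equals some \<open>r\<close> in \<open>R\<close>.\<close>

definition integrally_closed_domain :: "('r, 'm) ring_scheme \<Rightarrow> bool" where
  "integrally_closed_domain R \<longleftrightarrow> domain R \<and>
     (\<forall>a\<in>carrier R. \<forall>b\<in>carrier R - {\<zero>\<^bsub>R\<^esub>}.
        integral_fraction R a b \<longrightarrow> (\<exists>r\<in>carrier R. a = r \<otimes>\<^bsub>R\<^esub> b))"

definition normal_variety :: "'p topology \<Rightarrow> ('p set \<Rightarrow> ('p \<Rightarrow> complex) set) \<Rightarrow> bool" where
  "normal_variety X F \<longleftrightarrow> (\<forall>p\<in>topspace X. integrally_closed_domain (local_ring X F p))"

text \<open>Smooth means locally isomorphic, as a space with a sheaf of functions, to an open subset of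
  some \<open>\<complex>\<^sup>d\<close>. Here \<open>\<complex>\<^sup>d\<close> is realized as the complexification \<open>M + iM\<close> of a \<open>d\<close>-dimensional
  subspace \<open>M\<close> of the vector space \<open>'a\<close>, so \<open>0 \<le> d \<le> DIM('a)\<close>. For subvarieties of an
  \<open>n\<close>-dimensional space with \<open>n = DIM('a)\<close> no other \<open>d\<close> can occur. Pulling back along a bijection
  \<open>\<phi>\<close> reaches all functions on an open set \<open>N\<close>, so the equivalence determines the sheaf.\<close>

definition smooth_variety ::
    "('a::euclidean_space \<times> 'a) set topology \<Rightarrow>
     (('a \<times> 'a) set set \<Rightarrow> (('a \<times> 'a) set \<Rightarrow> complex) set) \<Rightarrow> bool" where
  "smooth_variety X F \<longleftrightarrow>
     (\<forall>p\<in>topspace X. \<exists>U (M::'a set) D (\<phi>::('a \<times> 'a) set \<Rightarrow> 'a \<times> 'a).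
        openin X U \<and> p \<in> U \<and>
        subspace M \<and> openin (top_of_set (M \<times> M)) D \<and>
        homeomorphic_map (subtopology X U) (top_of_set D) \<phi> \<and>
        (\<forall>N g. openin X N \<and> N \<subseteq> U \<longrightarrow>
           (analytic_fun (\<phi> ` N) g \<longleftrightarrow> (\<lambda>x. g (\<phi> x)) \<in> F N)))"

end

theory Submission
  imports Defs "HOL-Complex_Analysis.Complex_Analysis"
begin

text \<open>Near the orbit of \<open>z\<close> in the complexification of \<open>L\<close>, the preimage of the stratum is a finite union
  of linear sheets through \<open>z\<close>, permuted by the stabilizer of \<open>z\<close>. At a smooth point, a fraction integral
  over the local ring is bounded and extends by Riemann's theorem, so the stratum is normal. Conversely, take an
  analytic function on the sheet of \<open>L\<close> that is invariant under the elements of the stabilizer preserving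
  \<open>L\<close>, carry it over to the conjugate sheets and extend it by zero to the others. The result is a root
  of the monic polynomial whose roots are its values on the sheets, so by normality it is analytic on the
  stratum. For the constant 1 this shows that all sheets are conjugate. For a coordinate normal to a
  hyperplane \<open>L \<inter> H\<close> of \<open>L\<close> it shows that some element of the group reflects \<open>L\<close> in \<open>L \<inter> H\<close>.
  Hence the stabilizer acts on \<open>L\<close> as a finite reflection group, the quotient by which is smooth by
  Chevalley's theorem, and the coordinates of this quotient extend to a chart of the stratum.\<close>

section \<open>Holomorphic functions of several variables\<close>

text \<open>The obstacle is the meaning of analyticity: a function on the stratum must be locally
  the restriction of a single ambient holomorphic function, and a function that is analytic on each
  sheet need not be one. Normality supplies what gluing cannot. A function prescribed on the sheets
  is written as a fraction \<open>a / b\<close> with ambient holomorphic, stabilizer-invariant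
  \<open>a\<close> and \<open>b\<close>, where \<open>b\<close> is a sum of polynomials each
  vanishing on all sheets but one; where the fraction is defined on a sheet, it is the prescribed
  function.

  Chevalley's theorem enters as a statement about a map. Its algebraic half bounds the number of
  generating invariants by the dimension of \<open>L\<close>. The rest is topology: the map they
  define is closed by homogeneity and locally invertible where a discriminant does not vanish, and
  the complement of the zeros of an entire function is connected and dense, so the map is onto and
  open.

  All maps live on the full space V + iV, the flat being completed by its orthogonal complement.
  This keeps one notion of holomorphy for all dimensions and makes invariance of domain
  applicable.\<close>

declare split_paired_All [simp del] split_paired_Ex [simp del]

definition cscale :: "complex \<Rightarrow> 'a::euclidean_space \<times> 'a \<Rightarrow> 'a \<times> 'a" where
  "cscale c z = (Re c *\<^sub>R fst z - Im c *\<^sub>R snd z, Re c *\<^sub>R snd z + Im c *\<^sub>R fst z)"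

definition hol_map :: "('a::euclidean_space \<times> 'a \<Rightarrow> 'a \<times> 'a) \<Rightarrow> ('a \<times> 'a) set \<Rightarrow> bool" where
  "hol_map T U \<longleftrightarrow> (\<forall>z\<in>U. \<exists>T'. (T has_derivative T') (at z) \<and>
     (\<forall>x y. T' (- y, x) = cscale \<i> (T' (x, y))))"

definition dir_deriv :: "('a::euclidean_space \<times> 'a \<Rightarrow> complex) \<Rightarrow> 'a \<times> 'a \<Rightarrow> 'a \<times> 'a \<Rightarrow> complex" where
  "dir_deriv f z = frechet_derivative f (at z)"

lemma cscale_simps [simp]:
  "cscale 1 z = z" "cscale 0 z = 0" "cscale c 0 = 0" "cscale \<i> (x, y) = (- y, x)"
  by (auto simp: cscale_def zero_prod_def)

lemma cscale_of_real: "cscale (of_real r) z = r *\<^sub>R z"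
  by (auto simp: cscale_def scaleR_prod_def)

lemma cscale_add_right: "cscale c (z + w) = cscale c z + cscale c w"
  by (auto simp: cscale_def algebra_simps)

lemma cscale_add_left: "cscale (c + d) z = cscale c z + cscale d z"
  by (auto simp: cscale_def algebra_simps)

lemma cscale_cscale: "cscale c (cscale d z) = cscale (c * d) z"
  by (auto simp: cscale_def algebra_simps)

lemma norm_cscale: "norm (cscale c z) = norm c * norm z"
proof -
  obtain x y where z: "z = (x, y)" by (cases z)
  have "(norm (cscale c z))\<^sup>2 = (Re c ^ 2 + Im c ^ 2) * (x \<bullet> x + y \<bullet> y)"
    unfolding power2_norm_eq_inner
    by (simp add: z cscale_def inner_diff_left inner_diff_right
        inner_add_left inner_add_right inner_commute)
      (simp add: algebra_simps power2_eq_square)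
  also have "\<dots> = (norm c * norm z)\<^sup>2"
    by (simp add: z norm_Pair power_mult_distrib cmod_power2 power2_norm_eq_inner)
  finally show ?thesis
    by (metis norm_ge_zero power2_eq_iff_nonneg zero_le_mult_iff)
qed

lemma bounded_linear_cscale_left: "bounded_linear (\<lambda>c. cscale c z)"
  by (rule bounded_linear_intro[of _ "norm z"])
    (auto simp: cscale_add_left norm_cscale, auto simp: cscale_def algebra_simps)

lemma continuous_on_cscale [continuous_intros]:
  "continuous_on S f \<Longrightarrow> continuous_on S g \<Longrightarrow> continuous_on S (\<lambda>x. cscale (f x) (g x))"
  unfolding cscale_def by (intro continuous_intros)

lemma has_derivative_cscale_line:
  "((\<lambda>t. z + cscale t v) has_derivative (\<lambda>h. cscale h v)) (at t)"
  by (rule has_derivative_eq_rhs, rule derivative_intros, rule derivative_intros,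
      rule bounded_linear_imp_has_derivative[OF bounded_linear_cscale_left]) auto

lemma clinear_cscale:
  assumes "linear f'" and "\<And>x y. f' (- y, x) = \<i> * f' (x, y)"
  shows "f' (cscale c z) = c * f' z"
proof -
  obtain x y where z: "z = (x, y)" by (cases z)
  have "cscale c z = Re c *\<^sub>R z + Im c *\<^sub>R (- y, x)"
    by (simp add: z cscale_def)
  then have "f' (cscale c z) = Re c *\<^sub>R f' z + Im c *\<^sub>R f' (- y, x)"
    by (simp only: linear_add[OF assms(1)] linear_scale[OF assms(1)])
  then show ?thesis
    using assms(2)[of y x] unfolding z by (simp add: scaleR_conv_of_real complex_eq_iff)
qed

lemma has_derivative_imp_dir_deriv: "(f has_derivative f') (at z) \<Longrightarrow> dir_deriv f z = f'"
  unfolding dir_deriv_def using frechet_derivative_at by metis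

lemma holomorphic_EC_has_derivative:
  assumes "holomorphic_EC f U" "z \<in> U"
  shows "(f has_derivative dir_deriv f z) (at z)"
    and "dir_deriv f z (- y, x) = \<i> * dir_deriv f z (x, y)"
    and "dir_deriv f z (cscale c v) = c * dir_deriv f z v"
proof -
  obtain f' where f': "(f has_derivative f') (at z)" "\<forall>x y. f' (- y, x) = \<i> * f' (x, y)"
    using assms unfolding holomorphic_EC_def by blast
  have e: "dir_deriv f z = f'" using f'(1) by (rule has_derivative_imp_dir_deriv)
  show "(f has_derivative dir_deriv f z) (at z)" "dir_deriv f z (- y, x) = \<i> * dir_deriv f z (x, y)"
    using f' e by auto
  show "dir_deriv f z (cscale c v) = c * dir_deriv f z v"
    unfolding e using f' by (intro clinear_cscale has_derivative_linear) auto
qed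

lemma holomorphic_EC_I:
  assumes "\<And>z. z \<in> U \<Longrightarrow> (f has_derivative f' z) (at z)"
    and "\<And>z x y. z \<in> U \<Longrightarrow> f' z (- y, x) = \<i> * f' z (x, y)"
  shows "holomorphic_EC f U"
  using assms unfolding holomorphic_EC_def by blast

lemma holomorphic_EC_subset: "holomorphic_EC f U \<Longrightarrow> V \<subseteq> U \<Longrightarrow> holomorphic_EC f V"
  unfolding holomorphic_EC_def by blast

lemma holomorphic_EC_locally: "(\<And>z. z \<in> U \<Longrightarrow> \<exists>V. z \<in> V \<and> holomorphic_EC f V) \<Longrightarrow> holomorphic_EC f U"
  unfolding holomorphic_EC_def by blast

lemma holomorphic_EC_cong:
  assumes "open U" "\<And>u. u \<in> U \<Longrightarrow> f u = g u" "holomorphic_EC f U"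
  shows "holomorphic_EC g U"
proof (rule holomorphic_EC_I)
  fix z assume z: "z \<in> U"
  show "(g has_derivative dir_deriv f z) (at z)"
    by (rule has_derivative_transform_within_open[OF holomorphic_EC_has_derivative(1)[OF assms(3) z] assms(1) z assms(2)])
  show "dir_deriv f z (- y, x) = \<i> * dir_deriv f z (x, y)" for x y
    by (rule holomorphic_EC_has_derivative(2)[OF assms(3) z])
qed

lemma holomorphic_EC_const [simp]: "holomorphic_EC (\<lambda>z. c) U"
  by (rule holomorphic_EC_I[where f' = "\<lambda>_ _. 0"]) auto

lemma holomorphic_EC_add:
  assumes "holomorphic_EC f U" "holomorphic_EC g U"
  shows "holomorphic_EC (\<lambda>z. f z + g z) U"
  by (rule holomorphic_EC_I, rule derivative_intros,
      erule holomorphic_EC_has_derivative[OF assms(1)], erule holomorphic_EC_has_derivative[OF assms(2)])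
    (auto simp: holomorphic_EC_has_derivative(2)[OF assms(1)] holomorphic_EC_has_derivative(2)[OF assms(2)]
      algebra_simps)

lemma holomorphic_EC_mult:
  assumes "holomorphic_EC f U" "holomorphic_EC g U"
  shows "holomorphic_EC (\<lambda>z. f z * g z) U"
  by (rule holomorphic_EC_I, rule derivative_intros,
      erule holomorphic_EC_has_derivative[OF assms(1)], erule holomorphic_EC_has_derivative[OF assms(2)])
    (auto simp: holomorphic_EC_has_derivative(2)[OF assms(1)] holomorphic_EC_has_derivative(2)[OF assms(2)]
      algebra_simps)

lemma holomorphic_EC_uminus:
  assumes "holomorphic_EC f U"
  shows "holomorphic_EC (\<lambda>z. - f z) U"
  using holomorphic_EC_mult[OF holomorphic_EC_const[of "-1"] assms] by simp

lemma holomorphic_EC_diff: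
  assumes "holomorphic_EC f U" "holomorphic_EC g U"
  shows "holomorphic_EC (\<lambda>z. f z - g z) U"
  using holomorphic_EC_add[OF assms(1) holomorphic_EC_uminus[OF assms(2)]] by simp

lemma holomorphic_EC_sum:
  "(\<And>i. i \<in> I \<Longrightarrow> holomorphic_EC (f i) U) \<Longrightarrow> holomorphic_EC (\<lambda>z. \<Sum>i\<in>I. f i z) U"
  by (induction I rule: infinite_finite_induct) (auto intro: holomorphic_EC_add)

lemma holomorphic_EC_prod:
  "(\<And>i. i \<in> I \<Longrightarrow> holomorphic_EC (f i) U) \<Longrightarrow> holomorphic_EC (\<lambda>z. \<Prod>i\<in>I. f i z) U"
  by (induction I rule: infinite_finite_induct) (auto intro: holomorphic_EC_mult)

lemma holomorphic_EC_continuous_on: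
  assumes "holomorphic_EC f U" shows "continuous_on U f"
  using holomorphic_EC_has_derivative(1)[OF assms] has_derivative_continuous
  by (metis continuous_at_imp_continuous_on)

lemma holomorphic_EC_compose_field:
  assumes "holomorphic_EC f U" and "\<And>z. z \<in> U \<Longrightarrow> (h has_field_derivative h' (f z)) (at (f z))"
  shows "holomorphic_EC (\<lambda>z. h (f z)) U"
proof (rule holomorphic_EC_I)
  fix z assume z: "z \<in> U"
  show "((\<lambda>z. h (f z)) has_derivative (\<lambda>v. h' (f z) * dir_deriv f z v)) (at z)"
    using has_derivative_compose[OF holomorphic_EC_has_derivative(1)[OF assms(1) z]
      assms(2)[OF z, unfolded has_field_derivative_def]] .
  show "h' (f z) * dir_deriv f z (- y, x) = \<i> * (h' (f z) * dir_deriv f z (x, y))" for x y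
    using holomorphic_EC_has_derivative(2)[OF assms(1) z] by simp
qed

lemma holomorphic_EC_divide:
  assumes "holomorphic_EC f U" "holomorphic_EC g U" "\<And>z. z \<in> U \<Longrightarrow> g z \<noteq> 0"
  shows "holomorphic_EC (\<lambda>z. f z / g z) U"
proof -
  have "holomorphic_EC (\<lambda>z. inverse (g z)) U"
    by (rule holomorphic_EC_compose_field[OF assms(2), where h = inverse and h' = "\<lambda>w. - (inverse w ^ 2)"])
      (use assms(3) DERIV_inverse in \<open>auto simp: numeral_2_eq_2\<close>)
  from holomorphic_EC_mult[OF assms(1) this] show ?thesis by (simp add: divide_inverse)
qed

lemma hol_map_has_derivative:
  assumes "hol_map T U" "z \<in> U"
  obtains T' where "(T has_derivative T') (at z)" "\<And>x y. T' (- y, x) = cscale \<i> (T' (x, y))"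
  using assms unfolding hol_map_def by blast

lemma hol_map_subset: "hol_map T U \<Longrightarrow> V \<subseteq> U \<Longrightarrow> hol_map T V"
  unfolding hol_map_def by blast

lemma holomorphic_EC_compose:
  assumes "hol_map T U" "holomorphic_EC f V" "\<And>u. u \<in> U \<Longrightarrow> T u \<in> V"
  shows "holomorphic_EC (\<lambda>z. f (T z)) U"
  unfolding holomorphic_EC_def
proof
  fix z assume z: "z \<in> U"
  obtain T' where T': "(T has_derivative T') (at z)" "\<And>x y. T' (- y, x) = cscale \<i> (T' (x, y))"
    by (rule hol_map_has_derivative[OF assms(1) z]) blast
  have "((\<lambda>z. f (T z)) has_derivative (\<lambda>v. dir_deriv f (T z) (T' v))) (at z)"
    using has_derivative_compose[OF T'(1) holomorphic_EC_has_derivative(1)[OF assms(2) assms(3)[OF z]]] .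
  moreover have "dir_deriv f (T z) (T' (- y, x)) = \<i> * dir_deriv f (T z) (T' (x, y))" for x y
    using holomorphic_EC_has_derivative(3)[OF assms(2) assms(3)[OF z]] T'(2) by simp
  ultimately show "\<exists>f'. ((\<lambda>z. f (T z)) has_derivative f') (at z) \<and> (\<forall>x y. f' (- y, x) = \<i> * f' (x, y))"
    by blast
qed

lemma hol_map_continuous_on: "hol_map T U \<Longrightarrow> continuous_on U T"
  by (meson continuous_at_imp_continuous_on has_derivative_continuous hol_map_def)

lemma hol_map_affine:
  assumes "linear T'" "\<And>x y. T' (- y, x) = cscale \<i> (T' (x, y))"
  shows "hol_map (\<lambda>z. a + T' (z - c)) U"
  unfolding hol_map_def
proof (intro ballI exI conjI allI)
  fix z
  have "bounded_linear T'" using assms(1) by (simp add: linear_conv_bounded_linear)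
  then show "((\<lambda>z. a + T' (z - c)) has_derivative T') (at z)"
    by (rule has_derivative_eq_rhs[OF has_derivative_add[OF has_derivative_const
          bounded_linear.has_derivative[OF _ has_derivative_diff[OF has_derivative_ident has_derivative_const]]]])
      auto
qed (use assms in auto)

lemma hol_map_add:
  assumes "hol_map S U" "hol_map T U" shows "hol_map (\<lambda>z. S z + T z) U"
  unfolding hol_map_def
proof
  fix z assume z: "z \<in> U"
  obtain S' where S': "(S has_derivative S') (at z)" "\<And>x y. S' (- y, x) = cscale \<i> (S' (x, y))"
    by (rule hol_map_has_derivative[OF assms(1) z]) blast
  obtain T' where T': "(T has_derivative T') (at z)" "\<And>x y. T' (- y, x) = cscale \<i> (T' (x, y))"
    by (rule hol_map_has_derivative[OF assms(2) z]) blast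
  have "((\<lambda>z. S z + T z) has_derivative (\<lambda>v. S' v + T' v)) (at z)"
    using S'(1) T'(1) by (rule has_derivative_add)
  then show "\<exists>T'. ((\<lambda>z. S z + T z) has_derivative T') (at z) \<and> (\<forall>x y. T' (- y, x) = cscale \<i> (T' (x, y)))"
    using S'(2) T'(2) by (intro exI[of _ "\<lambda>v. S' v + T' v"]) (simp add: cscale_add_right)
qed

lemma hol_map_cscale:
  assumes "holomorphic_EC f U" shows "hol_map (\<lambda>z. cscale (f z) v) U"
  unfolding hol_map_def
proof
  fix z assume z: "z \<in> U"
  have "((\<lambda>z. cscale (f z) v) has_derivative (\<lambda>u. cscale (dir_deriv f z u) v)) (at z)"
    using has_derivative_compose[OF holomorphic_EC_has_derivative(1)[OF assms z]
        bounded_linear_imp_has_derivative[OF bounded_linear_cscale_left]] .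
  then show "\<exists>T'. ((\<lambda>z. cscale (f z) v) has_derivative T') (at z) \<and> (\<forall>x y. T' (- y, x) = cscale \<i> (T' (x, y)))"
    using holomorphic_EC_has_derivative(2)[OF assms z]
    by (intro exI[of _ "\<lambda>u. cscale (dir_deriv f z u) v"]) (simp add: cscale_cscale)
qed

lemma hol_map_const: "hol_map (\<lambda>z. a) U"
  using hol_map_affine[of "\<lambda>z. 0" a 0 U] by (simp add: linear_zero)

lemma hol_map_sum:
  "(\<And>i. i \<in> I \<Longrightarrow> hol_map (f i) U) \<Longrightarrow> hol_map (\<lambda>z. \<Sum>i\<in>I. f i z) U"
  by (induction I rule: infinite_finite_induct) (auto intro: hol_map_add hol_map_const)

section \<open>Restriction to complex lines\<close>

lemma holomorphic_EC_line_deriv: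
  assumes "holomorphic_EC f U" "z + cscale t v \<in> U"
  shows "((\<lambda>t. f (z + cscale t v)) has_field_derivative dir_deriv f (z + cscale t v) v) (at t)"
  unfolding has_field_derivative_def
  by (rule has_derivative_eq_rhs[OF has_derivative_compose[OF has_derivative_cscale_line
          holomorphic_EC_has_derivative(1)[OF assms]]])
    (simp add: holomorphic_EC_has_derivative(3)[OF assms] fun_eq_iff)

text \<open>One-variable theory enters through complex lines: the identity theorem, the continuity
  of the derivative and the extension theorem all restrict to
  \<open>t \<mapsto> z + cscale t v\<close>.\<close>

lemma holomorphic_EC_line:
  assumes "holomorphic_EC f U" "\<And>t. t \<in> A \<Longrightarrow> z + cscale t v \<in> U"
  shows "(\<lambda>t. f (z + cscale t v)) holomorphic_on A"
  unfolding holomorphic_on_def field_differentiable_def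
  using holomorphic_EC_line_deriv[OF assms(1)] assms(2) has_field_derivative_at_within by blast

lemma open_line_preimage: "open U \<Longrightarrow> open {t. z + cscale t v \<in> U}"
  using open_vimage[of U "\<lambda>t. z + cscale t v"]
  by (simp add: vimage_def continuous_on_add continuous_on_cscale)

lemma convex_line_preimage:
  assumes "convex U" shows "convex {t. z + cscale t v \<in> U}"
proof (rule convexI)
  fix s t :: complex and a b :: real
  assume *: "s \<in> {t. z + cscale t v \<in> U}" "t \<in> {t. z + cscale t v \<in> U}" "0 \<le> a" "0 \<le> b" "a + b = 1"
  have "z + cscale (a *\<^sub>R s + b *\<^sub>R t) v = a *\<^sub>R (z + cscale s v) + b *\<^sub>R (z + cscale t v)"
  proof -
    have "z = a *\<^sub>R z + b *\<^sub>R z" using *(5) by (metis scaleR_add_left scaleR_one)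
    then show ?thesis
      by (simp add: cscale_add_left cscale_of_real cscale_cscale[symmetric] scaleR_conv_of_real[where 'a = complex]
          scaleR_add_right)
  qed
  then show "a *\<^sub>R s + b *\<^sub>R t \<in> {t. z + cscale t v \<in> U}"
    using * assms by (auto intro!: convexD)
qed

text \<open>A point of \<open>V\<close> and the point \<open>u\<close> lie on a common complex line,
  whose trace on the convex set \<open>U\<close> is convex and hence connected, so analytic
  continuation in one variable applies.\<close>

lemma holomorphic_EC_identity:
  assumes U: "open U" "convex U" and f: "holomorphic_EC f U"
    and V: "open V" "V \<noteq> {}" "V \<subseteq> U" "\<And>u. u \<in> V \<Longrightarrow> f u = 0" and u: "u \<in> U"
  shows "f u = 0"
proof -
  obtain w where w: "w \<in> V" using V by blast
  define v where "v = u - w"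
  let ?S = "\<lambda>A. {t. w + cscale t v \<in> A}"
  have "f (w + cscale 1 v) = 0"
  proof (rule analytic_continuation_open[where s = "?S V" and s' = "?S U" and z = 1 and
        f = "\<lambda>t. f (w + cscale t v)" and g = "\<lambda>_. 0"])
    show "open (?S V)" using V by (intro open_line_preimage)
    show "open (?S U)" using U by (intro open_line_preimage)
    show "?S V \<noteq> {}" using w by (auto intro!: exI[of _ 0])
    show "connected (?S U)" using U by (intro convex_connected convex_line_preimage)
    show "(\<lambda>t. f (w + cscale t v)) holomorphic_on ?S U"
      by (rule holomorphic_EC_line[OF f]) auto
  qed (use V u v_def in auto)
  then show ?thesis by (simp add: v_def)
qed

text \<open>The set where \<open>f\<close> does not vanish is open, and \<open>g\<close> is zero on
  it; the identity theorem spreads this over \<open>U\<close>.\<close>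

lemma holomorphic_EC_no_zero_divisors:
  assumes U: "open U" "convex U" and f: "holomorphic_EC f U" and g: "holomorphic_EC g U"
    and 0: "\<And>u. u \<in> U \<Longrightarrow> f u * g u = 0" and u: "u \<in> U" "f u \<noteq> 0" and v: "v \<in> U"
  shows "g v = 0"
proof (rule holomorphic_EC_identity[OF U g])
  show "open (U \<inter> f -` (- {0}))"
    using holomorphic_EC_continuous_on[OF f] U(1) by (rule continuous_open_preimage) auto
qed (use 0 u v in auto)

text \<open>Holomorphy is defined by pointwise differentiability, so continuity of the derivative
  has to be earned. The difference of \<open>f\<close> along two parallel complex lines is small on
  a circle by uniform continuity, and Cauchy's inequality passes this on to the derivative at the
  centre. Differentiation under the integral sign will use it.\<close>

lemma dir_deriv_continuous_on:
  assumes U: "open U" and f: "holomorphic_EC f U"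
  shows "continuous_on U (\<lambda>z. dir_deriv f z v)"
proof -
  have "\<exists>d>0. \<forall>z. dist z z0 < d \<longrightarrow> dist (dir_deriv f z v) (dir_deriv f z0 v) < e"
    if z0: "z0 \<in> U" and e: "e > 0" for z0 e
  proof -
    obtain \<rho> where \<rho>: "\<rho> > 0" "cball z0 (2 * \<rho>) \<subseteq> U"
      using U z0 by (metis open_contains_cball mult_2 field_sum_of_halves half_gt_zero)
    \<comment> \<open>A circle of radius \<open>s\<close> in direction \<open>v\<close> moves a
      point by at most \<open>\<rho>\<close>; the summand 1 allows \<open>v = 0\<close>.\<close>
    define s where "s = \<rho> / (norm v + 1)"
    have s: "s > 0" "s * norm v \<le> \<rho>"
    proof -
      have "norm v + 1 > 0" by (simp add: add_nonneg_pos)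
      then show "s > 0" "s * norm v \<le> \<rho>"
        using \<rho>(1) by (auto simp: s_def field_simps)
    qed
    have "uniformly_continuous_on (cball z0 (2 * \<rho>)) f"
      using holomorphic_EC_continuous_on[OF f] \<rho>(2)
      by (intro compact_uniformly_continuous) (auto intro: continuous_on_subset)
    then obtain d where d: "d > 0" "\<And>x y. x \<in> cball z0 (2 * \<rho>) \<Longrightarrow> y \<in> cball z0 (2 * \<rho>) \<Longrightarrow>
        dist y x < d \<Longrightarrow> dist (f y) (f x) < e * s / 2"
      unfolding uniformly_continuous_on_def using e s by (metis half_gt_zero mult_pos_pos)
    have "dist (dir_deriv f z v) (dir_deriv f z0 v) < e" if z: "dist z z0 < min d \<rho>" for z
    proof -
      have in1: "y + cscale t v \<in> cball z0 (2 * \<rho>)" if "norm t \<le> s" "dist y z0 < \<rho>" for t y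
      proof -
        have "norm (cscale t v) \<le> \<rho>"
          using that s by (metis mult_right_mono norm_cscale norm_ge_zero order_trans)
        then show ?thesis
          using that norm_triangle_ineq[of "y - z0" "cscale t v"]
          by (simp add: dist_norm norm_minus_commute algebra_simps)
      qed
      define h where "h = (\<lambda>t. f (z + cscale t v) - f (z0 + cscale t v))"
      have hol: "h holomorphic_on ball 0 s" "continuous_on (cball 0 s) h"
      proof -
        have 1: "(\<lambda>t. f (y + cscale t v)) holomorphic_on cball 0 s" if "dist y z0 < \<rho>" for y
          by (intro holomorphic_EC_line[OF f] subsetD[OF \<rho>(2) in1]) (use that in auto)
        have "h holomorphic_on cball 0 s"
          unfolding h_def using z \<rho>(1) by (intro holomorphic_intros 1) auto
        then show "h holomorphic_on ball 0 s" "continuous_on (cball 0 s) h"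
          by (auto intro: holomorphic_on_subset holomorphic_on_imp_continuous_on)
      qed
      have B: "norm (h t) \<le> e * s / 2" if "norm (0 - t) = s" for t
        using d(2)[OF in1[of t z0] in1[of t z]] that z \<rho>(1) by (simp add: h_def dist_norm)
      have zU: "z + cscale 0 v \<in> U" "z0 + cscale 0 v \<in> U" using z0 z \<rho> in1[of 0 z] s(1) by auto
      have "(h has_field_derivative dir_deriv f z v - dir_deriv f z0 v) (at 0)"
        using DERIV_diff[OF holomorphic_EC_line_deriv[OF f zU(1)] holomorphic_EC_line_deriv[OF f zU(2)]]
        by (simp add: h_def[abs_def])
      then have "deriv h 0 = dir_deriv f z v - dir_deriv f z0 v" by (rule DERIV_imp_deriv)
      moreover have "norm ((deriv ^^ 1) h 0) \<le> fact 1 * (e * s / 2) / s ^ 1"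
        by (rule Cauchy_inequality[OF hol s(1) B])
      ultimately have "dist (dir_deriv f z v) (dir_deriv f z0 v) \<le> e / 2"
        using s(1) by (simp add: dist_norm)
      then show ?thesis using e by linarith
    qed
    then show ?thesis using d(1) \<rho>(1) by (intro exI[of _ "min d \<rho>"]) auto
  qed
  then show ?thesis unfolding continuous_on_iff by blast
qed

section \<open>Removable singularities in several variables\<close>

lemma holomorphic_on_extend_finite:
  assumes "finite K" "open S" "f holomorphic_on (S - K)"
    and "\<And>k. k \<in> K \<inter> S \<Longrightarrow> \<exists>B. eventually (\<lambda>z. norm (f z) \<le> B) (at k)"
  shows "\<exists>g. g holomorphic_on S \<and> (\<forall>z\<in>S - K. g z = f z)"
  using assms
proof (induction K arbitrary: S f rule: finite_induct)
  case empty
  then show ?case by auto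
next
  case (insert k K)
  show ?case
  proof (cases "k \<in> S")
    case False
    then have "S - insert k K = S - K" by blast
    then show ?thesis using insert.IH[of S f] insert.prems by auto
  next
    case True
    let ?S = "S - K"
    have o: "open ?S" using insert by (simp add: finite_imp_closed open_Diff)
    have e: "S - insert k K = ?S - {k}" by blast
    have "\<exists>g. g holomorphic_on ?S \<and> (\<forall>z\<in>?S - {k}. g z = f z)"
      using insert.prems(2,3) True insert.hyps o unfolding e
      by (subst holomorphic_on_extend_bounded) (auto simp: interior_open)
    then obtain g where g: "g holomorphic_on ?S" "\<And>z. z \<in> ?S - {k} \<Longrightarrow> g z = f z" by blast
    \<comment> \<open>Near another exceptional point the extension agrees with \<open>f\<close> on a
      punctured neighbourhood, so it inherits the bound and the induction can go on.\<close>
    have "\<exists>B. eventually (\<lambda>z. norm (g z) \<le> B) (at k')" if k': "k' \<in> K \<inter> S" for k'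
    proof -
      obtain B where B: "eventually (\<lambda>z. norm (f z) \<le> B) (at k')"
        using insert.prems(3)[of k'] k' by blast
      have "open (S - (insert k K - {k'}))" "k' \<in> S - (insert k K - {k'})"
        using insert k' by (auto simp: finite_imp_closed open_Diff)
      then have "eventually (\<lambda>z. z \<in> S - (insert k K - {k'}) \<and> z \<noteq> k') (at k')"
        by (auto simp: eventually_at_topological)
      with B have "eventually (\<lambda>z. norm (g z) \<le> B) (at k')"
        by eventually_elim (use g(2) in auto)
      then show ?thesis by blast
    qed
    then obtain h where "h holomorphic_on S" "\<forall>z\<in>S - K. h z = g z"
      using insert.IH[of S g] insert.prems(1) g(1) by blast
    then show ?thesis using g(2) e by (intro exI[of _ h]) auto
  qed
qed

text \<open>On \<open>circlepath 0 s\<close> the factor \<open>1 / u\<close> of Cauchy's formula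
  cancels against the derivative of the path up to a constant, leaving the plain mean over the
  circle.\<close>

lemma has_integral_circle_mean:
  assumes "continuous_on (cball 0 s) f" "f holomorphic_on ball 0 s" "0 < s"
  shows "((\<lambda>\<theta>. f (of_real s * exp (2 * of_real pi * \<i> * of_real \<theta>))) has_integral f 0) {0..1::real}"
proof -
  have "((\<lambda>u. f u / (u - 0)) has_contour_integral (2 * of_real pi * \<i> * f 0)) (circlepath 0 s)"
    using assms by (intro Cauchy_integral_circlepath) auto
  then have "((\<lambda>x. f (circlepath 0 s x) / circlepath 0 s x * vector_derivative (circlepath 0 s) (at x within {0..1}))
     has_integral (2 * of_real pi * \<i> * f 0)) {0..1}"
    by (simp add: has_contour_integral_def)
  then have "((\<lambda>x. 2 * of_real pi * \<i> * f (circlepath 0 s x)) has_integral (2 * of_real pi * \<i> * f 0)) {0..1}"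
    by (rule has_integral_eq[rotated])
      (use assms(3) in \<open>simp add: vector_derivative_circlepath01, simp add: circlepath\<close>)
  then have "((\<lambda>x. 2 * of_real pi * \<i> * f (of_real s * exp (2 * of_real pi * \<i> * of_real x))) has_integral
      (2 * of_real pi * \<i> * f 0)) {0..1}"
    by (simp add: circlepath)
  from has_integral_mult_right[OF this, of "1 / (2 * of_real pi * \<i>)"]
  show ?thesis by simp
qed

text \<open>Differentiation under the integral sign. The Leibniz rule asks for a continuous family
  of bounded linear maps on a convex set, which is why the derivative is packed into
  \<open>D\<close> and why \<open>dir_deriv_continuous_on\<close> is called.\<close>

lemma holomorphic_EC_mean:
  fixes V :: "('a::euclidean_space \<times> 'a) set"
  assumes V: "open V" "convex V" and U: "open U" and q: "holomorphic_EC q U"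
    and c: "continuous_on {0..1::real} c" and sub: "\<And>z \<theta>. z \<in> V \<Longrightarrow> \<theta> \<in> {0..1} \<Longrightarrow> z + cscale (c \<theta>) v \<in> U"
  shows "holomorphic_EC (\<lambda>z. integral {0..1} (\<lambda>\<theta>. q (z + cscale (c \<theta>) v))) V"
proof -
  define D where "D = (\<lambda>u. Blinfun (dir_deriv q u))"
  have D: "blinfun_apply (D u) = dir_deriv q u" if "u \<in> U" for u
    unfolding D_def using holomorphic_EC_has_derivative(1)[OF q that]
    by (intro bounded_linear_Blinfun_apply) (rule has_derivative_bounded_linear)
  have cD: "continuous_on U D"
  proof (rule continuous_on_blinfun_componentwise)
    fix i :: "'a \<times> 'a"
    have "continuous_on U (\<lambda>x. blinfun_apply (D x) i) = continuous_on U (\<lambda>z. dir_deriv q z i)"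
      by (rule continuous_on_cong) (auto simp: D)
    then show "continuous_on U (\<lambda>x. blinfun_apply (D x) i)"
      using dir_deriv_continuous_on[OF U q] by simp
  qed
  have cont: "continuous_on (V \<times> {0..1}) (\<lambda>(z, \<theta>). z + cscale (c \<theta>) v)"
    unfolding case_prod_unfold
    by (intro continuous_intros continuous_on_compose2[OF c]) auto
  have cD': "continuous_on (V \<times> {0..1}) (\<lambda>(z, \<theta>). D (z + cscale (c \<theta>) v))"
    unfolding case_prod_unfold
    by (rule continuous_on_compose2[OF cD cont[unfolded case_prod_unfold]]) (use sub in auto)
  have cD1: "continuous_on {0..1} (\<lambda>\<theta>. D (z + cscale (c \<theta>) v))" if "z \<in> V" for z
  proof -
    have "continuous_on {0..1} (Pair z)" by (intro continuous_intros)
    from continuous_on_compose2[OF cD' this] that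
    have "continuous_on {0..1} (\<lambda>\<theta>. case (z, \<theta>) of (z, \<theta>) \<Rightarrow> D (z + cscale (c \<theta>) v))" by blast
    then show ?thesis by simp
  qed
  have cq: "continuous_on {0..1} (\<lambda>\<theta>. q (z + cscale (c \<theta>) v))" if "z \<in> V" for z
    by (rule continuous_on_compose2[OF holomorphic_EC_continuous_on[OF q]])
      (use sub[OF that] in \<open>auto intro!: continuous_intros c simp del: split_paired_All\<close>)
  show ?thesis
  proof (rule holomorphic_EC_I)
    fix z assume z: "z \<in> V"
    have "((\<lambda>z. integral (cbox 0 1) (\<lambda>\<theta>. q (z + cscale (c \<theta>) v))) has_derivative
        blinfun_apply (integral (cbox 0 1) (\<lambda>\<theta>. D (z + cscale (c \<theta>) v)))) (at z within V)"
    proof (rule leibniz_rule[OF _ _ _ z V(2)])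
      fix y and \<theta> :: real assume y: "y \<in> V" and t: "\<theta> \<in> cbox 0 1"
      have "((\<lambda>y. q (y + cscale (c \<theta>) v)) has_derivative dir_deriv q (y + cscale (c \<theta>) v)) (at y)"
      proof -
        have "((\<lambda>y. y + cscale (c \<theta>) v) has_derivative (\<lambda>h. h)) (at y)"
          by (auto intro!: derivative_eq_intros)
        from has_derivative_compose[OF this holomorphic_EC_has_derivative(1)[OF q sub]] y t
        show ?thesis by auto
      qed
      then show "((\<lambda>y. q (y + cscale (c \<theta>) v)) has_derivative blinfun_apply (D (y + cscale (c \<theta>) v))) (at y within V)"
        using D[OF sub] y t by (simp add: has_derivative_at_withinI)
    next
      fix y assume "y \<in> V"
      from integrable_continuous_interval[OF cq[OF this]]
      show "(\<lambda>\<theta>. q (y + cscale (c \<theta>) v)) integrable_on cbox 0 1" by simp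
    next
      show "continuous_on (V \<times> cbox 0 1) (\<lambda>(z, \<theta>). D (z + cscale (c \<theta>) v))"
        using cD' by simp
    qed
    then show "((\<lambda>z. integral {0..1} (\<lambda>\<theta>. q (z + cscale (c \<theta>) v))) has_derivative
        blinfun_apply (integral {0..1} (\<lambda>\<theta>. D (z + cscale (c \<theta>) v)))) (at z)"
      by (simp only: at_within_open[OF z V(1)] box_real)
    have *: "blinfun_apply (integral {0..1} (\<lambda>\<theta>. D (z + cscale (c \<theta>) v))) w =
        integral {0..1} (\<lambda>\<theta>. dir_deriv q (z + cscale (c \<theta>) v) w)" for w
      using cD1[OF z] D[OF sub[OF z]]
      by (subst blinfun_apply_integral) (auto intro!: integrable_continuous_interval integral_cong)
    fix x y :: 'a
    show "blinfun_apply (integral {0..1} (\<lambda>\<theta>. D (z + cscale (c \<theta>) v))) (- y, x) =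
      \<i> * blinfun_apply (integral {0..1} (\<lambda>\<theta>. D (z + cscale (c \<theta>) v))) (x, y)"
      unfolding * integral_mult_right[symmetric]
      by (rule integral_cong) (rule holomorphic_EC_has_derivative(2)[OF q sub[OF z]])
  qed
qed

text \<open>The extension is the mean of \<open>q\<close> over a circle in a fixed direction
  \<open>v\<close> that avoids the zeros of \<open>b\<close>. The mean depends holomorphically on
  the centre, even at zeros of \<open>b\<close>. Elsewhere it equals \<open>q\<close>, because on
  each line the bounded function \<open>q\<close> extends over the finitely many zeros of
  \<open>b\<close> and then has the mean value property.\<close>

theorem riemann_extension_EC:
  fixes p :: "'a::euclidean_space \<times> 'a"
  assumes U: "open U" "p \<in> U" and b: "holomorphic_EC b U"
    and nz: "\<And>V. open V \<Longrightarrow> p \<in> V \<Longrightarrow> \<exists>u\<in>V \<inter> U. b u \<noteq> 0"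
    and q: "holomorphic_EC q {u \<in> U. b u \<noteq> 0}"
    and bd: "\<And>u. u \<in> U \<Longrightarrow> b u \<noteq> 0 \<Longrightarrow> norm (q u) \<le> C"
  obtains V r where "open V" "p \<in> V" "V \<subseteq> U" "holomorphic_EC r V"
    "\<And>u. u \<in> V \<Longrightarrow> b u \<noteq> 0 \<Longrightarrow> r u = q u"
proof -
  obtain \<rho> where \<rho>: "\<rho> > 0" "ball p (2 * \<rho>) \<subseteq> U"
    using U by (metis open_contains_ball mult_2 field_sum_of_halves half_gt_zero)
  obtain u0 where u0: "u0 \<in> ball p \<rho>" "b u0 \<noteq> 0"
    using nz[of "ball p \<rho>"] \<rho>(1) by auto
  define v where "v = u0 - p"
  have v: "norm v < \<rho>" using u0 by (simp add: v_def dist_norm norm_minus_commute)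
  \<comment> \<open>The radius 3/2 leaves the closed unit disc compact inside the domain, so that
    zeros on it can be counted.\<close>
  have inU: "z + cscale t v \<in> ball p (2 * \<rho>)" if "z \<in> ball p (\<rho> / 2)" "norm t < 3 / 2" for z t
  proof -
    have "norm (cscale t v) \<le> 3 / 2 * \<rho>"
      unfolding norm_cscale using that v by (intro mult_mono) auto
    then show ?thesis
      using that norm_triangle_ineq[of "z - p" "cscale t v"]
      by (simp add: dist_norm norm_minus_commute algebra_simps)
  qed
  have fin: "finite {t \<in> cball 0 1. b (z + cscale t v) = 0}"
    if z: "z \<in> ball p (\<rho> / 2)" and t0: "norm t0 < 3 / 2" "b (z + cscale t0 v) \<noteq> 0" for z t0
  proof (cases "(\<lambda>t. b (z + cscale t v)) constant_on ball 0 (3 / 2)")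
    case True
    then have "b (z + cscale t v) \<noteq> 0" if "t \<in> cball 0 1" for t
      using t0 that unfolding constant_on_def by force
    then have e: "{t \<in> cball 0 1. b (z + cscale t v) = 0} = {}" by blast
    show ?thesis unfolding e by simp
  next
    case False
    have "(\<lambda>t. b (z + cscale t v)) holomorphic_on ball 0 (3 / 2)"
      using inU[OF z] \<rho>(2) by (intro holomorphic_EC_line[OF b]) auto
    from holomorphic_compact_finite_zeros[OF this open_ball connected_ball _ _ False, of "cball 0 1"]
    show ?thesis by (simp add: subset_iff)
  qed
  have "finite {t \<in> cball 0 1. b (p + cscale t v) = 0}" (is "finite ?Z")
    using fin[of p 1] u0(2) \<rho>(1) by (simp add: v_def)
  \<comment> \<open>Finitely many zeros have finitely many absolute values, so some radius in the
    unit interval meets none of them.\<close>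
  then have "infinite ({0<..<1} - norm ` ?Z)"
    by (intro Diff_infinite_finite) (auto simp: infinite_Ioo)
  then have "{0<..<1} - norm ` ?Z \<noteq> {}" by (metis finite.emptyI)
  then obtain s where s: "0 < s" "s < 1" "\<And>t. t \<in> cball 0 1 \<Longrightarrow> norm t = s \<Longrightarrow> b (p + cscale t v) \<noteq> 0"
    by fastforce
  define G where "G = {u \<in> ball p (2 * \<rho>). b u \<noteq> 0}"
  have G: "open G" "G \<subseteq> {u \<in> U. b u \<noteq> 0}"
  proof -
    have "open (ball p (2 * \<rho>) \<inter> b -` (- {0}))"
      using holomorphic_EC_continuous_on[OF holomorphic_EC_subset[OF b \<rho>(2)]]
      by (rule continuous_open_preimage) auto
    then show "open G" by (simp add: G_def vimage_def Int_def)
  qed (use \<rho> in \<open>auto simp: G_def\<close>)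
  \<comment> \<open>The circle around \<open>p\<close> is a compact subset of the open set where
    \<open>b\<close> does not vanish, so parallel circles around nearby centres stay in that
    set.\<close>
  define K where "K = (\<lambda>t. p + cscale t v) ` sphere 0 s"
  have "compact K" unfolding K_def
    by (intro compact_continuous_image continuous_intros compact_sphere)
  moreover have "K \<subseteq> G" using s inU[of p] \<rho>(1) by (auto simp: K_def G_def)
  ultimately obtain e where e: "e > 0" "(\<Union>x\<in>K. ball x e) \<subseteq> G"
    using G(1) compact_subset_open_imp_ball_epsilon_subset by metis
  define V where "V = ball p (min e (\<rho> / 2))"
  have VG: "z + cscale t v \<in> G" if "z \<in> V" "norm t = s" for z t
  proof -
    have "z + cscale t v \<in> ball (p + cscale t v) e" using that by (simp add: V_def dist_norm)
    moreover have "p + cscale t v \<in> K" using that by (auto simp: K_def)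
    ultimately show ?thesis using e by blast
  qed
  define c where "c = (\<lambda>\<theta>::real. of_real s * exp (2 * of_real pi * \<i> * of_real \<theta>) :: complex)"
  have c: "norm (c \<theta>) = s" for \<theta>
  proof -
    have "exp (2 * of_real pi * \<i> * of_real \<theta>) = exp (\<i> * of_real (2 * pi * \<theta>))"
      by (simp add: mult_ac)
    then show ?thesis using s by (simp add: c_def norm_mult norm_exp_i_times)
  qed
  define r where "r = (\<lambda>z. integral {0..1} (\<lambda>\<theta>. q (z + cscale (c \<theta>) v)))"
  have "holomorphic_EC r V"
    unfolding r_def
  proof (rule holomorphic_EC_mean[OF _ _ G(1)])
    show "holomorphic_EC q G" using q G(2) by (rule holomorphic_EC_subset)
    show "continuous_on {0..1} c" unfolding c_def by (intro continuous_intros)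
  qed (use c VG in \<open>auto simp: V_def\<close>)
  moreover have "r z = q z" if z: "z \<in> V" "b z \<noteq> 0" for z
  proof -
    have zb: "z \<in> ball p (\<rho> / 2)" using z by (simp add: V_def)
    define Z where "Z = {t \<in> cball 0 1. b (z + cscale t v) = 0}"
    have Z: "finite Z" unfolding Z_def using zb z(2) by (intro fin[of z 0]) auto
    have hol: "(\<lambda>t. q (z + cscale t v)) holomorphic_on (ball 0 1 - Z)"
      using inU[OF zb] \<rho>(2) by (intro holomorphic_EC_line[OF q]) (auto simp: Z_def)
    have "\<exists>B. eventually (\<lambda>t. norm (q (z + cscale t v)) \<le> B) (at k)" if "k \<in> Z \<inter> ball 0 1" for k
    proof -
      have "open (ball 0 1 - (Z - {k}))" "k \<in> ball 0 1 - (Z - {k})"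
        using Z that by (auto simp: finite_imp_closed open_Diff)
      then have "eventually (\<lambda>t. t \<in> ball 0 1 - (Z - {k}) \<and> t \<noteq> k) (at k)"
        by (auto simp: eventually_at_topological)
      then have "eventually (\<lambda>t. norm (q (z + cscale t v)) \<le> C) (at k)"
        by eventually_elim (use inU[OF zb] \<rho>(2) in \<open>auto intro!: bd simp: Z_def\<close>)
      then show ?thesis by blast
    qed
    then obtain g where g: "g holomorphic_on ball 0 1" "\<And>t. t \<in> ball 0 1 - Z \<Longrightarrow> g t = q (z + cscale t v)"
      using holomorphic_on_extend_finite[OF Z open_ball hol] by blast
    have sub: "cball 0 s \<subseteq> ball (0::complex) 1" using s by auto
    have "((\<lambda>\<theta>. g (c \<theta>)) has_integral g 0) {0..1}"
      unfolding c_def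
      by (rule has_integral_circle_mean)
        (use g(1) s sub in \<open>auto intro: holomorphic_on_imp_continuous_on holomorphic_on_subset\<close>)
    moreover have "g (c \<theta>) = q (z + cscale (c \<theta>) v)" for \<theta>
      using c[of \<theta>] s VG[OF z(1) c] by (intro g(2)) (auto simp: Z_def G_def)
    moreover have "g 0 = q z" using g(2)[of 0] z(2) by (simp add: Z_def)
    ultimately show ?thesis unfolding r_def by (simp add: integral_unique)
  qed
  moreover have "open V" "p \<in> V" "V \<subseteq> U" using e \<rho> by (auto simp: V_def)
  ultimately show ?thesis using that by blast
qed

section \<open>Descent of holomorphy along a branched quotient map\<close>

lemma descend_has_derivative:
  fixes T :: "'a::euclidean_space \<times> 'a \<Rightarrow> 'a \<times> 'a"
  assumes S: "open S" "u \<in> S" "inj_on T S" "hol_map T S"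
    and T': "(T has_derivative T') (at u)" "\<And>x y. T' (- y, x) = cscale \<i> (T' (x, y))" "inj T'"
    and gT: "holomorphic_EC (\<lambda>z. g (T z)) S"
  shows "\<exists>g'. (g has_derivative g') (at (T u)) \<and> (\<forall>x y. g' (- y, x) = \<i> * g' (x, y))"
proof -
  have lin: "linear T'" using T'(1) by (rule has_derivative_linear)
  obtain T'' where T'': "linear T''" "T'' \<circ> T' = id" "T' \<circ> T'' = id"
    using linear_injective_isomorphism[OF lin T'(3)] by (auto simp: fun_eq_iff)
  define \<psi> where "\<psi> = inv_into S T"
  have cont: "continuous_on S T" using S(4) by (rule hol_map_continuous_on)
  have \<psi>: "(\<psi> has_derivative T'') (at (T u))"
    by (rule has_derivative_inverse_strong[OF S(1,2) cont _ T'(1) T''(3)])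
      (simp add: \<psi>_def inv_into_f_f[OF S(3)])
  have "\<psi> (T u) = u" using S by (simp add: \<psi>_def)
  then have "((\<lambda>z. g (T (\<psi> z))) has_derivative (\<lambda>v. dir_deriv (\<lambda>z. g (T z)) u (T'' v))) (at (T u))"
    using has_derivative_compose[OF \<psi>, of "\<lambda>z. g (T z)"] holomorphic_EC_has_derivative(1)[OF gT S(2)] by simp
  moreover have "open (T ` S)" using cont S(1,3) by (rule invariance_of_domain)
  moreover have "g (T (\<psi> z)) = g z" if "z \<in> T ` S" for z
    using that by (simp add: \<psi>_def f_inv_into_f)
  ultimately have "(g has_derivative (\<lambda>v. dir_deriv (\<lambda>z. g (T z)) u (T'' v))) (at (T u))"
    using has_derivative_transform_within_open S(2) by blast
  \<comment> \<open>The inverse of a complex-linear isomorphism is complex-linear.\<close>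
  moreover have "T'' (- y, x) = cscale \<i> (T'' (x, y))" for x y
  proof -
    have "T' (cscale \<i> (T'' (x, y))) = cscale \<i> (T' (T'' (x, y)))"
      using T'(2)[of "snd (T'' (x, y))" "fst (T'' (x, y))"] by (simp add: cscale_def)
    also have "\<dots> = T' (T'' (- y, x))"
      using T''(3) by (simp add: fun_eq_iff)
    finally have "T' (cscale \<i> (T'' (x, y))) = T' (T'' (- y, x))" .
    from injD[OF T'(3) this] show ?thesis by (rule sym)
  qed
  then have "dir_deriv (\<lambda>z. g (T z)) u (T'' (- y, x)) = \<i> * dir_deriv (\<lambda>z. g (T z)) u (T'' (x, y))" for x y
    by (simp only: holomorphic_EC_has_derivative(3)[OF gT S(2)])
  ultimately show ?thesis by blast
qed

text \<open>Where \<open>Q\<close> does not vanish, \<open>T\<close> has holomorphic local inverses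
  and the claim is local. The zeros of \<open>Q\<close> form a removable set: \<open>g\<close> is
  continuous, hence locally bounded, so it has a holomorphic extension there, and by density of the
  complement the extension is \<open>g\<close> itself.\<close>

theorem holomorphic_EC_descend:
  fixes T :: "'a::euclidean_space \<times> 'a \<Rightarrow> 'a \<times> 'a"
  assumes T: "hol_map T UNIV" "surj T" "\<And>G. open G \<Longrightarrow> open (T ` G)"
    and Q: "holomorphic_EC Q UNIV" "Q w0 \<noteq> 0"
    and loc: "\<And>u. Q (T u) \<noteq> 0 \<Longrightarrow> \<exists>S T'. open S \<and> u \<in> S \<and> inj_on T S \<and> (T has_derivative T') (at u) \<and> inj T'"
    and D: "open D" and g: "holomorphic_EC (\<lambda>z. g (T z)) {z. T z \<in> D}"
  shows "holomorphic_EC g D"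
proof -
  have cT: "continuous_on UNIV T" using T(1) by (rule hol_map_continuous_on)
  have oD: "open {z. T z \<in> D}" using open_vimage[OF D cT] by (simp add: vimage_def)
  \<comment> \<open>Continuity of \<open>g\<close> on \<open>D\<close>, obtained because the open
    surjection \<open>T\<close> carries preimages under the composite to preimages under
    \<open>g\<close>.\<close>
  have cg: "open {y \<in> D. g y \<in> G}" if G: "open G" for G
  proof -
    have "open ({z. T z \<in> D} \<inter> (\<lambda>z. g (T z)) -` G)"
      using holomorphic_EC_continuous_on[OF g] oD G by (rule continuous_open_preimage)
    from T(3)[OF this] have "open (T ` ({z. T z \<in> D} \<inter> (\<lambda>z. g (T z)) -` G))" .
    moreover have "T ` ({z. T z \<in> D} \<inter> (\<lambda>z. g (T z)) -` G) = {y \<in> D. g y \<in> G}"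
    proof (intro equalityI subsetI)
      fix y assume y: "y \<in> {y \<in> D. g y \<in> G}"
      obtain z where "y = T z" using T(2) by blast
      then show "y \<in> T ` ({z. T z \<in> D} \<inter> (\<lambda>z. g (T z)) -` G)" using y by blast
    qed auto
    ultimately show ?thesis by simp
  qed
  have g_open: "holomorphic_EC g {y \<in> D. Q y \<noteq> 0}"
    unfolding holomorphic_EC_def
  proof
    fix y assume y: "y \<in> {y \<in> D. Q y \<noteq> 0}"
    obtain u where u: "y = T u" using T(2) by blast
    obtain S T1 where S: "open S" "u \<in> S" "inj_on T S" "(T has_derivative T1) (at u)" "inj T1"
      using loc[of u] y u by blast
    obtain T' where T': "(T has_derivative T') (at u)" "\<And>x y. T' (- y, x) = cscale \<i> (T' (x, y))"
      by (rule hol_map_has_derivative[OF T(1) UNIV_I]) blast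
    have "inj T'" using S(4,5) T'(1) has_derivative_unique by metis
    let ?S = "S \<inter> {z. T z \<in> D}"
    have "\<exists>g'. (g has_derivative g') (at (T u)) \<and> (\<forall>x y. g' (- y, x) = \<i> * g' (x, y))"
    proof (rule descend_has_derivative[OF _ _ _ _ T' \<open>inj T'\<close>])
      show "open ?S" "u \<in> ?S" using S oD y u by auto
      show "inj_on T ?S" using S(3) by (rule inj_on_subset) auto
      show "hol_map T ?S" using T(1) by (rule hol_map_subset) auto
      show "holomorphic_EC (\<lambda>z. g (T z)) ?S" using g by (rule holomorphic_EC_subset) auto
    qed
    then show "\<exists>f'. (g has_derivative f') (at y) \<and> (\<forall>x y. f' (- y, x) = \<i> * f' (x, y))"
      by (simp add: u)
  qed
  have dense: "\<exists>u\<in>V. Q u \<noteq> 0" if "open V" "V \<noteq> {}" for V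
    using holomorphic_EC_identity[OF open_UNIV convex_UNIV Q(1) that, of w0] Q(2) by blast
  show ?thesis
  proof (rule holomorphic_EC_locally)
    fix p assume p: "p \<in> D"
    define U where "U = {y \<in> D. g y \<in> ball (g p) 1}"
    have U: "open U" "p \<in> U" using cg[of "ball (g p) 1"] p by (auto simp: U_def)
    have bd: "norm (g u) \<le> norm (g p) + 1" if "u \<in> U" for u
      using that norm_triangle_sub[of "g u" "g p"] by (simp add: U_def dist_norm norm_minus_commute)
    obtain V r where V: "open V" "p \<in> V" "V \<subseteq> U" "holomorphic_EC r V"
      "\<And>u. u \<in> V \<Longrightarrow> Q u \<noteq> 0 \<Longrightarrow> r u = g u"
    proof (rule riemann_extension_EC[OF U])
      show "holomorphic_EC Q U" using Q(1) by (rule holomorphic_EC_subset) auto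
      show "holomorphic_EC g {u \<in> U. Q u \<noteq> 0}"
        using g_open by (rule holomorphic_EC_subset) (auto simp: U_def)
      show "\<exists>u\<in>V \<inter> U. Q u \<noteq> 0" if "open V" "p \<in> V" for V
        using dense[of "V \<inter> U"] that U by auto
    qed (use bd in auto)
    \<comment> \<open>Two continuous functions that differ at \<open>u\<close> differ on a
      neighbourhood, which would contain a point with \<open>Q\<close> nonzero.\<close>
    have "r u = g u" if u: "u \<in> V" for u
    proof (rule ccontr)
      assume ne: "r u \<noteq> g u"
      define d where "d = dist (r u) (g u) / 2"
      have d: "d > 0" using ne by (simp add: d_def)
      have "open (V \<inter> r -` ball (r u) d)"
        using holomorphic_EC_continuous_on[OF V(4)] V(1) by (rule continuous_open_preimage) auto
      then have "open (V \<inter> r -` ball (r u) d \<inter> {y \<in> D. g y \<in> ball (g u) d})"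
        using cg by blast
      moreover have "u \<in> V \<inter> r -` ball (r u) d \<inter> {y \<in> D. g y \<in> ball (g u) d}"
        using u V(3) d by (auto simp: U_def)
      ultimately obtain y where y: "y \<in> V" "dist (r u) (r y) < d" "dist (g u) (g y) < d" "Q y \<noteq> 0"
      proof -
        let ?W = "V \<inter> r -` ball (r u) d \<inter> {y \<in> D. g y \<in> ball (g u) d}"
        assume "open ?W" "u \<in> ?W"
        then have "\<exists>y\<in>?W. Q y \<noteq> 0" by (intro dense) auto
        then show ?thesis using that by auto
      qed
      then have "dist (r u) (g u) < d + d"
        using V(5)[of y] dist_triangle[of "r u" "g u" "r y"] by (simp add: dist_commute)
      then show False by (simp add: d_def)
    qed
    then have "holomorphic_EC g V"
      using holomorphic_EC_cong[OF V(1) _ V(4)] by blast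
    then show "\<exists>V. p \<in> V \<and> holomorphic_EC g V" using V(2) by blast
  qed
qed

section \<open>Invariants of finite reflection groups\<close>

definition onb :: "'a::euclidean_space set \<Rightarrow> 'a set" where
  "onb M = (SOME B. B \<subseteq> M \<and> pairwise orthogonal B \<and> (\<forall>x\<in>B. norm x = 1) \<and> independent B \<and> span B = M)"

definition proj :: "'a::euclidean_space set \<Rightarrow> 'a \<Rightarrow> 'a" where
  "proj M x = (\<Sum>b\<in>onb M. (b \<bullet> x) *\<^sub>R b)"

lemma onb:
  assumes "subspace M"
  shows "onb M \<subseteq> M" "pairwise orthogonal (onb M)" "\<And>b. b \<in> onb M \<Longrightarrow> norm b = 1"
    "independent (onb M)" "span (onb M) = M" "finite (onb M)"
proof -
  have "\<exists>B. B \<subseteq> M \<and> pairwise orthogonal B \<and> (\<forall>x\<in>B. norm x = 1) \<and> independent B \<and> span B = M"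
    using orthonormal_basis_subspace[OF assms] by metis
  from someI_ex[OF this, folded onb_def]
  show "onb M \<subseteq> M" "pairwise orthogonal (onb M)" "\<And>b. b \<in> onb M \<Longrightarrow> norm b = 1"
    "independent (onb M)" "span (onb M) = M" by auto
  then show "finite (onb M)" using independent_imp_finite by blast
qed

lemma onb_inner:
  assumes "subspace M" "b \<in> onb M" "c \<in> onb M" shows "b \<bullet> c = (if b = c then 1 else 0)"
  using onb(2,3)[OF assms(1)] assms(2,3)
  by (auto simp: pairwise_def orthogonal_def norm_eq_1)

lemma linear_proj: "linear (proj M)"
  unfolding proj_def
  by (intro linearI)
    (auto simp: inner_add_right scaleR_add_left sum.distrib scaleR_sum_right)

lemma proj_mem: "subspace M \<Longrightarrow> proj M x \<in> M"
  unfolding proj_def using onb(1) by (intro subspace_sum subspace_scale) auto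

lemma inner_onb_proj: "subspace M \<Longrightarrow> b \<in> onb M \<Longrightarrow> b \<bullet> proj M x = b \<bullet> x"
  unfolding proj_def
  by (simp add: inner_sum_right onb_inner onb(6) if_distrib[of "\<lambda>u. _ * u"] sum.delta' cong: if_cong)

lemma inner_diff_proj:
  assumes "subspace M" "y \<in> M" shows "y \<bullet> (x - proj M x) = 0"
proof -
  have "y \<in> span (onb M)" using assms onb(5) by metis
  then show ?thesis
    by (induction rule: span_induct_alt)
      (auto simp: inner_add_left inner_diff_right inner_onb_proj[OF assms(1)])
qed

text \<open>Frees \<open>proj\<close> from the arbitrary basis behind it: the remainder being
  orthogonal to \<open>M\<close> already determines the value. Compatibility with isometries follows
  from this later.\<close>

lemma proj_unique:
  assumes "subspace M" "y \<in> M" "\<And>u. u \<in> M \<Longrightarrow> u \<bullet> (x - y) = 0" shows "proj M x = y"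
proof -
  have d: "y - proj M x \<in> M" using assms proj_mem subspace_diff by blast
  have "(y - proj M x) \<bullet> (y - proj M x) = (y - proj M x) \<bullet> (x - proj M x) - (y - proj M x) \<bullet> (x - y)"
    by (simp add: inner_diff_right)
  also have "\<dots> = 0" using assms(3)[OF d] inner_diff_proj[OF assms(1) d] by simp
  finally show ?thesis by simp
qed

lemma proj_id: "subspace M \<Longrightarrow> x \<in> M \<Longrightarrow> proj M x = x"
  by (rule proj_unique) auto

lemma norm_proj: assumes "subspace M" shows "(norm (proj M x))\<^sup>2 + (norm (x - proj M x))\<^sup>2 = (norm x)\<^sup>2"
proof -
  have "proj M x \<bullet> (x - proj M x) = 0"
    using inner_diff_proj[OF assms proj_mem[OF assms]] .
  then have "(norm (proj M x + (x - proj M x)))\<^sup>2 = (norm (proj M x))\<^sup>2 + (norm (x - proj M x))\<^sup>2"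
    by (intro norm_add_Pythagorean) (simp add: orthogonal_def)
  then show ?thesis by simp
qed

definition cproj :: "'a::euclidean_space set \<Rightarrow> 'a \<times> 'a \<Rightarrow> 'a \<times> 'a" where
  "cproj M = map_prod (proj M) (proj M)"

lemma linear_map_prod_dup: "linear w \<Longrightarrow> linear (map_prod w w)"
  by (intro linearI) (auto simp: linear_add linear_scale scaleR_prod_def)

lemma map_prod_cscale: "linear w \<Longrightarrow> map_prod w w (cscale c z) = cscale c (map_prod w w z)"
  by (simp add: cscale_def linear_add linear_diff linear_scale)

lemma map_prod_i: "linear w \<Longrightarrow> map_prod w w (- y, x) = cscale \<i> (map_prod w w (x, y))"
  by (simp add: linear_neg)

lemma cproj_mem: "subspace M \<Longrightarrow> cproj M z \<in> M \<times> M"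
  by (cases z) (simp add: cproj_def proj_mem)

lemma cproj_id: "subspace M \<Longrightarrow> z \<in> M \<times> M \<Longrightarrow> cproj M z = z"
  by (cases z) (simp add: cproj_def proj_id)

lemma linear_cproj: "linear (cproj M)"
  unfolding cproj_def by (rule linear_map_prod_dup[OF linear_proj])

lemma norm_cproj:
  assumes "subspace M" shows "(norm (cproj M z))\<^sup>2 + (norm (z - cproj M z))\<^sup>2 = (norm z)\<^sup>2"
proof -
  obtain x y where z: "z = (x, y)" by (cases z)
  show ?thesis using norm_proj[OF assms, of x] norm_proj[OF assms, of y]
    by (simp add: z cproj_def norm_Pair)
qed

lemma norm_cproj_le: "subspace M \<Longrightarrow> norm (cproj M z) \<le> norm z" "subspace M \<Longrightarrow> norm (z - cproj M z) \<le> norm z"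
proof -
  assume "subspace M"
  from norm_cproj[OF this, of z] show "norm (cproj M z) \<le> norm z" "norm (z - cproj M z) \<le> norm z"
    by (metis le_add_same_cancel1 le_add_same_cancel2 norm_ge_zero power2_le_imp_le zero_le_power2)+
qed

lemma cscale_mem: "subspace M \<Longrightarrow> z \<in> M \<times> M \<Longrightarrow> cscale c z \<in> M \<times> M"
  by (cases z) (auto simp: cscale_def subspace_add subspace_diff subspace_scale)

text \<open>The complex-linear extension to V + iV of the real linear form
  \<open>x \<mapsto> b \<bullet> x\<close>.\<close>

definition zeta :: "'a::euclidean_space \<Rightarrow> 'a \<times> 'a \<Rightarrow> complex" where
  "zeta b z = Complex (b \<bullet> fst z) (b \<bullet> snd z)"

lemma zeta_linear: "linear (zeta b)"
  by (intro linearI) (auto simp: zeta_def complex_eq_iff inner_add_right)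

lemma zeta_add: "zeta (a + b) z = zeta a z + zeta b z"
  and zeta_scale: "zeta (r *\<^sub>R a) z = of_real r * zeta a z"
  and zeta_zero: "zeta 0 z = 0"
  by (auto simp: zeta_def complex_eq_iff inner_add_left)

lemma zeta_cscale: "zeta b (cscale c z) = c * zeta b z"
  by (auto simp: zeta_def cscale_def complex_eq_iff inner_diff_right inner_add_right)

lemma zeta_has_derivative: "(zeta b has_derivative zeta b) (at z)"
  using zeta_linear[of b] by (simp add: bounded_linear_imp_has_derivative linear_conv_bounded_linear)

lemma holomorphic_EC_zeta: "holomorphic_EC (zeta b) U"
  by (rule holomorphic_EC_I[OF zeta_has_derivative])
    (auto simp: zeta_def complex_eq_iff)

lemma dir_deriv_zeta: "dir_deriv (zeta b) z = zeta b"
  by (rule has_derivative_imp_dir_deriv[OF zeta_has_derivative])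

lemma norm_zeta_le: "norm (zeta b z) \<le> norm b * norm z * 2"
proof -
  have "norm (zeta b z) \<le> \<bar>b \<bullet> fst z\<bar> + \<bar>b \<bullet> snd z\<bar>"
    using cmod_le[of "zeta b z"] by (simp add: zeta_def)
  also have "\<dots> \<le> norm b * norm (fst z) + norm b * norm (snd z)"
    by (intro add_mono Cauchy_Schwarz_ineq2)
  also have "\<dots> \<le> norm b * norm z + norm b * norm z"
    using norm_fst_le[of "fst z" "snd z"] norm_snd_le[of "snd z" "fst z"]
    by (intro add_mono mult_left_mono) auto
  finally show ?thesis by simp
qed

text \<open>Homogeneous polynomials of degree \<open>k\<close> on \<open>M + iM\<close>. In negative degrees only the zero function
  qualifies, so differences of degrees can be used without case distinctions.\<close>

inductive hpoly :: "'a::euclidean_space set \<Rightarrow> int \<Rightarrow> ('a \<times> 'a \<Rightarrow> complex) \<Rightarrow> bool" for M where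
  zero: "hpoly M k (\<lambda>z. 0)"
| const: "hpoly M 0 (\<lambda>z. c)"
| lin: "hpoly M k p \<Longrightarrow> b \<in> M \<Longrightarrow> hpoly M (k + 1) (\<lambda>z. zeta b z * p z)"
| add: "hpoly M k p \<Longrightarrow> hpoly M k q \<Longrightarrow> hpoly M k (\<lambda>z. p z + q z)"

lemma hpoly_cong: "hpoly M k p \<Longrightarrow> k = l \<Longrightarrow> (\<And>z. p z = q z) \<Longrightarrow> hpoly M l q"
  by (metis ext)

lemma hpoly_mult:
  assumes "hpoly M k p" "hpoly M l q" shows "hpoly M (k + l) (\<lambda>z. p z * q z)"
  using assms(1)
proof induction
  case (zero k)
  then show ?case using hpoly.zero by simp
next
  case (const c)
  show ?case using assms(2)
  proof induction
    case (lin k p b)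
    show ?case by (rule hpoly_cong[OF hpoly.lin[OF lin(3,2)]]) (auto simp: algebra_simps)
  next
    case (add k p q)
    show ?case by (rule hpoly_cong[OF hpoly.add[OF add(3,4)]]) (auto simp: algebra_simps)
  qed (auto intro: hpoly.zero hpoly.const)
next
  case (lin k p b)
  show ?case by (rule hpoly_cong[OF hpoly.lin[OF lin(3,2)]]) (auto simp: algebra_simps)
next
  case (add k p q)
  show ?case by (rule hpoly_cong[OF hpoly.add[OF add(3,4)]]) (auto simp: algebra_simps)
qed

lemma hpoly_cmult: "hpoly M k p \<Longrightarrow> hpoly M k (\<lambda>z. c * p z)"
  using hpoly_mult[OF hpoly.const] by fastforce

lemma hpoly_uminus: "hpoly M k p \<Longrightarrow> hpoly M k (\<lambda>z. - p z)"
  using hpoly_cmult[of M k p "-1"] by simp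

lemma hpoly_diff: "hpoly M k p \<Longrightarrow> hpoly M k q \<Longrightarrow> hpoly M k (\<lambda>z. p z - q z)"
  using hpoly.add[OF _ hpoly_uminus] by fastforce

lemma hpoly_sum: "(\<And>i. i \<in> I \<Longrightarrow> hpoly M k (p i)) \<Longrightarrow> hpoly M k (\<lambda>z. \<Sum>i\<in>I. p i z)"
  by (induction I rule: infinite_finite_induct) (auto intro: hpoly.zero hpoly.add)

lemma hpoly_zeta: "b \<in> M \<Longrightarrow> hpoly M 1 (zeta b)"
  using hpoly.lin[OF hpoly.const[of M 1]] by force

lemma hpoly_neg: "hpoly M k p \<Longrightarrow> k < 0 \<Longrightarrow> p = (\<lambda>z. 0)"
  by (induction rule: hpoly.induct) auto

lemma hpoly_0: "hpoly M k p \<Longrightarrow> k = 0 \<Longrightarrow> \<exists>c. p = (\<lambda>z. c)"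
proof (induction rule: hpoly.induct)
  case (lin k p b)
  then have "p = (\<lambda>z. 0)" by (intro hpoly_neg) auto
  then show ?case by auto
qed (fastforce simp: fun_eq_iff)+

lemma hpoly_cscale: "hpoly M k p \<Longrightarrow> 0 \<le> k \<Longrightarrow> p (cscale t z) = t ^ nat k * p z"
proof (induction rule: hpoly.induct)
  case (lin k p b)
  show ?case
  proof (cases "k < 0")
    case True
    then have "p = (\<lambda>z. 0)" using lin by (intro hpoly_neg)
    then show ?thesis by simp
  next
    case False
    then show ?thesis using lin by (simp add: zeta_cscale nat_add_distrib)
  qed
qed (auto simp: algebra_simps)

lemma hpoly_at_0: "hpoly M k p \<Longrightarrow> 0 < k \<Longrightarrow> p 0 = 0"
  using hpoly_cscale[of M k p 0 0] by (simp add: power_0_left split: if_splits)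

lemma holomorphic_EC_hpoly: "hpoly M k p \<Longrightarrow> holomorphic_EC p U"
  by (induction rule: hpoly.induct) (auto intro: holomorphic_EC_add holomorphic_EC_mult holomorphic_EC_zeta)

text \<open>The linear forms \<open>zeta b\<close> with \<open>b \<in> M\<close> do not see the
  component orthogonal to \<open>M\<close>.\<close>

lemma hpoly_cproj: "hpoly M k p \<Longrightarrow> subspace M \<Longrightarrow> p (cproj M z) = p z"
proof (induction rule: hpoly.induct)
  case (lin k p b)
  have "b \<bullet> proj M x = b \<bullet> x" for x
    using inner_diff_proj[OF lin(4,2), of x] by (simp add: inner_diff_right)
  then show ?case using lin by (simp add: zeta_def cproj_def)
qed auto

lemma hpoly_compose:
  assumes "hpoly M k p" and "\<And>b. b \<in> M \<Longrightarrow> \<exists>b'\<in>M. \<forall>x. b \<bullet> w x = b' \<bullet> x"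
  shows "hpoly M k (\<lambda>z. p (map_prod w w z))"
  using assms(1)
proof induction
  case (lin k p b)
  obtain b' where b': "b' \<in> M" "\<And>x. b \<bullet> w x = b' \<bullet> x" using assms(2)[OF lin(2)] by blast
  have "zeta b (map_prod w w z) = zeta b' z" for z by (simp add: zeta_def b'(2))
  then show ?case using hpoly.lin[OF lin(3) b'(1)] by simp
qed (auto intro: hpoly.intros)

lemma entire_prod_nonzero:
  assumes "finite I" "\<And>i. i \<in> I \<Longrightarrow> holomorphic_EC (p i) UNIV" "\<And>i. i \<in> I \<Longrightarrow> \<exists>z. p i z \<noteq> 0"
  shows "\<exists>z. (\<Prod>i\<in>I. p i z) \<noteq> 0"
  using assms
proof (induction I rule: finite_induct)
  case (insert i I)
  obtain z where z: "p i z \<noteq> 0" using insert by blast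
  obtain z' where z': "(\<Prod>i\<in>I. p i z') \<noteq> 0" using insert by blast
  show ?case
  proof (rule ccontr)
    assume "\<not> ?thesis"
    then have "\<And>u. p i u * (\<Prod>i\<in>I. p i u) = 0" using insert by simp
    moreover have "holomorphic_EC (p i) UNIV" "holomorphic_EC (\<lambda>z. \<Prod>i\<in>I. p i z) UNIV"
      using insert by (auto intro: holomorphic_EC_prod)
    ultimately have "(\<Prod>i\<in>I. p i z') = 0"
      using holomorphic_EC_no_zero_divisors[of UNIV "p i" "\<lambda>u. \<Prod>i\<in>I. p i u" z z'] z by auto
    then show False using z' by simp
  qed
qed simp

lemma entire_no_zero_divisors:
  assumes "holomorphic_EC p UNIV" "holomorphic_EC q UNIV" "\<And>u. p u * q u = 0" "p z \<noteq> 0"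
  shows "q u = 0"
  using holomorphic_EC_no_zero_divisors[OF open_UNIV convex_UNIV assms(1,2,3) UNIV_I assms(4)] by blast

lemma dir_deriv_mult:
  assumes "holomorphic_EC p U" "holomorphic_EC q U" "z \<in> U"
  shows "dir_deriv (\<lambda>z. p z * q z) z v = p z * dir_deriv q z v + dir_deriv p z v * q z"
  using fun_cong[OF has_derivative_imp_dir_deriv[OF has_derivative_mult[OF
        holomorphic_EC_has_derivative(1)[OF assms(1,3)] holomorphic_EC_has_derivative(1)[OF assms(2,3)]]]] .

lemma dir_deriv_add:
  assumes "holomorphic_EC p U" "holomorphic_EC q U" "z \<in> U"
  shows "dir_deriv (\<lambda>z. p z + q z) z v = dir_deriv p z v + dir_deriv q z v"
  using fun_cong[OF has_derivative_imp_dir_deriv[OF has_derivative_add[OF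
        holomorphic_EC_has_derivative(1)[OF assms(1,3)] holomorphic_EC_has_derivative(1)[OF assms(2,3)]]]] .

lemma dir_deriv_const: "dir_deriv (\<lambda>z. c) z v = 0"
  using fun_cong[OF has_derivative_imp_dir_deriv[OF has_derivative_const]] .

lemma linear_dir_deriv:
  "holomorphic_EC p U \<Longrightarrow> z \<in> U \<Longrightarrow> linear (dir_deriv p z)"
  using holomorphic_EC_has_derivative(1) has_derivative_linear by blast

lemma dir_deriv_sum:
  assumes "\<And>i. i \<in> I \<Longrightarrow> holomorphic_EC (p i) U" "z \<in> U"
  shows "dir_deriv (\<lambda>z. \<Sum>i\<in>I. p i z) z v = (\<Sum>i\<in>I. dir_deriv (p i) z v)"
  using assms
  by (induction I rule: infinite_finite_induct)
    (auto simp: dir_deriv_const dir_deriv_add[where U = U] holomorphic_EC_sum)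

lemma dir_deriv_compose_linear:
  assumes "holomorphic_EC p UNIV" "linear w"
  shows "dir_deriv (\<lambda>z. p (w z)) z v = dir_deriv p (w z) (w v)"
proof -
  have "(w has_derivative w) (at z)"
    using assms(2) by (simp add: bounded_linear_imp_has_derivative linear_conv_bounded_linear)
  from has_derivative_compose[OF this holomorphic_EC_has_derivative(1)[OF assms(1) UNIV_I]]
  have "((\<lambda>z. p (w z)) has_derivative (\<lambda>v. dir_deriv p (w z) (w v))) (at z)" .
  from has_derivative_imp_dir_deriv[OF this] show ?thesis by simp
qed

text \<open>A constant has derivative zero, which is a polynomial of degree \<open>-1\<close> in the
  sense of \<open>hpoly\<close>, so the degree formula has no exception.\<close>

lemma hpoly_dir_deriv:
  assumes "hpoly M k p" shows "hpoly M (k - 1) (\<lambda>z. dir_deriv p z (v, 0))"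
  using assms
proof induction
  case (lin k p b)
  have "hpoly M k (\<lambda>z. zeta b z * dir_deriv p z (v, 0))"
    using hpoly.lin[OF lin(3,2)] by simp
  moreover have "hpoly M k (\<lambda>z. of_real (b \<bullet> v) * p z)"
    using lin(1) by (rule hpoly_cmult)
  ultimately have "hpoly M k (\<lambda>z. zeta b z * dir_deriv p z (v, 0) + of_real (b \<bullet> v) * p z)"
    by (rule hpoly.add)
  then show ?case
    by (rule hpoly_cong)
      (auto simp: dir_deriv_mult[OF holomorphic_EC_zeta holomorphic_EC_hpoly[OF lin(1)], of _ UNIV]
        dir_deriv_zeta, auto simp: zeta_def complex_of_real_def)
next
  case (add k p q)
  then show ?case
    using hpoly.add[OF add(3,4)] dir_deriv_add[OF holomorphic_EC_hpoly[OF add(1)] holomorphic_EC_hpoly[OF add(2)], of _ UNIV]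
    by simp
qed (auto simp: dir_deriv_const intro: hpoly.zero)

lemma zeta_onb_sum:
  assumes "subspace M" "b \<in> M"
  shows "(\<Sum>c\<in>onb M. zeta c z * of_real (b \<bullet> c)) = zeta b z"
proof -
  have "proj M b = b" using assms by (rule proj_id)
  then have "zeta b z = zeta (\<Sum>c\<in>onb M. (c \<bullet> b) *\<^sub>R c) z" by (simp add: proj_def)
  also have "\<dots> = (\<Sum>c\<in>onb M. zeta ((c \<bullet> b) *\<^sub>R c) z)"
  proof -
    have "zeta (\<Sum>c\<in>S. (c \<bullet> b) *\<^sub>R c) z = (\<Sum>c\<in>S. zeta ((c \<bullet> b) *\<^sub>R c) z)" for S
      by (induction S rule: infinite_finite_induct) (auto simp: zeta_zero zeta_add)
    then show ?thesis .
  qed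
  finally show ?thesis by (simp add: zeta_scale inner_commute mult.commute)
qed

text \<open>Euler's identity. It turns relations between first derivatives back into relations
  between the polynomials themselves.\<close>

lemma euler_hpoly:
  assumes "hpoly M k p" "subspace M"
  shows "(\<Sum>c\<in>onb M. zeta c z * dir_deriv p z (c, 0)) = of_int k * p z"
  using assms(1)
proof induction
  case (lin k p b)
  have d: "dir_deriv (\<lambda>z. zeta b z * p z) z (c, 0) = zeta b z * dir_deriv p z (c, 0) + of_real (b \<bullet> c) * p z" for c
    using dir_deriv_mult[OF holomorphic_EC_zeta holomorphic_EC_hpoly[OF lin(1)], of z UNIV]
    by (simp add: dir_deriv_zeta zeta_def complex_of_real_def)
  have "(\<Sum>c\<in>onb M. zeta c z * dir_deriv (\<lambda>z. zeta b z * p z) z (c, 0)) =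
      zeta b z * (\<Sum>c\<in>onb M. zeta c z * dir_deriv p z (c, 0)) + (\<Sum>c\<in>onb M. zeta c z * of_real (b \<bullet> c)) * p z"
    unfolding d by (simp add: sum_distrib_left sum_distrib_right sum.distrib algebra_simps)
  then show ?case using lin(3) zeta_onb_sum[OF assms(2) lin(2)] by (simp add: algebra_simps)
next
  case (add k p q)
  have "dir_deriv (\<lambda>z. p z + q z) z v = dir_deriv p z v + dir_deriv q z v" for v
    using dir_deriv_add[OF holomorphic_EC_hpoly[OF add(1)] holomorphic_EC_hpoly[OF add(2)], of z UNIV] by simp
  then show ?case using add(3,4) by (simp add: algebra_simps sum.distrib)
qed (auto simp: dir_deriv_const)

definition refl :: "'a::euclidean_space \<Rightarrow> 'a \<Rightarrow> 'a" where
  "refl \<alpha> x = x - (2 * (\<alpha> \<bullet> x) / (\<alpha> \<bullet> \<alpha>)) *\<^sub>R \<alpha>"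

lemma hpoly_refl:
  assumes "hpoly M k p" "subspace M" "\<alpha> \<in> M"
  shows "hpoly M k (\<lambda>z. p (map_prod (refl \<alpha>) (refl \<alpha>) z))"
proof (rule hpoly_compose[OF assms(1)])
  fix b assume b: "b \<in> M"
  have "b \<bullet> refl \<alpha> x = refl \<alpha> b \<bullet> x" for x
    by (simp add: refl_def inner_diff_left inner_diff_right inner_commute)
  moreover have "refl \<alpha> b \<in> M" using assms b by (simp add: refl_def subspace_diff subspace_scale)
  ultimately show "\<exists>b'\<in>M. \<forall>x. b \<bullet> refl \<alpha> x = b' \<bullet> x" by blast
qed

text \<open>The divided difference operator of a reflection. The quotient is built along the
  construction of the polynomial by a twisted product rule: on a linear form the difference is a
  constant multiple of \<open>zeta \<alpha>\<close>, and a product distributes it over both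
  factors.\<close>

lemma hpoly_refl_divides:
  assumes "hpoly M k p" "subspace M" "\<alpha> \<in> M"
  shows "\<exists>h. hpoly M (k - 1) h \<and> (\<forall>z. p z - p (map_prod (refl \<alpha>) (refl \<alpha>) z) = zeta \<alpha> z * h z)"
  using assms(1)
proof induction
  case (lin k p b)
  let ?s = "map_prod (refl \<alpha>) (refl \<alpha>)"
  obtain h where h: "hpoly M (k - 1) h" "\<And>z. p z - p (?s z) = zeta \<alpha> z * h z" using lin by blast
  define c where "c = complex_of_real (2 * (\<alpha> \<bullet> b) / (\<alpha> \<bullet> \<alpha>))"
  have c: "zeta b z - zeta b (?s z) = c * zeta \<alpha> z" for z
    by (simp add: zeta_def refl_def c_def complex_eq_iff inner_diff_right inner_commute)
  have "zeta b z * p z - zeta b (?s z) * p (?s z) = zeta \<alpha> z * (zeta b z * h z + c * p (?s z))" for z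
  proof -
    have "zeta b z * p z - zeta b (?s z) * p (?s z) =
        zeta b z * (p z - p (?s z)) + (zeta b z - zeta b (?s z)) * p (?s z)" by (simp add: algebra_simps)
    then show ?thesis unfolding h(2) c by (simp add: algebra_simps)
  qed
  moreover have "hpoly M k (\<lambda>z. zeta b z * h z + c * p (?s z))"
    using hpoly.lin[OF h(1) lin(2)] hpoly_cmult[OF hpoly_refl[OF lin(1) assms(2,3)]]
    by (auto intro!: hpoly.add)
  ultimately show ?case by (intro exI[of _ "\<lambda>z. zeta b z * h z + c * p (?s z)"]) simp
next
  case (add k p q)
  then obtain h h' where h: "hpoly M (k - 1) h" "\<And>z. p z - p (map_prod (refl \<alpha>) (refl \<alpha>) z) = zeta \<alpha> z * h z"
    "hpoly M (k - 1) h'" "\<And>z. q z - q (map_prod (refl \<alpha>) (refl \<alpha>) z) = zeta \<alpha> z * h' z" by blast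
  show ?case
  proof (intro exI conjI allI)
    show "hpoly M (k - 1) (\<lambda>z. h z + h' z)" using h by (intro hpoly.add)
    show "p z + q z - (p (map_prod (refl \<alpha>) (refl \<alpha>) z) + q (map_prod (refl \<alpha>) (refl \<alpha>) z)) = zeta \<alpha> z * (h z + h' z)" for z
      using h(2,4)[of z] by (simp add: algebra_simps)
  qed
qed (auto intro!: exI[of _ "\<lambda>z. 0"] hpoly.zero)

text \<open>The part of degree \<open>k\<close> of the ideal generated by \<open>G\<close>, with coefficients from the graded ring \<open>A\<close>;
  the integer arguments of \<open>A\<close> and \<open>G\<close> are degrees.\<close>

inductive gid :: "(int \<Rightarrow> ('b \<Rightarrow> complex) \<Rightarrow> bool) \<Rightarrow> (int \<Rightarrow> ('b \<Rightarrow> complex) \<Rightarrow> bool) \<Rightarrow> int \<Rightarrow> ('b \<Rightarrow> complex) \<Rightarrow> bool"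
  for A G where
  zero: "gid A G k (\<lambda>z. 0)"
| add: "gid A G k p \<Longrightarrow> gid A G k q \<Longrightarrow> gid A G k (\<lambda>z. p z + q z)"
| gen: "A l c \<Longrightarrow> G e g \<Longrightarrow> gid A G (l + e) (\<lambda>z. c z * g z)"

definition fam :: "'i set \<Rightarrow> ('i \<Rightarrow> int) \<Rightarrow> ('i \<Rightarrow> 'b \<Rightarrow> complex) \<Rightarrow> int \<Rightarrow> ('b \<Rightarrow> complex) \<Rightarrow> bool" where
  "fam J d f e g \<longleftrightarrow> (\<exists>j\<in>J. e = d j \<and> g = f j)"

lemma gid_cong: "gid A G k p \<Longrightarrow> k = l \<Longrightarrow> (\<And>z. p z = q z) \<Longrightarrow> gid A G l q"
  by (metis ext)

lemma gid_sum: "(\<And>i. i \<in> I \<Longrightarrow> gid A G k (p i)) \<Longrightarrow> gid A G k (\<lambda>z. \<Sum>i\<in>I. p i z)"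
  by (induction I rule: infinite_finite_induct) (auto intro: gid.zero gid.add)

lemma gid_mult:
  assumes "gid A G k p" "A m a" and A: "\<And>k l p q. A k p \<Longrightarrow> A l q \<Longrightarrow> A (k + l) (\<lambda>z. p z * q z)"
  shows "gid A G (m + k) (\<lambda>z. a z * p z)"
  using assms(1)
proof induction
  case (gen l c e g)
  have "gid A G (m + l + e) (\<lambda>z. a z * c z * g z)"
    by (rule gid.gen[of A "m + l" "\<lambda>z. a z * c z" G e g, OF A[OF assms(2) gen(1)] gen(2)])
  then show ?case by (rule gid_cong) (auto simp: algebra_simps)
next
  case (add k p q)
  show ?case by (rule gid_cong[OF gid.add[OF add(3,4)]]) (auto simp: algebra_simps)
qed (auto intro: gid.zero)

text \<open>Each generator may be replaced by its own expression in other generators; this is how a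
  generating set is made smaller.\<close>

lemma gid_trans:
  assumes "gid A G k p" and A: "\<And>k l p q. A k p \<Longrightarrow> A l q \<Longrightarrow> A (k + l) (\<lambda>z. p z * q z)"
    and G: "\<And>e g. G e g \<Longrightarrow> gid A G' e g"
  shows "gid A G' k p"
  using assms(1)
proof induction
  case (gen l c e g)
  show ?case using gid_mult[of A G' e g l c] G[OF gen(2)] gen(1) A by blast
next
  case (add k p q)
  show ?case using gid.add[of A G' k p q] add(3,4) by blast
next
  case (zero k)
  show ?case by (rule gid.zero)
qed

text \<open>Terms with the same generator are collected; homogeneity then dictates the degree of
  each coefficient.\<close>

lemma gid_fam_explicit:
  assumes "gid A (fam J d f) k p" "finite J"
    and A: "\<And>k. A k (\<lambda>z. 0)" "\<And>k p q. A k p \<Longrightarrow> A k q \<Longrightarrow> A k (\<lambda>z. p z + q z)"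
  shows "\<exists>c. (\<forall>j\<in>J. A (k - d j) (c j)) \<and> (\<forall>z. p z = (\<Sum>j\<in>J. c j z * f j z))"
  using assms(1)
proof induction
  case (zero k)
  show ?case by (intro exI[of _ "\<lambda>_ _. 0"]) (auto intro: A)
next
  case (add k p q)
  then obtain c c' where c: "\<forall>j\<in>J. A (k - d j) (c j)" "\<forall>z. p z = (\<Sum>j\<in>J. c j z * f j z)"
    "\<forall>j\<in>J. A (k - d j) (c' j)" "\<forall>z. q z = (\<Sum>j\<in>J. c' j z * f j z)" by blast
  then show ?case
    by (intro exI[of _ "\<lambda>j z. c j z + c' j z"]) (auto intro: A simp: algebra_simps sum.distrib)
next
  case (gen l c e g)
  then obtain j where j: "j \<in> J" "e = d j" "g = f j" unfolding fam_def by blast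
  have "(\<Sum>i\<in>J. (if i = j then c else (\<lambda>z. 0)) z * f i z) = c z * f j z" for z
  proof -
    have "(\<Sum>i\<in>J. (if i = j then c else (\<lambda>z. 0)) z * f i z) = (\<Sum>i\<in>J. if i = j then c z * f j z else 0)"
      by (rule sum.cong) auto
    then show ?thesis using assms(2) j(1) by simp
  qed
  moreover have "A (l + e - d i) (if i = j then c else (\<lambda>z. 0))" for i
    using gen(1) j A(1) by (cases "i = j") auto
  ultimately show ?case
    using j by (intro exI[of _ "\<lambda>i. if i = j then c else (\<lambda>z. 0)"]) metis
qed

lemma gid_fam_sum:
  assumes "\<And>j. j \<in> J \<Longrightarrow> A (k - d j) (c j)"
  shows "gid A (fam J d f) k (\<lambda>z. \<Sum>j\<in>J. c j z * f j z)"
proof (rule gid_sum)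
  fix j assume j: "j \<in> J"
  have "gid A (fam J d f) (k - d j + d j) (\<lambda>z. c j z * f j z)"
    using assms[OF j] j by (intro gid.gen) (auto simp: fam_def)
  then show "gid A (fam J d f) k (\<lambda>z. c j z * f j z)" by simp
qed

text \<open>Fraction-free Gaussian elimination, one column at a time: rows are cleared by cross
  multiplication with a pivot entry, so all entries stay homogeneous polynomials. With more rows
  than columns a nontrivial relation is left over.\<close>

lemma hpoly_elimination:
  assumes "finite C" "finite I" "card C < card I" "\<And>i b. i \<in> I \<Longrightarrow> b \<in> C \<Longrightarrow> hpoly M (\<delta> i) (v i b)"
  shows "\<exists>p c. (\<forall>i\<in>I. hpoly M (c - \<delta> i) (p i)) \<and> (\<exists>i\<in>I. \<exists>z. p i z \<noteq> 0) \<and>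
    (\<forall>b\<in>C. \<forall>z. (\<Sum>i\<in>I. p i z * v i b z) = 0)"
  using assms
proof (induction C arbitrary: I v \<delta> rule: finite_induct)
  case empty
  then obtain i0 where i0: "i0 \<in> I" by fastforce
  then show ?case
    by (intro exI[of _ "\<lambda>i z. if i = i0 then 1 else 0"] exI[of _ "\<delta> i0"])
      (auto intro: hpoly.zero hpoly.const)
next
  case (insert b C)
  show ?case
  proof (cases "\<forall>i\<in>I. \<forall>z. v i b z = 0")
    case True
    have "card C < card I" using insert by simp
    then obtain p c where "\<forall>i\<in>I. hpoly M (c - \<delta> i) (p i)" "\<exists>i\<in>I. \<exists>z. p i z \<noteq> 0"
      "\<forall>b\<in>C. \<forall>z. (\<Sum>i\<in>I. p i z * v i b z) = 0"
      using insert.IH[of I \<delta> v] insert.prems by auto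
    then show ?thesis using True by (intro exI[of _ p] exI[of _ c]) auto
  next
    case False
    then obtain j z0 where j: "j \<in> I" "v j b z0 \<noteq> 0" by blast
    define I' where "I' = I - {j}"
    have I: "I = insert j I'" "j \<notin> I'" "finite I'" using j insert.prems by (auto simp: I'_def)
    define v' where "v' = (\<lambda>i b' z. v j b z * v i b' z - v i b z * v j b' z)"
    have "hpoly M (\<delta> j + \<delta> i) (v' i b')" if "i \<in> I'" "b' \<in> C" for i b'
    proof -
      have "hpoly M (\<delta> i + \<delta> j) (\<lambda>z. v i b z * v j b' z)"
        using insert.prems(3) that I by (intro hpoly_mult) auto
      moreover have "hpoly M (\<delta> j + \<delta> i) (\<lambda>z. v j b z * v i b' z)"
        using insert.prems(3) that I by (intro hpoly_mult) auto
      ultimately show ?thesis unfolding v'_def by (intro hpoly_diff) (simp_all add: add.commute)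
    qed
    moreover have "card C < card I'" using insert I by simp
    ultimately obtain q c where q: "\<And>i. i \<in> I' \<Longrightarrow> hpoly M (c - (\<delta> j + \<delta> i)) (q i)"
      "\<exists>i\<in>I'. \<exists>z. q i z \<noteq> 0" "\<And>b' z. b' \<in> C \<Longrightarrow> (\<Sum>i\<in>I'. q i z * v' i b' z) = 0"
      using insert.IH[of I' "\<lambda>i. \<delta> j + \<delta> i" v', OF I(3)] by blast
    \<comment> \<open>Back substitution: the other coefficients are multiplied by the pivot entry,
      and the pivot row gets the coefficient that cancels column \<open>b\<close>.\<close>
    define p where "p = (\<lambda>i z. if i = j then - (\<Sum>i\<in>I'. q i z * v i b z) else q i z * v j b z)"
    have vj: "hpoly M (\<delta> j) (v j b)" using insert.prems(3) j by auto
    have "hpoly M (c - \<delta> i) (p i)" if "i \<in> I" for i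
    proof (cases "i = j")
      case True
      have "hpoly M (c - \<delta> j) (\<lambda>z. q i z * v i b z)" if "i \<in> I'" for i
        using hpoly_mult[OF q(1)[OF that] insert.prems(3)[of i b]] that I by (simp add: algebra_simps)
      then show ?thesis using True unfolding p_def by (simp add: hpoly_uminus hpoly_sum)
    next
      case False
      then have "i \<in> I'" using that I by auto
      then show ?thesis using hpoly_mult[OF q(1) vj, of i] False unfolding p_def by (simp add: algebra_simps)
    qed
    moreover have "\<exists>i\<in>I. \<exists>z. p i z \<noteq> 0"
    proof -
      obtain i z where i: "i \<in> I'" "q i z \<noteq> 0" using q(2) by blast
      then have "i \<noteq> j" using I by auto
      moreover have "\<not> (\<forall>u. q i u * v j b u = 0)"
        using entire_no_zero_divisors[OF holomorphic_EC_hpoly[OF q(1)[OF i(1)]] holomorphic_EC_hpoly[OF vj] _ i(2), of z0] j(2)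
        by auto
      ultimately show ?thesis using i(1) I unfolding p_def by auto
    qed
    moreover have "(\<Sum>i\<in>I. p i z * v i b' z) = 0" if "b' \<in> insert b C" for b' z
    proof -
      have "(\<Sum>i\<in>I. p i z * v i b' z) = (\<Sum>i\<in>I'. q i z * v j b z * v i b' z) - (\<Sum>i\<in>I'. q i z * v i b z) * v j b' z"
        using I by (auto simp: p_def intro!: sum.cong)
      also have "\<dots> = (\<Sum>i\<in>I'. q i z * v' i b' z)"
        by (simp add: v'_def sum_distrib_left sum_distrib_right right_diff_distrib sum_subtractf mult_ac)
      also have "\<dots> = 0"
        using that q(3) by (cases "b' = b") (auto simp: v'_def)
      finally show ?thesis .
    qed
    ultimately show ?thesis by blast
  qed
qed

section \<open>Finite reflection groups and averaging\<close>

inductive_set compositions :: "('b \<Rightarrow> 'b) set \<Rightarrow> ('b \<Rightarrow> 'b) set" for S where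
  id: "id \<in> compositions S"
| comp: "s \<in> S \<Longrightarrow> w \<in> compositions S \<Longrightarrow> s \<circ> w \<in> compositions S"

text \<open>The group acts on the whole space and fixes the orthogonal complement of
  \<open>M\<close> pointwise, so that its quotient map can be realized as a map of V + iV to itself.
  In \<open>gen\<close>, words in reflections stand for the generated group; reflections are
  involutions.\<close>

locale finite_refl_group =
  fixes M :: "'a::euclidean_space set" and F :: "('a \<Rightarrow> 'a) set"
  assumes sub: "subspace M" and fin: "finite F" and id_mem: "id \<in> F"
    and comp_mem: "v \<in> F \<Longrightarrow> w \<in> F \<Longrightarrow> v \<circ> w \<in> F"
    and inv_mem: "w \<in> F \<Longrightarrow> \<exists>v\<in>F. v \<circ> w = id \<and> w \<circ> v = id"
    and orth: "w \<in> F \<Longrightarrow> orthogonal_transformation w"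
    and M_inv: "w \<in> F \<Longrightarrow> x \<in> M \<Longrightarrow> w x \<in> M"
    and fix_perp: "w \<in> F \<Longrightarrow> (\<And>y. y \<in> M \<Longrightarrow> y \<bullet> x = 0) \<Longrightarrow> w x = x"
    and gen: "F \<subseteq> compositions {refl \<alpha> | \<alpha>. \<alpha> \<in> M \<and> \<alpha> \<noteq> 0 \<and> refl \<alpha> \<in> F}"
begin

abbreviation act :: "('a \<Rightarrow> 'a) \<Rightarrow> 'a \<times> 'a \<Rightarrow> 'a \<times> 'a" where "act w \<equiv> map_prod w w"

definition invariant :: "('a \<times> 'a \<Rightarrow> complex) \<Rightarrow> bool" where
  "invariant p \<longleftrightarrow> (\<forall>w\<in>F. \<forall>z. p (act w z) = p z)"

definition av :: "('a \<times> 'a \<Rightarrow> complex) \<Rightarrow> 'a \<times> 'a \<Rightarrow> complex" where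
  "av p z = (\<Sum>w\<in>F. p (act w z)) / of_nat (card F)"

definition ipoly :: "int \<Rightarrow> ('a \<times> 'a \<Rightarrow> complex) \<Rightarrow> bool" where
  "ipoly k p \<longleftrightarrow> hpoly M k p \<and> invariant p"

definition pipoly :: "int \<Rightarrow> ('a \<times> 'a \<Rightarrow> complex) \<Rightarrow> bool" where
  "pipoly k p \<longleftrightarrow> 0 < k \<and> ipoly k p"

lemma act_comp: "act v (act w z) = act (v \<circ> w) z"
  by (cases z) simp

lemma linear_F: "w \<in> F \<Longrightarrow> linear w"
  using orth orthogonal_transformation_linear by blast

lemma inner_F: "w \<in> F \<Longrightarrow> w x \<bullet> w y = x \<bullet> y"
  using orth unfolding orthogonal_transformation_def by blast

lemma bij_comp_right: assumes "w \<in> F" shows "bij_betw (\<lambda>v. v \<circ> w) F F"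
proof -
  obtain u where u: "u \<in> F" "u \<circ> w = id" "w \<circ> u = id" using inv_mem[OF assms] by blast
  show ?thesis
    by (rule bij_betw_byWitness[where f' = "\<lambda>v. v \<circ> u"])
      (use u assms comp_mem in \<open>auto simp: o_assoc[symmetric]\<close>)
qed

lemma card_F: "card F \<noteq> 0"
  using fin id_mem by auto

lemma invariant_av: "invariant (av p)"
  unfolding invariant_def
proof (intro ballI allI)
  fix w z assume w: "w \<in> F"
  have "(\<Sum>v\<in>F. p (act v (act w z))) = (\<Sum>v\<in>F. p (act v z))"
    unfolding act_comp by (rule sum.reindex_bij_betw[OF bij_comp_right[OF w]])
  then show "av p (act w z) = av p z" by (simp add: av_def)
qed

lemma av_invariant: "invariant p \<Longrightarrow> av p = p"
  using card_F by (auto simp: av_def invariant_def fun_eq_iff)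

lemma av_add: "av (\<lambda>z. p z + q z) = (\<lambda>z. av p z + av q z)"
  by (auto simp: av_def sum.distrib add_divide_distrib)

lemma av_zero: "av (\<lambda>z. 0) = (\<lambda>z. 0)"
  by (auto simp: av_def)

lemma av_mult: "invariant g \<Longrightarrow> av (\<lambda>z. p z * g z) = (\<lambda>z. av p z * g z)"
  by (auto simp: fun_eq_iff av_def invariant_def sum_distrib_right)

lemma av_sum: "av (\<lambda>z. \<Sum>i\<in>I. p i z) = (\<lambda>z. \<Sum>i\<in>I. av (p i) z)"
  by (induction I rule: infinite_finite_induct) (auto simp: av_zero av_add)

lemma hpoly_act:
  assumes "hpoly M k p" "w \<in> F" shows "hpoly M k (\<lambda>z. p (act w z))"
proof (rule hpoly_compose[OF assms(1)])
  fix b assume b: "b \<in> M"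
  obtain u where u: "u \<in> F" "w \<circ> u = id" using inv_mem[OF assms(2)] by blast
  have "b \<bullet> w x = u b \<bullet> x" for x
    using inner_F[OF assms(2), of "u b" x] u(2) by (simp add: fun_eq_iff)
  then show "\<exists>b'\<in>M. \<forall>x. b \<bullet> w x = b' \<bullet> x" using M_inv[OF u(1) b] by blast
qed

lemma hpoly_av: "hpoly M k p \<Longrightarrow> hpoly M k (av p)"
  unfolding av_def[abs_def] divide_inverse mult.commute[of _ "inverse _"]
  by (intro hpoly_cmult hpoly_sum hpoly_act)

lemma ipoly_av: "hpoly M k p \<Longrightarrow> ipoly k (av p)"
  unfolding ipoly_def using hpoly_av invariant_av by blast

lemma ipoly_mult: "ipoly k p \<Longrightarrow> ipoly l q \<Longrightarrow> ipoly (k + l) (\<lambda>z. p z * q z)"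
  unfolding ipoly_def invariant_def using hpoly_mult[of M k p l q] by simp

lemma ipoly_zero: "ipoly k (\<lambda>z. 0)"
  unfolding ipoly_def invariant_def by (simp add: hpoly.zero)

lemma ipoly_add: "ipoly k p \<Longrightarrow> ipoly k q \<Longrightarrow> ipoly k (\<lambda>z. p z + q z)"
  unfolding ipoly_def invariant_def using hpoly.add[of M k p q] by simp

lemma ipoly_cmult: "ipoly k p \<Longrightarrow> ipoly k (\<lambda>z. c * p z)"
  unfolding ipoly_def invariant_def using hpoly_cmult[of M k p c] by simp

text \<open>Averaging commutes with multiplication by an invariant, so it leaves the generators
  alone and makes the coefficients invariant.\<close>

lemma gid_av:
  assumes "gid (hpoly M) G k p" "\<And>e g. G e g \<Longrightarrow> invariant g"
  shows "gid ipoly G k (av p)"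
  using assms(1)
proof induction
  case (gen l c e g)
  show ?case unfolding av_mult[OF assms(2)[OF gen(2)]]
    using gid.gen[of ipoly l "av c" G e g] ipoly_av[OF gen(1)] gen(2) by blast
next
  case (add k p q)
  show ?case unfolding av_add using gid.add[of ipoly G k "av p" "av q"] add(3,4) by blast
qed (simp add: av_zero gid.zero)

lemma gid_pipoly_act:
  assumes "gid (hpoly M) pipoly k p" "w \<in> F" shows "gid (hpoly M) pipoly k (\<lambda>z. p (act w z))"
  using assms(1)
proof induction
  case (gen l c e g)
  have "gid (hpoly M) pipoly (l + e) (\<lambda>z. c (act w z) * g z)"
    using gid.gen[of "hpoly M" l "\<lambda>z. c (act w z)" pipoly e g] hpoly_act[OF gen(1) assms(2)] gen(2) by blast
  moreover have "g (act w z) = g z" for z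
    using gen(2) assms(2) by (simp add: pipoly_def ipoly_def invariant_def)
  ultimately show ?case by simp
next
  case (add k p q)
  show ?case
    using gid.add[of "hpoly M" pipoly k "\<lambda>z. p (act w z)" "\<lambda>z. q (act w z)"] add(3,4) by blast
qed (simp add: gid.zero)

text \<open>Chevalley's lemma. Applying a reflection to the relation and dividing the difference by
  the linear form of the mirror lowers the degree of the coefficients.\<close>

lemma chevalley_syzygy:
  assumes J: "finite J" "j0 \<in> J" and a: "\<And>j. j \<in> J \<Longrightarrow> ipoly (e j) (a j)"
    and min: "\<not> gid ipoly (fam (J - {j0}) e a) (e j0) (a j0)"
    and b: "\<And>j. j \<in> J \<Longrightarrow> hpoly M (m - e j) (b j)" and rel: "\<And>z. (\<Sum>j\<in>J. a j z * b j z) = 0"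
  shows "gid (hpoly M) pipoly (m - e j0) (b j0)"
  using b rel
proof (induction "nat (m - e j0)" arbitrary: m b)
  case 0
  show ?case
  proof (cases "m - e j0 < 0")
    case True
    then have "b j0 = (\<lambda>z. 0)" using hpoly_neg[OF 0(2)[OF J(2)]] by blast
    then show ?thesis by (simp add: gid.zero)
  next
    case False
    then have m: "m = e j0" using 0 by simp
    then obtain c where c: "b j0 = (\<lambda>z. c)" using hpoly_0[OF 0(2)[OF J(2)]] by auto
    \<comment> \<open>Otherwise averaging the relation would solve it for \<open>a j0\<close> with
      invariant coefficients, against \<open>min\<close>.\<close>
    have "c = 0"
    proof (rule ccontr)
      assume c0: "c \<noteq> 0"
      have "(\<lambda>z. \<Sum>j\<in>J. av (b j) z * a j z) = av (\<lambda>z. \<Sum>j\<in>J. b j z * a j z)"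
        using a unfolding av_sum by (intro ext sum.cong) (auto simp: av_mult ipoly_def)
      also have "\<dots> = (\<lambda>z. 0)" using 0(3) by (simp add: mult.commute av_zero)
      finally have "(\<Sum>j\<in>J. av (b j) z * a j z) = 0" for z by (meson fun_cong)
      moreover have "av (b j0) = (\<lambda>z. c)" using c card_F by (auto simp: av_def)
      ultimately have "c * a j0 z + (\<Sum>j\<in>J - {j0}. av (b j) z * a j z) = 0" for z
        using sum.remove[OF J, of "\<lambda>j. av (b j) z * a j z"] by (metis (no_types, lifting))
      then have "a j0 z = (\<Sum>j\<in>J - {j0}. (- 1 / c * av (b j) z) * a j z)" for z
        using c0 by (simp add: sum_negf sum_divide_distrib[symmetric] eq_neg_iff_add_eq_0 field_simps)
      moreover have "gid ipoly (fam (J - {j0}) e a) (e j0) (\<lambda>z. \<Sum>j\<in>J - {j0}. (- 1 / c * av (b j) z) * a j z)"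
        using 0(2) m by (intro gid_fam_sum ipoly_cmult ipoly_av) auto
      ultimately show False using min by (metis (no_types, lifting) ext)
    qed
    then show ?thesis using c by (simp add: gid.zero)
  qed
next
  case (Suc n)
  let ?k = "m - e j0"
  have IH: "gid (hpoly M) pipoly (?k - 1) (h j0)"
    if "\<And>j. j \<in> J \<Longrightarrow> hpoly M (m - e j - 1) (h j)" "\<And>z. (\<Sum>j\<in>J. a j z * h j z) = 0" for h
    using Suc(1)[of "m - 1" h] Suc(2) that by (simp add: algebra_simps)
  have step: "gid (hpoly M) pipoly ?k (\<lambda>z. b j0 z - b j0 (act (refl \<alpha>) z))"
    if \<alpha>: "\<alpha> \<in> M" "\<alpha> \<noteq> 0" "refl \<alpha> \<in> F" for \<alpha>
  proof -
    have "\<forall>j\<in>J. \<exists>h. hpoly M (m - e j - 1) h \<and> (\<forall>z. b j z - b j (act (refl \<alpha>) z) = zeta \<alpha> z * h z)"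
      using hpoly_refl_divides[OF Suc(3) sub \<alpha>(1)] by blast
    then obtain h where h: "\<And>j. j \<in> J \<Longrightarrow> hpoly M (m - e j - 1) (h j)"
      "\<And>j z. j \<in> J \<Longrightarrow> b j z - b j (act (refl \<alpha>) z) = zeta \<alpha> z * h j z" by metis
    have "zeta \<alpha> z * (\<Sum>j\<in>J. a j z * h j z) = 0" for z
    proof -
      have "zeta \<alpha> z * (\<Sum>j\<in>J. a j z * h j z) = (\<Sum>j\<in>J. a j z * (b j z - b j (act (refl \<alpha>) z)))"
        by (simp add: sum_distrib_left h(2) mult_ac)
      also have "\<dots> = (\<Sum>j\<in>J. a j z * b j z) - (\<Sum>j\<in>J. a j (act (refl \<alpha>) z) * b j (act (refl \<alpha>) z))"
        unfolding right_diff_distrib sum_subtractf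
        using a \<alpha>(3) by (auto simp: ipoly_def invariant_def intro!: sum.cong)
      finally show ?thesis using Suc(4) by simp
    qed
    moreover have "zeta \<alpha> (\<alpha>, 0) \<noteq> 0" using \<alpha>(2) by (simp add: zeta_def complex_eq_iff)
    moreover have "holomorphic_EC (\<lambda>z. \<Sum>j\<in>J. a j z * h j z) UNIV"
      using a h(1) by (intro holomorphic_EC_sum holomorphic_EC_mult) (auto simp: ipoly_def intro: holomorphic_EC_hpoly)
    ultimately have "(\<Sum>j\<in>J. a j z * h j z) = 0" for z
      using entire_no_zero_divisors[OF holomorphic_EC_zeta] by blast
    then have "gid (hpoly M) pipoly (?k - 1) (h j0)" using h(1) by (intro IH)
    then have "gid (hpoly M) pipoly (1 + (?k - 1)) (\<lambda>z. zeta \<alpha> z * h j0 z)"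
      using gid_mult[of "hpoly M" pipoly "?k - 1" "h j0" 1 "zeta \<alpha>"] hpoly_zeta[OF \<alpha>(1)] hpoly_mult[of M]
      by simp
    then show ?thesis using h(2)[OF J(2)] by simp
  qed
  \<comment> \<open>Telescoping along a word in reflections; the ideal itself is stable under the
    group by \<open>gid_pipoly_act\<close>.\<close>
  have "gid (hpoly M) pipoly ?k (\<lambda>z. b j0 z - b j0 (act w z))" if "w \<in> F" for w
  proof -
    have "w \<in> compositions {refl \<alpha> | \<alpha>. \<alpha> \<in> M \<and> \<alpha> \<noteq> 0 \<and> refl \<alpha> \<in> F}" using gen that by blast
    then have "w \<in> F \<and> gid (hpoly M) pipoly ?k (\<lambda>z. b j0 z - b j0 (act w z))"
    proof induction
      case id
      have e: "(\<lambda>z. b j0 z - b j0 (act id z)) = (\<lambda>z. 0)" by (simp add: map_prod.id)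
      show ?case unfolding e using id_mem gid.zero by blast
    next
      case (comp s w)
      then obtain \<alpha> where \<alpha>: "s = refl \<alpha>" "\<alpha> \<in> M" "\<alpha> \<noteq> 0" "refl \<alpha> \<in> F" by blast
      have w: "w \<in> F" "gid (hpoly M) pipoly ?k (\<lambda>z. b j0 z - b j0 (act w z))" using comp by auto
      have "gid (hpoly M) pipoly ?k (\<lambda>z. b j0 (act w z) - b j0 (act (refl \<alpha>) (act w z)))"
        by (rule gid_pipoly_act[OF step[OF \<alpha>(2-4)] w(1)])
      from gid.add[OF w(2) this] have "gid (hpoly M) pipoly ?k (\<lambda>z. b j0 z - b j0 (act (refl \<alpha> \<circ> w) z))"
        by (rule gid_cong) (auto simp: act_comp[symmetric])
      then show ?case using \<alpha>(1,4) w(1) comp_mem by blast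
    qed
    then show ?thesis by blast
  qed
  \<comment> \<open>Summing over the group shows that \<open>b j0\<close> is congruent to its
    average, and the average lies in the ideal because it is an invariant of positive
    degree.\<close>
  then have "gid (hpoly M) pipoly ?k (\<lambda>z. \<Sum>w\<in>F. b j0 z - b j0 (act w z))"
    by (rule gid_sum)
  from gid_mult[of "hpoly M" pipoly ?k _ 0 "\<lambda>z. 1 / of_nat (card F)", OF this hpoly.const hpoly_mult]
  have "gid (hpoly M) pipoly (0 + ?k) (\<lambda>z. 1 / of_nat (card F) * (\<Sum>w\<in>F. b j0 z - b j0 (act w z)))"
    by blast
  then have 1: "gid (hpoly M) pipoly ?k (\<lambda>z. b j0 z - av (b j0) z)"
    by (rule gid_cong) (use card_F in \<open>auto simp: av_def sum_subtractf diff_divide_distrib\<close>)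
  have "pipoly ?k (av (b j0))"
    using Suc(2) ipoly_av[OF Suc(3)[OF J(2)]] by (simp add: pipoly_def)
  from gid.gen[of "hpoly M" 0 "\<lambda>z. 1" pipoly ?k "av (b j0)", OF hpoly.const this]
  have "gid (hpoly M) pipoly ?k (av (b j0))" by simp
  from gid.add[of "hpoly M" pipoly ?k "\<lambda>z. b j0 z - av (b j0) z" "av (b j0)", OF 1 this]
  show ?case by simp
qed

end

section \<open>The number of generating invariants\<close>

context finite_refl_group
begin

text \<open>The greedy choice of generators for the ideal of invariants of positive degree: each
  \<open>f i\<close> has the least degree among those invariants outside the ideal of its
  predecessors.\<close>

definition good_seq :: "nat \<Rightarrow> (nat \<Rightarrow> int) \<Rightarrow> (nat \<Rightarrow> 'a \<times> 'a \<Rightarrow> complex) \<Rightarrow> bool" where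
  "good_seq r d f \<longleftrightarrow> (\<forall>i<r. pipoly (d i) (f i) \<and>
     \<not> gid (hpoly M) (fam {..<i} d f) (d i) (f i) \<and>
     (\<forall>e g. pipoly e g \<longrightarrow> e < d i \<longrightarrow> gid (hpoly M) (fam {..<i} d f) e g))"

lemma holomorphic_EC_ipoly: "ipoly k p \<Longrightarrow> holomorphic_EC p U"
  by (auto simp: ipoly_def intro: holomorphic_EC_hpoly)

lemma dir_deriv_act:
  assumes "ipoly k p" "w \<in> F" shows "dir_deriv p (act w z) (act w v) = dir_deriv p z v"
proof -
  have "(\<lambda>z. p (act w z)) = p" using assms by (auto simp: ipoly_def invariant_def)
  then show ?thesis
    using dir_deriv_compose_linear[OF holomorphic_EC_ipoly[OF assms(1)] linear_map_prod_dup[OF linear_F[OF assms(2)]], of z v]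
    by simp
qed

lemma dir_deriv_onb:
  assumes "holomorphic_EC p UNIV" "u \<in> M"
  shows "dir_deriv p z (u, 0) = (\<Sum>b\<in>onb M. of_real (b \<bullet> u) * dir_deriv p z (b, 0))"
proof -
  have l: "linear (dir_deriv p z)" by (rule linear_dir_deriv[OF assms(1)]) simp
  have "(u, 0) = (\<Sum>b\<in>onb M. (b \<bullet> u) *\<^sub>R (b, 0::'a))"
    using proj_id[OF sub assms(2)] unfolding proj_def
    by (simp add: prod_eq_iff fst_sum snd_sum)
  then have "dir_deriv p z (u, 0) = (\<Sum>b\<in>onb M. (b \<bullet> u) *\<^sub>R dir_deriv p z (b, 0))"
    by (simp only: linear_sum[OF l] linear_scale[OF l])
  then show ?thesis by (simp add: scaleR_conv_of_real)
qed

text \<open>A syzygy of the differentials becomes invariant after multiplying by the product of the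
  other conjugates of one coefficient and averaging.\<close>

lemma invariant_relation:
  assumes f: "\<And>i. i < r \<Longrightarrow> pipoly (d i) (f i)" and r: "card (onb M) < r"
  shows "\<exists>p c. (\<forall>i<r. ipoly (c - d i) (p i)) \<and> (\<exists>i<r. \<exists>z. p i z \<noteq> 0) \<and>
    (\<forall>b\<in>onb M. \<forall>z. (\<Sum>i<r. p i z * dir_deriv (f i) z (b, 0)) = 0)"
proof -
  have fi: "ipoly (d i) (f i)" if "i < r" for i using f[OF that] by (simp add: pipoly_def)
  have "\<exists>p c. (\<forall>i\<in>{..<r}. hpoly M (c - (d i - 1)) (p i)) \<and> (\<exists>i\<in>{..<r}. \<exists>z. p i z \<noteq> 0) \<and>
      (\<forall>b\<in>onb M. \<forall>z. (\<Sum>i<r. p i z * dir_deriv (f i) z (b, 0)) = 0)"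
    using r onb(6)[OF sub] fi
    by (intro hpoly_elimination hpoly_dir_deriv) (auto simp: ipoly_def)
  then obtain p c j where p: "\<And>i. i < r \<Longrightarrow> hpoly M (c - (d i - 1)) (p i)" and j: "j < r" "\<exists>z. p j z \<noteq> 0"
    and rel: "\<And>b z. b \<in> onb M \<Longrightarrow> (\<Sum>i<r. p i z * dir_deriv (f i) z (b, 0)) = 0" by blast
  have rel': "(\<Sum>i<r. p i z * dir_deriv (f i) z (u, 0)) = 0" if "u \<in> M" for u z
  proof -
    have "(\<Sum>i<r. p i z * dir_deriv (f i) z (u, 0)) =
        (\<Sum>i<r. \<Sum>b\<in>onb M. p i z * (of_real (b \<bullet> u) * dir_deriv (f i) z (b, 0)))"
      using dir_deriv_onb[OF holomorphic_EC_ipoly[OF fi] that] by (simp add: sum_distrib_left)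
    also have "\<dots> = (\<Sum>b\<in>onb M. \<Sum>i<r. p i z * (of_real (b \<bullet> u) * dir_deriv (f i) z (b, 0)))"
      by (rule sum.swap)
    also have "\<dots> = (\<Sum>b\<in>onb M. of_real (b \<bullet> u) * (\<Sum>i<r. p i z * dir_deriv (f i) z (b, 0)))"
      by (simp add: sum_distrib_left mult_ac)
    finally show ?thesis using rel by simp
  qed
  define q where "q = (\<lambda>z. \<Prod>v\<in>F - {id}. p j (act v z))"
  have q: "hpoly M (of_nat (card (F - {id})) * (c - (d j - 1))) q"
  proof -
    have "hpoly M (of_nat (card A) * (c - (d j - 1))) (\<lambda>z. \<Prod>v\<in>A. p j (act v z))" if "A \<subseteq> F" for A
      using finite_subset[OF that fin] that
    proof (induction A rule: finite_induct)
      case (insert v A)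
      then show ?case
        using hpoly_mult[OF hpoly_act[OF p[OF j(1)], of v] insert.IH] by (simp add: algebra_simps)
    qed (simp add: hpoly.const)
    then show ?thesis unfolding q_def by blast
  qed
  define P where "P = (\<lambda>i. av (\<lambda>z. q z * p i z))"
  \<comment> \<open>The summand 1 accounts for the derivatives having degree
    \<open>d i - 1\<close>.\<close>
  define c' where "c' = of_nat (card (F - {id})) * (c - (d j - 1)) + c + 1"
  have "ipoly (c' - d i) (P i)" if "i < r" for i
    using ipoly_av[OF hpoly_mult[OF q p[OF that]]] unfolding P_def c'_def by (simp add: algebra_simps)
  moreover have "\<exists>z. P j z \<noteq> 0"
  proof -
    have qp: "q z * p j z = (\<Prod>v\<in>F. p j (act v z))" for z
      using prod.remove[OF fin id_mem, of "\<lambda>v. p j (act v z)"] unfolding q_def by (simp add: map_prod.id)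
    have "(\<Prod>v\<in>F. p j (act v (act w z))) = (\<Prod>v\<in>F. p j (act v z))" if "w \<in> F" for w z
      unfolding act_comp by (rule prod.reindex_bij_betw[OF bij_comp_right[OF that]])
    then have "P j z = (\<Prod>v\<in>F. p j (act v z))" for z
      unfolding P_def qp using av_invariant[of "\<lambda>z. \<Prod>v\<in>F. p j (act v z)"]
      by (simp add: invariant_def)
    moreover have "\<exists>z. (\<Prod>v\<in>F. p j (act v z)) \<noteq> 0"
    proof (rule entire_prod_nonzero[OF fin])
      fix v assume v: "v \<in> F"
      show "holomorphic_EC (\<lambda>z. p j (act v z)) UNIV"
        using hpoly_act[OF p[OF j(1)] v] by (rule holomorphic_EC_hpoly)
      obtain u where u: "u \<in> F" "v \<circ> u = id" using inv_mem[OF v] by blast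
      obtain z where "p j z \<noteq> 0" using j by blast
      then have "p j (act v (act u z)) \<noteq> 0" by (simp add: act_comp u map_prod.id)
      then show "\<exists>z. p j (act v z) \<noteq> 0" by blast
    qed
    ultimately show ?thesis by simp
  qed
  moreover have "(\<Sum>i<r. P i z * dir_deriv (f i) z (b, 0)) = 0" if b: "b \<in> onb M" for b z
  proof -
    have b': "b \<in> M" using onb(1)[OF sub] b by blast
    have "(\<Sum>i<r. (\<Sum>w\<in>F. q (act w z) * p i (act w z)) * dir_deriv (f i) z (b, 0)) =
        (\<Sum>w\<in>F. q (act w z) * (\<Sum>i<r. p i (act w z) * dir_deriv (f i) (act w z) (w b, 0)))"
    proof -
      have "dir_deriv (f i) z (b, 0) = dir_deriv (f i) (act w z) (w b, 0)" if "i < r" "w \<in> F" for i w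
        using dir_deriv_act[OF fi[OF that(1)] that(2), of z "(b, 0)"] linear_0[OF linear_F[OF that(2)]] by simp
      then show ?thesis
        unfolding sum_distrib_left sum_distrib_right
        by (subst sum.swap) (auto intro!: sum.cong simp: mult_ac)
    qed
    also have "\<dots> = 0" using rel' M_inv b' by simp
    finally show ?thesis
      unfolding P_def av_def by (simp add: sum_divide_distrib[symmetric])
  qed
  ultimately show ?thesis using j(1) by blast
qed

text \<open>More invariants than dimensions would have dependent differentials, with invariant
  coefficients \<open>p i\<close> by \<open>invariant_relation\<close>. Chevalley's lemma puts the
  cofactors of a minimal generating set of the \<open>p i\<close> into the ideal of positive
  invariants, and Euler's identity converts this into an expression of some \<open>f k\<close>
  through its predecessors, against the greedy choice.\<close>

lemma good_seq_le:
  assumes g: "good_seq r d f" shows "r \<le> card (onb M)"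
proof (rule ccontr)
  assume "\<not> r \<le> card (onb M)"
  then have r: "card (onb M) < r" by simp
  have f: "pipoly (d i) (f i)" if "i < r" for i using g that by (auto simp: good_seq_def)
  have fi: "ipoly (d i) (f i)" if "i < r" for i using f[OF that] by (simp add: pipoly_def)
  obtain p c j0 where p: "\<And>i. i < r \<Longrightarrow> ipoly (c - d i) (p i)" and j0: "j0 < r" "\<exists>z. p j0 z \<noteq> 0"
    and rel: "\<And>b z. b \<in> onb M \<Longrightarrow> (\<Sum>i<r. p i z * dir_deriv (f i) z (b, 0)) = 0"
    using invariant_relation[of r d f, OF f r] by blast
  \<comment> \<open>The degree of \<open>p i\<close>, complementary to that of \<open>f i\<close>:
    all products \<open>p i * f i\<close> have degree \<open>c\<close>.\<close>
  define e where "e = (\<lambda>i. c - d i)"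
  let ?P = "\<lambda>T. T \<subseteq> {..<r} \<and> (\<forall>i<r. gid ipoly (fam T e p) (e i) (p i))"
  have one: "ipoly 0 (\<lambda>z. 1)" by (simp add: ipoly_def invariant_def hpoly.const)
  have fam_gid: "gid ipoly (fam T e p) (e i) (p i)" if "i \<in> T" for i T
    using gid.gen[of ipoly 0 "\<lambda>z. 1" "fam T e p" "e i" "p i", OF one] that by (auto simp: fam_def)
  have "?P {..<r}" using fam_gid by blast
  \<comment> \<open>A smallest index set whose \<open>p i\<close> generate all the others over the
    invariants; minimality gives Chevalley's lemma its hypothesis on \<open>i0\<close>.\<close>
  then obtain T where T: "?P T" and Tmin: "\<And>T'. ?P T' \<Longrightarrow> card T \<le> card T'"
    using ex_has_least_nat[of ?P "{..<r}" card] by blast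
  have finT: "finite T" using T finite_subset by blast
  have "T \<noteq> {}"
  proof
    assume "T = {}"
    then have "gid ipoly (fam {} e p) (e j0) (p j0)" using T j0(1) by simp
    then have "p j0 = (\<lambda>z. 0)" by induction (auto simp: fam_def)
    then show False using j0(2) by simp
  qed
  then obtain i0 where i0: "i0 \<in> T" by blast
  then have i0r: "i0 < r" using T by blast
  have min: "\<not> gid ipoly (fam (T - {i0}) e p) (e i0) (p i0)"
  proof
    assume *: "gid ipoly (fam (T - {i0}) e p) (e i0) (p i0)"
    have "gid ipoly (fam (T - {i0}) e p) (e i) (p i)" if "i < r" for i
    proof (rule gid_trans[of ipoly "fam T e p"])
      show "gid ipoly (fam T e p) (e i) (p i)" using T that by blast
      fix e' g assume "fam T e p e' g"
      then obtain i where i: "i \<in> T" "e' = e i" "g = p i" by (auto simp: fam_def)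
      show "gid ipoly (fam (T - {i0}) e p) e' g"
      proof (cases "i = i0")
        case True then show ?thesis using * i by simp
      next
        case False then show ?thesis using fam_gid[of i "T - {i0}"] i by simp
      qed
    qed (rule ipoly_mult)
    then have "card T \<le> card (T - {i0})" using T by (intro Tmin) auto
    then show False using i0 finT by (metis card_Diff1_less not_le)
  qed
  define J where "J = {..<r} - T"
  have "\<forall>j\<in>J. \<exists>q. (\<forall>i\<in>T. ipoly (e j - e i) (q i)) \<and> (\<forall>z. p j z = (\<Sum>i\<in>T. q i z * p i z))"
  proof
    fix j assume "j \<in> J"
    then have "gid ipoly (fam T e p) (e j) (p j)" using T by (auto simp: J_def)
    from gid_fam_explicit[OF this finT ipoly_zero ipoly_add]
    show "\<exists>q. (\<forall>i\<in>T. ipoly (e j - e i) (q i)) \<and> (\<forall>z. p j z = (\<Sum>i\<in>T. q i z * p i z))" by blast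
  qed
  then obtain q where q: "\<And>j i. j \<in> J \<Longrightarrow> i \<in> T \<Longrightarrow> ipoly (d i - d j) (q j i)"
    "\<And>j z. j \<in> J \<Longrightarrow> p j z = (\<Sum>i\<in>T. q j i z * p i z)"
    unfolding e_def by (simp add: bchoice_iff) metis
  \<comment> \<open>Inserting the expressions of \<open>p j\<close> for \<open>j \<in> J\<close>
    into the relation leaves \<open>\<beta> b i\<close> as the cofactor of \<open>p i\<close> for
    \<open>i \<in> T\<close>.\<close>
  define \<beta> where "\<beta> = (\<lambda>b i z. dir_deriv (f i) z (b, 0) + (\<Sum>j\<in>J. q j i z * dir_deriv (f j) z (b, 0)))"
  define D where "D = d i0"
  have \<beta>: "gid (hpoly M) pipoly (D - 1) (\<beta> b i0)" if b: "b \<in> onb M" for b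
  proof -
    have "gid (hpoly M) pipoly (c - 1 - e i0) (\<beta> b i0)"
    proof (rule chevalley_syzygy[OF finT i0 _ min])
      show "ipoly (e i) (p i)" if "i \<in> T" for i using p that T by (auto simp: e_def)
      fix i assume i: "i \<in> T"
      have "hpoly M (d i - 1) (\<lambda>z. q j i z * dir_deriv (f j) z (b, 0))" if "j \<in> J" for j
        using hpoly_mult[of M "d i - d j" "q j i" "d j - 1"] q(1)[OF that i] fi[of j] that
        by (auto simp: J_def ipoly_def hpoly_dir_deriv)
      then show "hpoly M (c - 1 - e i) (\<beta> b i)"
        unfolding \<beta>_def e_def using fi[of i] i T
        by (auto intro!: hpoly.add hpoly_sum simp: ipoly_def hpoly_dir_deriv)
    next
      fix z
      have "(\<Sum>i\<in>T. p i z * \<beta> b i z) = (\<Sum>i\<in>T. p i z * dir_deriv (f i) z (b, 0)) +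
          (\<Sum>j\<in>J. (\<Sum>i\<in>T. q j i z * p i z) * dir_deriv (f j) z (b, 0))"
        unfolding \<beta>_def distrib_left sum.distrib sum_distrib_left sum_distrib_right
        by (subst (2) sum.swap) (simp add: mult_ac)
      also have "\<dots> = (\<Sum>i\<in>T. p i z * dir_deriv (f i) z (b, 0)) + (\<Sum>j\<in>J. p j z * dir_deriv (f j) z (b, 0))"
        using q(2) by simp
      also have "\<dots> = (\<Sum>i<r. p i z * dir_deriv (f i) z (b, 0))"
        unfolding J_def using T by (subst sum.subset_diff[of T "{..<r}"]) auto
      finally show "(\<Sum>i\<in>T. p i z * \<beta> b i z) = 0" using rel[OF b] by simp
    qed
    then show ?thesis by (simp add: e_def D_def)
  qed
  define J' where "J' = insert i0 J"
  define h where "h = (\<lambda>j z. if j = i0 then 1 else q j i0 z)"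
  have i0J: "i0 \<notin> J" and finJ: "finite J'" and J'r: "\<And>j. j \<in> J' \<Longrightarrow> j < r"
    using i0 i0r by (auto simp: J_def J'_def)
  have h: "hpoly M (D - d j) (h j)" if "j \<in> J'" for j
    using q(1)[of j i0] i0 that by (cases "j = i0") (auto simp: h_def D_def J'_def ipoly_def hpoly.const)
  have euler: "(\<Sum>b\<in>onb M. zeta b z * \<beta> b i0 z) = (\<Sum>j\<in>J'. of_int (d j) * (h j z * f j z))" for z
  proof -
    have E: "(\<Sum>b\<in>onb M. zeta b z * dir_deriv (f j) z (b, 0)) = of_int (d j) * f j z" if "j < r" for j
      using fi[OF that] sub by (intro euler_hpoly) (auto simp: ipoly_def)
    have "(\<Sum>b\<in>onb M. zeta b z * \<beta> b i0 z) = (\<Sum>b\<in>onb M. zeta b z * dir_deriv (f i0) z (b, 0)) +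
        (\<Sum>j\<in>J. q j i0 z * (\<Sum>b\<in>onb M. zeta b z * dir_deriv (f j) z (b, 0)))"
      unfolding \<beta>_def distrib_left sum.distrib sum_distrib_left
      by (subst (2) sum.swap) (simp add: mult_ac)
    also have "\<dots> = of_int (d i0) * f i0 z + (\<Sum>j\<in>J. q j i0 z * (of_int (d j) * f j z))"
      using E i0r by (simp add: J_def)
    also have "\<dots> = (\<Sum>j\<in>J'. of_int (d j) * (h j z * f j z))"
      using i0J finJ by (auto simp: J'_def h_def mult_ac intro!: sum.cong)
    finally show ?thesis .
  qed
  \<comment> \<open>Where \<open>d j = D\<close> the coefficient \<open>h j\<close> is constant. The
    last index \<open>k\<close> with a nonzero one is taken, so that every other nonzero term
    involves an earlier \<open>f j\<close> or one of smaller degree.\<close>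
  define K where "K = {j \<in> J'. d j = D \<and> h j \<noteq> (\<lambda>z. 0)}"
  have K: "finite K" "i0 \<in> K"
    using finJ by (auto simp: K_def J'_def D_def h_def fun_eq_iff)
  define k where "k = Max K"
  have k: "k \<in> K" "\<And>j. j \<in> K \<Longrightarrow> j \<le> k" unfolding k_def using K Max_in by auto
  then have kr: "k < r" and dk: "d k = D" and kJ: "k \<in> J'" using J'r by (auto simp: K_def)
  define G where "G = fam {..<k} d f"
  have low: "gid (hpoly M) G e g" if "pipoly e g" "e < D" for e g
    using g kr that dk unfolding good_seq_def G_def by blast
  \<comment> \<open>Coefficients of negative degree vanish, so an element of degree below
    \<open>D\<close> uses only invariants of degree below \<open>D\<close>, and these lie in the
    ideal of the predecessors of \<open>f k\<close>.\<close>
  have low': "gid (hpoly M) pipoly l u \<Longrightarrow> l < D \<Longrightarrow> gid (hpoly M) G l u" for l u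
  proof (induction rule: gid.induct)
    case (gen l c e g)
    show ?case
    proof (cases "l < 0")
      case True
      then have "c = (\<lambda>z. 0)" using gen(1) by (intro hpoly_neg)
      then show ?thesis by (simp add: gid.zero)
    next
      case False
      then have "gid (hpoly M) G e g" using gen by (intro low) auto
      then show ?thesis using gid_mult[of "hpoly M" G e g l c] gen(1) hpoly_mult[of M] by blast
    qed
  next
    case (add k p q)
    then show ?case using gid.add[of "hpoly M" G k p q] by blast
  qed (simp add: gid.zero)
  have S1: "gid (hpoly M) G D (\<lambda>z. \<Sum>b\<in>onb M. zeta b z * \<beta> b i0 z)"
  proof (rule gid_sum)
    fix b assume b: "b \<in> onb M"
    then have "hpoly M 1 (zeta b)" using onb(1)[OF sub] by (intro hpoly_zeta) auto
    then show "gid (hpoly M) G D (\<lambda>z. zeta b z * \<beta> b i0 z)"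
      using gid_mult[of "hpoly M" G "D - 1" "\<beta> b i0" 1 "zeta b"] low'[OF \<beta>[OF b]] hpoly_mult[of M] by simp
  qed
  have S2: "gid (hpoly M) G D (\<lambda>z. \<Sum>j\<in>J' - {k}. - of_int (d j) * (h j z * f j z))"
  proof (rule gid_sum)
    fix j assume j: "j \<in> J' - {k}"
    have hj: "hpoly M (D - d j) (\<lambda>z. - of_int (d j) * h j z)" using h[of j] j by (intro hpoly_cmult) auto
    consider "h j = (\<lambda>z. 0)" | "h j \<noteq> (\<lambda>z. 0)" "d j < D" | "h j \<noteq> (\<lambda>z. 0)" "d j = D"
      using hpoly_neg[OF h[of j]] j by force
    then show "gid (hpoly M) G D (\<lambda>z. - of_int (d j) * (h j z * f j z))"
    proof cases
      case 1
      then show ?thesis by (simp add: gid.zero)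
    next
      case 2
      then have "gid (hpoly M) G (d j) (f j)" using f[of j] J'r j by (intro low) auto
      then show ?thesis
        using gid_mult[of "hpoly M" G "d j" "f j" "D - d j" "\<lambda>z. - of_int (d j) * h j z"] hj hpoly_mult[of M]
        by (simp add: mult.assoc)
    next
      case 3
      then have "j < k" using j k(2)[of j] by (auto simp: K_def)
      then have "G (d j) (f j)" by (auto simp: G_def fam_def)
      then show ?thesis
        using gid.gen[of "hpoly M" "D - d j" "\<lambda>z. - of_int (d j) * h j z" G "d j" "f j"] hj
        by (simp add: mult.assoc)
    qed
  qed
  obtain \<gamma> where \<gamma>: "h k = (\<lambda>z. \<gamma>)" using hpoly_0[OF h[OF kJ]] dk by auto
  have \<gamma>0: "of_int (d k) * \<gamma> \<noteq> 0" using k(1) \<gamma> f[OF kr] by (auto simp: K_def pipoly_def)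
  have "gid (hpoly M) G D (\<lambda>z. of_int (d k) * \<gamma> * f k z)"
  proof (rule gid_cong[OF gid.add[OF S1 S2]])
    fix z
    show "(\<Sum>b\<in>onb M. zeta b z * \<beta> b i0 z) + (\<Sum>j\<in>J' - {k}. - of_int (d j) * (h j z * f j z)) =
        of_int (d k) * \<gamma> * f k z"
      unfolding euler using sum.remove[OF finJ kJ, of "\<lambda>j. of_int (d j) * (h j z * f j z)"] \<gamma>
      by (simp add: sum_negf mult.assoc)
  qed simp
  then have "gid (hpoly M) G D (\<lambda>z. 1 / (of_int (d k) * \<gamma>) * (of_int (d k) * \<gamma> * f k z))"
    using gid_mult[of "hpoly M" G D "\<lambda>z. of_int (d k) * \<gamma> * f k z" 0 "\<lambda>z. 1 / (of_int (d k) * \<gamma>)"]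
      hpoly.const[of M] hpoly_mult[of M] by simp
  then have "gid (hpoly M) G D (f k)" using \<gamma>0 by simp
  then show False using g kr dk unfolding good_seq_def G_def by blast
qed

text \<open>The length of greedy sequences is bounded, so there is a longest one. If it did not
  generate, an invariant of least degree outside its ideal would prolong it.\<close>

lemma good_generators:
  obtains r d f where "r \<le> card (onb M)" "\<And>i. i < r \<Longrightarrow> pipoly (d i) (f i)"
    "\<And>e g. pipoly e g \<Longrightarrow> gid (hpoly M) (fam {..<r} d f) e g"
proof -
  let ?P = "\<lambda>r. \<exists>d f. good_seq r d f"
  have P0: "?P 0" by (simp add: good_seq_def)
  have bd: "\<And>r. ?P r \<Longrightarrow> r \<le> card (onb M)" using good_seq_le by blast
  obtain r where r: "?P r" "\<And>r'. ?P r' \<Longrightarrow> r' \<le> r"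
    by (rule that[OF GreatestI_nat[of ?P, OF P0 bd] Greatest_le_nat[of ?P, OF _ bd]])
  then obtain d f where df: "good_seq r d f" by blast
  have "gid (hpoly M) (fam {..<r} d f) e g" if eg: "pipoly e g" for e g
  proof (rule ccontr)
    assume ng: "\<not> gid (hpoly M) (fam {..<r} d f) e g"
    let ?Q = "\<lambda>n. \<exists>g. pipoly (int n) g \<and> \<not> gid (hpoly M) (fam {..<r} d f) (int n) g"
    have "?Q (nat e)" using eg ng by (auto simp: pipoly_def)
    then obtain n where n: "?Q n" "\<And>m. m < n \<Longrightarrow> \<not> ?Q m" using exists_least_iff[of ?Q] by blast
    then obtain h where h: "pipoly (int n) h" "\<not> gid (hpoly M) (fam {..<r} d f) (int n) h" by blast
    define d' f' where "d' = d(r := int n)" and "f' = f(r := h)"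
    have fam: "fam {..<i} d' f' = fam {..<i} d f" if "i \<le> r" for i
      using that by (auto simp: fam_def d'_def f'_def fun_eq_iff)
    have "gid (hpoly M) (fam {..<r} d f) e' g'" if "pipoly e' g'" "e' < int n" for e' g'
      using n(2)[of "nat e'"] that by (auto simp: pipoly_def)
    then have "good_seq (Suc r) d' f'"
      using df h unfolding good_seq_def less_Suc_eq
      by (auto simp: fam less_imp_le d'_def[THEN fun_cong] f'_def[THEN fun_cong])
    then show False using r(2)[of "Suc r"] by auto
  qed
  moreover have "pipoly (d i) (f i)" if "i < r" for i using df that by (auto simp: good_seq_def)
  ultimately show ?thesis using that good_seq_le[OF df] by blast
qed

end

section \<open>Polynomials in the invariants, interpolation and connectedness\<close>

inductive palg :: "nat \<Rightarrow> (nat \<Rightarrow> 'b \<Rightarrow> complex) \<Rightarrow> ('b \<Rightarrow> complex) \<Rightarrow> bool" for r f where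
  const: "palg r f (\<lambda>z. c)"
| base: "i < r \<Longrightarrow> palg r f (f i)"
| add: "palg r f p \<Longrightarrow> palg r f q \<Longrightarrow> palg r f (\<lambda>z. p z + q z)"
| mult: "palg r f p \<Longrightarrow> palg r f q \<Longrightarrow> palg r f (\<lambda>z. p z * q z)"

lemma palg_cong: "palg r f p \<Longrightarrow> (\<And>z. p z = q z) \<Longrightarrow> palg r f q"
  by (metis ext)

lemma palg_sum: "(\<And>i. i \<in> I \<Longrightarrow> palg r f (p i)) \<Longrightarrow> palg r f (\<lambda>z. \<Sum>i\<in>I. p i z)"
proof (induction I rule: infinite_finite_induct)
  case (insert x F)
  then show ?case using palg.add[of r f "p x" "\<lambda>z. \<Sum>i\<in>F. p i z"] by simp
qed (auto intro: palg.const)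

lemma palg_eq: "palg r f g \<Longrightarrow> (\<And>i. i < r \<Longrightarrow> f i z = f i z') \<Longrightarrow> g z = g z'"
  by (induction rule: palg.induct) auto

lemma palg_dir_deriv:
  assumes "palg r f g" "\<And>i. i < r \<Longrightarrow> holomorphic_EC (f i) UNIV" "\<And>i. i < r \<Longrightarrow> dir_deriv (f i) z v = 0"
  shows "holomorphic_EC g UNIV \<and> dir_deriv g z v = 0"
  using assms(1)
  by induction
    (auto simp: assms dir_deriv_const dir_deriv_add[where U = UNIV] dir_deriv_mult[where U = UNIV]
      intro: holomorphic_EC_add holomorphic_EC_mult)

text \<open>Lets a polynomial in the invariants, such as the discriminant, be read as an entire
  function on the target of the quotient map.\<close>

lemma palg_factor:
  assumes "palg r f g" "\<And>i z. i < r \<Longrightarrow> f i z = h i (T z)" "\<And>i. i < r \<Longrightarrow> holomorphic_EC (h i) UNIV"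
  shows "\<exists>Q. holomorphic_EC Q UNIV \<and> (\<forall>z. g z = Q (T z))"
  using assms(1)
proof induction
  case (const c)
  show ?case by (rule exI[of _ "\<lambda>z. c"]) simp
next
  case (base i)
  then show ?case using assms(2,3) by blast
next
  case (add p q)
  then obtain Q Q' where "holomorphic_EC Q UNIV" "\<forall>z. p z = Q (T z)" "holomorphic_EC Q' UNIV" "\<forall>z. q z = Q' (T z)"
    by blast
  then show ?case by (intro exI[of _ "\<lambda>z. Q z + Q' z"]) (auto intro: holomorphic_EC_add)
next
  case (mult p q)
  then obtain Q Q' where "holomorphic_EC Q UNIV" "\<forall>z. p z = Q (T z)" "holomorphic_EC Q' UNIV" "\<forall>z. q z = Q' (T z)"
    by blast
  then show ?case by (intro exI[of _ "\<lambda>z. Q z * Q' z"]) (auto intro: holomorphic_EC_mult)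
qed

inductive cpoly :: "'a::euclidean_space set \<Rightarrow> ('a \<times> 'a \<Rightarrow> complex) \<Rightarrow> bool" for M where
  hom: "hpoly M k p \<Longrightarrow> cpoly M p"
| add: "cpoly M p \<Longrightarrow> cpoly M q \<Longrightarrow> cpoly M (\<lambda>z. p z + q z)"

lemma cpoly_cong: "cpoly M p \<Longrightarrow> (\<And>z. p z = q z) \<Longrightarrow> cpoly M q"
  by (metis ext)

lemma cpoly_const: "cpoly M (\<lambda>z. c)"
  by (rule cpoly.hom[OF hpoly.const])

lemma cpoly_mult:
  assumes "cpoly M p" "cpoly M q" shows "cpoly M (\<lambda>z. p z * q z)"
  using assms(1)
proof induction
  case (hom k p)
  show ?case using assms(2)
  proof induction
    case (hom l q)
    show ?case using cpoly.hom[OF hpoly_mult[OF \<open>hpoly M k p\<close> hom]] .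
  next
    case (add q q')
    show ?case using cpoly.add[OF add(3,4)] by (rule cpoly_cong) (simp add: algebra_simps)
  qed
next
  case (add p p')
  show ?case using cpoly.add[OF add(3,4)] by (rule cpoly_cong) (simp add: algebra_simps)
qed

lemma cpoly_prod: "(\<And>i. i \<in> I \<Longrightarrow> cpoly M (p i)) \<Longrightarrow> cpoly M (\<lambda>z. \<Prod>i\<in>I. p i z)"
proof (induction I rule: infinite_finite_induct)
  case (insert x F)
  then show ?case using cpoly_mult[of M "p x" "\<lambda>z. \<Prod>i\<in>F. p i z"] by simp
qed (auto intro: cpoly_const)

lemma holomorphic_EC_cpoly: "cpoly M p \<Longrightarrow> holomorphic_EC p U"
  by (induction rule: cpoly.induct) (auto intro: holomorphic_EC_hpoly holomorphic_EC_add)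

lemma zeta_separates:
  assumes "subspace M" "v \<in> M \<times> M" "v \<noteq> 0" obtains b where "b \<in> M" "zeta b v \<noteq> 0"
proof (cases "fst v = 0")
  case True
  then have "snd v \<noteq> 0" using assms(3) by (auto simp: prod_eq_iff)
  then show ?thesis using that[of "snd v"] assms(2) by (auto simp: zeta_def complex_eq_iff)
next
  case False
  then show ?thesis using that[of "fst v"] assms(2) by (auto simp: zeta_def complex_eq_iff)
qed

text \<open>A product of affine-linear factors, one for each point of \<open>S\<close>, with value 1
  at \<open>z\<close> and 0 at that point; a linear form separating two points exists by
  \<open>zeta_separates\<close>.\<close>

lemma cpoly_interpolation:
  assumes "subspace M" "finite S" "S \<subseteq> M \<times> M" "z \<in> M \<times> M" "z \<notin> S"
  obtains e where "cpoly M e" "e z = 1" "\<And>s. s \<in> S \<Longrightarrow> e s = 0"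
proof -
  have "\<exists>l. cpoly M l \<and> l z = 1 \<and> l s = 0" if s: "s \<in> S" for s
  proof -
    have zs: "z - s \<in> M \<times> M" "z - s \<noteq> 0"
      using assms s by (auto simp: mem_Times_iff subspace_diff)
    obtain b where b: "b \<in> M" "zeta b (z - s) \<noteq> 0" by (rule zeta_separates[OF assms(1) zs])
    then have ne: "zeta b z \<noteq> zeta b s" by (simp add: linear_diff[OF zeta_linear])
    have "cpoly M (\<lambda>u. (1 / (zeta b z - zeta b s)) * zeta b u + - (zeta b s / (zeta b z - zeta b s)))"
      by (intro cpoly.add cpoly_const cpoly.hom[OF hpoly_cmult[OF hpoly_zeta[OF b(1)]]])
    then have "cpoly M (\<lambda>u. (zeta b u - zeta b s) / (zeta b z - zeta b s))"
      by (rule cpoly_cong) (simp add: diff_divide_distrib)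
    then show ?thesis using ne by (intro exI[of _ "\<lambda>u. (zeta b u - zeta b s) / (zeta b z - zeta b s)"]) simp
  qed
  then obtain l where l: "\<And>s. s \<in> S \<Longrightarrow> cpoly M (l s) \<and> l s z = 1 \<and> l s s = 0" by metis
  show ?thesis
  proof (rule that[of "\<lambda>u. \<Prod>s\<in>S. l s u"])
    show "cpoly M (\<lambda>u. \<Prod>s\<in>S. l s u)" using l by (intro cpoly_prod) blast
    show "(\<Prod>s\<in>S. l s z) = 1" using l by simp
    show "(\<Prod>s\<in>S. l s s') = 0" if "s' \<in> S" for s' using that l by (intro prod_zero[OF assms(2)]) blast
  qed
qed

text \<open>Two points of the set lie on a complex line on which \<open>Q\<close> has only countably
  many zeros, and the plane minus a countable set is connected.\<close>

lemma connected_entire_nonzero: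
  assumes Q: "holomorphic_EC Q UNIV" shows "connected {y. Q y \<noteq> 0}"
  unfolding connected_iff_connected_component
proof (intro ballI)
  fix a b assume a: "a \<in> {y. Q y \<noteq> 0}" and b: "b \<in> {y. Q y \<noteq> 0}"
  define h where "h = (\<lambda>t. Q (a + cscale t (b - a)))"
  have hol: "h holomorphic_on UNIV" unfolding h_def by (rule holomorphic_EC_line[OF Q]) auto
  have h01: "h 0 \<noteq> 0" "h 1 \<noteq> 0" using a b by (auto simp: h_def)
  have "countable {t. h t = 0}"
  proof (cases "h constant_on UNIV")
    case True
    then have "{t. h t = 0} = {}" using h01 by (auto simp: constant_on_def)
    then show ?thesis by simp
  next
    case False
    from holomorphic_countable_zeros[OF hol open_UNIV connected_UNIV _ False] show ?thesis
      using fsigma.intros[of "\<lambda>_. UNIV :: complex set"] by simp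
  qed
  moreover have "\<not> collinear (UNIV :: complex set)"
    by (simp add: collinear_aff_dim aff_dim_UNIV)
  ultimately have "connected (UNIV - {t. h t = 0})"
    by (intro connected_convex_diff_countable) auto
  then have "connected ((\<lambda>t. a + cscale t (b - a)) ` (UNIV - {t. h t = 0}))"
    by (intro connected_continuous_image continuous_intros)
  moreover have "(\<lambda>t. a + cscale t (b - a)) ` (UNIV - {t. h t = 0}) \<subseteq> {y. Q y \<noteq> 0}"
    by (auto simp: h_def)
  moreover have "a \<in> (\<lambda>t. a + cscale t (b - a)) ` (UNIV - {t. h t = 0})"
    using h01 by (intro image_eqI[of _ _ 0]) auto
  moreover have "b \<in> (\<lambda>t. a + cscale t (b - a)) ` (UNIV - {t. h t = 0})"
    using h01 by (intro image_eqI[of _ _ 1]) auto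
  ultimately show "connected_component {y. Q y \<noteq> 0} a b"
    unfolding connected_component_def by blast
qed

section \<open>The quotient map given by generating invariants\<close>

locale refl_generators = finite_refl_group M F
  for M :: "'a::euclidean_space set" and F +
  fixes r :: nat and d :: "nat \<Rightarrow> int" and f :: "nat \<Rightarrow> 'a \<times> 'a \<Rightarrow> complex"
  assumes r_le: "r \<le> card (onb M)" and f: "\<And>i. i < r \<Longrightarrow> pipoly (d i) (f i)"
    and gens: "\<And>e g. pipoly e g \<Longrightarrow> gid (hpoly M) (fam {..<r} d f) e g"
begin

lemma f': "i < r \<Longrightarrow> ipoly (d i) (f i)" "i < r \<Longrightarrow> hpoly M (d i) (f i)" "i < r \<Longrightarrow> 0 < d i"
  "i < r \<Longrightarrow> holomorphic_EC (f i) UNIV" "i < r \<Longrightarrow> w \<in> F \<Longrightarrow> f i (act w z) = f i z"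
  using f[of i] holomorphic_EC_hpoly by (auto simp: pipoly_def ipoly_def invariant_def)

text \<open>Hilbert's argument: averaging makes the coefficients of an ideal expression invariant,
  and they have smaller degree because the generators have positive degree.\<close>

lemma ipoly_palg: "ipoly e g \<Longrightarrow> palg r f g"
proof (induction "nat e" arbitrary: e g rule: less_induct)
  case less
  have g: "hpoly M e g" using less(2) by (simp add: ipoly_def)
  consider "e < 0" | "e = 0" | "e > 0" by linarith
  then show ?case
  proof cases
    case 1
    then have "g = (\<lambda>z. 0)" using hpoly_neg[OF g] by blast
    then show ?thesis by (simp add: palg.const)
  next
    case 2
    then obtain c where "g = (\<lambda>z. c)" using hpoly_0[OF g] by blast
    then show ?thesis by (simp add: palg.const)
  next
    case 3
    then have "gid (hpoly M) (fam {..<r} d f) e g" using less(2) by (intro gens) (simp add: pipoly_def)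
    then have "gid ipoly (fam {..<r} d f) e (av g)"
      by (rule gid_av) (use f'(1) in \<open>auto simp: fam_def ipoly_def\<close>)
    then have "gid ipoly (fam {..<r} d f) e g" using less(2) by (simp add: av_invariant ipoly_def)
    from gid_fam_explicit[OF this finite_lessThan ipoly_zero ipoly_add]
    obtain c where c: "\<And>j. j < r \<Longrightarrow> ipoly (e - d j) (c j)" "\<And>z. g z = (\<Sum>j<r. c j z * f j z)" by blast
    have "palg r f (\<lambda>z. c j z * f j z)" if j: "j < r" for j
    proof -
      have "palg r f (c j)" using 3 f'(3)[OF j] by (intro less(1)[OF _ c(1)[OF j]]) auto
      then show ?thesis using palg.mult[of r f "c j" "f j"] palg.base[OF j] by blast
    qed
    then have "palg r f (\<lambda>z. \<Sum>j<r. c j z * f j z)" by (intro palg_sum) auto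
    then show ?thesis by (rule palg_cong) (simp add: c(2))
  qed
qed

lemma cpoly_av_palg: "cpoly M p \<Longrightarrow> palg r f (av p)"
proof (induction rule: cpoly.induct)
  case (hom k p)
  then show ?case using ipoly_palg[OF ipoly_av] by blast
next
  case (add p q)
  show ?case unfolding av_add using palg.add[of r f "av p" "av q"] add by blast
qed

lemma act_mem: "w \<in> F \<Longrightarrow> z \<in> M \<times> M \<Longrightarrow> act w z \<in> M \<times> M"
  using M_inv by (cases z) auto

text \<open>A polynomial that is 1 at \<open>z\<close> and 0 on the rest of its orbit and on the
  orbit of \<open>z'\<close> has an average that tells the two orbits apart, and this average is a
  polynomial in the \<open>f i\<close>.\<close>

lemma orbit_separation:
  assumes z: "z \<in> M \<times> M" "z' \<in> M \<times> M" and eq: "\<And>i. i < r \<Longrightarrow> f i z = f i z'"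
  shows "\<exists>w\<in>F. z' = act w z"
proof (rule ccontr)
  assume ne: "\<not> ?thesis"
  let ?S = "(\<lambda>w. act w z') ` F \<union> ((\<lambda>w. act w z) ` F - {z})"
  have "z \<notin> (\<lambda>w. act w z') ` F"
  proof
    assume "z \<in> (\<lambda>w. act w z') ` F"
    then obtain w where w: "w \<in> F" "z = act w z'" by blast
    obtain u where "u \<in> F" "u \<circ> w = id" using inv_mem[OF w(1)] by blast
    then have "z' = act u z" using w by (simp add: act_comp map_prod.id)
    then show False using ne \<open>u \<in> F\<close> by blast
  qed
  moreover have "?S \<subseteq> M \<times> M" using act_mem z by blast
  ultimately obtain e where e: "cpoly M e" "e z = 1" "\<And>s. s \<in> ?S \<Longrightarrow> e s = 0"
    using cpoly_interpolation[OF sub _ _ z(1), of ?S] fin by (metis (no_types, lifting) Diff_iff UnE finite_Diff finite_Un finite_imageI insertI1)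
  have "av e z = av e z'" using palg_eq[OF cpoly_av_palg[OF e(1)]] eq by blast
  moreover have "av e z' = 0" using e(3) by (simp add: av_def)
  moreover have "av e z \<noteq> 0"
  proof -
    have "(\<Sum>w\<in>F. e (act w z)) = (\<Sum>w\<in>F. if act w z = z then 1 else 0)"
      using e by (intro sum.cong) auto
    also have "\<dots> = of_nat (card {w \<in> F. act w z = z})" using fin by (simp add: sum.If_cases Int_def)
    moreover have "card {w \<in> F. act w z = z} \<noteq> 0" using fin id_mem by (auto simp: map_prod.id)
    ultimately show ?thesis using card_F by (simp add: av_def)
  qed
  ultimately show False by simp
qed

text \<open>The square of the interpolating polynomial \<open>e\<close> kills value and derivative
  of \<open>Q\<close> at the other points of the orbit. The orbit sum of \<open>Q\<close> therefore
  has at \<open>z\<close> the derivative \<open>zeta b\<close>, chosen to be nonzero at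
  \<open>v\<close>; but as a polynomial in the \<open>f i\<close> it would have derivative zero
  along \<open>v\<close>.\<close>

lemma deriv_separation:
  assumes z: "z \<in> M \<times> M" and free: "\<And>w. w \<in> F \<Longrightarrow> act w z = z \<Longrightarrow> w = id"
    and v: "v \<in> M \<times> M" and D0: "\<And>i. i < r \<Longrightarrow> dir_deriv (f i) z v = 0"
  shows "v = 0"
proof (rule ccontr)
  assume "v \<noteq> 0"
  obtain b where b: "b \<in> M" "zeta b v \<noteq> 0" by (rule zeta_separates[OF sub v \<open>v \<noteq> 0\<close>])
  let ?S = "(\<lambda>w. act w z) ` (F - {id})"
  have "?S \<subseteq> M \<times> M" "z \<notin> ?S" "finite ?S" using act_mem z free fin by (auto simp: image_iff)
  then obtain e where e: "cpoly M e" "e z = 1" "\<And>s. s \<in> ?S \<Longrightarrow> e s = 0"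
    using cpoly_interpolation[OF sub _ _ z, of ?S] by blast
  define g where "g = (\<lambda>u. zeta b u + - zeta b z)"
  have g: "cpoly M g" unfolding g_def
    by (intro cpoly.add cpoly.hom[OF hpoly_zeta[OF b(1)]] cpoly_const)
  define Q where "Q = (\<lambda>u. g u * (e u * e u))"
  have Q: "cpoly M Q" unfolding Q_def by (intro cpoly_mult g e)
  have hol: "holomorphic_EC e UNIV" "holomorphic_EC g UNIV" "holomorphic_EC Q UNIV"
    using e(1) g Q by (auto intro: holomorphic_EC_cpoly)
  have Dg: "dir_deriv g u x = zeta b x" for u x
    using dir_deriv_add[OF holomorphic_EC_zeta holomorphic_EC_const UNIV_I, of b "- zeta b z" u x]
    unfolding g_def dir_deriv_zeta dir_deriv_const by (simp only: add_0_right)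
  have DQ: "dir_deriv Q u x = g u * (2 * e u * dir_deriv e u x) + zeta b x * (e u * e u)" for u x
    unfolding Q_def
    using dir_deriv_mult[OF hol(2) holomorphic_EC_mult[OF hol(1,1)], of u x] dir_deriv_mult[OF hol(1,1), of u x]
    by (simp add: Dg)
  have D: "dir_deriv (\<lambda>u. Q (act w u)) z v = dir_deriv Q (act w z) (act w v)" if "w \<in> F" for w
    by (rule dir_deriv_compose_linear[OF hol(3) linear_map_prod_dup[OF linear_F[OF that]]])
  have hQ: "holomorphic_EC (\<lambda>u. Q (act w u)) UNIV" if "w \<in> F" for w
    using hol(3) hol_map_affine[OF linear_map_prod_dup[OF linear_F[OF that]] map_prod_i[OF linear_F[OF that]], of 0 0 UNIV]
    by (auto intro: holomorphic_EC_compose)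
  have "dir_deriv (\<lambda>u. \<Sum>w\<in>F. Q (act w u)) z v = (\<Sum>w\<in>F. dir_deriv Q (act w z) (act w v))"
    using dir_deriv_sum[of F "\<lambda>w u. Q (act w u)" UNIV z v] hQ D by simp
  also have "\<dots> = dir_deriv Q (act id z) (act id v) + (\<Sum>w\<in>F - {id}. dir_deriv Q (act w z) (act w v))"
    using sum.remove[OF fin id_mem] by blast
  also have "\<dots> = zeta b v" using e by (simp add: DQ g_def map_prod.id)
  finally have DF: "dir_deriv (\<lambda>u. \<Sum>w\<in>F. Q (act w u)) z v = zeta b v" .
  have "palg r f (\<lambda>z. of_nat (card F) * av Q z)"
    using palg.mult[of r f "\<lambda>z. of_nat (card F)" "av Q"] palg.const cpoly_av_palg[OF Q] by blast
  then have "palg r f (\<lambda>u. \<Sum>w\<in>F. Q (act w u))"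
    by (rule palg_cong) (use card_F in \<open>simp add: av_def\<close>)
  from palg_dir_deriv[OF this f'(4) D0] show False using DF b by simp
qed

text \<open>For each nontrivial element a linear form vanishing on its fixed points is taken; the
  product of all these forms and of all their conjugates is an invariant polynomial whose
  nonvanishing forces a trivial stabilizer.\<close>

lemma discriminant:
  obtains N where "palg r f N" "\<exists>z. N z \<noteq> 0" "\<And>z w. N z \<noteq> 0 \<Longrightarrow> w \<in> F \<Longrightarrow> act w z = z \<Longrightarrow> w = id"
proof -
  have "\<exists>l. hpoly M 1 l \<and> (\<exists>z. l z \<noteq> 0) \<and> (\<forall>z. act w z = z \<longrightarrow> l z = 0)" if w: "w \<in> F - {id}" for w
  proof -
    obtain x where x: "w x \<noteq> x" using w by (auto simp: fun_eq_iff)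
    \<comment> \<open>The complement of \<open>M\<close> is fixed, so a point moved by
      \<open>w\<close> has a moved component in \<open>M\<close>.\<close>
    define m where "m = proj M x"
    have m: "m \<in> M" using proj_mem[OF sub] by (simp add: m_def)
    have "w (x - m) = x - m"
      using w inner_diff_proj[OF sub] by (intro fix_perp) (auto simp: m_def)
    then have "w m \<noteq> m" using x w linear_diff[OF linear_F, of w x m] by auto
    define b where "b = w m - m"
    have b: "b \<in> M" "b \<noteq> 0" using m w M_inv \<open>w m \<noteq> m\<close> sub by (auto simp: b_def subspace_diff)
    let ?l = "\<lambda>z. zeta b (act w z) - zeta b z"
    have "hpoly M 1 ?l" using w b by (intro hpoly_diff hpoly_act hpoly_zeta) auto
    moreover have "?l (m, 0) \<noteq> 0"
    proof -
      have "Re (?l (m, 0)) = b \<bullet> b" by (simp add: zeta_def b_def inner_diff_right)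
      then show ?thesis using b(2) by (metis inner_eq_zero_iff zero_complex.sel(1))
    qed
    moreover have "\<forall>z. act w z = z \<longrightarrow> ?l z = 0" by simp
    ultimately show ?thesis by blast
  qed
  then obtain l where l: "\<And>w. w \<in> F - {id} \<Longrightarrow> hpoly M 1 (l w)" "\<And>w. w \<in> F - {id} \<Longrightarrow> \<exists>z. l w z \<noteq> 0"
    "\<And>w z. w \<in> F - {id} \<Longrightarrow> act w z = z \<Longrightarrow> l w z = 0" by metis
  define \<delta> where "\<delta> = (\<lambda>z. \<Prod>w\<in>F - {id}. l w z)"
  define N where "N = (\<lambda>z. \<Prod>v\<in>F. \<delta> (act v z))"
  have \<delta>: "cpoly M (\<lambda>z. \<delta> (act v z))" if "v \<in> F" for v
    unfolding \<delta>_def using l(1) hpoly_act that by (intro cpoly_prod) (blast intro: cpoly.hom)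
  have "cpoly M N" unfolding N_def using \<delta> by (rule cpoly_prod)
  moreover have "invariant N"
    unfolding invariant_def N_def act_comp
  proof (intro ballI allI)
    fix w z assume "w \<in> F"
    from prod.reindex_bij_betw[OF bij_comp_right[OF this], of "\<lambda>v. \<delta> (act v z)"]
    show "(\<Prod>v\<in>F. \<delta> (act (v \<circ> w) z)) = (\<Prod>v\<in>F. \<delta> (act v z))" .
  qed
  ultimately have "palg r f N" using cpoly_av_palg[of N] by (simp add: av_invariant)
  moreover have "\<exists>z. N z \<noteq> 0" unfolding N_def
  proof (rule entire_prod_nonzero[OF fin])
    fix v assume v: "v \<in> F"
    show "holomorphic_EC (\<lambda>z. \<delta> (act v z)) UNIV" using \<delta>[OF v] by (rule holomorphic_EC_cpoly)
    obtain u where u: "u \<in> F" "v \<circ> u = id" using inv_mem[OF v] by blast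
    have "\<exists>z. \<delta> z \<noteq> 0" unfolding \<delta>_def
      using l fin by (intro entire_prod_nonzero) (auto intro: holomorphic_EC_hpoly)
    then obtain z where "\<delta> z \<noteq> 0" by blast
    then have "\<delta> (act v (act u z)) \<noteq> 0" by (simp add: act_comp u map_prod.id)
    then show "\<exists>z. \<delta> (act v z) \<noteq> 0" by blast
  qed
  moreover have "w = id" if Nz: "N z \<noteq> 0" and w: "w \<in> F" "act w z = z" for z w
  proof (rule ccontr)
    assume "w \<noteq> id"
    then have "l w z = 0" using l(3) w by blast
    then have "\<delta> (act id z) = 0" using fin w \<open>w \<noteq> id\<close> by (auto simp: \<delta>_def map_prod.id prod_zero_iff)
    then show False using Nz fin id_mem unfolding N_def by (metis prod_zero_iff)
  qed
  ultimately show ?thesis using that by blast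
qed

lemma act_perp: "w \<in> F \<Longrightarrow> act w (z - cproj M z) = z - cproj M z"
  by (cases z) (simp add: cproj_def fix_perp inner_diff_proj[OF sub])

lemma cproj_act: assumes "w \<in> F" shows "cproj M (act w z) = act w (cproj M z)"
proof -
  have l: "linear (act w)" using linear_F[OF assms] by (rule linear_map_prod_dup)
  have "act w z = act w (cproj M z) + (z - cproj M z)"
    using act_perp[OF assms, of z] unfolding linear_diff[OF l] by (metis add.commute diff_add_cancel)
  then have "cproj M (act w z) = cproj M (act w (cproj M z)) + (cproj M z - cproj M (cproj M z))"
    by (simp only: linear_add[OF linear_cproj] linear_diff[OF linear_cproj])
  then show ?thesis using act_mem[OF assms cproj_mem[OF sub]] cproj_mem[OF sub] by (simp add: cproj_id[OF sub])
qed

text \<open>\<open>\<Phi>\<close> puts the invariants into coordinates of M + iM and keeps the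
  component orthogonal to \<open>M\<close>. Its fibres are the orbits by
  \<open>orbit_separation\<close>, homogeneity makes it proper, and off the discriminant it is
  locally invertible; surjectivity, openness and descent of holomorphy are drawn from these three
  facts.\<close>

lemma quotient_chart_generators:
  obtains \<Phi> where "hol_map \<Phi> UNIV" "\<And>w z. w \<in> F \<Longrightarrow> \<Phi> (act w z) = \<Phi> z"
    "\<And>z z'. \<Phi> z = \<Phi> z' \<Longrightarrow> \<exists>w\<in>F. z' = act w z" "\<And>z. \<Phi> (cproj M z) = cproj M (\<Phi> z)"
    "surj \<Phi>" "\<And>G. open G \<Longrightarrow> open (\<Phi> ` G)"
    "\<And>D g. open D \<Longrightarrow> holomorphic_EC (\<lambda>z. g (\<Phi> z)) {z. \<Phi> z \<in> D} \<Longrightarrow> holomorphic_EC g D"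
proof -
  \<comment> \<open>Since \<open>r\<close> does not exceed the dimension, every invariant gets a
    basis vector of its own.\<close>
  obtain \<sigma> where \<sigma>: "\<sigma> ` {..<r} \<subseteq> onb M" "inj_on \<sigma> {..<r}"
    using card_le_inj[of "{..<r}" "onb M"] onb(6)[OF sub] r_le by auto
  have \<sigma>M: "\<sigma> i \<in> M" if "i < r" for i using \<sigma>(1) onb(1)[OF sub] that by auto
  have \<sigma>\<sigma>: "\<sigma> i \<bullet> \<sigma> j = (if i = j then 1 else 0)" if "i < r" "j < r" for i j
  proof -
    have "\<sigma> i \<in> onb M" "\<sigma> j \<in> onb M" using \<sigma>(1) that by auto
    then show ?thesis using onb_inner[OF sub, of "\<sigma> i" "\<sigma> j"] inj_on_eq_iff[OF \<sigma>(2), of i j] that by auto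
  qed
  define S where "S = (\<lambda>c. \<Sum>i<r. cscale (c i) (\<sigma> i, 0::'a))"
  define \<Phi> where "\<Phi> = (\<lambda>z. S (\<lambda>i. f i z) + (z - cproj M z))"
  have zS: "zeta (\<sigma> j) (S c) = c j" if "j < r" for j c
  proof -
    have "zeta (\<sigma> j) (S c) = (\<Sum>i<r. c i * (if i = j then 1 else 0))"
      unfolding S_def linear_sum[OF zeta_linear] zeta_cscale
      using \<sigma>\<sigma> that by (intro sum.cong) (auto simp: zeta_def complex_eq_iff)
    then show ?thesis using that by (simp add: if_distrib[of "\<lambda>x. _ * x"] cong: if_cong)
  qed
  have SM: "S c \<in> M \<times> M" for c
    unfolding S_def using sub \<sigma>M
    by (intro subspace_sum subspace_Times cscale_mem) (auto simp: subspace_0)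
  have perp0: "cproj M (z - cproj M z) = 0" for z
    by (simp add: linear_diff[OF linear_cproj] cproj_id[OF sub cproj_mem[OF sub]])
  have z_perp: "zeta (\<sigma> j) (z - cproj M z) = 0" if "j < r" for j z
    using inner_diff_proj[OF sub \<sigma>M[OF that]] by (cases z) (simp add: zeta_def cproj_def complex_eq_iff)
  have cS: "cproj M (S c + (z - cproj M z)) = S c" for c z
    by (simp add: linear_add[OF linear_cproj] perp0 cproj_id[OF sub SM])
  have S_eq: "(\<forall>j<r. c j = c' j) \<and> z - cproj M z = z' - cproj M z'"
    if "S c + (z - cproj M z) = S c' + (z' - cproj M z')" for c c' z z'
  proof -
    have "S c = S c'" using cS that by metis
    then show ?thesis using that zS by (metis add_left_cancel)
  qed
  have f_cproj: "f i (cproj M z) = f i z" if "i < r" for i z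
    using hpoly_cproj[OF f'(2)[OF that] sub] .
  have hol: "hol_map \<Phi> UNIV" unfolding \<Phi>_def S_def
  proof (intro hol_map_add hol_map_sum hol_map_cscale f'(4))
    have "hol_map (\<lambda>z. 0 + (\<lambda>z. z - cproj M z) (z - 0)) UNIV"
    proof (rule hol_map_affine)
      show "linear (\<lambda>z. z - cproj M z)" using linear_cproj by (intro linear_compose_sub linear_ident)
      show "(- y, x) - cproj M (- y, x) = cscale \<i> ((x, y) - cproj M (x, y))" for x y
        by (simp add: cproj_def linear_neg[OF linear_proj])
    qed
    then show "hol_map (\<lambda>z. z - cproj M z) UNIV" by simp
  qed auto
  have cont: "continuous_on UNIV \<Phi>" using hol by (rule hol_map_continuous_on)
  have inv: "\<Phi> (act w z) = \<Phi> z" if w: "w \<in> F" for w z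
  proof -
    have l: "linear (act w)" using linear_F[OF w] by (rule linear_map_prod_dup)
    have "act w z - cproj M (act w z) = z - cproj M z"
      using act_perp[OF w, of z] by (simp add: cproj_act[OF w] linear_diff[OF l])
    then show ?thesis using f'(5) w by (simp add: \<Phi>_def S_def)
  qed
  have fib: "\<exists>w\<in>F. z' = act w z" if "\<Phi> z = \<Phi> z'" for z z'
  proof -
    from S_eq[OF that[unfolded \<Phi>_def]]
    have eq: "\<And>j. j < r \<Longrightarrow> f j z = f j z'" "z - cproj M z = z' - cproj M z'" by auto
    obtain w where w: "w \<in> F" "cproj M z' = act w (cproj M z)"
      using orbit_separation[OF cproj_mem[OF sub] cproj_mem[OF sub], of z z'] eq(1) f_cproj by auto
    have l: "linear (act w)" using linear_F[OF w(1)] by (rule linear_map_prod_dup)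
    have "z' = act w (cproj M z) + act w (z - cproj M z)" using act_perp[OF w(1), of z] w(2) eq(2)
      by (metis add.commute diff_add_cancel)
    also have "\<dots> = act w z" by (simp add: linear_diff[OF l])
    finally show ?thesis using w(1) by blast
  qed
  have proj: "\<Phi> (cproj M z) = cproj M (\<Phi> z)" for z
    unfolding \<Phi>_def cS using cproj_id[OF sub cproj_mem[OF sub], of z] f_cproj by (simp add: S_def)
  obtain N where N: "palg r f N" "\<exists>z. N z \<noteq> 0" "\<And>z w. N z \<noteq> 0 \<Longrightarrow> w \<in> F \<Longrightarrow> act w z = z \<Longrightarrow> w = id"
    by (rule discriminant) blast
  have f\<Phi>: "f i z = zeta (\<sigma> i) (\<Phi> z)" if "i < r" for i z
    unfolding \<Phi>_def using that by (simp add: linear_add[OF zeta_linear] zS z_perp)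
  \<comment> \<open>The discriminant as an entire function on the target of
    \<open>\<Phi>\<close>.\<close>
  obtain Q where Q: "holomorphic_EC Q UNIV" "\<And>z. N z = Q (\<Phi> z)"
    using palg_factor[OF N(1), of "\<lambda>i. zeta (\<sigma> i)" \<Phi>] f\<Phi> holomorphic_EC_zeta by blast
  have loc: "\<exists>S T'. open S \<and> u \<in> S \<and> inj_on \<Phi> S \<and> (\<Phi> has_derivative T') (at u) \<and> inj T'"
    if u: "Q (\<Phi> u) \<noteq> 0" for u
  proof -
    have free: "w = id" if "w \<in> F" "act w u = u" for w using N(3)[of u w] u that Q(2) by simp
    have free': "w = id" if w: "w \<in> F" "act w (cproj M u) = cproj M u" for w
    proof -
      have "act w u = act w (cproj M u) + act w (u - cproj M u)"
        by (simp add: linear_diff[OF linear_map_prod_dup[OF linear_F[OF w(1)]]])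
      then show ?thesis using act_perp[OF w(1)] w(2) by (intro free[OF w(1)]) simp
    qed
    let ?T' = "\<lambda>v. S (\<lambda>i. dir_deriv (f i) u v) + (v - cproj M v)"
    have der: "(\<Phi> has_derivative ?T') (at u)"
      unfolding \<Phi>_def S_def
      using holomorphic_EC_has_derivative(1)[OF f'(4)] linear_cproj[of M]
      by (intro has_derivative_add has_derivative_sum has_derivative_diff has_derivative_ident
          bounded_linear.has_derivative[OF bounded_linear_cscale_left] bounded_linear_imp_has_derivative)
        (auto simp: linear_conv_bounded_linear)
    have "v = 0" if "?T' v = 0" for v
    proof -
      have "S (\<lambda>i. dir_deriv (f i) u v) + (v - cproj M v) = S (\<lambda>_. 0) + (0 - cproj M 0)"
        using that by (simp add: S_def linear_0[OF linear_cproj])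
      from S_eq[OF this] have v: "v = cproj M v" and D0: "\<And>i. i < r \<Longrightarrow> dir_deriv (f i) u v = 0"
        by (auto simp: linear_0[OF linear_cproj])
      have "dir_deriv (f i) (cproj M u) v = 0" if "i < r" for i
        using dir_deriv_compose_linear[OF f'(4)[OF that] linear_cproj, of M u v] D0[OF that] f_cproj[OF that] v by simp
      then show ?thesis
        using deriv_separation[OF cproj_mem[OF sub] free', of u v] cproj_mem[OF sub, of v] v by metis
    qed
    then have "inj ?T'" using linear_injective_0[OF has_derivative_linear[OF der]] by blast
    \<comment> \<open>\<open>e\<close> bounds from below the distance of \<open>u\<close> to its
      images under nontrivial elements, so two distinct points within \<open>e / 2\<close> of
      \<open>u\<close> are never in one orbit.\<close>
    moreover obtain e where e: "e > 0" "\<And>w. w \<in> F - {id} \<Longrightarrow> e \<le> dist (act w u) u"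
    proof -
      let ?E = "insert 1 ((\<lambda>w. dist (act w u) u) ` (F - {id}))"
      have "Min ?E > 0" using free fin by (subst Min_gr_iff) auto
      moreover have "Min ?E \<le> dist (act w u) u" if "w \<in> F - {id}" for w using that fin by (intro Min_le) auto
      ultimately show ?thesis using that by blast
    qed
    have "inj_on \<Phi> (ball u (e / 2))"
    proof (rule inj_onI)
      fix z z' assume z: "z \<in> ball u (e / 2)" "z' \<in> ball u (e / 2)" and eq: "\<Phi> z = \<Phi> z'"
      obtain w where w: "w \<in> F" "z' = act w z" using fib[OF eq] by blast
      have "w = id"
      proof (rule ccontr)
        assume "w \<noteq> id"
        have "orthogonal_transformation (act w)"
          unfolding orthogonal_transformation_def
          using linear_map_prod_dup[OF linear_F[OF w(1)]] inner_F[OF w(1)] by (auto simp: inner_prod_def)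
        then have "dist (act w u) (act w z) = dist u z"
          using orthogonal_transformation_isometry by blast
        then have "dist (act w u) u < e / 2 + e / 2"
          using z w dist_triangle[of "act w u" u "act w z"] by (simp add: dist_commute)
        then show False using e(2)[of w] w \<open>w \<noteq> id\<close> by simp
      qed
      then show "z = z'" using w by (simp add: map_prod.id)
    qed
    ultimately show ?thesis using der e(1)
      by (intro exI[of _ "ball u (e / 2)"] exI[of _ ?T']) auto
  qed
  \<comment> \<open>The generators have no common zero on the unit sphere of M + iM, because the
    orbit of 0 is 0 alone. So the sum of their absolute values is bounded away from 0 there, and
    positive degrees make it grow at least linearly outside the unit ball.\<close>
  have bounded: "\<exists>R'. \<forall>z. norm (\<Phi> z) \<le> R \<longrightarrow> norm z \<le> R'" for R
  proof -
    define K where "K = (M \<times> M) \<inter> sphere (0 :: 'a \<times> 'a) 1"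
    define h where "h = (\<lambda>z. \<Sum>i<r. norm (f i z))"
    have K: "compact K"
      unfolding K_def using closed_subspace[OF subspace_Times[OF sub sub]] by (intro closed_Int_compact) auto
    have ch: "continuous_on K h" unfolding h_def
      using holomorphic_EC_continuous_on[OF f'(4)] by (intro continuous_intros) (auto intro: continuous_on_subset)
    have hpos: "h z > 0" if z: "z \<in> K" for z
    proof (rule ccontr)
      assume "\<not> h z > 0"
      then have "h z = 0" unfolding h_def by (metis antisym_conv1 norm_ge_zero sum_nonneg)
      then have "f i z = f i 0" if "i < r" for i
        using that hpoly_at_0[OF f'(2,3)[OF that]] unfolding h_def by (subst (asm) sum_nonneg_eq_0_iff) auto
      then obtain w where "w \<in> F" "0 = act w z"
        using orbit_separation[of z 0] z subspace_0[OF subspace_Times[OF sub sub]] by (auto simp: K_def)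
      then have "w (fst z) = 0" "w (snd z) = 0" by (auto simp: prod_eq_iff)
      then have "fst z = 0" "snd z = 0"
        using inner_F[OF \<open>w \<in> F\<close>, of "fst z" "fst z"] inner_F[OF \<open>w \<in> F\<close>, of "snd z" "snd z"] by auto
      then have "z = 0" by (simp add: prod_eq_iff)
      then show False using z by (simp add: K_def)
    qed
    obtain m where m: "m > 0" "\<And>z. z \<in> K \<Longrightarrow> m \<le> h z"
    proof (cases "K = {}")
      case False
      then obtain z0 where "z0 \<in> K" "\<And>z. z \<in> K \<Longrightarrow> h z0 \<le> h z"
        using continuous_attains_inf[OF K _ ch] by blast
      then show ?thesis using hpos that by blast
    qed (use that[of 1] in auto)
    define C where "C = (\<Sum>i<r. norm (\<sigma> i) * 2)"
    have "norm z \<le> max 1 (C * R / m) + R" if z: "norm (\<Phi> z) \<le> R" for z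
    proof -
      define x where "x = cproj M z"
      have x: "x \<in> M \<times> M" unfolding x_def by (rule cproj_mem[OF sub])
      have "z - x = \<Phi> z - cproj M (\<Phi> z)"
        unfolding \<Phi>_def cS x_def by simp
      then have 1: "norm (z - x) \<le> R" using norm_cproj_le(2)[OF sub, of "\<Phi> z"] z by simp
      have 2: "norm x \<le> max 1 (C * R / m)"
      proof (cases "norm x \<le> 1")
        case False
        define u where "u = (1 / norm x) *\<^sub>R x"
        have u: "u \<in> K" "x = cscale (of_real (norm x)) u"
          using False x subspace_scale[OF subspace_Times[OF sub sub]] by (auto simp: u_def K_def cscale_of_real)
        have "norm x * norm (f i u) \<le> norm (f i z)" if i: "i < r" for i
        proof -
          have "f i x = of_real (norm x) ^ nat (d i) * f i u"
            using hpoly_cscale[OF f'(2)[OF i]] f'(3)[OF i] u(2) by (metis less_imp_le)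
          then have "norm (f i z) = norm x ^ nat (d i) * norm (f i u)"
            using f_cproj[OF i, of z] by (simp add: x_def norm_mult norm_power)
          moreover have "norm x \<le> norm x ^ nat (d i)" using False f'(3)[OF i] by (intro self_le_power) auto
          ultimately show ?thesis by (simp add: mult_right_mono)
        qed
        then have "norm x * h u \<le> (\<Sum>i<r. norm (f i z))"
          unfolding h_def sum_distrib_left by (intro sum_mono) auto
        also have "\<dots> \<le> (\<Sum>i<r. norm (\<sigma> i) * 2 * R)"
        proof (rule sum_mono)
          fix i assume "i \<in> {..<r}"
          then have "norm (f i z) \<le> norm (\<sigma> i) * norm (\<Phi> z) * 2" using f\<Phi> norm_zeta_le by simp
          also have "\<dots> \<le> norm (\<sigma> i) * R * 2" using z by (intro mult_right_mono mult_left_mono) auto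
          finally show "norm (f i z) \<le> norm (\<sigma> i) * 2 * R" by (simp add: mult_ac)
        qed
        also have "\<dots> = C * R" by (simp add: C_def sum_distrib_right)
        finally have "norm x * m \<le> C * R"
          using m(2)[OF u(1)] by (meson mult_left_mono norm_ge_zero order_trans)
        then show ?thesis using m(1) by (simp add: pos_le_divide_eq le_max_iff_disj)
      qed simp
      show ?thesis using 1 2 norm_triangle_sub[of z x] by linarith
    qed
    then show ?thesis by blast
  qed
  \<comment> \<open>A convergent sequence of values has bounded preimages, of which a subsequence
    converges in \<open>C\<close>.\<close>
  have closed: "closed (\<Phi> ` C)" if C: "closed C" for C
    unfolding closed_sequential_limits
  proof (intro allI impI)
    fix y l assume y: "(\<forall>n. y n \<in> \<Phi> ` C) \<and> y \<longlonglongrightarrow> l"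
    then have "\<forall>n. \<exists>u. u \<in> C \<and> y n = \<Phi> u" by blast
    then obtain x where x: "\<And>n. x n \<in> C" "\<And>n. y n = \<Phi> (x n)" by (auto dest!: choice)
    have "Bseq y" using y convergent_imp_Bseq convergentI by blast
    then obtain R where "\<And>n. norm (y n) \<le> R" unfolding Bseq_def by blast
    then obtain R' where R': "\<And>n. norm (x n) \<le> R'" using bounded[of R] x(2) by metis
    have "compact (C \<inter> cball 0 R')" using C by (intro closed_Int_compact) auto
    then obtain l' \<tau> where \<tau>: "l' \<in> C \<inter> cball 0 R'" "strict_mono \<tau>" "(x \<circ> \<tau>) \<longlonglongrightarrow> l'"
      using x(1) R' unfolding compact_def by (metis (no_types, lifting) IntI mem_cball_0)
    have "(\<lambda>n. \<Phi> ((x \<circ> \<tau>) n)) \<longlonglongrightarrow> \<Phi> l'"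
      using cont \<tau>(3) by (intro continuous_on_tendsto_compose[of UNIV \<Phi>]) (auto simp: o_def)
    moreover have "(\<lambda>n. \<Phi> ((x \<circ> \<tau>) n)) = y \<circ> \<tau>" by (auto simp: x(2))
    moreover have "(y \<circ> \<tau>) \<longlonglongrightarrow> l" using y \<tau>(2) by (intro LIMSEQ_subseq_LIMSEQ) auto
    ultimately have "l = \<Phi> l'" using LIMSEQ_unique by metis
    then show "l \<in> \<Phi> ` C" using \<tau>(1) by blast
  qed
  have surj: "surj \<Phi>"
  proof -
    let ?C = "{y. Q y \<noteq> 0}"
    have cQ: "continuous_on UNIV Q" using Q(1) by (rule holomorphic_EC_continuous_on)
    have oC: "open ?C" using open_vimage[OF open_Compl[OF closed_singleton] cQ, of 0] by (simp add: vimage_def)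
    \<comment> \<open>Off the discriminant the range is open by invariance of domain. It is also
      closed, so connectedness leaves no missing value there, and a missing value elsewhere would
      make \<open>Q\<close> vanish on an open set.\<close>
    have oRC: "open (range \<Phi> \<inter> ?C)"
      unfolding open_subopen[of "range \<Phi> \<inter> ?C"]
    proof
      fix y assume "y \<in> range \<Phi> \<inter> ?C"
      then obtain u where u: "y = \<Phi> u" "Q (\<Phi> u) \<noteq> 0" by blast
      obtain S where S: "open S" "u \<in> S" "inj_on \<Phi> S" using loc[OF u(2)] by blast
      have "open (\<Phi> ` S)" using S cont by (intro invariance_of_domain) (auto intro: continuous_on_subset)
      then have "open (\<Phi> ` S \<inter> ?C)" using oC by (rule open_Int)
      then show "\<exists>T. open T \<and> y \<in> T \<and> T \<subseteq> range \<Phi> \<inter> ?C"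
        using u S(2) by (intro exI[of _ "\<Phi> ` S \<inter> ?C"]) auto
    qed
    have cl: "closed (range \<Phi>)" using closed[of UNIV] by simp
    obtain z0 where "Q (\<Phi> z0) \<noteq> 0" using N(2) Q(2) by auto
    then have ne: "range \<Phi> \<inter> ?C \<noteq> {}" by blast
    have "(range \<Phi> \<inter> ?C) \<inter> ?C = {} \<or> (- range \<Phi>) \<inter> ?C = {}"
      by (rule connectedD[OF connected_entire_nonzero[OF Q(1)] oRC open_Compl[OF cl]]) auto
    then have "?C \<subseteq> range \<Phi>" using ne by auto
    show ?thesis
    proof (rule ccontr)
      assume "\<not> surj \<Phi>"
      then have "- range \<Phi> \<noteq> {}" by blast
      moreover have "open (- range \<Phi>)" using cl by (rule open_Compl)
      moreover have "\<And>u. u \<in> - range \<Phi> \<Longrightarrow> Q u = 0" using \<open>?C \<subseteq> range \<Phi>\<close> by blast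
      ultimately have "Q y = 0" for y
        using holomorphic_EC_identity[OF open_UNIV convex_UNIV Q(1), of "- range \<Phi>" y] by blast
      then show False using N(2) Q(2) by auto
    qed
  qed
  have opn: "open (\<Phi> ` G)" if G: "open G" for G
  proof -
    \<comment> \<open>Saturating \<open>G\<close> turns openness of its image into closedness of the
      image of a complement.\<close>
    let ?W = "\<Union>w\<in>F. act w -` G"
    have "open ?W"
    proof (intro open_UN ballI open_vimage[OF G])
      fix w assume "w \<in> F"
      then show "continuous_on UNIV (act w)"
        using linear_map_prod_dup[OF linear_F] linear_continuous_on linear_conv_bounded_linear by blast
    qed
    then have "closed (\<Phi> ` (- ?W))" by (intro closed) (rule closed_Compl)
    moreover have "\<Phi> ` G = - \<Phi> ` (- ?W)"
    proof (intro equalityI subsetI)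
      fix y assume "y \<in> \<Phi> ` G"
      then obtain z where z: "z \<in> G" "y = \<Phi> z" by blast
      have "y \<notin> \<Phi> ` (- ?W)"
      proof
        assume "y \<in> \<Phi> ` (- ?W)"
        then obtain z' where z': "z' \<notin> ?W" "\<Phi> z' = \<Phi> z" using z by auto
        obtain w where "w \<in> F" "z = act w z'" using fib[OF z'(2)] by blast
        then show False using z z' by blast
      qed
      then show "y \<in> - \<Phi> ` (- ?W)" by blast
    next
      fix y assume y: "y \<in> - \<Phi> ` (- ?W)"
      obtain z where z: "y = \<Phi> z" using surj by blast
      then obtain w where "w \<in> F" "act w z \<in> G" using y by blast
      then show "y \<in> \<Phi> ` G" using z inv by (metis imageI)
    qed
    ultimately show ?thesis by (simp add: open_Compl)
  qed
  have "holomorphic_EC g D" if D: "open D" "holomorphic_EC (\<lambda>z. g (\<Phi> z)) {z. \<Phi> z \<in> D}" for D g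
  proof -
    obtain z0 where "Q (\<Phi> z0) \<noteq> 0" using N(2) Q(2) by auto
    from holomorphic_EC_descend[OF hol surj opn Q(1) this loc D] show ?thesis .
  qed
  then show ?thesis using that[OF hol inv fib proj surj opn] by blast
qed

end

theorem (in finite_refl_group) quotient_chart:
  obtains \<Phi> where "hol_map \<Phi> UNIV" "\<And>w z. w \<in> F \<Longrightarrow> \<Phi> (act w z) = \<Phi> z"
    "\<And>z z'. \<Phi> z = \<Phi> z' \<Longrightarrow> \<exists>w\<in>F. z' = act w z" "\<And>z. \<Phi> (cproj M z) = cproj M (\<Phi> z)"
    "surj \<Phi>" "\<And>G. open G \<Longrightarrow> open (\<Phi> ` G)"
    "\<And>D g. open D \<Longrightarrow> holomorphic_EC (\<lambda>z. g (\<Phi> z)) {z. \<Phi> z \<in> D} \<Longrightarrow> holomorphic_EC g D"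
proof -
  obtain r d f where *: "r \<le> card (onb M)" "\<And>i. i < r \<Longrightarrow> pipoly (d i) (f i)"
    "\<And>e g. pipoly e g \<Longrightarrow> gid (hpoly M) (fam {..<r} d f) e g"
    by (rule good_generators) blast
  interpret refl_generators M F r d f
    by unfold_locales (use * in auto)
  show ?thesis by (rule quotient_chart_generators) (rule that)
qed

section \<open>Hyperplanes and chambers\<close>

definition aff_iso :: "('a::euclidean_space \<Rightarrow> 'a) \<Rightarrow> bool" where
  "aff_iso w \<longleftrightarrow> orthogonal_transformation (\<lambda>x. w x - w 0)"

lemma aff_isoE:
  assumes "aff_iso w" obtains a l where "orthogonal_transformation l" "\<And>x. w x = a + l x"
proof (rule that)
  show "orthogonal_transformation (\<lambda>x. w x - w 0)" using assms by (simp only: aff_iso_def)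
  show "w x = w 0 + (w x - w 0)" for x by simp
qed

lemma aff_isoI:
  assumes "orthogonal_transformation l" "\<And>x. w x = a + l x" shows "aff_iso w"
proof -
  have "(\<lambda>x. w x - w 0) = l"
    using linear_0[OF orthogonal_transformation_linear[OF assms(1)]] by (simp add: assms(2))
  then show ?thesis using assms(1) by (simp add: aff_iso_def)
qed

lemma aff_iso_id: "aff_iso id"
  by (rule aff_isoI[of id _ 0]) (auto simp: orthogonal_transformation_id[unfolded id_def[symmetric]])

lemma aff_iso_comp: assumes "aff_iso v" "aff_iso w" shows "aff_iso (v \<circ> w)"
proof -
  obtain l a where l: "orthogonal_transformation l" "\<And>x. v x = a + l x" using assms(1) by (rule aff_isoE) blast
  obtain m b where m: "orthogonal_transformation m" "\<And>x. w x = b + m x" using assms(2) by (rule aff_isoE) blast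
  show ?thesis
  proof (rule aff_isoI)
    show "orthogonal_transformation (l \<circ> m)" using l m by (intro orthogonal_transformation_compose)
    show "(v \<circ> w) x = (a + l b) + (l \<circ> m) x" for x
      using linear_add[OF orthogonal_transformation_linear[OF l(1)], of b "m x"] by (simp add: l(2) m(2))
  qed
qed

lemma aff_iso_dist: assumes "aff_iso w" shows "dist (w x) (w y) = dist x y"
proof -
  obtain l a where l: "orthogonal_transformation l" "\<And>x. w x = a + l x" using assms by (rule aff_isoE) blast
  have "dist (l x) (l y) = dist x y" using l(1) orthogonal_transformation_isometry by blast
  then show ?thesis by (simp add: l(2) dist_norm)
qed

lemma aff_iso_affine:
  assumes "aff_iso w" "s + t = (1::real)" shows "w (s *\<^sub>R x + t *\<^sub>R y) = s *\<^sub>R w x + t *\<^sub>R w y"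
proof -
  obtain l a where l: "orthogonal_transformation l" "\<And>x. w x = a + l x" using assms(1) by (rule aff_isoE) blast
  note lin = orthogonal_transformation_linear[OF l(1)]
  have "a = s *\<^sub>R a + t *\<^sub>R a" using assms(2) by (metis scaleR_add_left scaleR_one)
  then show ?thesis
    by (simp add: l(2) linear_add[OF lin] linear_scale[OF lin] scaleR_add_right)
qed

lemma aff_iso_inj: "aff_iso w \<Longrightarrow> inj w"
  by (metis aff_iso_dist dist_eq_0_iff injI)

lemma aff_iso_segment: assumes "aff_iso w" shows "w ` closed_segment x y = closed_segment (w x) (w y)"
proof -
  have "closed_segment x y = (\<lambda>t. (1 - t) *\<^sub>R x + t *\<^sub>R y) ` {0..1}" for x y :: 'a
    by (auto simp: closed_segment_def)
  then show ?thesis using aff_iso_affine[OF assms, of "1 - t" t for t] by (simp add: image_image)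
qed

text \<open>An affine function with zero set \<open>H\<close>. Its sign and scale are arbitrary, so
  only statements unaffected by a nonzero factor carry meaning, such as the sign of a product of two
  values.\<close>

definition hval :: "'a::euclidean_space set \<Rightarrow> 'a \<Rightarrow> real" where
  "hval H = (SOME f. \<exists>a b. a \<noteq> 0 \<and> f = (\<lambda>x. a \<bullet> x - b) \<and> H = {x. f x = 0})"

lemma hvalE:
  assumes "affine_hyperplane H"
  obtains a b where "a \<noteq> 0" "\<And>x. hval H x = a \<bullet> x - b" "H = {x. a \<bullet> x = b}" "\<And>x. x \<in> H \<longleftrightarrow> hval H x = 0"
proof -
  obtain a b where "a \<noteq> 0" "H = {x. a \<bullet> x = b}" using assms unfolding affine_hyperplane_def by blast
  then have "\<exists>f a b. a \<noteq> 0 \<and> f = (\<lambda>x. a \<bullet> x - b) \<and> H = {x. f x = 0}"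
    by (intro exI[of _ "\<lambda>x. a \<bullet> x - b"] exI[of _ a] exI[of _ b]) auto
  from someI_ex[OF this, folded hval_def] obtain a b where
    "a \<noteq> 0" "hval H = (\<lambda>x. a \<bullet> x - b)" "H = {x. hval H x = 0}" by blast
  then show ?thesis by (intro that[of a b]) auto
qed

lemma mem_hyperplane: "affine_hyperplane H \<Longrightarrow> x \<in> H \<longleftrightarrow> hval H x = 0"
  by (metis hvalE)

lemma hval_affine:
  assumes "affine_hyperplane H" "s + t = 1" shows "hval H (s *\<^sub>R x + t *\<^sub>R y) = s * hval H x + t * hval H y"
proof -
  obtain a b where ab: "\<And>x. hval H x = a \<bullet> x - b" using assms(1) hvalE by metis
  have "b = s * b + t * b" using assms(2) by (metis distrib_right mult_1)
  then show ?thesis by (simp add: ab inner_add_right algebra_simps)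
qed

lemma closest_point_hyperplane:
  assumes "a \<noteq> 0" shows "closest_point {x. a \<bullet> x = b} x = x - ((a \<bullet> x - b) / (a \<bullet> a)) *\<^sub>R a"
proof -
  define k where "k = (a \<bullet> x - b) / (a \<bullet> a)"
  define p where "p = x - k *\<^sub>R a"
  have "k * (a \<bullet> a) = a \<bullet> x - b" using assms by (simp add: k_def)
  then have p: "a \<bullet> p = b" by (simp add: p_def inner_diff_right)
  have xp: "x - p = k *\<^sub>R a" by (simp add: p_def)
  have "p = closest_point {x. a \<bullet> x = b} x"
  proof (rule closest_point_unique)
    show "\<forall>z\<in>{x. a \<bullet> x = b}. dist x p \<le> dist x z"
    proof
      fix z assume "z \<in> {x. a \<bullet> x = b}"
      then have "orthogonal (x - p) (p - z)" using p by (simp add: xp orthogonal_def inner_diff_right)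
      from norm_add_Pythagorean[OF this]
      have "(norm (x - z))\<^sup>2 = (norm (x - p))\<^sup>2 + (norm (p - z))\<^sup>2" by simp
      then have "(norm (x - p))\<^sup>2 \<le> (norm (x - z))\<^sup>2" by simp
      then show "dist x p \<le> dist x z" unfolding dist_norm by (rule power2_le_imp_le) simp
    qed
  qed (use p in \<open>auto intro: convex_hyperplane closed_hyperplane\<close>)
  then show ?thesis by (simp add: p_def k_def)
qed

lemma orth_reflection_eq:
  assumes "a \<noteq> 0" shows "orth_reflection {x. a \<bullet> x = b} x = x - (2 * (a \<bullet> x - b) / (a \<bullet> a)) *\<^sub>R a"
proof -
  have "2 *\<^sub>R (x - ((a \<bullet> x - b) / (a \<bullet> a)) *\<^sub>R a) - x = x - (2 * (a \<bullet> x - b) / (a \<bullet> a)) *\<^sub>R a"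
    by (simp add: scaleR_diff_right scaleR_2)
  then show ?thesis by (simp add: orth_reflection_def closest_point_hyperplane[OF assms])
qed

lemma orthogonal_transformation_refl:
  assumes "a \<noteq> 0" shows "orthogonal_transformation (refl a)"
  unfolding orthogonal_transformation_def
proof (intro conjI allI)
  show "linear (refl a)"
    unfolding refl_def by (intro linearI) (auto simp: inner_add_right algebra_simps add_divide_distrib)
  show "refl a v \<bullet> refl a w = v \<bullet> w" for v w
  proof -
    define c where "c = 2 / (a \<bullet> a)"
    have c: "c * (a \<bullet> a) = 2" using assms by (simp add: c_def)
    have r: "refl a x = x - (c * (a \<bullet> x)) *\<^sub>R a" for x by (simp add: refl_def c_def)
    have "refl a v \<bullet> refl a w = v \<bullet> w - 2 * (c * (a \<bullet> v) * (a \<bullet> w)) + (c * (a \<bullet> a)) * (c * (a \<bullet> v) * (a \<bullet> w))"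
      unfolding r by (simp add: inner_diff_left inner_diff_right inner_commute[of v a] algebra_simps)
    then show ?thesis unfolding c by simp
  qed
qed

lemma orth_reflection_refl:
  assumes "a \<noteq> 0" "p \<in> H" "H = {x. a \<bullet> x = b}"
  shows "orth_reflection H x = p + refl a (x - p)"
  using assms by (simp add: orth_reflection_eq refl_def inner_diff_right)

lemma aff_iso_orth_reflection:
  assumes "affine_hyperplane H" shows "aff_iso (orth_reflection H)"
proof -
  obtain a b where ab: "a \<noteq> 0" "H = {x. a \<bullet> x = b}" using assms unfolding affine_hyperplane_def by blast
  show ?thesis
    by (rule aff_isoI[OF orthogonal_transformation_refl[OF ab(1)], of _ "(2 * b / (a \<bullet> a)) *\<^sub>R a"])
      (simp add: ab orth_reflection_eq refl_def diff_divide_distrib right_diff_distrib scaleR_diff_left)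
qed

lemma orth_reflection_involution:
  assumes "affine_hyperplane H" shows "orth_reflection H (orth_reflection H x) = x"
proof -
  obtain a b where ab: "a \<noteq> 0" "H = {x. a \<bullet> x = b}" using assms unfolding affine_hyperplane_def by blast
  define k where "k = (\<lambda>x. 2 * (a \<bullet> x - b) / (a \<bullet> a))"
  have r: "orth_reflection H x = x - k x *\<^sub>R a" for x unfolding ab(2) k_def by (rule orth_reflection_eq[OF ab(1)])
  have "k x * (a \<bullet> a) = 2 * (a \<bullet> x - b)" using ab(1) by (simp add: k_def)
  then have "a \<bullet> (x - k x *\<^sub>R a) - b = - (a \<bullet> x - b)" by (simp add: inner_diff_right)
  moreover have "k y = - k x" if "a \<bullet> y - b = - (a \<bullet> x - b)" for y
    unfolding k_def by (simp only: that mult_minus_right minus_divide_left)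
  ultimately have "k (x - k x *\<^sub>R a) = - k x" by blast
  then show ?thesis by (simp add: r)
qed

lemma orth_reflection_fix: "affine_hyperplane H \<Longrightarrow> orth_reflection H x = x \<longleftrightarrow> x \<in> H"
  unfolding affine_hyperplane_def by (auto simp: orth_reflection_eq)

lemma hval_orth_reflection:
  assumes "affine_hyperplane H" shows "hval H (orth_reflection H x) = - hval H x"
proof -
  obtain a b where ab: "a \<noteq> 0" "\<And>x. hval H x = a \<bullet> x - b" "H = {x. a \<bullet> x = b}" using assms hvalE by metis
  show ?thesis using ab(1) by (simp add: ab(2) orth_reflection_eq[of a b x, folded ab(3)] inner_diff_right)
qed

lemma closest_point_aff_iso:
  assumes "aff_iso w" "closed H" "convex H" "H \<noteq> {}" "closed (w ` H)" "convex (w ` H)"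
  shows "closest_point (w ` H) (w x) = w (closest_point H x)"
  by (rule closest_point_unique[symmetric])
    (use assms closest_point_in_set[OF assms(2,4)] closest_point_le[OF assms(2)] in \<open>auto simp: aff_iso_dist\<close>)

lemma affine_hyperplane_facts:
  assumes "affine_hyperplane H" shows "closed H" "convex H" "H \<noteq> {}"
proof -
  obtain a b where ab: "a \<noteq> 0" "H = {x. a \<bullet> x = b}" using assms unfolding affine_hyperplane_def by blast
  show "closed H" "convex H" unfolding ab(2) by (auto intro: closed_hyperplane convex_hyperplane)
  have "(b / (a \<bullet> a)) *\<^sub>R a \<in> H" using ab by simp
  then show "H \<noteq> {}" by blast
qed

lemma orth_reflection_image:
  assumes "aff_iso w" "affine_hyperplane H" "affine_hyperplane (w ` H)"
  shows "orth_reflection (w ` H) (w x) = w (orth_reflection H x)"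
proof -
  have "w (2 *\<^sub>R closest_point H x - x) = 2 *\<^sub>R w (closest_point H x) - w x"
    using aff_iso_affine[OF assms(1), of 2 "-1" "closest_point H x" x] by simp
  then show ?thesis
    unfolding orth_reflection_def
    using closest_point_aff_iso[OF assms(1) affine_hyperplane_facts[OF assms(2)] affine_hyperplane_facts(1,2)[OF assms(3)]]
    by simp
qed

section \<open>Separation by hyperplanes and generic points\<close>

definition sep :: "'a::euclidean_space set \<Rightarrow> 'a \<Rightarrow> 'a \<Rightarrow> bool" where
  "sep H x y \<longleftrightarrow> x \<notin> H \<and> y \<notin> H \<and> closed_segment x y \<inter> H \<noteq> {}"

text \<open>Signs make separation computable, while the segments in its definition make it visibly
  invariant under isometries. Points of \<open>H\<close> are separated from nothing.\<close>

lemma sep_iff: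
  assumes "affine_hyperplane H" shows "sep H x y \<longleftrightarrow> hval H x * hval H y < 0"
proof
  assume "sep H x y"
  then obtain t where t: "0 \<le> t" "t \<le> 1" "(1 - t) *\<^sub>R x + t *\<^sub>R y \<in> H" and xy: "hval H x \<noteq> 0" "hval H y \<noteq> 0"
    using mem_hyperplane[OF assms] by (auto simp: sep_def closed_segment_def)
  have e: "(1 - t) * hval H x + t * hval H y = 0"
    using t(3) mem_hyperplane[OF assms] hval_affine[OF assms, of "1 - t" t x y] by simp
  show "hval H x * hval H y < 0"
  proof (rule ccontr)
    assume "\<not> ?thesis"
    then have "hval H x * hval H y > 0" using xy by (metis mult_eq_0_iff linorder_less_linear)
    then have "(1 - t) * (hval H x)\<^sup>2 + t * (hval H x * hval H y) > 0"
      using t xy by (cases "t = 0") (auto intro!: add_nonneg_pos mult_nonneg_nonneg)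
    moreover have "hval H x * ((1 - t) * hval H x + t * hval H y) = (1 - t) * (hval H x)\<^sup>2 + t * (hval H x * hval H y)"
      by (simp add: power2_eq_square algebra_simps)
    ultimately show False using e by simp
  qed
next
  assume *: "hval H x * hval H y < 0"
  define t where "t = hval H x / (hval H x - hval H y)"
  have ne: "hval H x - hval H y \<noteq> 0" using * by (auto simp: mult_less_0_iff)
  have t: "0 \<le> t" "t \<le> 1" using * by (auto simp: t_def divide_simps mult_less_0_iff)
  have "(1 - t) * hval H x + t * hval H y = 0" using ne by (simp add: t_def field_simps)
  then have "(1 - t) *\<^sub>R x + t *\<^sub>R y \<in> H"
    using mem_hyperplane[OF assms] hval_affine[OF assms, of "1 - t" t x y] by simp
  moreover have "(1 - t) *\<^sub>R x + t *\<^sub>R y \<in> closed_segment x y" using t by (auto simp: closed_segment_def)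
  ultimately show "sep H x y" using * mem_hyperplane[OF assms] by (auto simp: sep_def)
qed

lemma sep_commute: "sep H x y = sep H y x"
  by (auto simp: sep_def closed_segment_commute)

lemma sep_image: "aff_iso w \<Longrightarrow> sep (w ` H) (w x) (w y) \<longleftrightarrow> sep H x y"
  unfolding sep_def aff_iso_segment[symmetric] using aff_iso_inj[of w]
  by (auto simp: inj_image_mem_iff image_Int[symmetric])

lemma sep_trans:
  assumes "affine_hyperplane H" "x \<notin> H" "y \<notin> H" "z \<notin> H"
  shows "sep H x z \<longleftrightarrow> sep H x y \<noteq> sep H y z"
  using assms by (auto simp: sep_iff mem_hyperplane mult_less_0_iff)

text \<open>The reflection brings \<open>x\<close> to the side of \<open>y\<close>. The descent in
  \<open>F_generated\<close> rests on this decrease of distance.\<close>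

lemma sep_closer:
  assumes "affine_hyperplane H" "sep H x y" shows "dist (orth_reflection H x) y < dist x y"
proof -
  obtain a b where ab: "a \<noteq> 0" "\<And>x. hval H x = a \<bullet> x - b" "H = {x. a \<bullet> x = b}" using assms(1) hvalE by metis
  define h c where "h = a \<bullet> x - b" and "c = 2 * h / (a \<bullet> a)"
  have c: "c * (a \<bullet> a) = 2 * h" using ab(1) by (simp add: c_def)
  have "orth_reflection H x - y = (x - y) - c *\<^sub>R a"
    using orth_reflection_eq[OF ab(1), of b x] by (simp add: ab(3) c_def h_def)
  moreover have "(norm (d - c *\<^sub>R a))\<^sup>2 = (norm d)\<^sup>2 - 2 * c * (a \<bullet> d) + c * (c * (a \<bullet> a))" for d
    unfolding power2_norm_eq_inner by (simp add: inner_diff_left inner_diff_right inner_commute[of d a] right_diff_distrib)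
  ultimately have "(norm (orth_reflection H x - y))\<^sup>2 = (norm (x - y))\<^sup>2 - 2 * c * (a \<bullet> (x - y)) + c * (c * (a \<bullet> a))"
    by metis
  also have "\<dots> = (norm (x - y))\<^sup>2 + 2 * c * (a \<bullet> y - b)"
    unfolding c by (simp add: h_def inner_diff_right algebra_simps)
  also have "\<dots> < (norm (x - y))\<^sup>2"
  proof -
    have "h * (a \<bullet> y - b) < 0" using assms by (simp add: sep_iff ab(2) h_def)
    then have "2 * (2 * (h * (a \<bullet> y - b)) / (a \<bullet> a)) < 0" using ab(1) by (simp add: divide_neg_pos)
    then show ?thesis by (simp add: c_def)
  qed
  finally show ?thesis by (simp add: dist_norm power2_less_imp_less)
qed

lemma generic_point:
  fixes U :: "'a::euclidean_space set" and v :: "'i \<Rightarrow> 'a" and \<beta> :: "'i \<Rightarrow> real"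
  assumes "finite I" "\<And>i. i \<in> I \<Longrightarrow> v i \<noteq> 0 \<or> \<beta> i \<noteq> 0" "open U" "U \<noteq> {}"
  shows "\<exists>u\<in>U. \<forall>i\<in>I. v i \<bullet> u \<noteq> \<beta> i"
proof (rule ccontr)
  assume "\<not> ?thesis"
  then have "U \<subseteq> (\<Union>i\<in>I. {u. v i \<bullet> u = \<beta> i})" by blast
  moreover have "negligible (\<Union>i\<in>I. {u. v i \<bullet> u = \<beta> i})"
    using assms(1,2) by (intro negligible_Union) (auto intro: negligible_hyperplane)
  ultimately show False using assms(3,4) open_not_negligible negligible_subset by blast
qed

text \<open>Conditions on \<open>u \<in> M\<close> are pulled back to the whole space by the
  projection, so that the measure argument of \<open>generic_point\<close> for open sets applies;
  projecting does not enlarge the norm.\<close>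

lemma generic_point_flat:
  fixes M :: "'a::euclidean_space set"
  assumes "subspace M" "finite \<A>" "\<And>H. H \<in> \<A> \<Longrightarrow> affine_hyperplane H"
    "\<And>H. H \<in> \<A> \<Longrightarrow> \<exists>m\<in>M. x + m \<notin> H" "e > 0"
  obtains u where "u \<in> M" "norm u < e" "\<And>H. H \<in> \<A> \<Longrightarrow> x + u \<notin> H"
proof -
  have "\<exists>a b. H = {y. a \<bullet> y = b}" if "H \<in> \<A>" for H using assms(3)[OF that] by (auto simp: affine_hyperplane_def)
  then obtain a b where "\<And>H. H \<in> \<A> \<Longrightarrow> H = {y. a H \<bullet> y = b H}" by metis
  then have ab: "y \<in> H \<longleftrightarrow> a H \<bullet> y = b H" if "H \<in> \<A>" for H y using that by blast
  have eq: "a H \<bullet> (x + proj M v) = a H \<bullet> x + proj M (a H) \<bullet> v" for H v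
    using inner_diff_proj[OF assms(1) proj_mem[OF assms(1)], of v "a H"]
      inner_diff_proj[OF assms(1) proj_mem[OF assms(1)], of "a H" v]
    by (simp add: inner_add_right inner_diff_right inner_commute)
  have "\<exists>v\<in>ball 0 e. \<forall>H\<in>\<A>. proj M (a H) \<bullet> v \<noteq> b H - a H \<bullet> x"
  proof (rule generic_point[OF assms(2)])
    fix H assume H: "H \<in> \<A>"
    obtain m where m: "m \<in> M" "x + m \<notin> H" using assms(4)[OF H] by blast
    have "a H \<bullet> x + proj M (a H) \<bullet> m \<noteq> b H"
      using m ab[OF H] eq[of H m] proj_id[OF assms(1) m(1)] by auto
    then show "proj M (a H) \<noteq> 0 \<or> b H - a H \<bullet> x \<noteq> 0" by auto
  qed (use assms(5) in auto)
  then obtain v where v: "norm v < e" "\<And>H. H \<in> \<A> \<Longrightarrow> proj M (a H) \<bullet> v \<noteq> b H - a H \<bullet> x" by auto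
  have le: "norm (proj M v) \<le> norm v"
  proof (rule power2_le_imp_le)
    show "(norm (proj M v))\<^sup>2 \<le> (norm v)\<^sup>2" using norm_proj[OF assms(1), of v] by (metis le_add_same_cancel1 zero_le_power2)
  qed simp
  show ?thesis
  proof (rule that[of "proj M v"])
    show "x + proj M v \<notin> H" if "H \<in> \<A>" for H using ab[OF that] v(2)[OF that] eq[of H v] by auto
  qed (use le v proj_mem[OF assms(1)] in auto)
qed

lemma compositions_comp: "v \<in> compositions S \<Longrightarrow> w \<in> compositions S \<Longrightarrow> v \<circ> w \<in> compositions S"
  by (induction rule: compositions.induct) (auto simp: o_assoc[symmetric] intro: compositions.comp)

lemma compositions_incl: "s \<in> S \<Longrightarrow> s \<in> compositions S"
  using compositions.comp[OF _ compositions.id] by fastforce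

lemma compositions_mono:
  assumes "w \<in> compositions S" "S \<subseteq> T" shows "w \<in> compositions T"
  using assms(1)
proof induction
  case (comp s w)
  then show ?case using compositions.comp[of s T w] assms(2) by blast
qed (rule compositions.id)

lemma compositions_inverse:
  assumes "\<And>s. s \<in> S \<Longrightarrow> s \<circ> s = id" "w \<in> compositions S"
  shows "\<exists>v\<in>compositions S. v \<circ> w = id \<and> w \<circ> v = id"
  using assms(2)
proof induction
  case id
  show ?case using compositions.id by (metis comp_id)
next
  case (comp s w)
  then obtain v where v: "v \<in> compositions S" "v \<circ> w = id" "w \<circ> v = id" by blast
  have "(v \<circ> s) \<circ> (s \<circ> w) = id" "(s \<circ> w) \<circ> (v \<circ> s) = id"
    using v assms(1)[OF comp(1)] by (metis comp_assoc comp_id id_comp)+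
  then show ?case using compositions_comp[OF v(1) compositions_incl[OF comp(1)]] by blast
qed

lemma hyperplane_subset_eq:
  assumes "affine_hyperplane H" "affine_hyperplane K" "H \<subseteq> K" shows "H = K"
proof -
  obtain a b where H: "a \<noteq> 0" "H = {x. a \<bullet> x = b}" using assms(1) unfolding affine_hyperplane_def by blast
  obtain a' b' where K: "a' \<noteq> 0" "K = {x. a' \<bullet> x = b'}" using assms(2) unfolding affine_hyperplane_def by blast
  obtain e where "e \<in> H" using affine_hyperplane_facts(3)[OF assms(1)] by blast
  then have e: "a \<bullet> e = b" "a' \<bullet> e = b'" using assms(3) H K by auto
  define k where "k = (a' \<bullet> a) / (a \<bullet> a)"
  define m where "m = a' - k *\<^sub>R a"
  have "a \<bullet> m = 0" using H(1) by (simp add: m_def k_def inner_diff_right inner_commute)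
  then have "e + m \<in> K" using assms(3) H(2) e(1) by (auto simp: inner_add_right)
  then have "a' \<bullet> m = 0" using K(2) e(2) by (simp add: inner_add_right)
  then have "m \<bullet> m = 0" using \<open>a \<bullet> m = 0\<close> by (subst m_def) (simp add: inner_diff_left)
  then have a': "a' = k *\<^sub>R a" by (simp add: m_def)
  then have "k \<noteq> 0" "b' = k * b" using K(1) e by auto
  then show ?thesis unfolding H(2) K(2) a' by simp
qed

section \<open>Chambers of a locally finite reflection arrangement\<close>

locale coxeter =
  fixes \<H> :: "'a::euclidean_space set set"
  assumes hyper: "H \<in> \<H> \<Longrightarrow> affine_hyperplane H"
    and stable: "H \<in> \<H> \<Longrightarrow> K \<in> \<H> \<Longrightarrow> orth_reflection H ` K \<in> \<H>"
    and loc_fin: "finite {H \<in> \<H>. H \<inter> cball x R \<noteq> {}}"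
begin

definition W :: "('a \<Rightarrow> 'a) set" where "W = compositions (orth_reflection ` \<H>)"

lemma W_aff_iso: assumes "w \<in> W" shows "aff_iso w"
  using assms unfolding W_def
proof induction
  case (comp s w)
  then have "aff_iso s" using aff_iso_orth_reflection[OF hyper] by blast
  then show ?case using comp(3) by (rule aff_iso_comp)
qed (rule aff_iso_id)

lemma W_stable: assumes "w \<in> W" "H \<in> \<H>" shows "w ` H \<in> \<H>"
  using assms(1) unfolding W_def
proof induction
  case (comp s w)
  then show ?case unfolding image_comp[symmetric] using stable by blast
qed (use assms in simp)

lemma refl_involution: "H \<in> \<H> \<Longrightarrow> orth_reflection H \<circ> orth_reflection H = id"
  by (auto simp: fun_eq_iff orth_reflection_involution hyper)

lemma W_inverse: "w \<in> W \<Longrightarrow> \<exists>v\<in>W. v \<circ> w = id \<and> w \<circ> v = id"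
  unfolding W_def by (rule compositions_inverse) (auto simp: refl_involution)

lemma W_comp: "v \<in> W \<Longrightarrow> w \<in> W \<Longrightarrow> v \<circ> w \<in> W"
  unfolding W_def by (rule compositions_comp)

lemma W_refl: "H \<in> \<H> \<Longrightarrow> orth_reflection H \<in> W"
  unfolding W_def by (rule compositions_incl) blast

lemma W_id: "id \<in> W"
  unfolding W_def by (rule compositions.id)

lemma refl_conj: "w \<in> W \<Longrightarrow> H \<in> \<H> \<Longrightarrow> orth_reflection (w ` H) (w x) = w (orth_reflection H x)"
  by (intro orth_reflection_image W_aff_iso hyper W_stable)

lemma sep_W: "w \<in> W \<Longrightarrow> sep (w ` H) (w x) (w y) \<longleftrightarrow> sep H x y"
  by (rule sep_image[OF W_aff_iso])

lemma refl_image_self: "H \<in> \<H> \<Longrightarrow> orth_reflection H ` H = H"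
  using image_cong[of H H "orth_reflection H" "\<lambda>x. x"] by (simp add: orth_reflection_fix hyper)

lemma refl_image_image: "H \<in> \<H> \<Longrightarrow> orth_reflection H ` (orth_reflection H ` K) = K"
  by (simp add: image_image orth_reflection_involution hyper)

lemma generic_mono: "c \<notin> \<Union>\<H> \<Longrightarrow> w \<in> W \<Longrightarrow> w c \<notin> \<Union>\<H>"
proof
  assume c: "c \<notin> \<Union>\<H>" and w: "w \<in> W" and "w c \<in> \<Union>\<H>"
  then obtain H where H: "H \<in> \<H>" "w c \<in> H" by blast
  obtain v where v: "v \<in> W" "v \<circ> w = id" using W_inverse[OF w] by blast
  have "c = v (w c)" using v(2) by (simp add: fun_eq_iff)
  then have "c \<in> v ` H" using H(2) by blast
  then show False using c W_stable[OF v(1) H(1)] by blast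
qed

text \<open>Not the walls of a chamber but the hyperplanes separating two points; for
  \<open>d = w c\<close> their number is the length of \<open>w\<close>.\<close>

definition walls :: "'a \<Rightarrow> 'a \<Rightarrow> 'a set set" where
  "walls c d = {H \<in> \<H>. sep H c d}"

text \<open>For generic \<open>c\<close> these are the walls of its chamber: reflecting in such a
  hyperplane leads to the chamber next door, with nothing else in between.\<close>

definition simple :: "'a \<Rightarrow> 'a set \<Rightarrow> bool" where
  "simple c H \<longleftrightarrow> H \<in> \<H> \<and> walls c (orth_reflection H c) = {H}"

lemma finite_walls: "finite (walls c d)"
proof (rule finite_subset[OF _ loc_fin[of c "dist c d"]])
  show "walls c d \<subseteq> {H \<in> \<H>. H \<inter> cball c (dist c d) \<noteq> {}}"
  proof
    fix H assume "H \<in> walls c d"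
    then obtain y where y: "H \<in> \<H>" "y \<in> closed_segment c d" "y \<in> H" by (auto simp: walls_def sep_def)
    then have "dist c y \<le> dist c d" using segment_bound(1)[OF y(2)] by (simp add: dist_norm norm_minus_commute)
    then show "H \<in> {H \<in> \<H>. H \<inter> cball c (dist c d) \<noteq> {}}" using y by auto
  qed
qed

text \<open>Since \<open>H\<close> alone separates \<open>c\<close> from its mirror image, replacing
  \<open>c\<close> by that image changes separation for no hyperplane but \<open>H\<close>; the
  reflection therefore permutes the others.\<close>

lemma walls_refl:
  assumes H: "simple c H" and c: "c \<notin> \<Union>\<H>" and d: "d \<notin> \<Union>\<H>" and K: "K \<in> \<H>"
  shows "K \<in> walls c (orth_reflection H d) \<longleftrightarrow>
    (if K = H then H \<notin> walls c d else orth_reflection H ` K \<in> walls c d)"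
proof -
  let ?s = "orth_reflection H"
  have H\<H>: "H \<in> \<H>" and s: "?s \<in> W" using H W_refl by (auto simp: simple_def)
  have K': "?s ` K \<in> \<H>" "affine_hyperplane (?s ` K)" using stable[OF H\<H> K] hyper by auto
  have gen: "c \<notin> ?s ` K" "d \<notin> ?s ` K" "?s c \<notin> ?s ` K"
    using c d K' generic_mono[OF c s] by auto
  have "sep K c (?s d) \<longleftrightarrow> sep (?s ` K) (?s c) d"
    using sep_W[OF s, of K c "?s d"] by (simp add: orth_reflection_involution hyper[OF H\<H>])
  also have "\<dots> \<longleftrightarrow> sep (?s ` K) c (?s c) \<noteq> sep (?s ` K) c d"
    using sep_trans[OF K'(2) gen(3,1,2)] by (simp add: sep_commute)
  also have "sep (?s ` K) c (?s c) \<longleftrightarrow> ?s ` K = H"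
  proof -
    have "?s ` K \<in> walls c (?s c) \<longleftrightarrow> ?s ` K = H" using H by (simp add: simple_def)
    then show ?thesis using K'(1) by (simp only: walls_def mem_Collect_eq simp_thms)
  qed
  also have "?s ` K = H \<longleftrightarrow> K = H"
    using refl_image_self[OF H\<H>] refl_image_image[OF H\<H>] by metis
  finally show ?thesis
    using K K' H\<H> refl_image_self[OF H\<H>] by (auto simp: walls_def)
qed

lemma card_walls_refl:
  assumes H: "simple c H" and c: "c \<notin> \<Union>\<H>" and d: "d \<notin> \<Union>\<H>" and Hd: "H \<in> walls c d"
  shows "card (walls c d) = Suc (card (walls c (orth_reflection H d)))"
proof -
  have H\<H>: "H \<in> \<H>" using H by (simp add: simple_def)
  have w: "K \<in> \<H>" if "K \<in> walls c x" for K x using that by (simp add: walls_def)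
  have ne: "orth_reflection H ` K \<noteq> H" if "K \<noteq> H" for K
    using that refl_image_self[OF H\<H>] refl_image_image[OF H\<H>] by metis
  have "walls c (orth_reflection H d) = (`) (orth_reflection H) ` (walls c d - {H})"
  proof (intro equalityI subsetI)
    fix K assume K: "K \<in> walls c (orth_reflection H d)"
    then have "K \<noteq> H" "orth_reflection H ` K \<in> walls c d"
      using walls_refl[OF H c d w[OF K]] Hd by (auto split: if_splits)
    then show "K \<in> (`) (orth_reflection H) ` (walls c d - {H})"
      using ne refl_image_image[OF H\<H>] by (intro image_eqI[of _ _ "orth_reflection H ` K"]) auto
  next
    fix K assume "K \<in> (`) (orth_reflection H) ` (walls c d - {H})"
    then obtain K0 where K0: "K0 \<in> walls c d" "K0 \<noteq> H" "K = orth_reflection H ` K0" by blast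
    then show "K \<in> walls c (orth_reflection H d)"
      using walls_refl[OF H c d, of K] stable[OF H\<H> w] ne refl_image_image[OF H\<H>] by auto
  qed
  moreover have "inj_on ((`) (orth_reflection H)) (walls c d - {H})"
    using refl_image_image[OF H\<H>] by (metis inj_onI)
  ultimately have "card (walls c (orth_reflection H d)) = card (walls c d - {H})" by (simp add: card_image)
  then show ?thesis using finite_walls Hd by (metis card_Suc_Diff1)
qed

text \<open>The first hyperplane met on the way from \<open>c\<close> to \<open>d\<close> is a wall
  of the chamber of \<open>c\<close>. For it to be the only one met at that moment, \<open>d\<close>
  is first replaced by a generic point \<open>u\<close> nearby.\<close>

lemma simple_exists:
  assumes c: "c \<notin> \<Union>\<H>" and d: "d \<notin> \<Union>\<H>" and ne: "walls c d \<noteq> {}"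
  shows "\<exists>H. simple c H \<and> H \<in> walls c d"
proof -
  \<comment> \<open>The extra radius 1 leaves room for moving \<open>d\<close> while all relevant
    hyperplanes stay in one finite family.\<close>
  define \<F> where "\<F> = {H \<in> \<H>. H \<inter> cball c (dist c d + 1) \<noteq> {}}"
  have fin: "finite \<F>" unfolding \<F>_def by (rule loc_fin)
  have "\<exists>a b. \<forall>x. hval H x = a \<bullet> x - b" if "H \<in> \<F>" for H
    using hvalE[OF hyper] that unfolding \<F>_def by (metis (no_types, lifting) mem_Collect_eq)
  then obtain a b where ab: "\<And>H x. H \<in> \<F> \<Longrightarrow> hval H x = a H \<bullet> x - b H" by metis
  have hyperF: "affine_hyperplane H" if "H \<in> \<F>" for H using that hyper by (simp add: \<F>_def)
  have cF: "hval H c \<noteq> 0" if "H \<in> \<F>" for H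
    using c that hyperF[OF that] mem_hyperplane by (auto simp: \<F>_def)
  define U where "U = ball d 1 \<inter> - \<Union>\<F>"
  have "closed (\<Union>\<F>)" using fin affine_hyperplane_facts(1)[OF hyperF] by (intro closed_Union) auto
  then have "open U" unfolding U_def by (intro open_Int) auto
  moreover have "d \<in> U" using d by (auto simp: U_def \<F>_def)
  ultimately obtain e where e: "e > 0" "ball d e \<subseteq> U" by (meson openE)
  let ?I = "{(H, K). H \<in> \<F> \<and> K \<in> \<F> \<and> H \<noteq> K}"
  \<comment> \<open>Two hyperplanes crossed by the segment from \<open>c\<close> to \<open>u\<close>
    are crossed at the same time exactly if
    \<open>hval K c * hval H u = hval H c * hval K u\<close>. These are affine equations in
    \<open>u\<close>, nontrivial for distinct hyperplanes, and \<open>u\<close> is chosen to violate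
    them all.\<close>
  have "\<exists>u\<in>ball d e. \<forall>i\<in>?I. (case i of (H, K) \<Rightarrow> hval K c *\<^sub>R a H - hval H c *\<^sub>R a K) \<bullet> u \<noteq>
      (case i of (H, K) \<Rightarrow> hval K c * b H - hval H c * b K)"
  proof (rule generic_point)
    show "finite ?I" by (rule finite_subset[of _ "\<F> \<times> \<F>"]) (use fin in auto)
    fix i assume "i \<in> ?I"
    then obtain H K where HK: "i = (H, K)" "H \<in> \<F>" "K \<in> \<F>" "H \<noteq> K" by auto
    have "\<not> (hval K c *\<^sub>R a H - hval H c *\<^sub>R a K = 0 \<and> hval K c * b H - hval H c * b K = 0)"
    proof
      assume *: "hval K c *\<^sub>R a H - hval H c *\<^sub>R a K = 0 \<and> hval K c * b H - hval H c * b K = 0"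
      have "hval K c * hval H x = hval H c * hval K x" for x
      proof -
        have "hval K c * hval H x - hval H c * hval K x =
            (hval K c *\<^sub>R a H - hval H c *\<^sub>R a K) \<bullet> x - (hval K c * b H - hval H c * b K)"
          by (simp add: ab[OF HK(2), of x] ab[OF HK(3), of x] inner_diff_left algebra_simps)
        then show ?thesis using * by simp
      qed
      then have "hval H x = 0 \<longleftrightarrow> hval K x = 0" for x
        using cF[OF HK(2)] cF[OF HK(3)] by (metis mult_eq_0_iff)
      then have "H = K" using mem_hyperplane[OF hyperF] HK by blast
      then show False using HK by simp
    qed
    then show "(case i of (H, K) \<Rightarrow> hval K c *\<^sub>R a H - hval H c *\<^sub>R a K) \<noteq> 0 \<or>
        (case i of (H, K) \<Rightarrow> hval K c * b H - hval H c * b K) \<noteq> 0" by (auto simp: HK(1))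
  qed (use e in auto)
  then obtain u where u: "u \<in> ball d e"
    and gen: "\<And>i. i \<in> ?I \<Longrightarrow> (case i of (H, K) \<Rightarrow> hval K c *\<^sub>R a H - hval H c *\<^sub>R a K) \<bullet> u \<noteq>
      (case i of (H, K) \<Rightarrow> hval K c * b H - hval H c * b K)" by blast
  have gen': "hval K c * hval H u \<noteq> hval H c * hval K u" if HK: "H \<in> \<F>" "K \<in> \<F>" "H \<noteq> K" for H K
    using gen[of "(H, K)"] HK by (simp add: ab[OF HK(1), of u] ab[OF HK(2), of u] inner_diff_left algebra_simps)
  have du: "\<not> sep H d u" if H: "H \<in> \<H>" for H
  proof
    assume "sep H d u"
    then obtain y where y: "y \<in> closed_segment d u" "y \<in> H" by (auto simp: sep_def)
    have "closed_segment d u \<subseteq> ball d e" using u e by (intro closed_segment_subset) auto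
    then have yU: "y \<in> U" using y e by blast
    then have "dist c y \<le> dist c d + 1" using dist_triangle[of c y d] by (simp add: U_def)
    then have "H \<in> \<F>" using y H by (auto simp: \<F>_def)
    then show False using yU y by (auto simp: U_def)
  qed
  have uF: "hval H u \<noteq> 0" if "H \<in> \<F>" for H
  proof -
    have "u \<notin> H" using u e(2) that by (auto simp: U_def)
    then show ?thesis using mem_hyperplane[OF hyperF[OF that]] by blast
  qed
  have walls_eq: "H \<in> walls c d \<longleftrightarrow> sep H c u" if H: "H \<in> \<F>" for H
  proof -
    have "H \<in> \<H>" using H by (simp add: \<F>_def)
    moreover have "u \<notin> H" "c \<notin> H" "d \<notin> H"
      using uF[OF H] cF[OF H] mem_hyperplane[OF hyperF[OF H]] d \<open>H \<in> \<H>\<close> by auto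
    ultimately show ?thesis
      using sep_trans[OF hyperF[OF H], of c d u] du[of H] by (auto simp: walls_def)
  qed
  have wF: "walls c d \<subseteq> \<F>"
  proof
    fix H assume "H \<in> walls c d"
    then obtain y where y: "H \<in> \<H>" "y \<in> closed_segment c d" "y \<in> H" by (auto simp: walls_def sep_def)
    then have "dist c y \<le> dist c d" using segment_bound(1)[OF y(2)] by (simp add: dist_norm norm_minus_commute)
    then show "H \<in> \<F>" using y by (auto simp: \<F>_def)
  qed
  \<comment> \<open>The parameter at which the segment from \<open>c\<close> to \<open>u\<close>
    meets \<open>H\<close>.\<close>
  define t where "t = (\<lambda>H. hval H c / (hval H c - hval H u))"
  obtain H where H: "H \<in> walls c d" and Hmin: "\<And>K. K \<in> walls c d \<Longrightarrow> t H \<le> t K"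
  proof -
    have "Min (t ` walls c d) \<in> t ` walls c d" using finite_walls ne by (intro Min_in) auto
    then obtain H where H: "H \<in> walls c d" "t H = Min (t ` walls c d)" by auto
    then have "t H \<le> t K" if "K \<in> walls c d" for K using that finite_walls by simp
    then show ?thesis using that H(1) by blast
  qed
  have HF: "H \<in> \<F>" and H\<H>: "H \<in> \<H>" using H wF by (auto simp: walls_def)
  have sgn: "hval K c * hval K u < 0" if "K \<in> walls c d" for K
    using that walls_eq[of K] wF sep_iff[OF hyperF] by blast
  have tH: "0 < t H" "t H < 1" using sgn[OF H] by (auto simp: t_def divide_simps mult_less_0_iff)
  define p where "p = (1 - t H) *\<^sub>R c + t H *\<^sub>R u"
  have hp: "hval K p = (1 - t H) * hval K c + t H * hval K u" if "K \<in> \<F>" for K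
    unfolding p_def using hval_affine[OF hyperF[OF that]] by simp
  have "hval H p = 0" using sgn[OF H] by (simp add: hp[OF HF] t_def divide_simps mult_less_0_iff) (auto simp: algebra_simps)
  then have pH: "p \<in> H" using mem_hyperplane[OF hyperF[OF HF]] by simp
  have side: "p \<notin> K \<and> \<not> sep K c p" if K: "K \<in> \<H>" "K \<noteq> H" for K
  proof (cases "K \<in> \<F>")
    case False
    have "p \<in> closed_segment c u" using tH by (auto simp: p_def closed_segment_def)
    then have seg: "closed_segment c p \<subseteq> closed_segment c u" by (simp add: subset_closed_segment)
    have "dist c u \<le> dist c d + 1" using u e dist_triangle[of c u d] by (auto simp: U_def)
    then have "closed_segment c u \<subseteq> cball c (dist c d + 1)" by (intro closed_segment_subset) auto
    then have "closed_segment c p \<inter> K = {}" using False K seg by (auto simp: \<F>_def)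
    then show ?thesis by (auto simp: sep_def)
  next
    case KF: True
    have "hval K c * hval K p > 0"
    proof (cases "K \<in> walls c d")
      case False
      then have "hval K c * hval K u > 0"
        using walls_eq[OF KF] sep_iff[OF hyperF[OF KF]] cF[OF KF] uF[OF KF]
        by (metis linorder_neqE_linordered_idom mult_eq_0_iff)
      have sq: "hval K c * hval K c > 0" using cF[OF KF] by (metis not_real_square_gt_zero)
      from \<open>hval K c * hval K u > 0\<close> have "(1 - t H) * (hval K c * hval K c) + t H * (hval K c * hval K u) > 0"
        using tH cF[OF KF] sq
        by (intro add_pos_pos mult_pos_pos[of "1 - t H"] mult_pos_pos[of "t H"]) auto
      then show ?thesis by (simp add: hp[OF KF] algebra_simps)
    next
      case True
      have "t H \<noteq> t K"
        using gen'[OF HF KF] K(2) sgn[OF H] sgn[OF True]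
        by (auto simp: t_def frac_eq_eq mult_less_0_iff algebra_simps)
      then have lt: "t H < t K" using Hmin[OF True] by simp
      have "t K * (hval K c - hval K u) = hval K c" using sgn[OF True] by (auto simp: t_def mult_less_0_iff)
      then have "hval K p = (t K - t H) * (hval K c - hval K u)" by (simp add: hp[OF KF] algebra_simps)
      then have "hval K c * hval K p = hval K c * ((t K - t H) * (hval K c - hval K u))" by simp
      also have "\<dots> = (t K - t H) * (hval K c * hval K c - hval K c * hval K u)" by (simp add: algebra_simps)
      also have "\<dots> > 0"
      proof (rule mult_pos_pos)
        have "hval K c * hval K c \<ge> 0" by simp
        then show "hval K c * hval K c - hval K c * hval K u > 0" using sgn[OF True] by linarith
      qed (use lt in simp)
      finally show ?thesis .
    qed
    then show ?thesis using sep_iff[OF hyperF[OF KF]] mem_hyperplane[OF hyperF[OF KF]] by auto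
  qed
  let ?s = "orth_reflection H"
  have sW: "?s \<in> W" by (rule W_refl[OF H\<H>])
  \<comment> \<open>The broken line from \<open>c\<close> through the fixed point \<open>p\<close>
    to \<open>?s c\<close> meets only \<open>H\<close>: its second half is the mirror image of the
    first, which \<open>side\<close> controls.\<close>
  have "walls c (?s c) = {H}"
  proof (intro equalityI subsetI)
    fix K assume K: "K \<in> walls c (?s c)"
    then have K\<H>: "K \<in> \<H>" by (simp add: walls_def)
    show "K \<in> {H}"
    proof (rule ccontr)
      assume "K \<notin> {H}"
      then have KH: "K \<noteq> H" by simp
      have sK: "?s ` K \<in> \<H>" by (rule stable[OF H\<H> K\<H>])
      have sK2: "?s ` K \<noteq> H"
        using KH refl_image_self[OF H\<H>] refl_image_image[OF H\<H>] by metis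
      have sp: "?s p = p" using pH orth_reflection_fix hyper H\<H> by blast
      have 1: "\<not> sep K c p" "p \<notin> K" using side[OF K\<H> KH] by auto
      have 2: "\<not> sep K (?s c) p"
        using side[OF sK sK2] sep_W[OF sW, of "?s ` K" c p] by (simp add: refl_image_image[OF H\<H>] sp)
      have "c \<notin> K" "?s c \<notin> K" using c generic_mono[OF c sW] K\<H> by auto
      then have "\<not> sep K c (?s c)"
        using sep_trans[OF hyper[OF K\<H>], of c p "?s c"] 1 2 by (auto simp: sep_commute)
      then show False using K by (simp add: walls_def)
    qed
  next
    fix K assume "K \<in> {H}"
    moreover have "sep H c (?s c)"
      using sep_iff[OF hyper[OF H\<H>]] cF[OF HF] hval_orth_reflection[OF hyper[OF H\<H>]]
      by (auto simp: mult_less_0_iff)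
    ultimately show "K \<in> walls c (?s c)" using H\<H> by (simp add: walls_def)
  qed
  then show ?thesis using H H\<H> by (auto simp: simple_def)
qed

lemma sep_walls_empty:
  assumes "walls c d = {}" "c \<notin> \<Union>\<H>" "d \<notin> \<Union>\<H>" "x \<notin> \<Union>\<H>" "H \<in> \<H>"
  shows "sep H c x \<longleftrightarrow> sep H d x"
proof -
  have "\<not> sep H c d" using assms by (auto simp: walls_def)
  then show ?thesis using sep_trans[OF hyper[OF assms(5)], of c d x] assms by auto
qed

text \<open>As long as some hyperplane separates \<open>c\<close> from \<open>d\<close>, so does a
  simple one, and reflecting \<open>d\<close> in it lowers the number of separating hyperplanes by
  one.\<close>

lemma move_to_chamber:
  assumes c: "c \<notin> \<Union>\<H>" and d: "d \<notin> \<Union>\<H>"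
  shows "\<exists>w\<in>compositions (orth_reflection ` {H. simple c H}). walls c (w d) = {}"
  using d
proof (induction "card (walls c d)" arbitrary: d rule: less_induct)
  case less
  show ?case
  proof (cases "walls c d = {}")
    case True
    then show ?thesis by (intro bexI[of _ id]) (auto intro: compositions.id)
  next
    case False
    obtain H where H: "simple c H" "H \<in> walls c d" using simple_exists[OF c less(2) False] by blast
    have sW: "orth_reflection H \<in> W" using H(1) by (intro W_refl) (simp add: simple_def)
    have "card (walls c (orth_reflection H d)) < card (walls c d)"
      using card_walls_refl[OF H(1) c less(2) H(2)] by simp
    from less(1)[OF this generic_mono[OF less(2) sW]] obtain w where
      w: "w \<in> compositions (orth_reflection ` {H. simple c H})" "walls c (w (orth_reflection H d)) = {}" by blast
    have "w \<circ> orth_reflection H \<in> compositions (orth_reflection ` {H. simple c H})"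
      using H(1) by (intro compositions_comp w compositions_incl) blast
    then show ?thesis using w(2) by (intro bexI[of _ "w \<circ> orth_reflection H"]) auto
  qed
qed

lemma generic_flat_point:
  assumes M: "subspace M" and e: "e > 0"
    and G: "\<And>H. H \<in> \<G> \<Longrightarrow> H \<in> \<H> \<and> (\<exists>m\<in>M. x + m \<notin> H)"
  obtains u where "u \<in> M" "norm u < e" "\<And>H. H \<in> \<G> \<Longrightarrow> x + u \<notin> H"
proof -
  have "finite {H \<in> \<G>. H \<inter> cball x e \<noteq> {}}"
    by (rule finite_subset[OF _ loc_fin[of x e]]) (use G in blast)
  then obtain u where u: "u \<in> M" "norm u < e" "\<And>H. H \<in> {H \<in> \<G>. H \<inter> cball x e \<noteq> {}} \<Longrightarrow> x + u \<notin> H"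
    by (rule generic_point_flat[OF M]) (use G hyper e in auto)
  have "x + u \<notin> H" if "H \<in> \<G>" for H
    using u that by (cases "H \<inter> cball x e = {}") (auto simp: dist_norm)
  then show ?thesis using that u by blast
qed

text \<open>By local finiteness only finitely many of the closed sets come near \<open>x\<close>,
  and their union is closed.\<close>

lemma avoiding_ball:
  assumes "\<And>H. H \<in> \<G> \<Longrightarrow> H \<in> \<H> \<and> x \<notin> H"
  obtains e where "e > 0" "\<And>H. H \<in> \<G> \<Longrightarrow> H \<inter> ball x e = {}"
proof -
  let ?G = "{H \<in> \<G>. H \<inter> cball x 1 \<noteq> {}}"
  have fin: "finite ?G" by (rule finite_subset[OF _ loc_fin[of x 1]]) (use assms in blast)
  have "closed (\<Union>?G)" using assms by (intro closed_Union fin) (auto intro: affine_hyperplane_facts(1)[OF hyper])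
  then have "open (ball x 1 - \<Union>?G)" by (intro open_Diff) auto
  moreover have "x \<in> ball x 1 - \<Union>?G" using assms by auto
  ultimately obtain e where e: "e > 0" "ball x e \<subseteq> ball x 1 - \<Union>?G" by (meson openE)
  have "H \<inter> ball x e = {}" if "H \<in> \<G>" for H
  proof (rule ccontr)
    assume "H \<inter> ball x e \<noteq> {}"
    then obtain y where y: "y \<in> H" "y \<in> ball x e" by blast
    then have *: "y \<in> ball x 1" "y \<notin> \<Union>?G" using e by blast+
    have "y \<in> H \<inter> cball x 1" using *(1) y(1) by auto
    then show False using *(2) that y(1) by blast
  qed
  then show ?thesis using that e(1) by blast
qed

lemma ball_not_sep: "H \<inter> ball x e = {} \<Longrightarrow> y \<in> ball x e \<Longrightarrow> z \<in> ball x e \<Longrightarrow> \<not> sep H y z"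
  using closed_segment_subset[of y "ball x e" z] unfolding sep_def by fastforce

text \<open>A generic point of \<open>H\<close> has a neighbourhood met by no other hyperplane; a
  short step along the normal stays inside it, and so does its mirror image.\<close>

lemma adjacent_point:
  assumes H: "H \<in> \<H>"
  obtains d where "d \<notin> \<Union>\<H>" "walls d (orth_reflection H d) = {H}"
proof -
  obtain a b where ab: "a \<noteq> 0" "H = {x. a \<bullet> x = b}" using hyper[OF H] unfolding affine_hyperplane_def by blast
  obtain e0 where e0: "e0 \<in> H" using affine_hyperplane_facts(3)[OF hyper[OF H]] by blast
  define M where "M = {x. a \<bullet> x = 0}"
  have M: "subspace M" unfolding M_def by (rule subspace_hyperplane)
  have m: "\<exists>m\<in>M. e0 + m \<notin> K" if "K \<in> \<H> - {H}" for K
  proof (rule ccontr)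
    assume *: "\<not> ?thesis"
    have "H \<subseteq> K"
    proof
      fix x assume "x \<in> H"
      then have "x - e0 \<in> M" using e0 ab(2) by (simp add: M_def inner_diff_right)
      then show "x \<in> K" using * by (metis add.commute diff_add_cancel)
    qed
    then show False using hyperplane_subset_eq[OF hyper[OF H] hyper, of K] that by blast
  qed
  have G: "K \<in> \<H> \<and> (\<exists>m\<in>M. e0 + m \<notin> K)" if "K \<in> \<H> - {H}" for K using m[OF that] that by blast
  obtain u where u: "u \<in> M" "\<And>K. K \<in> \<H> - {H} \<Longrightarrow> e0 + u \<notin> K"
    by (rule generic_flat_point[OF M zero_less_one G]) blast+
  define e where "e = e0 + u"
  have eH: "a \<bullet> e = b" using e0 u(1) ab(2) by (simp add: e_def M_def inner_add_right)
  obtain \<epsilon> where \<epsilon>: "\<epsilon> > 0" "\<And>K. K \<in> \<H> - {H} \<Longrightarrow> K \<inter> ball e \<epsilon> = {}"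
    using avoiding_ball[of "\<H> - {H}" e] u(2) by (auto simp: e_def)
  define \<delta> where "\<delta> = \<epsilon> / (2 * norm a)"
  define d where "d = e + \<delta> *\<^sub>R a"
  have \<delta>: "\<delta> > 0" "\<delta> * norm a < \<epsilon>" using \<epsilon>(1) ab(1) by (auto simp: \<delta>_def)
  have dH: "d \<notin> H" using ab \<delta>(1) eH by (simp add: d_def inner_add_right)
  have d: "d \<in> ball e \<epsilon>" using \<delta> by (simp add: d_def dist_norm)
  have "orth_reflection H e = e" using orth_reflection_fix[OF hyper[OF H]] eH ab(2) by simp
  then have sd: "orth_reflection H d \<in> ball e \<epsilon>"
    using d aff_iso_dist[OF aff_iso_orth_reflection[OF hyper[OF H]], of e d] by simp
  have "d \<notin> \<Union>\<H>" using dH d \<epsilon>(2) by blast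
  moreover have "walls d (orth_reflection H d) = {H}"
  proof (intro equalityI subsetI)
    fix K assume "K \<in> walls d (orth_reflection H d)"
    then show "K \<in> {H}" using ball_not_sep[OF \<epsilon>(2) d sd, of K] by (auto simp: walls_def)
  next
    fix K assume "K \<in> {H}"
    moreover have "hval H d \<noteq> 0" using dH mem_hyperplane[OF hyper[OF H]] by simp
    then have "hval H d * hval H d > 0" by (metis not_real_square_gt_zero)
    then have "sep H d (orth_reflection H d)"
      by (simp add: sep_iff[OF hyper[OF H]] hval_orth_reflection[OF hyper[OF H]])
    ultimately show "K \<in> walls d (orth_reflection H d)" using H by (simp add: walls_def)
  qed
  ultimately show ?thesis using that by blast
qed

text \<open>Each reflection is conjugate to a simple one: a point next to \<open>H\<close> is moved
  into the chamber of \<open>c\<close> by simple reflections, and then the image of \<open>H\<close>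
  is a wall of that chamber.\<close>

lemma W_simple:
  assumes c: "c \<notin> \<Union>\<H>" and w: "w \<in> W"
  shows "w \<in> compositions (orth_reflection ` {H. simple c H})"
proof -
  let ?S = "orth_reflection ` {H. simple c H}"
  have SW: "compositions ?S \<subseteq> W"
  proof
    fix x assume "x \<in> compositions ?S"
    then show "x \<in> W" unfolding W_def by (rule compositions_mono) (auto simp: simple_def)
  qed
  have refl: "orth_reflection H \<in> compositions ?S" if H: "H \<in> \<H>" for H
  proof -
    obtain d where d: "d \<notin> \<Union>\<H>" "walls d (orth_reflection H d) = {H}" by (rule adjacent_point[OF H])
    obtain u where u: "u \<in> compositions ?S" "walls c (u d) = {}" using move_to_chamber[OF c d(1)] by (rule bexE)
    have uW: "u \<in> W" using SW u(1) by blast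
    have ud: "u d \<notin> \<Union>\<H>" using generic_mono[OF d(1) uW] .
    have "\<exists>v\<in>compositions ?S. v \<circ> u = id \<and> u \<circ> v = id"
    proof (rule compositions_inverse[OF _ u(1)])
      fix s assume "s \<in> ?S"
      then obtain H where "s = orth_reflection H" "H \<in> \<H>" by (auto simp only: simple_def)
      then show "s \<circ> s = id" using refl_involution by (simp only:)
    qed
    then obtain v where v: "v \<in> compositions ?S" "v \<circ> u = id" "u \<circ> v = id" by blast
    have vW: "v \<in> W" using SW v(1) by blast
    define K where "K = u ` H"
    have K: "K \<in> \<H>" unfolding K_def by (rule W_stable[OF uW H])
    let ?s = "orth_reflection K"
    have sK: "?s (u x) = u (orth_reflection H x)" for x unfolding K_def by (rule refl_conj[OF uW H])
    have sW: "?s \<in> W" by (rule W_refl[OF K])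
    \<comment> \<open>As \<open>c\<close> and \<open>u d\<close> lie in one chamber, so do their
      images under \<open>?s\<close>; the question can be asked for \<open>u d\<close> and carried
      back to \<open>d\<close> and \<open>H\<close>.\<close>
    have "K' \<in> walls c (?s c) \<longleftrightarrow> K' = K" for K'
    proof (cases "K' \<in> \<H>")
      case True
      have "sep K' c (?s c) \<longleftrightarrow> sep K' (u d) (?s c)"
        using sep_walls_empty[OF u(2) c ud generic_mono[OF c sW] True] .
      also have "\<dots> \<longleftrightarrow> sep (?s ` K') c (?s (u d))"
        using sep_W[OF sW, of K' "u d" "?s c"] by (simp add: orth_reflection_involution hyper[OF K] sep_commute)
      also have "\<dots> \<longleftrightarrow> sep (?s ` K') (u d) (?s (u d))"
        using sep_walls_empty[OF u(2) c ud generic_mono[OF ud sW] stable[OF K True]] .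
      also have "\<dots> \<longleftrightarrow> sep K' (u d) (?s (u d))"
        using sep_W[OF sW, of K' "u d" "?s (u d)"] by (simp add: orth_reflection_involution hyper[OF K] sep_commute)
      also have "\<dots> \<longleftrightarrow> sep (v ` K') d (orth_reflection H d)"
        using sep_W[OF uW, of "v ` K'" d "orth_reflection H d"] v(3) by (simp add: sK image_comp)
      also have "\<dots> \<longleftrightarrow> v ` K' = H"
      proof -
        have "v ` K' \<in> walls d (orth_reflection H d) \<longleftrightarrow> v ` K' = H" using d(2) by simp
        then show ?thesis using W_stable[OF vW True] by (simp add: walls_def)
      qed
      also have "\<dots> \<longleftrightarrow> K' = K"
      proof
        assume "v ` K' = H"
        then have "u ` (v ` K') = K" by (simp add: K_def)
        then show "K' = K" using v(3) by (simp add: image_comp)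
      next
        assume "K' = K"
        then show "v ` K' = H" using v(2) by (simp add: K_def image_comp)
      qed
      finally show ?thesis using True by (simp add: walls_def)
    qed (use K in \<open>auto simp: walls_def\<close>)
    then have "simple c K" using K by (auto simp: simple_def)
    then have "?s \<in> compositions ?S" by (intro compositions_incl) blast
    then have "v \<circ> (?s \<circ> u) \<in> compositions ?S" using u(1) v(1) by (intro compositions_comp)
    moreover have "v \<circ> (?s \<circ> u) = orth_reflection H"
      using v(2) by (auto simp: fun_eq_iff sK)
    ultimately show ?thesis by simp
  qed
  show ?thesis using w unfolding W_def
  proof induction
    case (comp s w)
    then obtain H where "H \<in> \<H>" "s = orth_reflection H" by blast
    then show ?case using refl compositions_comp comp(3) by blast
  qed (rule compositions.id)
qed

section \<open>Words, exchange and length\<close>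

inductive word :: "'a \<Rightarrow> nat \<Rightarrow> ('a \<Rightarrow> 'a) \<Rightarrow> bool" for c where
  Nil: "word c 0 id"
| Cons: "simple c K \<Longrightarrow> word c n w \<Longrightarrow> word c (Suc n) (orth_reflection K \<circ> w)"

lemma word_W: "word c n w \<Longrightarrow> w \<in> W"
proof (induction rule: word.induct)
  case (Cons K n w)
  then show ?case by (intro W_comp W_refl) (simp_all only: simple_def)
qed (rule W_id)

text \<open>The hyperplane \<open>H\<close> is crossed at one letter of the word, and composing with
  its reflection deletes that letter. Passing behind the first letter replaces \<open>H\<close> by
  its mirror image, on which the induction works.\<close>

lemma word_exchange:
  assumes "word c n w" "c \<notin> \<Union>\<H>" "H \<in> walls c (w c)"
  shows "\<exists>m. n = Suc m \<and> word c m (orth_reflection H \<circ> w)"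
  using assms(1,3)
proof (induction arbitrary: H)
  case Nil
  then show ?case by (auto simp: walls_def sep_def)
next
  case (Cons K n w)
  have K: "K \<in> \<H>" using Cons(1) by (simp add: simple_def)
  have H: "H \<in> \<H>" using Cons(4) by (simp add: walls_def)
  have wc: "w c \<notin> \<Union>\<H>" using generic_mono[OF assms(2) word_W[OF Cons(2)]] .
  show ?case
  proof (cases "H = K")
    case True
    then have "orth_reflection H \<circ> (orth_reflection K \<circ> w) = w"
      by (simp add: o_assoc refl_involution[OF K])
    then show ?thesis using Cons(2) by metis
  next
    case False
    let ?s = "orth_reflection K"
    have "?s ` H \<in> walls c (w c)"
      using walls_refl[OF Cons(1) assms(2) wc H] Cons(4) False by simp
    then obtain m where m: "n = Suc m" "word c m (orth_reflection (?s ` H) \<circ> w)" using Cons(3) by blast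
    have "?s \<circ> (orth_reflection (?s ` H) \<circ> w) = orth_reflection H \<circ> (?s \<circ> w)"
    proof
      fix x
      have "orth_reflection (?s ` H) (?s (?s (w x))) = ?s (orth_reflection H (?s (w x)))"
        by (rule refl_conj[OF W_refl[OF K] H])
      then show "(?s \<circ> (orth_reflection (?s ` H) \<circ> w)) x = (orth_reflection H \<circ> (?s \<circ> w)) x"
        by (simp add: orth_reflection_involution hyper[OF K])
    qed
    then show ?thesis using word.Cons[OF Cons(1) m(2)] m(1) by metis
  qed
qed

text \<open>A new letter whose hyperplane already separates \<open>c\<close> from \<open>w c\<close>
  is cancelled by exchange, and any other letter adds one separating hyperplane.\<close>

lemma word_reduced:
  assumes "word c n w" "c \<notin> \<Union>\<H>" shows "word c (card (walls c (w c))) w"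
  using assms(1)
proof induction
  case Nil
  have "walls c (id c) = {}" by (auto simp: walls_def sep_def)
  then show ?case by (metis card.empty word.Nil)
next
  case (Cons K n w)
  have K: "K \<in> \<H>" using Cons(1) by (simp add: simple_def)
  let ?s = "orth_reflection K"
  have wc: "w c \<notin> \<Union>\<H>" using generic_mono[OF assms(2) word_W[OF Cons(2)]] .
  show ?case
  proof (cases "K \<in> walls c (w c)")
    case True
    then obtain m where m: "card (walls c (w c)) = Suc m" "word c m (?s \<circ> w)"
      using word_exchange[OF Cons(3) assms(2)] by blast
    moreover have "card (walls c ((?s \<circ> w) c)) = m"
      using card_walls_refl[OF Cons(1) assms(2) wc True] m(1) by simp
    ultimately show ?thesis by metis
  next
    case False
    have "K \<in> walls c (?s (w c))" using walls_refl[OF Cons(1) assms(2) wc K] False by simp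
    from card_walls_refl[OF Cons(1) assms(2) generic_mono[OF wc W_refl[OF K]] this]
    have "card (walls c (?s (w c))) = Suc (card (walls c (w c)))"
      by (simp add: orth_reflection_involution hyper[OF K])
    then have "card (walls c ((?s \<circ> w) c)) = Suc (card (walls c (w c)))" by simp
    then show ?thesis using word.Cons[OF Cons(1,3)] by metis
  qed
qed

text \<open>The action on chambers is free: with no separating hyperplane the reduced word is
  empty.\<close>

lemma walls_empty_imp_id:
  assumes "w \<in> W" "c \<notin> \<Union>\<H>" "walls c (w c) = {}" shows "w = id"
proof -
  have "\<exists>n. word c n w" using W_simple[OF assms(2,1)]
  proof induction
    case (comp s w)
    then show ?case using word.Cons by blast
  qed (use word.Nil in blast)
  then have "word c 0 w" using word_reduced[of c _ w] assms(2,3) by fastforce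
  then show ?thesis by cases auto
qed

section \<open>Stabilizers are generated by reflections\<close>

lemma compositions_fix:
  "w \<in> compositions (orth_reflection ` {H \<in> \<H>. x \<in> H}) \<Longrightarrow> w x = x"
  by (induction rule: compositions.induct) (auto simp: orth_reflection_fix[OF hyper])

text \<open>Both \<open>x\<close> and \<open>w x\<close> lie in the closed chamber of
  \<open>c\<close>. If a simple \<open>H\<close> separates \<open>c\<close> from \<open>w c\<close>,
  then \<open>w x\<close>, being separated from neither, lies on \<open>H\<close>; reflecting in
  \<open>H\<close> shortens \<open>w\<close> and leaves \<open>w x\<close> where it is.\<close>

lemma chamber_stabilizer:
  assumes c: "c \<notin> \<Union>\<H>" and w: "w \<in> W"
    and x: "\<And>H. H \<in> \<H> \<Longrightarrow> \<not> sep H c x" "\<And>H. H \<in> \<H> \<Longrightarrow> \<not> sep H c (w x)"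
  shows "w \<in> compositions (orth_reflection ` {H \<in> \<H>. x \<in> H})"
  using w x(2)
proof (induction "card (walls c (w c))" arbitrary: w rule: less_induct)
  case less
  show ?case
  proof (cases "walls c (w c) = {}")
    case True
    then show ?thesis using walls_empty_imp_id[OF less(2) c] compositions.id by blast
  next
    case False
    have wc: "w c \<notin> \<Union>\<H>" using generic_mono[OF c less(2)] .
    obtain H where H: "simple c H" "H \<in> walls c (w c)" using simple_exists[OF c wc False] by blast
    then have H\<H>: "H \<in> \<H>" and s: "sep H c (w c)" by (auto simp: simple_def walls_def)
    let ?s = "orth_reflection H"
    obtain v where v: "v \<in> W" "v \<circ> w = id" "w \<circ> v = id" using W_inverse[OF less(2)] by blast
    have "\<not> sep H (w c) (w x)"
      using x(1)[OF W_stable[OF v(1) H\<H>]] sep_W[OF less(2), of "v ` H" c x] v(3) by (simp add: image_comp)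
    then have wxH: "w x \<in> H"
      using sep_trans[OF hyper[OF H\<H>], of c "w x" "w c"] s less(3)[OF H\<H>] c wc H\<H> by (auto simp: sep_commute)
    then have sx: "?s (w x) = w x" using orth_reflection_fix[OF hyper[OF H\<H>]] by simp
    have "card (walls c ((?s \<circ> w) c)) < card (walls c (w c))" using card_walls_refl[OF H(1) c wc H(2)] by simp
    moreover have sw: "?s \<circ> w \<in> W" by (rule W_comp[OF W_refl[OF H\<H>] less(2)])
    ultimately have 1: "?s \<circ> w \<in> compositions (orth_reflection ` {H \<in> \<H>. x \<in> H})"
      using less(1)[of "?s \<circ> w"] less(3) sx by simp
    then have "w x = x" using compositions_fix[OF 1] sx by simp
    then have "?s \<in> orth_reflection ` {H \<in> \<H>. x \<in> H}" using wxH H\<H> by auto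
    from compositions.comp[OF this 1] show ?thesis
      by (simp add: o_assoc refl_involution[OF H\<H>])
  qed
qed

text \<open>Two points separated by no hyperplane lie in a common closed chamber, that of a generic
  point near their midpoint. The hypothesis is weaker than \<open>w x = x\<close> on purpose: the
  descent in \<open>F_generated\<close> knows only that nothing separates a point from its
  image.\<close>

theorem stabilizer_generated:
  assumes w: "w \<in> W" and x: "\<And>H. H \<in> \<H> \<Longrightarrow> \<not> sep H x (w x)"
  shows "w \<in> compositions (orth_reflection ` {H \<in> \<H>. x \<in> H})"
proof -
  define m where "m = (1/2) *\<^sub>R x + (1/2) *\<^sub>R w x"
  have hm: "hval H m = 1/2 * hval H x + 1/2 * hval H (w x)" if "H \<in> \<H>" for H
    unfolding m_def using hval_affine[OF hyper[OF that], of "1/2" "1/2"] by simp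
  obtain e where e: "e > 0" "\<And>H. H \<in> {H \<in> \<H>. m \<notin> H} \<Longrightarrow> H \<inter> ball m e = {}"
    by (rule avoiding_ball[of "{H \<in> \<H>. m \<notin> H}" m]) auto
  have "\<exists>v\<in>UNIV. m + v \<notin> H" if "H \<in> \<H>" for H
  proof -
    have "affine_hyperplane H" using that by (rule hyper)
    then obtain a b where ab: "a \<noteq> 0" "H = {x. a \<bullet> x = b}" unfolding affine_hyperplane_def by blast
    have "m + a \<notin> H \<or> m \<notin> H" using ab by (auto simp: inner_add_right)
    then show ?thesis by (metis UNIV_I add.right_neutral)
  qed
  then have G: "H \<in> \<H> \<and> (\<exists>v\<in>UNIV. m + v \<notin> H)" if "H \<in> \<H>" for H using that by blast
  obtain u where u: "norm u < e" "\<And>H. H \<in> \<H> \<Longrightarrow> m + u \<notin> H"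
    by (rule generic_flat_point[OF subspace_UNIV e(1) G]) blast+
  define c where "c = m + u"
  have c: "c \<notin> \<Union>\<H>" "c \<in> ball m e" using u by (auto simp: c_def dist_norm)
  \<comment> \<open>A hyperplane through the midpoint contains both points, because it does not
    separate them; any other one has \<open>c\<close> and \<open>m\<close> on the same side.\<close>
  have "\<not> sep H c x \<and> \<not> sep H c (w x)" if H: "H \<in> \<H>" for H
  proof (cases "m \<in> H")
    case True
    then have "hval H x = - hval H (w x)" using hm[OF H] mem_hyperplane[OF hyper[OF H]] by simp
    then have "hval H x = 0" "hval H (w x) = 0"
      using x[OF H] sep_iff[OF hyper[OF H]] by (auto simp: mult_less_0_iff)
    then show ?thesis by (simp add: sep_iff[OF hyper[OF H]])
  next
    case False
    have "\<not> sep H c m" using ball_not_sep[OF e(2), of H c m] H False c(2) e(1) by auto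
    moreover have "hval H c \<noteq> 0" "hval H m \<noteq> 0"
      using c(1) H False mem_hyperplane[OF hyper[OF H]] by auto
    ultimately show ?thesis
      using x[OF H] hm[OF H] by (auto simp: sep_iff[OF hyper[OF H]] mult_less_0_iff not_less)
  qed
  then show ?thesis by (intro chamber_stabilizer[OF c(1) w]) auto
qed

end

section \<open>Germs of functions and normality of smooth points\<close>

text \<open>What the local ring asks of a sheaf of functions. Functions are total, so
  \<open>F_cong\<close> records that only the values on \<open>U\<close> count.\<close>

locale germ_ring =
  fixes X :: "'p topology" and F :: "'p set \<Rightarrow> ('p \<Rightarrow> complex) set" and p :: 'p
  assumes p: "p \<in> topspace X"
    and F_const: "openin X U \<Longrightarrow> (\<lambda>x. c) \<in> F U"
    and F_add: "f \<in> F U \<Longrightarrow> g \<in> F U \<Longrightarrow> (\<lambda>x. f x + g x) \<in> F U"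
    and F_mult: "f \<in> F U \<Longrightarrow> g \<in> F U \<Longrightarrow> (\<lambda>x. f x * g x) \<in> F U"
    and F_restrict: "f \<in> F U \<Longrightarrow> openin X V \<Longrightarrow> V \<subseteq> U \<Longrightarrow> f \<in> F V"
    and F_cong: "f \<in> F U \<Longrightarrow> openin X U \<Longrightarrow> (\<And>x. x \<in> U \<Longrightarrow> f x = g x) \<Longrightarrow> g \<in> F U"
begin

abbreviation R where "R \<equiv> near_ring X F p"
abbreviation I where "I \<equiv> vanishing_near X p"
abbreviation Q where "Q \<equiv> local_ring X F p"

lemma R_simps [simp]:
  "\<one>\<^bsub>R\<^esub> = (\<lambda>x. 1)" "\<zero>\<^bsub>R\<^esub> = (\<lambda>x. 0)" "f \<otimes>\<^bsub>R\<^esub> g = (\<lambda>x. f x * g x)" "f \<oplus>\<^bsub>R\<^esub> g = (\<lambda>x. f x + g x)"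
  by (auto simp: near_ring_def)

lemma R_carrier: "f \<in> carrier R \<longleftrightarrow> (\<exists>U. openin X U \<and> p \<in> U \<and> f \<in> F U)"
  by (auto simp: near_ring_def)

lemma common_nhd:
  assumes "finite S" "S \<subseteq> carrier R"
  shows "\<exists>U. openin X U \<and> p \<in> U \<and> S \<subseteq> F U"
  using assms
proof (induction S rule: finite_induct)
  case empty
  then show ?case using p by (intro exI[of _ "topspace X"]) auto
next
  case (insert f S)
  then obtain U V where "openin X U" "p \<in> U" "S \<subseteq> F U" "openin X V" "p \<in> V" "f \<in> F V"
    by (auto simp: R_carrier)
  then show ?case by (intro exI[of _ "U \<inter> V"]) (auto intro: F_restrict)
qed

lemma R_closed:
  assumes "f \<in> carrier R" "g \<in> carrier R"
  shows "(\<lambda>x. f x + g x) \<in> carrier R" "(\<lambda>x. f x * g x) \<in> carrier R"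
proof -
  obtain U where U: "openin X U" "p \<in> U" "f \<in> F U" "g \<in> F U" using common_nhd[of "{f, g}"] assms by auto
  show "(\<lambda>x. f x + g x) \<in> carrier R"
    unfolding R_carrier using U(1,2) F_add[OF U(3,4)] by (intro exI[of _ U]) simp
  show "(\<lambda>x. f x * g x) \<in> carrier R"
    unfolding R_carrier using U(1,2) F_mult[OF U(3,4)] by (intro exI[of _ U]) simp
qed

lemma R_const: "(\<lambda>x. c) \<in> carrier R"
  unfolding R_carrier using p F_const[OF openin_topspace] by blast

lemma R_uminus: "f \<in> carrier R \<Longrightarrow> (\<lambda>x. - f x) \<in> carrier R"
  using R_closed(2)[OF R_const[of "-1"], of f] by simp

lemma cring_R: "cring R"
proof (rule cringI)
  show "abelian_group R"
  proof (rule abelian_groupI)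
    fix f assume "f \<in> carrier R"
    then show "\<exists>g\<in>carrier R. g \<oplus>\<^bsub>R\<^esub> f = \<zero>\<^bsub>R\<^esub>"
      using R_uminus by (intro bexI[of _ "\<lambda>x. - f x"]) auto
  qed (use R_closed R_const in \<open>auto simp: algebra_simps\<close>)
  show "comm_monoid R"
    by (rule comm_monoidI) (use R_closed R_const in \<open>auto simp: algebra_simps\<close>)
qed (auto simp: algebra_simps)

lemma vanishing_nhd: "f \<in> I \<longleftrightarrow> (\<exists>U. openin X U \<and> p \<in> U \<and> (\<forall>x\<in>U. f x = 0))"
  by (auto simp: vanishing_near_def)

lemma I_subset: "I \<subseteq> carrier R"
proof
  fix f assume "f \<in> I"
  then obtain U where U: "openin X U" "p \<in> U" "\<forall>x\<in>U. f x = 0" by (auto simp: vanishing_nhd)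
  then have "f \<in> F U" using F_cong[OF F_const[of U 0]] by auto
  then show "f \<in> carrier R" using U by (auto simp: R_carrier)
qed

lemma I_mult: "f \<in> I \<Longrightarrow> (\<lambda>x. f x * g x) \<in> I" "f \<in> I \<Longrightarrow> (\<lambda>x. g x * f x) \<in> I"
  unfolding vanishing_nhd by (metis mult_zero_left, metis mult_zero_right)

lemma I_add: assumes "f \<in> I" "g \<in> I" shows "(\<lambda>x. f x + g x) \<in> I"
proof -
  obtain U V where "openin X U" "p \<in> U" "\<forall>x\<in>U. f x = 0" "openin X V" "p \<in> V" "\<forall>x\<in>V. g x = 0"
    using assms by (auto simp: vanishing_nhd)
  then show ?thesis unfolding vanishing_nhd by (intro exI[of _ "U \<inter> V"]) auto
qed

lemma a_minus_R: "f \<in> carrier R \<Longrightarrow> \<ominus>\<^bsub>R\<^esub> f = (\<lambda>x. - f x)"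
proof -
  interpret cring R by (rule cring_R)
  assume f: "f \<in> carrier R"
  show ?thesis by (rule minus_equality) (use f R_uminus[OF f] in auto)
qed

lemma ideal_I: "ideal I R"
proof (rule idealI)
  interpret cring R by (rule cring_R)
  show "ring R" by (rule ring_axioms)
  show "subgroup I (add_monoid R)"
  proof (rule add.subgroupI)
    have "(\<lambda>x. 0) \<in> I" using openin_topspace p by (auto simp: vanishing_nhd)
    then show "I \<noteq> {}" by blast
    show "\<ominus>\<^bsub>R\<^esub> f \<in> I" if "f \<in> I" for f
      using a_minus_R[of f] that I_subset I_mult(2)[OF that, of "\<lambda>x. -1"] by auto
  qed (use I_subset I_add in auto)
qed (auto intro: I_mult)

lemma ring_hom_Q: "ring_hom_cring R Q ((+>\<^bsub>R\<^esub>) I)"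
  unfolding local_ring_def by (rule ideal.rcos_ring_hom_cring[OF ideal_I cring_R])

lemma coset_zero_iff: assumes f: "f \<in> carrier R" shows "I +>\<^bsub>R\<^esub> f = \<zero>\<^bsub>Q\<^esub> \<longleftrightarrow> f \<in> I"
proof -
  interpret i: ideal I R by (rule ideal_I)
  have z: "\<zero>\<^bsub>Q\<^esub> = I" by (simp add: local_ring_def FactRing_def)
  show ?thesis
    unfolding z using i.a_rcos_self[OF f] i.a_rcos_const by metis
qed

lemma carrier_Q: "A \<in> carrier Q \<longleftrightarrow> (\<exists>f\<in>carrier R. A = I +>\<^bsub>R\<^esub> f)"
  by (auto simp: local_ring_def FactRing_def A_RCOSETS_def')

lemma coset_eq_iff:
  assumes f: "f \<in> carrier R" and g: "g \<in> carrier R"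
  shows "I +>\<^bsub>R\<^esub> f = I +>\<^bsub>R\<^esub> g \<longleftrightarrow> (\<lambda>x. f x - g x) \<in> I"
proof -
  interpret i: ideal I R by (rule ideal_I)
  have d: "(\<lambda>x. f x - g x) = f \<ominus>\<^bsub>R\<^esub> g" using g by (simp add: a_minus_def a_minus_R)
  have "f \<in> I +>\<^bsub>R\<^esub> g \<longleftrightarrow> f \<ominus>\<^bsub>R\<^esub> g \<in> I"
    unfolding a_minus_def by (rule i.a_rcos_module[OF g f])
  moreover have "I +>\<^bsub>R\<^esub> f = I +>\<^bsub>R\<^esub> g \<longleftrightarrow> f \<in> I +>\<^bsub>R\<^esub> g"
    using i.a_rcos_self[OF f] i.a_repr_independence'[of f g] g by metis
  ultimately show ?thesis by (simp only: d)
qed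

lemma coset_pow:
  assumes "a \<in> carrier R" shows "I +>\<^bsub>R\<^esub> (a [^]\<^bsub>R\<^esub> (n::nat)) = (I +>\<^bsub>R\<^esub> a) [^]\<^bsub>Q\<^esub> n"
proof -
  interpret h: ring_hom_cring R Q "(+>\<^bsub>R\<^esub>) I" by (rule ring_hom_Q)
  show ?thesis
  proof (induction n)
    case (Suc n)
    have "I +>\<^bsub>R\<^esub> (a [^]\<^bsub>R\<^esub> n \<otimes>\<^bsub>R\<^esub> a) = (I +>\<^bsub>R\<^esub> a [^]\<^bsub>R\<^esub> n) \<otimes>\<^bsub>Q\<^esub> (I +>\<^bsub>R\<^esub> a)"
      using assms by (intro h.hom_mult h.R.nat_pow_closed)
    then show ?case using Suc by (simp only: h.R.nat_pow_Suc h.S.nat_pow_Suc)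
  next
    case 0
    show ?case using h.hom_one by (simp only: h.R.nat_pow_0 h.S.nat_pow_0)
  qed
qed

lemma R_pow: "f \<in> carrier R \<Longrightarrow> f [^]\<^bsub>R\<^esub> (n::nat) = (\<lambda>x. f x ^ n)"
proof (induction n)
  case 0
  interpret cring R by (rule cring_R)
  show ?case by simp
next
  case (Suc n)
  interpret cring R by (rule cring_R)
  show ?case using Suc by (simp add: mult.commute)
qed

lemma R_finsum: "(\<And>i. i < n \<Longrightarrow> f i \<in> carrier R) \<Longrightarrow> finsum R f {..<n::nat} = (\<lambda>x. \<Sum>i<n. f i x)"
proof (induction n)
  case 0
  interpret cring R by (rule cring_R)
  show ?case by simp
next
  case (Suc n)
  interpret cring R by (rule cring_R)
  have "finsum R f (insert n {..<n}) = f n \<oplus>\<^bsub>R\<^esub> finsum R f {..<n}"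
    using Suc by (intro finsum_insert) auto
  then show ?case using Suc by (simp add: lessThan_Suc add.commute)
qed

text \<open>Passing to germs is a ring homomorphism, so an equation in the local ring is an identity
  of functions up to one that vanishes near \<open>p\<close>. All work on normality is thereby done
  with functions instead of cosets.\<close>

lemma integral_equation:
  assumes a: "a \<in> carrier R" and b: "b \<in> carrier R" and c: "\<And>i. i < n \<Longrightarrow> c i \<in> carrier R"
  shows "(I +>\<^bsub>R\<^esub> a) [^]\<^bsub>Q\<^esub> n \<oplus>\<^bsub>Q\<^esub> (\<Oplus>\<^bsub>Q\<^esub>i\<in>{..<n}. (I +>\<^bsub>R\<^esub> c i) \<otimes>\<^bsub>Q\<^esub> (I +>\<^bsub>R\<^esub> a) [^]\<^bsub>Q\<^esub> i \<otimes>\<^bsub>Q\<^esub> (I +>\<^bsub>R\<^esub> b) [^]\<^bsub>Q\<^esub> (n - i)) = \<zero>\<^bsub>Q\<^esub>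
    \<longleftrightarrow> (\<lambda>x. a x ^ n + (\<Sum>i<n. c i x * a x ^ i * b x ^ (n - i))) \<in> I"
proof -
  interpret h: ring_hom_cring R Q "(+>\<^bsub>R\<^esub>) I" by (rule ring_hom_Q)
  define g where "g = (\<lambda>i. c i \<otimes>\<^bsub>R\<^esub> a [^]\<^bsub>R\<^esub> i \<otimes>\<^bsub>R\<^esub> b [^]\<^bsub>R\<^esub> (n - i))"
  have g: "g i \<in> carrier R" if "i < n" for i
    unfolding g_def using a b c[OF that] by (intro h.R.m_closed h.R.nat_pow_closed)
  have hg: "(I +>\<^bsub>R\<^esub> c i) \<otimes>\<^bsub>Q\<^esub> (I +>\<^bsub>R\<^esub> a) [^]\<^bsub>Q\<^esub> i \<otimes>\<^bsub>Q\<^esub> (I +>\<^bsub>R\<^esub> b) [^]\<^bsub>Q\<^esub> (n - i) = I +>\<^bsub>R\<^esub> g i" if "i < n" for i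
    unfolding g_def using a b c[OF that] by (simp only: h.hom_mult coset_pow h.R.m_closed h.R.nat_pow_closed)
  have "(\<Oplus>\<^bsub>Q\<^esub>i\<in>{..<n}. (I +>\<^bsub>R\<^esub> c i) \<otimes>\<^bsub>Q\<^esub> (I +>\<^bsub>R\<^esub> a) [^]\<^bsub>Q\<^esub> i \<otimes>\<^bsub>Q\<^esub> (I +>\<^bsub>R\<^esub> b) [^]\<^bsub>Q\<^esub> (n - i)) =
      (\<Oplus>\<^bsub>Q\<^esub>i\<in>{..<n}. I +>\<^bsub>R\<^esub> g i)"
    by (rule h.S.finsum_cong') (use g hg h.hom_closed in auto)
  also have "\<dots> = I +>\<^bsub>R\<^esub> finsum R g {..<n}"
    using h.hom_finsum[of g "{..<n}"] g by (simp add: o_def Pi_def)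
  finally have S: "(\<Oplus>\<^bsub>Q\<^esub>i\<in>{..<n}. (I +>\<^bsub>R\<^esub> c i) \<otimes>\<^bsub>Q\<^esub> (I +>\<^bsub>R\<^esub> a) [^]\<^bsub>Q\<^esub> i \<otimes>\<^bsub>Q\<^esub> (I +>\<^bsub>R\<^esub> b) [^]\<^bsub>Q\<^esub> (n - i)) =
      I +>\<^bsub>R\<^esub> finsum R g {..<n}" .
  have pa: "a [^]\<^bsub>R\<^esub> n \<in> carrier R" using a by (rule h.R.nat_pow_closed)
  have fs: "finsum R g {..<n} \<in> carrier R" using g by (intro h.R.finsum_closed) auto
  have "(I +>\<^bsub>R\<^esub> a) [^]\<^bsub>Q\<^esub> n \<oplus>\<^bsub>Q\<^esub> (\<Oplus>\<^bsub>Q\<^esub>i\<in>{..<n}. (I +>\<^bsub>R\<^esub> c i) \<otimes>\<^bsub>Q\<^esub> (I +>\<^bsub>R\<^esub> a) [^]\<^bsub>Q\<^esub> i \<otimes>\<^bsub>Q\<^esub> (I +>\<^bsub>R\<^esub> b) [^]\<^bsub>Q\<^esub> (n - i)) =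
      I +>\<^bsub>R\<^esub> (a [^]\<^bsub>R\<^esub> n \<oplus>\<^bsub>R\<^esub> finsum R g {..<n})"
    unfolding S coset_pow[OF a, of n, symmetric] using h.hom_add[OF pa fs] by (rule sym)
  moreover have "a [^]\<^bsub>R\<^esub> n \<oplus>\<^bsub>R\<^esub> finsum R g {..<n} \<in> carrier R"
    using a g by (intro h.R.a_closed h.R.nat_pow_closed h.R.finsum_closed) auto
  moreover have "a [^]\<^bsub>R\<^esub> n \<oplus>\<^bsub>R\<^esub> finsum R g {..<n} = (\<lambda>x. a x ^ n + (\<Sum>i<n. c i x * a x ^ i * b x ^ (n - i)))"
    using R_finsum[of n g] g a b by (simp add: R_pow g_def)
  ultimately show ?thesis using coset_zero_iff[of "a [^]\<^bsub>R\<^esub> n \<oplus>\<^bsub>R\<^esub> finsum R g {..<n}"] by (simp only:)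
qed

lemma integrally_closedD:
  assumes ic: "integrally_closed_domain Q" and a: "a \<in> carrier R" and b: "b \<in> carrier R" "b \<notin> I"
    and c: "\<And>i. i < n \<Longrightarrow> c i \<in> carrier R"
    and eq: "(\<lambda>x. a x ^ n + (\<Sum>i<n. c i x * a x ^ i * b x ^ (n - i))) \<in> I"
  shows "\<exists>r\<in>carrier R. (\<lambda>x. a x - r x * b x) \<in> I"
proof -
  interpret h: ring_hom_cring R Q "(+>\<^bsub>R\<^esub>) I" by (rule ring_hom_Q)
  have "integral_fraction Q (I +>\<^bsub>R\<^esub> a) (I +>\<^bsub>R\<^esub> b)"
    unfolding integral_fraction_def
    using eq h.hom_closed c
    by (intro exI[of _ n] exI[of _ "\<lambda>i. I +>\<^bsub>R\<^esub> c i"] conjI) (simp_all add: integral_equation[OF a b(1) c])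
  moreover have "I +>\<^bsub>R\<^esub> b \<in> carrier Q - {\<zero>\<^bsub>Q\<^esub>}" using b coset_zero_iff h.hom_closed by auto
  ultimately obtain r' where r': "r' \<in> carrier Q" "I +>\<^bsub>R\<^esub> a = r' \<otimes>\<^bsub>Q\<^esub> (I +>\<^bsub>R\<^esub> b)"
    using ic h.hom_closed[OF a] unfolding integrally_closed_domain_def by blast
  then obtain r where r: "r \<in> carrier R" "r' = I +>\<^bsub>R\<^esub> r" by (auto simp: carrier_Q)
  have "I +>\<^bsub>R\<^esub> a = I +>\<^bsub>R\<^esub> (\<lambda>x. r x * b x)"
    using r' r b h.hom_mult[OF r(1) b(1)] by simp
  then show ?thesis using coset_eq_iff[OF a R_closed(2)[OF r(1) b(1)]] r(1) by blast
qed

lemma integrally_closedI: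
  assumes dom: "\<And>f g. f \<in> carrier R \<Longrightarrow> g \<in> carrier R \<Longrightarrow> (\<lambda>x. f x * g x) \<in> I \<Longrightarrow> f \<in> I \<or> g \<in> I"
    and int: "\<And>a b n c. a \<in> carrier R \<Longrightarrow> b \<in> carrier R \<Longrightarrow> b \<notin> I \<Longrightarrow> (\<And>i. i < n \<Longrightarrow> c i \<in> carrier R) \<Longrightarrow>
      (\<lambda>x. a x ^ n + (\<Sum>i<n. c i x * a x ^ i * b x ^ (n - i))) \<in> I \<Longrightarrow>
      \<exists>r\<in>carrier R. (\<lambda>x. a x - r x * b x) \<in> I"
  shows "integrally_closed_domain Q"
  unfolding integrally_closed_domain_def
proof (intro conjI ballI impI)
  interpret h: ring_hom_cring R Q "(+>\<^bsub>R\<^esub>) I" by (rule ring_hom_Q)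
  show "domain Q"
  proof (rule domain.intro[OF h.S.is_cring domain_axioms.intro])
    have "(\<lambda>x. 1) \<notin> I" by (auto simp: vanishing_nhd)
    then show "\<one>\<^bsub>Q\<^esub> \<noteq> \<zero>\<^bsub>Q\<^esub>" using coset_zero_iff[OF R_const[of 1]] h.hom_one by simp
    fix A B assume AB: "A \<otimes>\<^bsub>Q\<^esub> B = \<zero>\<^bsub>Q\<^esub>" "A \<in> carrier Q" "B \<in> carrier Q"
    then obtain f g where fg: "f \<in> carrier R" "A = I +>\<^bsub>R\<^esub> f" "g \<in> carrier R" "B = I +>\<^bsub>R\<^esub> g"
      by (auto simp: carrier_Q)
    have "(\<lambda>x. f x * g x) \<in> I"
      using AB(1) fg h.hom_mult[OF fg(1,3)] coset_zero_iff[OF R_closed(2)[OF fg(1,3)]] by simp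
    then show "A = \<zero>\<^bsub>Q\<^esub> \<or> B = \<zero>\<^bsub>Q\<^esub>" using dom[OF fg(1,3)] fg coset_zero_iff by blast
  qed
  fix A B assume A: "A \<in> carrier Q" and B: "B \<in> carrier Q - {\<zero>\<^bsub>Q\<^esub>}" and i: "integral_fraction Q A B"
  obtain a b where ab: "a \<in> carrier R" "A = I +>\<^bsub>R\<^esub> a" "b \<in> carrier R" "B = I +>\<^bsub>R\<^esub> b"
    using A B by (auto simp: carrier_Q)
  have bI: "b \<notin> I" using B ab coset_zero_iff by auto
  obtain n :: nat and C where "C \<in> {..<n} \<rightarrow> carrier Q \<and>
    A [^]\<^bsub>Q\<^esub> n \<oplus>\<^bsub>Q\<^esub> (\<Oplus>\<^bsub>Q\<^esub>i\<in>{..<n}. C i \<otimes>\<^bsub>Q\<^esub> A [^]\<^bsub>Q\<^esub> i \<otimes>\<^bsub>Q\<^esub> B [^]\<^bsub>Q\<^esub> (n - i)) = \<zero>\<^bsub>Q\<^esub>"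
    using i[unfolded integral_fraction_def] by (elim exE) (rule that)
  note C = conjunct1[OF this] conjunct2[OF this]
  have "\<exists>c. \<forall>i<n. c i \<in> carrier R \<and> C i = I +>\<^bsub>R\<^esub> c i"
    using C(1) by (intro choice_iff'[THEN iffD1]) (auto simp: carrier_Q Pi_def)
  then obtain c where c: "\<And>i. i < n \<Longrightarrow> c i \<in> carrier R" "\<And>i. i < n \<Longrightarrow> C i = I +>\<^bsub>R\<^esub> c i" by blast
  have "(\<Oplus>\<^bsub>Q\<^esub>i\<in>{..<n}. C i \<otimes>\<^bsub>Q\<^esub> A [^]\<^bsub>Q\<^esub> i \<otimes>\<^bsub>Q\<^esub> B [^]\<^bsub>Q\<^esub> (n - i)) =
      (\<Oplus>\<^bsub>Q\<^esub>i\<in>{..<n}. (I +>\<^bsub>R\<^esub> c i) \<otimes>\<^bsub>Q\<^esub> A [^]\<^bsub>Q\<^esub> i \<otimes>\<^bsub>Q\<^esub> B [^]\<^bsub>Q\<^esub> (n - i))"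
    using c h.hom_closed A B by (intro h.S.finsum_cong') (auto intro!: h.S.m_closed h.S.nat_pow_closed)
  then have "(\<lambda>x. a x ^ n + (\<Sum>i<n. c i x * a x ^ i * b x ^ (n - i))) \<in> I"
    using C(2) ab integral_equation[OF ab(1,3) c(1)] by simp
  then obtain r where r: "r \<in> carrier R" "(\<lambda>x. a x - r x * b x) \<in> I"
    using int[OF ab(1,3) bI, of n c] c(1) by blast
  then have "A = I +>\<^bsub>R\<^esub> (\<lambda>x. r x * b x)"
    using coset_eq_iff[OF ab(1) R_closed(2)[OF r(1) ab(3)]] ab by simp
  then show "\<exists>r\<in>carrier Q. A = r \<otimes>\<^bsub>Q\<^esub> B"
    using h.hom_mult[OF r(1) ab(3)] ab r(1) h.hom_closed by (intro bexI[of _ "I +>\<^bsub>R\<^esub> r"]) auto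
qed

end

section \<open>Analytic functions on subsets and smooth points\<close>

lemma analytic_fun_const: "analytic_fun S (\<lambda>z. c)"
  unfolding analytic_fun_def using holomorphic_EC_const open_UNIV by blast

lemma analytic_fun_subset:
  assumes "analytic_fun S f" "T \<subseteq> S" shows "analytic_fun T f"
  unfolding analytic_fun_def
proof
  fix z assume "z \<in> T"
  then have "z \<in> S" using assms(2) by (rule subsetD[rotated])
  from bspec[OF assms(1)[unfolded analytic_fun_def] this]
  obtain U h where U: "open U" "z \<in> U" "holomorphic_EC h U" "\<forall>u\<in>U \<inter> S. f u = h u"
    by (elim exE conjE) (rule that)
  then have "\<forall>u\<in>U \<inter> T. f u = h u" using assms(2) by auto
  then show "\<exists>U h. open U \<and> z \<in> U \<and> holomorphic_EC h U \<and> (\<forall>u\<in>U \<inter> T. f u = h u)"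
    using U(1-3) by (intro exI[of _ U] exI[of _ h]) simp
qed

lemma analytic_fun_cong:
  assumes "analytic_fun S f" "\<And>z. z \<in> S \<Longrightarrow> f z = g z" shows "analytic_fun S g"
  unfolding analytic_fun_def
proof
  fix z assume "z \<in> S"
  then obtain U h where "open U" "z \<in> U" "holomorphic_EC h U" "\<forall>u\<in>U \<inter> S. f u = h u"
    using assms(1) unfolding analytic_fun_def by blast
  then show "\<exists>U h. open U \<and> z \<in> U \<and> holomorphic_EC h U \<and> (\<forall>u\<in>U \<inter> S. g u = h u)"
    using assms(2) by (intro exI[of _ U] exI[of _ h]) auto
qed

lemma analytic_funE:
  assumes "analytic_fun S f" "z \<in> S"
  obtains e g where "e > 0" "holomorphic_EC g (ball z e)" "\<And>u. u \<in> ball z e \<Longrightarrow> u \<in> S \<Longrightarrow> f u = g u"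
proof -
  obtain U g where U: "open U" "z \<in> U" "holomorphic_EC g U" "\<forall>u\<in>U \<inter> S. f u = g u"
    using assms unfolding analytic_fun_def by blast
  obtain e where e: "e > 0" "ball z e \<subseteq> U" using U openE by blast
  show ?thesis
    by (rule that[OF e(1) holomorphic_EC_subset[OF U(3) e(2)]]) (use U(4) e(2) in blast)
qed

lemma analytic_funI:
  assumes "\<And>z. z \<in> S \<Longrightarrow> \<exists>e g. e > 0 \<and> holomorphic_EC g (ball z e) \<and> (\<forall>u\<in>ball z e \<inter> S. f u = g u)"
  shows "analytic_fun S f"
  unfolding analytic_fun_def
proof
  fix z assume "z \<in> S"
  from assms[OF this] obtain e g where "e > 0" "holomorphic_EC g (ball z e)" "\<forall>u\<in>ball z e \<inter> S. f u = g u"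
    by (elim exE conjE) (rule that)
  then show "\<exists>U g. open U \<and> z \<in> U \<and> holomorphic_EC g U \<and> (\<forall>u\<in>U \<inter> S. f u = g u)"
    by (intro exI[of _ "ball z e"] exI[of _ g]) simp
qed

lemma analytic_fun_binop:
  fixes S :: "('a::euclidean_space \<times> 'a) set"
  assumes "analytic_fun S f" "analytic_fun S g"
    and op: "\<And>(U :: ('a \<times> 'a) set) f g. holomorphic_EC f U \<Longrightarrow> holomorphic_EC g U \<Longrightarrow> holomorphic_EC (\<lambda>z. op (f z) (g z)) U"
  shows "analytic_fun S (\<lambda>z. op (f z) (g z))"
proof (rule analytic_funI)
  fix z assume z: "z \<in> S"
  obtain e f' where f: "e > 0" "holomorphic_EC f' (ball z e)" "\<And>u. u \<in> ball z e \<Longrightarrow> u \<in> S \<Longrightarrow> f u = f' u"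
    by (rule analytic_funE[OF assms(1) z]) blast
  obtain d g' where g: "d > 0" "holomorphic_EC g' (ball z d)" "\<And>u. u \<in> ball z d \<Longrightarrow> u \<in> S \<Longrightarrow> g u = g' u"
    by (rule analytic_funE[OF assms(2) z]) blast
  show "\<exists>e h. e > 0 \<and> holomorphic_EC h (ball z e) \<and> (\<forall>u\<in>ball z e \<inter> S. op (f u) (g u) = h u)"
  proof (intro exI conjI)
    show "holomorphic_EC (\<lambda>z. op (f' z) (g' z)) (ball z (min e d))"
      by (rule op) (rule holomorphic_EC_subset[OF f(2)] holomorphic_EC_subset[OF g(2)], auto)+
  qed (use f g in auto)
qed

lemma germ_ring_stratum:
  assumes "p \<in> topspace (stratum \<H> L)" shows "germ_ring (stratum \<H> L) (stratum_sheaf \<H> L) p"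
proof
  fix U V f g
  let ?F = "stratum_sheaf \<H> L"
  assume f: "f \<in> ?F U"
  then show "openin (stratum \<H> L) V \<Longrightarrow> V \<subseteq> U \<Longrightarrow> f \<in> ?F V"
    unfolding stratum_sheaf_def by (auto elim!: analytic_fun_subset)
  show "(\<And>x. x \<in> U \<Longrightarrow> f x = g x) \<Longrightarrow> g \<in> ?F U"
    using f unfolding stratum_sheaf_def by (auto elim!: analytic_fun_cong)
  assume g: "g \<in> ?F U"
  show "(\<lambda>x. f x + g x) \<in> ?F U" "(\<lambda>x. f x * g x) \<in> ?F U"
    using f g unfolding stratum_sheaf_def
    by (auto intro: analytic_fun_binop holomorphic_EC_add holomorphic_EC_mult)
qed (use assms in \<open>auto simp: stratum_sheaf_def analytic_fun_const\<close>)

lemma monic_root_bound: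
  fixes q :: complex
  assumes eq: "q ^ n + (\<Sum>i<n. c i * q ^ i) = 0" and c: "\<And>i. i < n \<Longrightarrow> norm (c i) \<le> C"
  shows "norm q \<le> max 1 (of_nat n * C)"
proof (cases "norm q \<le> 1")
  case False
  then have q1: "norm q > 1" by simp
  \<comment> \<open>For \<open>n = 0\<close> the equation reads \<open>1 = 0\<close>.\<close>
  obtain m where m: "n = Suc m" using eq by (cases n) auto
  have C0: "0 \<le> C" using c[of 0] m norm_ge_zero order_trans by blast
  have "norm q ^ n = norm (\<Sum>i<n. c i * q ^ i)"
    using eq by (metis add_eq_0_iff2 norm_minus_cancel norm_power)
  also have "\<dots> \<le> (\<Sum>i<n. C * norm q ^ m)"
  proof (rule sum_norm_le)
    fix i assume "i \<in> {..<n}"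
    then have "norm (c i) \<le> C" "norm q ^ i \<le> norm q ^ m"
      using c m q1 by (auto intro!: power_increasing)
    then show "norm (c i * q ^ i) \<le> C * norm q ^ m"
      unfolding norm_mult norm_power using C0 by (intro mult_mono) auto
  qed
  finally have "norm q * norm q ^ m \<le> of_nat n * C * norm q ^ m" by (simp add: m)
  moreover have "norm q ^ m > 0" using q1 by (intro zero_less_power) linarith
  ultimately have "norm q \<le> of_nat n * C" by simp
  then show ?thesis by simp
qed simp

lemma hol_map_linear:
  assumes "linear w" shows "hol_map (\<lambda>z. a + map_prod w w (z - c)) U"
  by (rule hol_map_affine[OF linear_map_prod_dup[OF assms]]) (rule map_prod_i[OF assms])

lemma hol_map_cproj: "hol_map (cproj M) U"
  using hol_map_linear[OF linear_proj, of 0 M 0 U] unfolding cproj_def[symmetric] by simp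

text \<open>Charts take values in M + iM, while the extension theorem is about open sets of V + iV.
  Functions are therefore lifted along \<open>cproj M\<close>; germs on the stratum become
  holomorphic germs on the full space, and the zero germ is recognized on either side.\<close>

theorem smooth_imp_normal:
  assumes smooth: "smooth_variety (stratum \<H> L) (stratum_sheaf \<H> L)"
  shows "normal_variety (stratum \<H> L) (stratum_sheaf \<H> (L :: 'a::euclidean_space set))"
  unfolding normal_variety_def
proof
  let ?X = "stratum \<H> L" and ?F = "stratum_sheaf \<H> L"
  fix p assume p: "p \<in> topspace ?X"
  interpret germ_ring ?X ?F p using p by (rule germ_ring_stratum)
  obtain U M D \<phi> where U: "openin ?X U" "p \<in> U" and M: "subspace (M :: 'a set)"
    and D: "openin (top_of_set (M \<times> M)) D" and hom: "homeomorphic_map (subtopology ?X U) (top_of_set D) \<phi>"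
    and sheaf': "\<forall>N g. openin ?X N \<and> N \<subseteq> U \<longrightarrow> (analytic_fun (\<phi> ` N) g \<longleftrightarrow> (\<lambda>x. g (\<phi> x)) \<in> ?F N)"
    using bspec[OF smooth[unfolded smooth_variety_def] p] by (elim exE conjE) (rule that)
  have sheaf: "analytic_fun (\<phi> ` N) g \<longleftrightarrow> (\<lambda>x. g (\<phi> x)) \<in> ?F N" if "openin ?X N" "N \<subseteq> U" for N g
    using sheaf' that by blast
  have tU: "topspace (subtopology ?X U) = U" using openin_subset[OF U(1)] by (simp add: Int_absorb1)
  have inj: "inj_on \<phi> U" and img: "\<phi> ` U = D"
    using homeomorphic_imp_injective_map[OF hom] homeomorphic_imp_surjective_map[OF hom] tU by auto
  have oU: "openin (subtopology ?X U) N \<longleftrightarrow> openin ?X N" if "N \<subseteq> U" for N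
    using U(1) that by (metis inf.absorb1 openin_open_subtopology)
  define \<psi> where "\<psi> = inv_into U \<phi>"
  have \<psi>: "\<psi> (\<phi> x) = x" if "x \<in> U" for x unfolding \<psi>_def using inj that by simp
  have DM: "D \<subseteq> M \<times> M" by (rule openin_imp_subset[OF D])
  have \<phi>M: "\<phi> x \<in> M \<times> M" if "x \<in> U" for x using img DM that by blast
  have pre: "openin ?X {x \<in> U. \<phi> x \<in> V}" if V: "open V" for V
  proof -
    have "continuous_map (subtopology ?X U) (top_of_set D) \<phi>" using hom homeomorphic_imp_continuous_map by blast
    then have "openin (subtopology ?X U) {x \<in> topspace (subtopology ?X U). \<phi> x \<in> D \<inter> V}"
      using V by (intro openin_continuous_map_preimage) (auto intro: openin_open_Int)
    moreover have "{x \<in> topspace (subtopology ?X U). \<phi> x \<in> D \<inter> V} = {x \<in> U. \<phi> x \<in> V}" using img tU by auto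
    ultimately show ?thesis using oU[of "{x \<in> U. \<phi> x \<in> V}"] by auto
  qed
  have post: "\<exists>O'. open O' \<and> \<phi> ` N = O' \<inter> (M \<times> M)" if N: "openin ?X N" "N \<subseteq> U" for N
  proof -
    have "openin (top_of_set D) (\<phi> ` N)"
      using homeomorphic_map_openness_eq[OF hom] N oU tU by blast
    then have "openin (top_of_set (M \<times> M)) (\<phi> ` N)" using D openin_trans by blast
    then show ?thesis by (auto simp: openin_open Int_commute)
  qed
  define lft where "lft = (\<lambda>f z. f (\<psi> (cproj M z)) :: complex)"
  have lft_\<phi>: "lft f (\<phi> x) = f x" if "x \<in> U" for f x
    using that \<psi> cproj_id[OF M \<phi>M] by (simp add: lft_def)
  have cproj_map: "hol_map (cproj M) UNIV" by (rule hol_map_cproj)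
  have ccont: "continuous_on UNIV (cproj M)" by (rule hol_map_continuous_on[OF cproj_map])
  have pM: "cproj M (\<phi> p) = \<phi> p" by (rule cproj_id[OF M \<phi>M[OF U(2)]])
  have lift_nhd: "\<exists>e>0. ball (\<phi> p) e \<subseteq> {z. cproj M z \<in> \<phi> ` N}" if N: "openin ?X N" "N \<subseteq> U" "p \<in> N" for N
  proof -
    obtain G where G: "open G" "\<phi> ` N = G \<inter> (M \<times> M)" using post[OF N(1,2)] by blast
    have "open {z. cproj M z \<in> G}" using open_vimage[OF G(1) ccont] by (simp add: vimage_def)
    moreover have "\<phi> p \<in> {z. cproj M z \<in> G}" using pM G N(3) by auto
    ultimately obtain e where "e > 0" "ball (\<phi> p) e \<subseteq> {z. cproj M z \<in> G}" using openE by blast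
    then show ?thesis using G(2) cproj_mem[OF M] by blast
  qed
  have lift_hol: "\<exists>e>0. \<forall>f\<in>S. holomorphic_EC (lft f) (ball (\<phi> p) e)" if S: "finite S" "S \<subseteq> carrier R" for S
  proof -
    obtain N0 where N0: "openin ?X N0" "p \<in> N0" "S \<subseteq> ?F N0" using common_nhd[OF S] by blast
    define N where "N = N0 \<inter> U"
    have N: "openin ?X N" "N \<subseteq> U" "p \<in> N" using N0 U by (auto simp: N_def)
    obtain e where e: "e > 0" "ball (\<phi> p) e \<subseteq> {z. cproj M z \<in> \<phi> ` N}" using lift_nhd[OF N] by blast
    have "holomorphic_EC (lft f) (ball (\<phi> p) e)" if f: "f \<in> S" for f
    proof (rule holomorphic_EC_locally)
      have "f \<in> ?F N" using F_restrict[of f N0 N] N0(3) f N(1) by (auto simp: N_def)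
      then have "(\<lambda>x. f (\<psi> (\<phi> x))) \<in> ?F N" by (rule F_cong[OF _ N(1)]) (use \<psi> N(2) in auto)
      then have an: "analytic_fun (\<phi> ` N) (\<lambda>z. f (\<psi> z))" using sheaf[OF N(1,2)] by blast
      fix z assume "z \<in> ball (\<phi> p) e"
      then have z: "cproj M z \<in> \<phi> ` N" using e(2) by blast
      obtain d g where g: "d > 0" "holomorphic_EC g (ball (cproj M z) d)"
        "\<And>u. u \<in> ball (cproj M z) d \<Longrightarrow> u \<in> \<phi> ` N \<Longrightarrow> f (\<psi> u) = g u"
        by (rule analytic_funE[OF an z]) blast
      let ?V = "ball (\<phi> p) e \<inter> cproj M -` ball (cproj M z) d"
      have V: "open ?V" using open_vimage[OF open_ball ccont] by (intro open_Int) auto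
      have "holomorphic_EC (\<lambda>z. g (cproj M z)) ?V"
        by (rule holomorphic_EC_compose[OF hol_map_subset[OF cproj_map] g(2)]) auto
      then have "holomorphic_EC (lft f) ?V"
      proof (rule holomorphic_EC_cong[OF V, rotated])
        fix u assume u: "u \<in> ?V"
        then have "cproj M u \<in> \<phi> ` N" "cproj M u \<in> ball (cproj M z) d" using e(2) by blast+
        then show "g (cproj M u) = lft f u" using g(3) by (simp only: lft_def)
      qed
      then show "\<exists>V. z \<in> V \<and> holomorphic_EC (lft f) V"
        using \<open>z \<in> ball (\<phi> p) e\<close> g(1) by (intro exI[of _ ?V]) auto
    qed
    then show ?thesis using e(1) by blast
  qed
  have vanish1: "\<exists>e>0. \<forall>z\<in>ball (\<phi> p) e. lft f z = 0" if f: "f \<in> I" for f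
  proof -
    obtain N0 where N0: "openin ?X N0" "p \<in> N0" "\<forall>x\<in>N0. f x = 0" using f by (auto simp: vanishing_nhd)
    have N: "openin ?X (N0 \<inter> U)" "N0 \<inter> U \<subseteq> U" "p \<in> N0 \<inter> U" using N0 U by auto
    obtain e where e: "e > 0" "ball (\<phi> p) e \<subseteq> {z. cproj M z \<in> \<phi> ` (N0 \<inter> U)}" using lift_nhd[OF N] by blast
    have "lft f z = 0" if z: "z \<in> ball (\<phi> p) e" for z
    proof -
      obtain x where "x \<in> N0 \<inter> U" "cproj M z = \<phi> x" using e(2) z by blast
      then show ?thesis using N0(3) \<psi> by (simp add: lft_def)
    qed
    then show ?thesis using e(1) by blast
  qed
  have vanish2: "f \<in> I" if V: "open V" "\<phi> p \<in> V" and f: "\<And>z. z \<in> V \<Longrightarrow> lft f z = 0" for f V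
    unfolding vanishing_nhd
  proof (intro exI conjI ballI)
    show "openin ?X {x \<in> U. \<phi> x \<in> V}" by (rule pre[OF V(1)])
    show "p \<in> {x \<in> U. \<phi> x \<in> V}" using U(2) V(2) by simp
    show "f x = 0" if "x \<in> {x \<in> U. \<phi> x \<in> V}" for x
      using lft_\<phi>[of x f] f[of "\<phi> x"] that by simp
  qed
  show "integrally_closed_domain Q"
  proof (rule integrally_closedI)
    fix f g assume f: "f \<in> carrier R" and g: "g \<in> carrier R" and fg: "(\<lambda>x. f x * g x) \<in> I"
    obtain e1 where e1: "e1 > 0" "\<And>z. z \<in> ball (\<phi> p) e1 \<Longrightarrow> lft (\<lambda>x. f x * g x) z = 0" using vanish1[OF fg] by blast
    obtain e2 where e2: "e2 > 0" "holomorphic_EC (lft f) (ball (\<phi> p) e2)" "holomorphic_EC (lft g) (ball (\<phi> p) e2)"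
      using lift_hol[of "{f, g}"] f g by auto
    let ?B = "ball (\<phi> p) (min e1 e2)"
    have B: "open ?B" "convex ?B" "\<phi> p \<in> ?B" using e1(1) e2(1) by auto
    have hol: "holomorphic_EC (lft f) ?B" "holomorphic_EC (lft g) ?B"
      using e2 by (auto intro: holomorphic_EC_subset)
    have 0: "lft f u * lft g u = 0" if "u \<in> ?B" for u using e1(2)[of u] that by (simp add: lft_def)
    show "f \<in> I \<or> g \<in> I"
    proof (cases "\<forall>u\<in>?B. lft f u = 0")
      case True
      then show ?thesis using vanish2[OF B(1,3)] by blast
    next
      case False
      then obtain u where "u \<in> ?B" "lft f u \<noteq> 0" by blast
      then have "\<And>v. v \<in> ?B \<Longrightarrow> lft g v = 0"
        using holomorphic_EC_no_zero_divisors[OF B(1,2) hol 0] by blast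
      then show ?thesis using vanish2[OF B(1,3)] by blast
    qed
  next
    fix a b n c
    assume a: "a \<in> carrier R" and b: "b \<in> carrier R" "b \<notin> I" and c: "\<And>i. i < n \<Longrightarrow> c i \<in> carrier R"
      and eq: "(\<lambda>x. a x ^ n + (\<Sum>i<n. c i x * a x ^ i * b x ^ (n - i))) \<in> I"
    obtain e1 where e1: "e1 > 0" "\<And>z. z \<in> ball (\<phi> p) e1 \<Longrightarrow>
        lft (\<lambda>x. a x ^ n + (\<Sum>i<n. c i x * a x ^ i * b x ^ (n - i))) z = 0" using vanish1[OF eq] by blast
    have "{a, b} \<union> c ` {..<n} \<subseteq> carrier R" using a b c by auto
    then obtain e2 where e2: "e2 > 0" "\<And>f. f \<in> {a, b} \<union> c ` {..<n} \<Longrightarrow> holomorphic_EC (lft f) (ball (\<phi> p) e2)"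
      using lift_hol[of "{a, b} \<union> c ` {..<n}"] by (metis finite.emptyI finite_Un finite_imageI finite_insert finite_lessThan)
    \<comment> \<open>Halving keeps the closed ball inside the domain, so the coefficients are
      bounded by compactness.\<close>
    define e where "e = min e1 (e2 / 2)"
    let ?B = "ball (\<phi> p) e"
    have e: "e > 0" "?B \<subseteq> ball (\<phi> p) e2" "cball (\<phi> p) e \<subseteq> ball (\<phi> p) e2"
      using e1(1) e2(1) by (auto simp: e_def)
    have hol: "holomorphic_EC (lft f) ?B" if "f \<in> {a, b} \<union> c ` {..<n}" for f
      using e2(2)[OF that] e(2) by (rule holomorphic_EC_subset)
    have "\<exists>C. \<forall>u\<in>?B. norm (lft (c i) u) \<le> C" if "i < n" for i
    proof -
      have "continuous_on (cball (\<phi> p) e) (lft (c i))"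
        using e2(2)[of "c i"] that e(3) by (auto intro!: holomorphic_EC_continuous_on intro: holomorphic_EC_subset)
      then have "bounded (lft (c i) ` cball (\<phi> p) e)" by (intro compact_imp_bounded compact_continuous_image) auto
      then show ?thesis unfolding bounded_iff by (metis ball_subset_cball imageI subsetD)
    qed
    then obtain C where C: "\<And>i u. i < n \<Longrightarrow> u \<in> ?B \<Longrightarrow> norm (lft (c i) u) \<le> C i" by metis
    define C' where "C' = (\<Sum>i<n. \<bar>C i\<bar>)"
    have C': "norm (lft (c i) u) \<le> C'" if "i < n" "u \<in> ?B" for i u
      using C[OF that] member_le_sum[of i "{..<n}" "\<lambda>i. \<bar>C i\<bar>"] that(1) unfolding C'_def by fastforce
    define q where "q = (\<lambda>u. lft a u / lft b u)"
    have qeq: "q u ^ n + (\<Sum>i<n. lft (c i) u * q u ^ i) = 0" if u: "u \<in> ?B" "lft b u \<noteq> 0" for u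
    proof -
      have "(q u ^ n + (\<Sum>i<n. lft (c i) u * q u ^ i)) * lft b u ^ n =
          lft a u ^ n + (\<Sum>i<n. lft (c i) u * lft a u ^ i * lft b u ^ (n - i))"
      proof -
        have "q u ^ i * lft b u ^ n = lft a u ^ i * lft b u ^ (n - i)" if "i \<le> n" for i
          using u(2) that by (simp add: q_def power_divide power_diff)
        then show ?thesis using u(2)
          by (simp add: distrib_right sum_distrib_right mult.assoc)
      qed
      also have "\<dots> = 0" using e1(2)[of u] u(1) by (simp add: lft_def e_def)
      finally show ?thesis using u(2) by simp
    qed
    have q: "holomorphic_EC q {u \<in> ?B. lft b u \<noteq> 0}"
      unfolding q_def
      by (intro holomorphic_EC_divide holomorphic_EC_subset[OF hol, of a] holomorphic_EC_subset[OF hol, of b]) auto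
    obtain V r where V: "open V" "\<phi> p \<in> V" "V \<subseteq> ?B" "holomorphic_EC r V"
      "\<And>u. u \<in> V \<Longrightarrow> lft b u \<noteq> 0 \<Longrightarrow> r u = q u"
    proof (rule riemann_extension_EC[OF open_ball _ _ _ q])
      show "holomorphic_EC (lft b) ?B" by (rule hol) simp
      show "\<exists>u\<in>V \<inter> ?B. lft b u \<noteq> 0" if "open V" "\<phi> p \<in> V" for V
      proof (rule ccontr)
        assume "\<not> ?thesis"
        then have "lft b u = 0" if "u \<in> V \<inter> ?B" for u using that by blast
        then have "b \<in> I" using that e(1) by (intro vanish2[of "V \<inter> ?B"]) auto
        then show False using b(2) by contradiction
      qed
      show "norm (q u) \<le> max 1 (of_nat n * C')" if "u \<in> ?B" "lft b u \<noteq> 0" for u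
        using monic_root_bound[OF qeq[OF that]] C' that(1) by blast
    qed (use e(1) in auto)
    obtain d where d: "d > 0" "ball (\<phi> p) d \<subseteq> V" using V openE by blast
    let ?W = "ball (\<phi> p) d"
    have WB: "?W \<subseteq> ?B" using d V by blast
    \<comment> \<open>True where \<open>lft b\<close> does not vanish, which is an open nonempty
      part of the ball; the identity theorem does the rest.\<close>
    have zero: "lft a u - r u * lft b u = 0" if u: "u \<in> ?W" for u
    proof (rule holomorphic_EC_identity[OF open_ball convex_ball _ _ _ _ _ u])
      show "holomorphic_EC (\<lambda>u. lft a u - r u * lft b u) ?W"
        by (intro holomorphic_EC_diff holomorphic_EC_mult holomorphic_EC_subset[OF hol WB]
            holomorphic_EC_subset[OF V(4) d(2)]) auto
      let ?Z = "?W \<inter> lft b -` (- {0})"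
      show "open ?Z"
        using holomorphic_EC_continuous_on[OF holomorphic_EC_subset[OF hol WB], of b]
        by (intro continuous_open_preimage) auto
      show "?Z \<noteq> {}"
      proof
        assume "?Z = {}"
        then have "lft b u = 0" if "u \<in> ?W" for u using that by blast
        then have "b \<in> I" using d(1) by (intro vanish2[of ?W]) auto
        then show False using b(2) by contradiction
      qed
      show "lft a u - r u * lft b u = 0" if "u \<in> ?Z" for u
        using V(5)[of u] that d(2) by (auto simp: q_def)
    qed auto
    define N where "N = {x \<in> U. \<phi> x \<in> ?W}"
    have N: "openin ?X N" "N \<subseteq> U" "p \<in> N" using pre[of ?W] U d(1) by (auto simp: N_def)
    have "analytic_fun (\<phi> ` N) r"
      unfolding analytic_fun_def
    proof
      fix z assume "z \<in> \<phi> ` N"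
      then have "z \<in> ?W" by (auto simp: N_def)
      then show "\<exists>U g. open U \<and> z \<in> U \<and> holomorphic_EC g U \<and> (\<forall>u\<in>U \<inter> \<phi> ` N. r u = g u)"
        using holomorphic_EC_subset[OF V(4) d(2)] by (intro exI[of _ ?W] exI[of _ r]) auto
    qed
    then have rF: "(\<lambda>x. r (\<phi> x)) \<in> ?F N" using sheaf[OF N(1,2)] by blast
    have "(\<lambda>x. a x - r (\<phi> x) * b x) \<in> I"
      unfolding vanishing_nhd
    proof (intro exI conjI ballI)
      fix x assume "x \<in> N"
      then show "a x - r (\<phi> x) * b x = 0"
        using zero[of "\<phi> x"] lft_\<phi>[of x a] lft_\<phi>[of x b] by (simp add: N_def)
    qed (use N in auto)
    then show "\<exists>r\<in>carrier R. (\<lambda>x. a x - r x * b x) \<in> I"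
      using rF N by (intro bexI[of _ "\<lambda>x. r (\<phi> x)"]) (auto simp: R_carrier)
  qed
qed

section \<open>The stratum near a point\<close>

text \<open>Every generator is its own inverse, so the group generated is already the set of
  words.\<close>

lemma refl_group_eq:
  assumes "\<And>H. H \<in> \<H> \<Longrightarrow> affine_hyperplane H"
  shows "refl_group \<H> = compositions (orth_reflection ` \<H>)"
proof -
  let ?G = "BijGroup (UNIV :: 'a set)" and ?S = "orth_reflection ` \<H>"
  interpret group ?G by (rule group_BijGroup)
  have mult: "f \<otimes>\<^bsub>?G\<^esub> g = f \<circ> g" if "f \<in> carrier ?G" "g \<in> carrier ?G" for f g
    using that by (auto simp: BijGroup_def compose_def)
  have one: "\<one>\<^bsub>?G\<^esub> = id" by (auto simp: BijGroup_def)
  have inv2: "s \<circ> s = id" if "s \<in> ?S" for s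
    using that orth_reflection_involution assms by fastforce
  have car: "s \<in> carrier ?G" if "s \<in> ?S" for s
    using inv2[OF that] by (auto simp: BijGroup_def Bij_def intro: o_bij)
  have car': "w \<in> carrier ?G" if "w \<in> compositions ?S" for w
    using that
  proof induction
    case id
    show ?case using one_closed by (simp only: one)
  next
    case (comp s w)
    show ?case using m_closed[OF car[OF comp(1)] comp(3)] by (simp only: mult[OF car[OF comp(1)] comp(3)])
  qed
  have minv: "inv\<^bsub>?G\<^esub> s = s" if "s \<in> ?S" for s
    by (rule inv_equality) (use car[OF that] mult[OF car[OF that] car[OF that]] inv2[OF that] one in auto)
  show ?thesis unfolding refl_group_def
  proof (intro equalityI subsetI)
    fix w assume "w \<in> generate ?G ?S"
    then show "w \<in> compositions ?S"
    proof induction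
      case one
      then show ?case using compositions.id by (simp only: \<open>\<one>\<^bsub>?G\<^esub> = id\<close>)
    next
      case (incl h)
      then show ?case by (rule compositions_incl)
    next
      case (inv h)
      then show ?case using compositions_incl[OF inv] by (simp only: minv)
    next
      case (eng h1 h2)
      then show ?case using mult[OF car' car'] compositions_comp by metis
    qed
  next
    fix w assume "w \<in> compositions ?S"
    then show "w \<in> generate ?G ?S"
    proof induction
      case id
      show ?case using generate.one[of ?G ?S] by (simp only: one)
    next
      case (comp s w)
      show ?case using generate.eng[OF generate.incl[OF comp(1)] comp(3)]
        by (simp only: mult[OF car[OF comp(1)] car'[OF comp(2)]])
    qed
  qed
qed

text \<open>The preimage of \<open>K \<times> K\<close> under the proper map is compact, and so is
  its projection to the discrete group, where compact means finite.\<close>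

lemma admissible_finite:
  assumes adm: "admissible \<H>" and K: "compact (K :: 'a::euclidean_space set)"
  shows "finite {w \<in> refl_group \<H>. w ` K \<inter> K \<noteq> {}}"
proof -
  let ?W = "refl_group \<H>"
  let ?X = "prod_topology (discrete_topology ?W) (euclidean :: 'a topology)"
  let ?f = "\<lambda>(w, x). (w x, x :: 'a)"
  have pm: "proper_map ?X (prod_topology euclidean euclidean) ?f"
    using adm by (simp add: admissible_def)
  have "compactin (prod_topology euclidean euclidean) (K \<times> K)"
    using K by (simp add: compactin_Times compact_Times)
  from compactin_proper_map_preimage[OF pm this]
  have "compactin ?X {x \<in> topspace ?X. ?f x \<in> K \<times> K}" .
  from image_compactin[OF this continuous_map_fst]
  have "finite (fst ` {x \<in> topspace ?X. ?f x \<in> K \<times> K})"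
    by (simp add: compactin_discrete_topology)
  moreover have "{w \<in> ?W. w ` K \<inter> K \<noteq> {}} \<subseteq> fst ` {x \<in> topspace ?X. ?f x \<in> K \<times> K}"
    by (force simp: image_iff)
  ultimately show ?thesis by (rule finite_subset[rotated])
qed

text \<open>Local finiteness of the hyperplanes is read off from the group: a hyperplane meeting a
  ball yields a reflection with a fixed point in that ball, and a reflection determines its
  hyperplane.\<close>

lemma admissible_coxeter:
  assumes adm: "admissible \<H>" shows "coxeter \<H>"
proof
  show hyper: "affine_hyperplane H" if "H \<in> \<H>" for H using adm that by (simp add: admissible_def)
  have W: "refl_group \<H> = compositions (orth_reflection ` \<H>)" using hyper by (rule refl_group_eq)
  have s: "orth_reflection H \<in> refl_group \<H>" if "H \<in> \<H>" for H
    unfolding W using that by (intro compositions_incl) blast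
  show "orth_reflection H ` K \<in> \<H>" if "H \<in> \<H>" "K \<in> \<H>" for H K
    using adm s that by (simp add: admissible_def)
  show "finite {H \<in> \<H>. H \<inter> cball x R \<noteq> {}}" for x R
  proof (rule finite_imageD)
    show "finite (orth_reflection ` {H \<in> \<H>. H \<inter> cball x R \<noteq> {}})"
    proof (rule finite_subset[OF _ admissible_finite[OF adm compact_cball[of x R]]])
      show "orth_reflection ` {H \<in> \<H>. H \<inter> cball x R \<noteq> {}} \<subseteq> {w \<in> refl_group \<H>. w ` cball x R \<inter> cball x R \<noteq> {}}"
      proof
        fix w assume "w \<in> orth_reflection ` {H \<in> \<H>. H \<inter> cball x R \<noteq> {}}"
        then obtain H y where H: "w = orth_reflection H" "H \<in> \<H>" "y \<in> H" "y \<in> cball x R" by blast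
        then have "w y = y" using orth_reflection_fix[OF hyper] by simp
        then have "y \<in> w ` cball x R" using H(4) by (metis image_eqI)
        then show "w \<in> {w \<in> refl_group \<H>. w ` cball x R \<inter> cball x R \<noteq> {}}"
          using s H by blast
      qed
    qed
    show "inj_on orth_reflection {H \<in> \<H>. H \<inter> cball x R \<noteq> {}}"
    proof (rule inj_onI)
      fix H K assume "H \<in> {H \<in> \<H>. H \<inter> cball x R \<noteq> {}}" "K \<in> {H \<in> \<H>. H \<inter> cball x R \<noteq> {}}"
        and eq: "orth_reflection H = orth_reflection K"
      then have "y \<in> H \<longleftrightarrow> y \<in> K" for y
        using orth_reflection_fix[OF hyper, of H y] orth_reflection_fix[OF hyper, of K y] by simp
      then show "H = K" by blast
    qed
  qed
qed

section \<open>The action on the complexification\<close>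

definition lin :: "('a::euclidean_space \<Rightarrow> 'a) \<Rightarrow> 'a \<Rightarrow> 'a" where
  "lin w y = w y - w 0"

lemma complex_action_eq: "complex_action w (x, y) = (w x, lin w y)"
  by (simp add: complex_action_def lin_def)

lemma lin_orth: "aff_iso w \<Longrightarrow> orthogonal_transformation (lin w)"
  by (simp add: aff_iso_def lin_def[abs_def])

lemma lin_linear: "aff_iso w \<Longrightarrow> linear (lin w)"
  using lin_orth orthogonal_transformation_linear by blast

lemma lin_diff: assumes "aff_iso w" shows "w x - w y = lin w (x - y)"
  using linear_diff[OF lin_linear[OF assms], of x y] by (simp add: lin_def)

lemma lin_comp: assumes "aff_iso v" "aff_iso w" shows "lin (v \<circ> w) = lin v \<circ> lin w"
  using lin_diff[OF assms(1)] by (auto simp: lin_def fun_eq_iff)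

lemma lin_id: "lin id = id"
  by (auto simp: lin_def)

lemma complex_action_diff:
  assumes "aff_iso w" shows "complex_action w u - complex_action w z = map_prod (lin w) (lin w) (u - z)"
  by (cases u, cases z) (simp add: complex_action_eq lin_diff[OF assms] linear_diff[OF lin_linear[OF assms]])

lemma complex_action_comp:
  assumes "aff_iso v" "aff_iso w" shows "complex_action (v \<circ> w) z = complex_action v (complex_action w z)"
  by (cases z) (simp add: complex_action_eq lin_comp[OF assms])

lemma complex_action_id: "complex_action id z = z"
  by (cases z) (simp add: complex_action_eq lin_id)

lemma complex_action_dist:
  assumes "aff_iso w" shows "dist (complex_action w u) (complex_action w z) = dist u z"
proof -
  have "norm (map_prod (lin w) (lin w) v) = norm v" for v
    using lin_orth[OF assms] by (cases v) (simp add: norm_Pair orthogonal_transformation_norm)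
  then show ?thesis by (simp only: dist_norm complex_action_diff[OF assms])
qed

lemma hol_map_complex_action: assumes "aff_iso w" shows "hol_map (complex_action w) U"
proof -
  have e: "complex_action w = (\<lambda>z. complex_action w 0 + map_prod (lin w) (lin w) (z - 0))"
  proof
    fix z
    show "complex_action w z = complex_action w 0 + map_prod (lin w) (lin w) (z - 0)"
      using complex_action_diff[OF assms, of z 0] by (metis add.commute diff_add_cancel)
  qed
  show ?thesis by (subst e) (rule hol_map_linear[OF lin_linear[OF assms]])
qed

lemma proj_image:
  assumes "orthogonal_transformation l" "subspace M" shows "proj (l ` M) (l x) = l (proj M x)"
proof (rule proj_unique)
  note lin = orthogonal_transformation_linear[OF assms(1)]
  show "subspace (l ` M)" using assms(2) lin by (simp add: linear_subspace_image)
  show "l (proj M x) \<in> l ` M" using proj_mem[OF assms(2)] by blast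
  fix u assume "u \<in> l ` M"
  then obtain m where m: "m \<in> M" "u = l m" by blast
  then show "u \<bullet> (l x - l (proj M x)) = 0"
    using assms(1) inner_diff_proj[OF assms(2) m(1)] by (simp add: orthogonal_transformation_def linear_diff[OF lin, symmetric])
qed

lemma cproj_image:
  assumes "orthogonal_transformation l" "subspace M"
  shows "cproj (l ` M) (map_prod l l v) = map_prod l l (cproj M v)"
  by (cases v) (simp add: cproj_def proj_image[OF assms])

section \<open>Translates of the flat and their complexifications\<close>

locale arrangement =
  fixes \<H> :: "'a::euclidean_space set set" and L :: "'a set"
  assumes adm: "admissible \<H>" and fl: "flat \<H> L"

sublocale arrangement \<subseteq> coxeter \<H>
  by (rule admissible_coxeter[OF adm])

context arrangement
begin

definition M :: "'a set" where "M = direction L"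

abbreviation X where "X \<equiv> stratum \<H> L"
abbreviation Sh where "Sh \<equiv> stratum_sheaf \<H> L"
abbreviation act where "act \<equiv> complex_action"

lemma refl_group_W: "refl_group \<H> = W"
  unfolding W_def by (rule refl_group_eq[OF hyper])

lemma act_comp: "v \<in> W \<Longrightarrow> w \<in> W \<Longrightarrow> act (v \<circ> w) z = act v (act w z)"
  by (intro complex_action_comp W_aff_iso)

lemma act_dist: "w \<in> W \<Longrightarrow> dist (act w u) (act w z) = dist u z"
  by (intro complex_action_dist W_aff_iso)

lemma act_inverse:
  assumes "w \<in> W" obtains v where "v \<in> W" "\<And>z. act v (act w z) = z" "\<And>z. act w (act v z) = z"
    "v \<circ> w = id" "w \<circ> v = id"
proof -
  obtain v where v: "v \<in> W" "v \<circ> w = id" "w \<circ> v = id" using W_inverse[OF assms] by blast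
  show ?thesis
    by (rule that[OF v(1) _ _ v(2,3)]) (simp_all add: act_comp[symmetric] assms v complex_action_id)
qed

lemma orbit_iff: "u \<in> refl_orbit \<H> z \<longleftrightarrow> (\<exists>w\<in>W. u = act w z)"
  by (auto simp: refl_orbit_def refl_group_W)

lemma orbit_act: assumes "w \<in> W" shows "refl_orbit \<H> (act w z) = refl_orbit \<H> z"
proof -
  obtain v where v: "v \<in> W" "\<And>z. act v (act w z) = z" by (rule act_inverse[OF assms]) blast
  show ?thesis
  proof (intro equalityI subsetI)
    fix u assume "u \<in> refl_orbit \<H> (act w z)"
    then obtain x where "x \<in> W" "u = act x (act w z)" by (auto simp: orbit_iff)
    then have "x \<circ> w \<in> W" "u = act (x \<circ> w) z" using W_comp assms act_comp by auto
    then show "u \<in> refl_orbit \<H> z" unfolding orbit_iff by blast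
  next
    fix u assume "u \<in> refl_orbit \<H> z"
    then obtain x where "x \<in> W" "u = act x z" by (auto simp: orbit_iff)
    then have "x \<circ> v \<in> W" "u = act (x \<circ> v) (act w z)" using W_comp v act_comp[of x v] by auto
    then show "u \<in> refl_orbit \<H> (act w z)" unfolding orbit_iff by blast
  qed
qed

lemma orbit_self: "z \<in> refl_orbit \<H> z"
  unfolding orbit_iff using W_id complex_action_id by metis

lemma orbit_eqD: "refl_orbit \<H> u = refl_orbit \<H> z \<Longrightarrow> \<exists>w\<in>W. u = act w z"
  using orbit_self orbit_iff by blast

lemma L_affine: assumes st: "s + t = 1" and "x \<in> L" "y \<in> L" shows "s *\<^sub>R x + t *\<^sub>R y \<in> L"
proof -
  obtain \<G> where \<G>: "\<G> \<subseteq> \<H>" "L = \<Inter>\<G>" using fl unfolding flat_def by blast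
  have "s *\<^sub>R x + t *\<^sub>R y \<in> H" if H: "H \<in> \<G>" for H
  proof -
    have hH: "affine_hyperplane H" using H \<G>(1) hyper by blast
    have "x \<in> H" "y \<in> H" using assms H \<G>(2) by auto
    then show ?thesis by (simp add: mem_hyperplane[OF hH] hval_affine[OF hH st])
  qed
  then show ?thesis using \<G>(2) by blast
qed

lemma L_closed: "closed L"
proof -
  obtain \<G> where \<G>: "\<G> \<subseteq> \<H>" "L = \<Inter>\<G>" using fl unfolding flat_def by blast
  then show ?thesis using affine_hyperplane_facts(1)[OF hyper] by (auto intro!: closed_Inter)
qed

lemma L_translate: assumes x: "x \<in> L" shows "x + m \<in> L \<longleftrightarrow> m \<in> M"
proof
  assume "x + m \<in> L"
  then have "\<exists>a b. m = a - b \<and> a \<in> L \<and> b \<in> L" using x by (intro exI[of _ "x + m"] exI[of _ x]) simp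
  then show "m \<in> M" by (simp add: M_def direction_def)
next
  assume "m \<in> M"
  then obtain a b where ab: "m = a - b" "a \<in> L" "b \<in> L" by (auto simp: M_def direction_def)
  have "(1/2) *\<^sub>R x + (1/2) *\<^sub>R a \<in> L" by (rule L_affine[OF _ x ab(2)]) simp
  from L_affine[OF _ this ab(3), of 2 "- 1"]
  have "2 *\<^sub>R ((1/2) *\<^sub>R x + (1/2) *\<^sub>R a) + (- 1) *\<^sub>R b \<in> L" by simp
  then show "x + m \<in> L" by (simp add: ab(1) scaleR_add_right algebra_simps)
qed

lemma M_subspace: "subspace M"
proof -
  obtain x where x: "x \<in> L" using fl unfolding flat_def by blast
  show ?thesis
  proof (rule subspaceI)
    show "0 \<in> M" using L_translate[OF x, of 0] x by simp
    show "a + b \<in> M" if "a \<in> M" "b \<in> M" for a b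
    proof -
      have xa: "x + a \<in> L" using L_translate[OF x] that by blast
      show ?thesis using L_translate[OF xa, of b] L_translate[OF x, of "a + b"] that by (simp add: add.assoc)
    qed
    show "c *\<^sub>R a \<in> M" if "a \<in> M" for c a
    proof -
      have "x + a \<in> L" using L_translate[OF x] that by blast
      from L_affine[OF _ x this, of "1 - c" c] have "(1 - c) *\<^sub>R x + c *\<^sub>R (x + a) \<in> L" by simp
      then have "x + c *\<^sub>R a \<in> L" by (simp add: algebra_simps)
      then show ?thesis using L_translate[OF x] by blast
    qed
  qed
qed

lemma LC_iff: assumes z: "z \<in> complexify L" shows "u \<in> complexify L \<longleftrightarrow> u - z \<in> M \<times> M"
proof -
  obtain x y where z': "z = (x, y)" "x \<in> L" "y \<in> M" using z by (auto simp: complexify_def M_def)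
  obtain a b where u: "u = (a, b)" by (cases u)
  have "a \<in> L \<longleftrightarrow> a - x \<in> M" using L_translate[OF z'(2), of "a - x"] by simp
  moreover have "b \<in> M \<longleftrightarrow> b - y \<in> M" using z'(3) M_subspace by (metis diff_add_cancel subspace_add subspace_diff)
  ultimately show ?thesis by (simp add: u z'(1) complexify_def M_def[symmetric])
qed

lemma sheet_iff:
  assumes w: "w \<in> W" and z: "z \<in> act w ` complexify L"
  shows "u \<in> act w ` complexify L \<longleftrightarrow> u - z \<in> lin w ` M \<times> lin w ` M"
proof -
  obtain z0 where z0: "z0 \<in> complexify L" "z = act w z0" using z by blast
  obtain v where v: "\<And>z. act v (act w z) = z" "\<And>z. act w (act v z) = z" by (rule act_inverse[OF w]) blast
  have m: "map_prod (lin w) (lin w) d \<in> lin w ` M \<times> lin w ` M \<longleftrightarrow> d \<in> M \<times> M" for d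
    using orthogonal_transformation_inj[OF lin_orth[OF W_aff_iso[OF w]]]
    by (cases d) (auto simp: inj_image_mem_iff)
  have "u - z = map_prod (lin w) (lin w) (act v u - z0)"
    using complex_action_diff[OF W_aff_iso[OF w], of "act v u" z0] by (simp add: v z0)
  then have "u - z \<in> lin w ` M \<times> lin w ` M \<longleftrightarrow> act v u \<in> complexify L" using m LC_iff[OF z0(1)] by simp
  also have "\<dots> \<longleftrightarrow> u \<in> act w ` complexify L" using v by (metis image_iff)
  finally show ?thesis by simp
qed

lemma sheet_eq: assumes w: "w \<in> W" shows "act w ` complexify L = w ` L \<times> lin w ` M"
proof -
  have "act w ` complexify L = map_prod w (lin w) ` (L \<times> M)"
    by (intro image_cong) (auto simp: complexify_def M_def complex_action_eq)
  then show ?thesis by (simp add: map_prod_surj_on[OF refl refl])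
qed

lemma translates_iff: "u \<in> translates \<H> L \<longleftrightarrow> (\<exists>w\<in>W. u \<in> act w ` complexify L)"
  by (auto simp: translates_def refl_group_W)

lemma LC_translates: "complexify L \<subseteq> translates \<H> L"
proof
  fix z assume "z \<in> complexify L"
  then have "z \<in> act id ` complexify L" by (rule image_eqI[of z "act id" z, OF complex_action_id[of z, symmetric]])
  then show "z \<in> translates \<H> L" unfolding translates_iff using W_id by blast
qed

lemma translates_act: assumes "w \<in> W" shows "act w z \<in> translates \<H> L \<longleftrightarrow> z \<in> translates \<H> L"
proof -
  have *: "act w z \<in> translates \<H> L" if w: "w \<in> W" and zt: "z \<in> translates \<H> L" for w z
  proof -
    obtain v u where v: "v \<in> W" "u \<in> complexify L" "z = act v u" using zt unfolding translates_iff by blast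
    have "w \<circ> v \<in> W" "act w z = act (w \<circ> v) u" using W_comp[OF w v(1)] act_comp[OF w v(1), of u] v(3) by auto
    then show ?thesis using v(2) unfolding translates_iff by blast
  qed
  obtain v where v: "v \<in> W" "\<And>z. act v (act w z) = z" by (rule act_inverse[OF assms]) blast
  show ?thesis using *[OF assms, of z] *[OF v(1), of "act w z"] v(2) by metis
qed

text \<open>A translate of \<open>L\<close> is an intersection of translates of the hyperplanes
  defining \<open>L\<close>. If it meets the ball, so does each of them, and only finitely many
  subsets of hyperplanes are then available.\<close>

lemma finite_flats: "finite {S. (\<exists>w\<in>W. S = w ` L) \<and> S \<inter> cball x R \<noteq> {}}"
proof -
  obtain \<G> where \<G>: "\<G> \<subseteq> \<H>" "L = \<Inter>\<G>" using fl unfolding flat_def by blast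
  let ?\<F> = "{H \<in> \<H>. H \<inter> cball x R \<noteq> {}}"
  have "{S. (\<exists>w\<in>W. S = w ` L) \<and> S \<inter> cball x R \<noteq> {}} \<subseteq> Inter ` Pow ?\<F>"
  proof
    fix S assume "S \<in> {S. (\<exists>w\<in>W. S = w ` L) \<and> S \<inter> cball x R \<noteq> {}}"
    then obtain w where w: "w \<in> W" "S = w ` L" "S \<inter> cball x R \<noteq> {}" by blast
    have "bij w" using W_inverse[OF w(1)] o_bij by blast
    from bij_image_INT[OF this, of "\<lambda>x. x" \<G>] have S: "S = \<Inter>((`) w ` \<G>)" using \<G>(2) w(2) by simp
    have "(`) w ` \<G> \<subseteq> ?\<F>"
    proof
      fix H assume H: "H \<in> (`) w ` \<G>"
      then have "S \<subseteq> H" using S by blast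
      then show "H \<in> ?\<F>" using H w(1,3) \<G>(1) W_stable by blast
    qed
    then show "S \<in> Inter ` Pow ?\<F>" using S by blast
  qed
  then show ?thesis using loc_fin by (meson finite_Pow_iff finite_imageI finite_subset)
qed

lemma direction_image: assumes w: "w \<in> W" shows "direction (w ` L) = lin w ` M"
proof -
  have "direction (w ` L) = {w x - w y | x y. x \<in> L \<and> y \<in> L}" by (auto simp: direction_def)
  also have "\<dots> = lin w ` M" unfolding M_def direction_def lin_diff[OF W_aff_iso[OF w]] by blast
  finally show ?thesis .
qed

section \<open>Slices\<close>

definition Stab :: "'a \<times> 'a \<Rightarrow> ('a \<Rightarrow> 'a) set" where
  "Stab z = {w \<in> W. act w z = z}"

lemma Stab_finite: "finite (Stab z)"
proof (rule finite_subset[OF _ admissible_finite[OF adm compact_sing[of "fst z"]]])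
  show "Stab z \<subseteq> {w \<in> refl_group \<H>. w ` {fst z} \<inter> {fst z} \<noteq> {}}"
    by (cases z) (auto simp: Stab_def refl_group_W complex_action_eq)
qed

text \<open>Two finiteness facts make a ball small enough: only finitely many elements bring the
  unit ball around the real part of \<open>z\<close> back to itself, and only finitely many sheets
  come near \<open>z\<close>. Elements that move \<open>z\<close> and sheets that miss it can thus
  be kept at a distance.\<close>

lemma slice:
  obtains e where "e > 0" "\<And>w u. w \<in> W \<Longrightarrow> u \<in> ball z e \<Longrightarrow> act w u \<in> ball z e \<Longrightarrow> w \<in> Stab z"
    "\<And>w u. w \<in> W \<Longrightarrow> u \<in> ball z e \<Longrightarrow> u \<in> act w ` complexify L \<Longrightarrow> z \<in> act w ` complexify L"
proof -
  let ?B = "cball (fst z) 1"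
  let ?W1 = "{w \<in> W. w ` ?B \<inter> ?B \<noteq> {}} - Stab z"
  have fin: "finite ?W1" using admissible_finite[OF adm compact_cball[of "fst z" 1]] by (simp add: refl_group_W)
  let ?E = "insert 1 ((\<lambda>w. dist (act w z) z) ` ?W1)"
  \<comment> \<open>Halved because \<open>u\<close> and \<open>act w u\<close> may both be off
    \<open>z\<close> by \<open>e1\<close>; the 1 in \<open>?E\<close> makes the minimum exist and
    keeps the ball small.\<close>
  define e1 where "e1 = Min ?E / 2"
  have finE: "finite ?E" using fin by simp
  have e1: "e1 > 0" "e1 \<le> 1" "\<And>w. w \<in> ?W1 \<Longrightarrow> 2 * e1 \<le> dist (act w z) z"
  proof -
    have "Min ?E > 0" by (subst Min_gr_iff[OF finE]) (auto simp: Stab_def)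
    moreover have "Min ?E \<le> 1" using finE by (intro Min_le) auto
    ultimately show "e1 > 0" "e1 \<le> 1" by (auto simp: e1_def)
    show "2 * e1 \<le> dist (act w z) z" if "w \<in> ?W1" for w
    proof -
      have "Min ?E \<le> dist (act w z) z" using finE that by (intro Min_le) auto
      then show ?thesis by (simp add: e1_def)
    qed
  qed
  have fst_ball: "fst u \<in> ?B" if "u \<in> ball z e1" for u
    using that e1(2) dist_fst_le[of z u] by simp
  have 1: "w \<in> Stab z" if w: "w \<in> W" "u \<in> ball z e1" "act w u \<in> ball z e1" for w u
  proof (rule ccontr)
    assume "w \<notin> Stab z"
    have "w (fst u) = fst (act w u)" by (cases u) (simp add: complex_action_eq)
    then have "w (fst u) \<in> ?B" using fst_ball[OF w(3)] by simp
    moreover have "w (fst u) \<in> w ` ?B" using fst_ball[OF w(2)] by (rule imageI)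
    ultimately have "w ` ?B \<inter> ?B \<noteq> {}" by blast
    then have "w \<in> ?W1" using w(1) \<open>w \<notin> Stab z\<close> by blast
    then have "2 * e1 \<le> dist (act w z) z" by (rule e1(3))
    also have "\<dots> \<le> dist (act w z) (act w u) + dist (act w u) z" by (rule dist_triangle)
    also have "\<dots> < 2 * e1" using w by (simp add: act_dist dist_commute)
    finally show False by simp
  qed
  let ?C = "{S. (\<exists>w\<in>W. S = act w ` complexify L) \<and> S \<inter> cball z 1 \<noteq> {} \<and> z \<notin> S}"
  have closedS: "closed (act w ` complexify L)" if w: "w \<in> W" for w
  proof -
    have "closed (w ` L)"
    proof -
      obtain v where v: "v \<in> W" "v \<circ> w = id" "w \<circ> v = id" using W_inverse[OF w] by blast
      have "w ` L = v -` L" using v(2,3) by (auto simp: fun_eq_iff) (metis imageI)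
      moreover have "continuous_on UNIV v"
        using aff_iso_dist[OF W_aff_iso[OF v(1)]] unfolding continuous_on_iff by metis
      ultimately show ?thesis using L_closed by (simp add: closed_vimage)
    qed
    moreover have "closed (lin w ` M)"
      using M_subspace lin_linear[OF W_aff_iso[OF w]] by (intro closed_subspace) (simp add: linear_subspace_image)
    ultimately show ?thesis unfolding sheet_eq[OF w] by (rule closed_Times)
  qed
  have finC: "finite ?C"
  proof -
    \<comment> \<open>A sheet is the product of a translate of \<open>L\<close> with its direction,
      so finitely many translates give finitely many sheets.\<close>
    define T where "T = {S. (\<exists>w\<in>W. S = w ` L) \<and> S \<inter> cball (fst z) 1 \<noteq> {}}"
    have "?C \<subseteq> (\<lambda>(A, B). A \<times> B) ` (T \<times> direction ` T)"
    proof
      fix S assume "S \<in> ?C"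
      then obtain w u where w: "w \<in> W" "S = act w ` complexify L" "u \<in> S" "u \<in> cball z 1" by blast
      have "fst u \<in> w ` L" using w sheet_eq[OF w(1)] by auto
      moreover have "fst u \<in> cball (fst z) 1" using w(4) dist_fst_le[of z u] by simp
      ultimately have T: "w ` L \<in> T" using w(1) unfolding T_def by blast
      have "lin w ` M = direction (w ` L)" using direction_image[OF w(1)] by simp
      then have "(w ` L, lin w ` M) \<in> T \<times> direction ` T" using T by simp
      then have "(\<lambda>(A, B). A \<times> B) (w ` L, lin w ` M) \<in> (\<lambda>(A, B). A \<times> B) ` (T \<times> direction ` T)"
        by (rule imageI)
      then show "S \<in> (\<lambda>(A, B). A \<times> B) ` (T \<times> direction ` T)"
        using w(2) sheet_eq[OF w(1)] by simp
    qed
    moreover have "finite T" unfolding T_def by (rule finite_flats)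
    ultimately show ?thesis by (meson finite_SigmaI finite_imageI finite_subset)
  qed
  have "closed (\<Union>?C)" using finC closedS by (intro closed_Union) auto
  then have "open (- \<Union>?C)" by (rule open_Compl)
  moreover have "z \<in> - \<Union>?C" by blast
  ultimately obtain e2 where e2: "e2 > 0" "ball z e2 \<subseteq> - \<Union>?C" using openE by blast
  show ?thesis
  proof (rule that[of "min e1 e2"])
    show "min e1 e2 > 0" using e1 e2 by simp
    show "w \<in> Stab z" if "w \<in> W" "u \<in> ball z (min e1 e2)" "act w u \<in> ball z (min e1 e2)" for w u
      using 1[of w u] that by simp
    show "z \<in> act w ` complexify L" if "w \<in> W" "u \<in> ball z (min e1 e2)" "u \<in> act w ` complexify L" for w u
    proof (rule ccontr)
      assume "z \<notin> act w ` complexify L"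
      moreover have "u \<in> cball z 1" using that(2) e1(2) by simp
      ultimately have "act w ` complexify L \<in> ?C" using that(1,3) by blast
      then have "u \<in> \<Union>?C" using that(3) by (rule UnionI)
      moreover have "u \<in> ball z e2" using that(2) by simp
      ultimately show False using subsetD[OF e2(2)] by blast
    qed
  qed
qed

lemma orbit_nhd_open: "openin X (refl_orbit \<H> ` (translates \<H> L \<inter> ball z d))"
  unfolding openin_stratum
proof
  have "{u \<in> translates \<H> L. refl_orbit \<H> u \<in> refl_orbit \<H> ` (translates \<H> L \<inter> ball z d)} =
      translates \<H> L \<inter> (\<Union>w\<in>W. act w -` ball z d)"
  proof (intro equalityI subsetI)
    fix u assume "u \<in> {u \<in> translates \<H> L. refl_orbit \<H> u \<in> refl_orbit \<H> ` (translates \<H> L \<inter> ball z d)}"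
    then obtain u' where u': "u \<in> translates \<H> L" "u' \<in> ball z d" "refl_orbit \<H> u' = refl_orbit \<H> u" by auto
    obtain w where "w \<in> W" "u' = act w u" using orbit_eqD[OF u'(3)] by blast
    then have "w \<in> W" "u \<in> act w -` ball z d" using u'(2) by auto
    then show "u \<in> translates \<H> L \<inter> (\<Union>w\<in>W. act w -` ball z d)" using u'(1) by blast
  next
    fix u assume "u \<in> translates \<H> L \<inter> (\<Union>w\<in>W. act w -` ball z d)"
    then obtain w where w: "u \<in> translates \<H> L" "w \<in> W" "act w u \<in> ball z d" by blast
    have "act w u \<in> translates \<H> L \<inter> ball z d" using w translates_act[OF w(2)] by blast
    then have "refl_orbit \<H> (act w u) \<in> refl_orbit \<H> ` (translates \<H> L \<inter> ball z d)" by (rule imageI)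
    then show "u \<in> {u \<in> translates \<H> L. refl_orbit \<H> u \<in> refl_orbit \<H> ` (translates \<H> L \<inter> ball z d)}"
      using w(1) by (simp only: orbit_act[OF w(2)] mem_Collect_eq simp_thms)
  qed
  moreover have "open (\<Union>w\<in>W. act w -` ball z d)"
    using hol_map_continuous_on[OF hol_map_complex_action[OF W_aff_iso]] by (intro open_UN ballI open_vimage) auto
  ultimately show "openin (top_of_set (translates \<H> L))
      {u \<in> translates \<H> L. refl_orbit \<H> u \<in> refl_orbit \<H> ` (translates \<H> L \<inter> ball z d)}"
    by (simp add: openin_open_Int)
qed blast

lemma orbit_nhd_mem: "z \<in> translates \<H> L \<Longrightarrow> d > 0 \<Longrightarrow> refl_orbit \<H> z \<in> refl_orbit \<H> ` (translates \<H> L \<inter> ball z d)"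
  by auto

text \<open>Points of one orbit inside the ball differ by elements of the stabilizer, so
  \<open>a\<close> is constant on that part of the orbit and any point chosen by \<open>SOME\<close>
  will do. At other points over the neighbourhood analyticity is transported by the group.\<close>

lemma invariant_descends:
  assumes slice: "\<And>w u. w \<in> W \<Longrightarrow> u \<in> ball z e \<Longrightarrow> act w u \<in> ball z e \<Longrightarrow> w \<in> Stab z"
    and hol: "holomorphic_EC a (ball z e)"
    and inv: "\<And>w u. w \<in> Stab z \<Longrightarrow> u \<in> ball z e \<Longrightarrow> a (act w u) = a u"
  obtains A where "A \<in> Sh (refl_orbit \<H> ` (translates \<H> L \<inter> ball z e))"
    "\<And>u. u \<in> ball z e \<Longrightarrow> A (refl_orbit \<H> u) = a u"
proof -
  define A where "A = (\<lambda>p. a (SOME u. u \<in> p \<inter> ball z e))"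
  have A: "A (refl_orbit \<H> u) = a u" if u: "u \<in> ball z e" for u
  proof -
    have "u \<in> refl_orbit \<H> u \<inter> ball z e" using u orbit_self by blast
    then have s: "(SOME u'. u' \<in> refl_orbit \<H> u \<inter> ball z e) \<in> refl_orbit \<H> u \<inter> ball z e" by (rule someI)
    then obtain w where w: "w \<in> W" "(SOME u'. u' \<in> refl_orbit \<H> u \<inter> ball z e) = act w u"
      by (auto simp: orbit_iff)
    then have "w \<in> Stab z" using slice[OF w(1) u] s by simp
    then show ?thesis unfolding A_def w(2) using inv u by blast
  qed
  have "analytic_fun {u \<in> translates \<H> L. refl_orbit \<H> u \<in> refl_orbit \<H> ` (translates \<H> L \<inter> ball z e)}
      (\<lambda>u. A (refl_orbit \<H> u))"
    unfolding analytic_fun_def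
  proof
    fix u assume "u \<in> {u \<in> translates \<H> L. refl_orbit \<H> u \<in> refl_orbit \<H> ` (translates \<H> L \<inter> ball z e)}"
    then obtain u' where "u' \<in> ball z e" "refl_orbit \<H> u' = refl_orbit \<H> u" by auto
    then obtain w where w: "w \<in> W" "act w u \<in> ball z e" using orbit_eqD by metis
    have hw: "hol_map (act w) V" for V by (rule hol_map_complex_action[OF W_aff_iso[OF w(1)]])
    have "open (act w -` ball z e)" using hol_map_continuous_on[OF hw] by (intro open_vimage) auto
    moreover have "holomorphic_EC (\<lambda>u. a (act w u)) (act w -` ball z e)"
      by (rule holomorphic_EC_compose[OF hw hol]) auto
    moreover have "A (refl_orbit \<H> v) = a (act w v)" if "v \<in> act w -` ball z e" for v
      using A[of "act w v"] orbit_act[OF w(1)] that by simp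
    ultimately show "\<exists>U g. open U \<and> u \<in> U \<and> holomorphic_EC g U \<and>
        (\<forall>v\<in>U \<inter> {u \<in> translates \<H> L. refl_orbit \<H> u \<in> refl_orbit \<H> ` (translates \<H> L \<inter> ball z e)}. A (refl_orbit \<H> v) = g v)"
      using w(2) by (intro exI[of _ "act w -` ball z e"] exI[of _ "\<lambda>u. a (act w u)"]) simp
  qed
  then show ?thesis using that A by (simp add: stratum_sheaf_def)
qed

lemma sheaf_germ:
  assumes "r \<in> Sh N" "refl_orbit \<H> z \<in> N" "z \<in> translates \<H> L"
    and N: "openin X N"
  obtains d g where "d > 0" "holomorphic_EC g (ball z d)"
    "\<And>u. u \<in> ball z d \<Longrightarrow> u \<in> translates \<H> L \<Longrightarrow> refl_orbit \<H> u \<in> N \<and> r (refl_orbit \<H> u) = g u"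
proof -
  let ?P = "{u \<in> translates \<H> L. refl_orbit \<H> u \<in> N}"
  have z: "z \<in> ?P" using assms by simp
  have "analytic_fun ?P (\<lambda>u. r (refl_orbit \<H> u))" using assms(1) by (simp add: stratum_sheaf_def)
  then obtain d g where g: "d > 0" "holomorphic_EC g (ball z d)"
    "\<And>u. u \<in> ball z d \<Longrightarrow> u \<in> ?P \<Longrightarrow> r (refl_orbit \<H> u) = g u"
    by (rule analytic_funE[OF _ z]) blast
  have "openin (top_of_set (translates \<H> L)) ?P" using N by (simp add: openin_stratum)
  then obtain d' where d': "d' > 0" "ball z d' \<inter> translates \<H> L \<subseteq> ?P"
    using z by (auto simp: openin_contains_ball)
  show ?thesis
  proof (rule that[of "min d d'"])
    show "holomorphic_EC g (ball z (min d d'))" by (rule holomorphic_EC_subset[OF g(2)]) auto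
    show "refl_orbit \<H> u \<in> N \<and> r (refl_orbit \<H> u) = g u"
      if "u \<in> ball z (min d d')" "u \<in> translates \<H> L" for u
      using g(3)[of u] d'(2) that by auto
  qed (use g d' in simp)
qed

end

section \<open>Extension of functions from a sheet\<close>

text \<open>The complex-bilinear extension of the squared norm, that is, the product of
  \<open>x + iy\<close> with itself. Unlike the norm it is holomorphic, and orthogonal maps preserve
  it.\<close>

definition csq :: "'a::euclidean_space \<times> 'a \<Rightarrow> complex" where
  "csq v = Complex (fst v \<bullet> fst v - snd v \<bullet> snd v) (2 * (fst v \<bullet> snd v))"

lemma csq_zeta: "csq v = (\<Sum>b\<in>Basis. zeta b v * zeta b v)"
  by (simp add: complex_eq_iff csq_def zeta_def euclidean_inner[of "fst v"] euclidean_inner[of "snd v"]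
      inner_commute sum_subtractf sum.distrib sum_distrib_left mult_ac)

lemma holomorphic_EC_csq: "holomorphic_EC csq U"
  unfolding csq_zeta[abs_def] by (intro holomorphic_EC_sum holomorphic_EC_mult holomorphic_EC_zeta)

lemma csq_map_prod: "orthogonal_transformation l \<Longrightarrow> csq (map_prod l l v) = csq v"
  by (cases v) (simp add: csq_def orthogonal_transformation_def)

lemma holomorphic_EC_coeff_prod:
  assumes "finite I" "\<And>j. j \<in> I \<Longrightarrow> holomorphic_EC (h j) U"
  shows "holomorphic_EC (\<lambda>u. coeff (\<Prod>j\<in>I. [:- h j u, 1:]) i) U"
  using assms
proof (induction I arbitrary: i rule: finite_induct)
  case empty
  show ?case by simp
next
  case (insert j I)
  have IH: "holomorphic_EC (\<lambda>u. coeff (\<Prod>j\<in>I. [:- h j u, 1:]) k) U" for k using insert by simp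
  have "holomorphic_EC (\<lambda>u. - h j u * coeff (\<Prod>j\<in>I. [:- h j u, 1:]) i +
      (case i of 0 \<Rightarrow> 0 | Suc k \<Rightarrow> coeff (\<Prod>j\<in>I. [:- h j u, 1:]) k)) U"
    using insert.prems by (cases i) (auto intro!: holomorphic_EC_add holomorphic_EC_diff holomorphic_EC_mult holomorphic_EC_uminus IH)
  moreover have "coeff (\<Prod>j\<in>insert j I. [:- h j u, 1:]) i = - h j u * coeff (\<Prod>j\<in>I. [:- h j u, 1:]) i +
      (case i of 0 \<Rightarrow> 0 | Suc k \<Rightarrow> coeff (\<Prod>j\<in>I. [:- h j u, 1:]) k)" for u
    using insert.hyps by (cases i) (auto simp: mult_pCons_left)
  ultimately show ?case by simp
qed

text \<open>\<open>x\<close> is a root of the monic polynomial with roots \<open>h j\<close>;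
  multiplying by \<open>b ^ card I\<close> gives the shape of \<open>integral_fraction\<close> with
  numerator \<open>x * b\<close> and denominator \<open>b\<close>.\<close>

lemma monic_prod_eq_0:
  fixes x b :: complex
  assumes I: "finite I" and j: "j \<in> I" and x: "h j = x"
  shows "(x * b) ^ card I + (\<Sum>i<card I. coeff (\<Prod>j\<in>I. [:- h j, 1:]) i * (x * b) ^ i * b ^ (card I - i)) = 0"
proof -
  let ?p = "\<Prod>j\<in>I. [:- h j, 1:]" and ?n = "card I"
  have deg: "degree ?p = ?n" by (subst degree_prod_eq_sum_degree) auto
  have lead: "coeff ?p ?n = 1" using lead_coeff_prod[of "\<lambda>j. [:- h j, 1:]" I] deg by simp
  have "poly ?p x = 0" using I j x by (auto simp: poly_prod)
  then have 0: "(\<Sum>i\<le>?n. coeff ?p i * x ^ i) = 0" by (simp add: poly_altdef deg)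
  have "(x * b) ^ ?n + (\<Sum>i<?n. coeff ?p i * (x * b) ^ i * b ^ (?n - i)) =
      b ^ ?n * (x ^ ?n + (\<Sum>i<?n. coeff ?p i * x ^ i))"
  proof -
    have "(\<Sum>i<?n. coeff ?p i * (x * b) ^ i * b ^ (?n - i)) = (\<Sum>i<?n. b ^ ?n * (coeff ?p i * x ^ i))"
    proof (intro sum.cong refl)
      fix i assume "i \<in> {..<?n}"
      then have "b ^ ?n = b ^ i * b ^ (?n - i)" by (simp flip: power_add)
      then show "coeff ?p i * (x * b) ^ i * b ^ (?n - i) = b ^ ?n * (coeff ?p i * x ^ i)"
        by (simp add: power_mult_distrib)
    qed
    moreover have "(x * b) ^ ?n = b ^ ?n * x ^ ?n" by (simp add: power_mult_distrib)
    ultimately show ?thesis by (simp only: distrib_left sum_distrib_left)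
  qed
  also have "x ^ ?n + (\<Sum>i<?n. coeff ?p i * x ^ i) = (\<Sum>i\<le>?n. coeff ?p i * x ^ i)"
    using lead by (simp add: lessThan_Suc_atMost[symmetric])
  finally show ?thesis using 0 by simp
qed

locale slice_point = arrangement \<H> L for \<H> :: "'a::euclidean_space set set" and L +
  fixes z :: "'a \<times> 'a" and e :: real
  assumes zL: "z \<in> complexify L" and e: "e > 0"
    and slice1: "\<And>w u. w \<in> W \<Longrightarrow> u \<in> ball z e \<Longrightarrow> act w u \<in> ball z e \<Longrightarrow> w \<in> Stab z"
    and slice2: "\<And>w u. w \<in> W \<Longrightarrow> u \<in> ball z e \<Longrightarrow> u \<in> act w ` complexify L \<Longrightarrow> z \<in> act w ` complexify L"
begin

text \<open>A sheet through \<open>z\<close> is determined by its direction, so the sheets are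
  indexed by these subspaces, which the stabilizer permutes through linear parts.\<close>

definition Ms :: "'a set set" where
  "Ms = {lin w ` M | w. w \<in> W \<and> z \<in> act w ` complexify L}"

lemma Stab_W: "g \<in> Stab z \<Longrightarrow> g \<in> W"
  and Stab_fix: "g \<in> Stab z \<Longrightarrow> act g z = z"
  by (auto simp: Stab_def)

lemma Stab_id: "id \<in> Stab z"
  by (simp add: Stab_def W_id complex_action_id)

lemma Stab_comp: "g \<in> Stab z \<Longrightarrow> k \<in> Stab z \<Longrightarrow> g \<circ> k \<in> Stab z"
  by (simp add: Stab_def W_comp act_comp)

lemma lin_Stab: "g \<in> Stab z \<Longrightarrow> orthogonal_transformation (lin g)"
  by (intro lin_orth W_aff_iso Stab_W)

lemma lin_Stab_comp: "g \<in> Stab z \<Longrightarrow> k \<in> Stab z \<Longrightarrow> lin (g \<circ> k) = lin g \<circ> lin k"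
  by (intro lin_comp W_aff_iso Stab_W)

lemma Stab_inverse:
  assumes "g \<in> Stab z" obtains k where "k \<in> Stab z" "k \<circ> g = id" "g \<circ> k = id"
    "\<And>u. act k (act g u) = u" "\<And>u. act g (act k u) = u" "\<And>A. lin k ` lin g ` A = A" "\<And>A. lin g ` lin k ` A = A"
proof -
  obtain k where k: "k \<in> W" "\<And>z. act k (act g z) = z" "\<And>z. act g (act k z) = z"
    "k \<circ> g = id" "g \<circ> k = id" by (rule act_inverse[OF Stab_W[OF assms]]) blast
  have "act k z = z" using k(2)[of z] by (simp only: Stab_fix[OF assms])
  then have kS: "k \<in> Stab z" using k(1) by (simp add: Stab_def)
  have "lin k \<circ> lin g = id" "lin g \<circ> lin k = id"
    by (simp_all only: lin_Stab_comp[OF kS assms, symmetric] lin_Stab_comp[OF assms kS, symmetric] k(4,5) lin_id)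
  then have "lin k ` lin g ` A = A" "lin g ` lin k ` A = A" for A by (simp_all add: image_comp)
  then show ?thesis using that kS k by blast
qed

lemma Stab_diff: "g \<in> Stab z \<Longrightarrow> act g u - z = map_prod (lin g) (lin g) (u - z)"
  using complex_action_diff[OF W_aff_iso[OF Stab_W], of g u z] by (simp add: Stab_fix)

lemma Stab_ball: "g \<in> Stab z \<Longrightarrow> act g u \<in> ball z d \<longleftrightarrow> u \<in> ball z d"
  using act_dist[OF Stab_W, of g u z] by (simp add: Stab_fix dist_commute)

lemma M_Ms: "M \<in> Ms"
proof -
  have "z \<in> act id ` complexify L" by (rule image_eqI[of z "act id" z, OF complex_action_id[of z, symmetric] zL])
  then show ?thesis unfolding Ms_def using W_id by (auto intro!: exI[of _ id] simp: lin_id)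
qed

lemma Ms_subspace: assumes "M' \<in> Ms" shows "subspace M'"
proof -
  obtain w where "w \<in> W" "M' = lin w ` M" using assms unfolding Ms_def by blast
  then show ?thesis using linear_subspace_image[OF lin_linear[OF W_aff_iso] M_subspace] by simp
qed

lemma Ms_dim: assumes "M' \<in> Ms" shows "dim M' = dim M"
proof -
  obtain w where w: "w \<in> W" "M' = lin w ` M" using assms unfolding Ms_def by blast
  show ?thesis unfolding w(2)
    by (rule dim_image_eq[OF lin_linear[OF W_aff_iso[OF w(1)]]])
      (rule inj_on_subset[OF orthogonal_transformation_inj[OF lin_orth[OF W_aff_iso[OF w(1)]]] subset_UNIV])
qed

lemma Ms_separate: assumes "M' \<in> Ms" "M'' \<in> Ms" "M' \<noteq> M''" obtains v where "v \<in> M''" "v \<notin> M'"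
proof -
  have "\<not> M'' \<subseteq> M'"
    using subspace_dim_equal[of M'' M'] assms Ms_subspace Ms_dim by auto
  then show ?thesis using that by blast
qed

lemma Ms_act: assumes k: "k \<in> Stab z" and M': "M' \<in> Ms" shows "lin k ` M' \<in> Ms"
proof -
  obtain w where w: "w \<in> W" "z \<in> act w ` complexify L" "M' = lin w ` M" using M' by (auto simp: Ms_def)
  have "z \<in> act k ` act w ` complexify L" using w(2) Stab_fix[OF k] by (metis imageI)
  then have "z \<in> act (k \<circ> w) ` complexify L" by (simp add: image_image act_comp[OF Stab_W[OF k] w(1)])
  moreover have "lin k ` M' = lin (k \<circ> w) ` M"
    by (simp add: w(3) image_image lin_comp[OF W_aff_iso[OF Stab_W[OF k]] W_aff_iso[OF w(1)]])
  ultimately show ?thesis unfolding Ms_def using W_comp[OF Stab_W[OF k] w(1)] by blast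
qed

lemma Ms_finite: "finite Ms"
proof (rule finite_subset)
  let ?T = "{S. (\<exists>w\<in>W. S = w ` L) \<and> S \<inter> cball (fst z) 0 \<noteq> {}}"
  show "Ms \<subseteq> direction ` ?T"
  proof
    fix M' assume "M' \<in> Ms"
    then obtain w where w: "w \<in> W" "z \<in> act w ` complexify L" "M' = lin w ` M" by (auto simp: Ms_def)
    have "fst z \<in> w ` L" using w(2) sheet_eq[OF w(1)] by auto
    then have "w ` L \<in> ?T" using w(1) by auto
    moreover have "M' = direction (w ` L)" using direction_image[OF w(1)] w(3) by simp
    ultimately show "M' \<in> direction ` ?T" by blast
  qed
  show "finite (direction ` ?T)" using finite_flats by blast
qed

lemma Stab_bij_Ms: assumes k: "k \<in> Stab z" shows "bij_betw ((`) (lin k)) Ms Ms"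
proof -
  obtain l where l: "l \<in> Stab z" "\<And>A. lin l ` lin k ` A = A" "\<And>A. lin k ` lin l ` A = A"
    by (rule Stab_inverse[OF k]) blast
  show ?thesis by (rule bij_betw_byWitness[of _ "(`) (lin l)"]) (use l Ms_act[OF k] Ms_act[OF l(1)] in auto)
qed

lemma slice_translates:
  assumes u: "u \<in> ball z e" shows "u \<in> translates \<H> L \<longleftrightarrow> (\<exists>M'\<in>Ms. u - z \<in> M' \<times> M')"
proof
  assume "u \<in> translates \<H> L"
  then obtain w where w: "w \<in> W" "u \<in> act w ` complexify L" by (auto simp: translates_iff)
  then show "\<exists>M'\<in>Ms. u - z \<in> M' \<times> M'"
  proof (intro bexI[of _ "lin w ` M"])
    show "u - z \<in> lin w ` M \<times> lin w ` M"
      using sheet_iff[OF w(1) slice2[OF w(1) u w(2)]] w(2) by blast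
    show "lin w ` M \<in> Ms" using w(1) slice2[OF w(1) u w(2)] unfolding Ms_def by blast
  qed
next
  assume "\<exists>M'\<in>Ms. u - z \<in> M' \<times> M'"
  then obtain M' where M': "M' \<in> Ms" "u - z \<in> M' \<times> M'" by (rule bexE)
  then obtain w where w: "w \<in> W" "z \<in> act w ` complexify L" "M' = lin w ` M"
    unfolding Ms_def by blast
  have "u \<in> act w ` complexify L" using sheet_iff[OF w(1,2)] M'(2) w(3) by simp
  then show "u \<in> translates \<H> L" using w(1) translates_iff by blast
qed

lemma z_translates: "z \<in> translates \<H> L"
  using zL LC_translates by blast

lemma L_eq: "L = (+) (fst z) ` M"
proof -
  have x: "fst z \<in> L" using zL by (auto simp: complexify_def)
  have "y \<in> L \<longleftrightarrow> y \<in> (+) (fst z) ` M" for y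
  proof -
    have "y \<in> L \<longleftrightarrow> y - fst z \<in> M" using L_translate[OF x, of "y - fst z"] by simp
    also have "\<dots> \<longleftrightarrow> y \<in> (+) (fst z) ` M" by (auto simp: image_iff intro!: bexI[of _ "y - fst z"])
    finally show ?thesis .
  qed
  then show ?thesis by blast
qed

lemma Stab_L_iff: assumes g: "g \<in> Stab z" shows "g ` L = L \<longleftrightarrow> lin g ` M = M"
proof -
  have "g (fst z) = fst z" using Stab_fix[OF g] by (cases z) (simp add: complex_action_eq)
  then have "g (fst z + m) = fst z + lin g m" for m
    using lin_diff[OF W_aff_iso[OF Stab_W[OF g]], of "fst z + m" "fst z"] by (simp add: algebra_simps)
  then have "g ` L = (+) (fst z) ` lin g ` M" by (subst L_eq) (simp add: image_image)
  then have "g ` L = L \<longleftrightarrow> (+) (fst z) ` lin g ` M = (+) (fst z) ` M" using L_eq by simp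
  also have "\<dots> \<longleftrightarrow> lin g ` M = M" by (simp add: inj_image_eq_iff)
  finally show ?thesis .
qed

text \<open>A quadratic polynomial that vanishes on the sheet with direction \<open>M'\<close>: the
  bilinear square of the component orthogonal to \<open>M'\<close>. Being built from the inner
  product, it is permuted by the stabilizer along with the sheets.\<close>

definition q :: "'a set \<Rightarrow> 'a \<times> 'a \<Rightarrow> complex" where
  "q M' u = csq ((u - z) - cproj M' (u - z))"

text \<open>\<open>P M'\<close> vanishes on every sheet except \<open>M'\<close>.\<close>

definition P :: "'a set \<Rightarrow> 'a \<times> 'a \<Rightarrow> complex" where
  "P M' u = (\<Prod>M''\<in>Ms - {M'}. q M'' u)"

lemma hol_q: "holomorphic_EC (q M') U"
proof -
  have "linear (\<lambda>x. x - proj M' x)" by (intro linear_compose_sub linear_ident linear_proj)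
  from hol_map_linear[OF this, of 0 z U]
  have "hol_map (\<lambda>u. (u - z) - cproj M' (u - z)) U"
    by (rule back_subst[of "\<lambda>f. hol_map f U"]) (auto simp: cproj_def prod_eq_iff)
  from holomorphic_EC_compose[OF this holomorphic_EC_csq[of UNIV]] show ?thesis
    unfolding q_def[abs_def] by simp
qed

lemma hol_P: "holomorphic_EC (P M') U"
  unfolding P_def[abs_def] by (intro holomorphic_EC_prod hol_q)

lemma q_sheet: "M' \<in> Ms \<Longrightarrow> u - z \<in> M' \<times> M' \<Longrightarrow> q M' u = 0"
  using cproj_id[OF Ms_subspace, of M' "u - z"] by (simp add: q_def csq_def zero_complex.code)

lemma P_sheet:
  assumes "M' \<in> Ms" "M' \<noteq> M''" "u - z \<in> M' \<times> M'" shows "P M'' u = 0"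
proof -
  have "q M' u = 0" by (rule q_sheet[OF assms(1,3)])
  then show ?thesis unfolding P_def using assms Ms_finite by (intro prod_zero) auto
qed

lemma q_invariant: assumes k: "k \<in> Stab z" and M': "M' \<in> Ms" shows "q (lin k ` M') (act k u) = q M' u"
proof -
  note l = orthogonal_transformation_linear[OF lin_Stab[OF k]]
  have "(act k u - z) - cproj (lin k ` M') (act k u - z) =
      map_prod (lin k) (lin k) ((u - z) - cproj M' (u - z))"
    unfolding Stab_diff[OF k] cproj_image[OF lin_Stab[OF k] Ms_subspace[OF M']]
    by (simp only: linear_diff[OF linear_map_prod_dup[OF l]])
  then show ?thesis by (simp only: q_def csq_map_prod[OF lin_Stab[OF k]])
qed

lemma P_invariant: assumes k: "k \<in> Stab z" and M': "M' \<in> Ms" shows "P (lin k ` M') (act k u) = P M' u"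
proof -
  have "bij_betw ((`) (lin k)) (Ms - {M'}) (Ms - {lin k ` M'})"
    using bij_betw_DiffI[OF Stab_bij_Ms[OF k], of "{M'}" "{lin k ` M'}"] M' Ms_act[OF k M'] by (simp add: bij_betw_def)
  from prod.reindex_bij_betw[OF this, of "\<lambda>M''. q M'' (act k u)", symmetric]
  show ?thesis unfolding P_def using q_invariant[OF k] by simp
qed

text \<open>All sheets have the same dimension, so \<open>M'\<close> contains a real vector outside
  any other \<open>M''\<close>, and there the square of the orthogonal component is a positive
  number. Pulling back along the projection gives entire functions, whose product cannot vanish near
  0.\<close>

lemma P_nonzero:
  assumes M': "M' \<in> Ms" and d: "d > 0"
  obtains u where "u \<in> ball z d" "u - z \<in> M' \<times> M'" "P M' u \<noteq> 0"
proof (rule ccontr)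
  assume neg: "\<not> thesis"
  define p where "p M'' v = q M'' (z + cproj M' (v - 0))" for M'' v
  have hol: "holomorphic_EC (p M'') UNIV" for M''
    using holomorphic_EC_compose[OF hol_map_linear[OF linear_proj, of z M' 0] hol_q[of M'' UNIV]]
    unfolding p_def cproj_def[symmetric] by simp
  have "\<exists>v. (\<Prod>M''\<in>Ms - {M'}. p M'' v) \<noteq> 0"
  proof (rule entire_prod_nonzero)
    fix M'' assume M'': "M'' \<in> Ms - {M'}"
    obtain v where v: "v \<in> M'" "v \<notin> M''" using Ms_separate[of M'' M'] M'' M' by blast
    have "v - proj M'' v \<noteq> 0" using v proj_mem[OF Ms_subspace, of M'' v] M'' by auto
    moreover have "cproj M' (v, 0) = (v, 0)"
      using cproj_id[OF Ms_subspace[OF M'], of "(v, 0)"] v(1) subspace_0[OF Ms_subspace[OF M']] by simp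
    ultimately have "p M'' (v, 0) \<noteq> 0"
      using linear_0[OF linear_proj[of M'']] by (simp add: p_def q_def cproj_def csq_def complex_eq_iff)
    then show "\<exists>v. p M'' v \<noteq> 0" by blast
  qed (use Ms_finite hol in simp_all)
  moreover have "(\<Prod>M''\<in>Ms - {M'}. p M'' v) = 0" for v
  proof (rule holomorphic_EC_identity[where f = "\<lambda>v. \<Prod>M''\<in>Ms - {M'}. p M'' v" and V = "ball 0 d",
        OF open_UNIV convex_UNIV _ open_ball _ _ _ UNIV_I])
    show "holomorphic_EC (\<lambda>v. \<Prod>M''\<in>Ms - {M'}. p M'' v) UNIV" by (intro holomorphic_EC_prod hol)
    fix v :: "'a \<times> 'a" assume v: "v \<in> ball 0 d"
    have "norm (cproj M' v) \<le> norm v" by (rule norm_cproj_le(1)[OF Ms_subspace[OF M']])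
    then have 1: "z + cproj M' v \<in> ball z d" using v by (simp add: dist_norm)
    have 2: "(z + cproj M' v) - z \<in> M' \<times> M'" using cproj_mem[OF Ms_subspace[OF M'], of v] by simp
    have "P M' (z + cproj M' v) = 0"
      by (rule ccontr) (rule notE[OF neg that[OF 1 2]])
    then show "(\<Prod>M''\<in>Ms - {M'}. p M'' v) = 0" by (simp add: p_def P_def)
  qed (use d in auto)
  ultimately show False by blast
qed

section \<open>Transport of functions between sheets\<close>

definition conjugator :: "'a set \<Rightarrow> ('a \<Rightarrow> 'a) \<Rightarrow> bool" where
  "conjugator M' g \<longleftrightarrow> g \<in> Stab z \<and> lin g ` M' = M"

text \<open>The function is carried from the sheet \<open>M\<close> to \<open>M'\<close> by a
  conjugating element and spread over the ball by projecting to \<open>M\<close>. The value 0 on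
  sheets not conjugate to \<open>M\<close> keeps the whole family invariant under the
  stabilizer.\<close>

definition transport :: "('a \<times> 'a \<Rightarrow> complex) \<Rightarrow> 'a set \<Rightarrow> 'a \<times> 'a \<Rightarrow> complex" where
  "transport h M' u = (if \<exists>g. conjugator M' g
     then h (z + cproj M (act (SOME g. conjugator M' g) u - z)) else 0)"

lemma conjugator_id: "conjugator M id"
  by (simp add: conjugator_def Stab_id lin_id)

lemma conjugator_comp:
  assumes k: "k \<in> Stab z" and g: "conjugator (lin k ` M') g" shows "conjugator M' (g \<circ> k)"
proof -
  have "g \<in> Stab z" "lin g ` lin k ` M' = M" using g by (auto simp: conjugator_def)
  then show ?thesis using k by (simp add: conjugator_def Stab_comp lin_Stab_comp image_comp)
qed

lemma cball_proj: "u \<in> ball z d \<Longrightarrow> z + cproj M (u - z) \<in> ball z d"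
  using norm_cproj_le(1)[OF M_subspace, of "u - z"] by (simp add: dist_norm norm_minus_commute)

lemma proj_complexify: "z + cproj M v \<in> complexify L"
  using cproj_mem[OF M_subspace] by (simp add: LC_iff[OF zL])

context
  fixes h :: "'a \<times> 'a \<Rightarrow> complex"
  assumes hol: "holomorphic_EC h (ball z e)"
    and inv: "\<And>w u. w \<in> Stab z \<Longrightarrow> lin w ` M = M \<Longrightarrow> u \<in> ball z e \<Longrightarrow> u \<in> complexify L \<Longrightarrow> h (act w u) = h u"
begin

text \<open>Two conjugators differ by an element of the stabilizer that preserves \<open>M\<close>,
  and \<open>h\<close> is invariant under those; the choice made by \<open>SOME\<close> does not
  matter.\<close>

lemma transport_eq:
  assumes g: "conjugator M' g" and u: "u \<in> ball z e"
  shows "transport h M' u = h (z + cproj M (act g u - z))"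
proof -
  define g' where "g' = (SOME g. conjugator M' g)"
  have g': "conjugator M' g'" unfolding g'_def by (rule someI[of "conjugator M'", OF g])
  have S: "g \<in> Stab z" "g' \<in> Stab z" "lin g ` M' = M" "lin g' ` M' = M"
    using g g' by (auto simp: conjugator_def)
  obtain l where l: "l \<in> Stab z" "\<And>u. act l (act g u) = u" "\<And>A. lin l ` lin g ` A = A"
    by (rule Stab_inverse[OF S(1)]) blast
  define k where "k = g' \<circ> l"
  have k: "k \<in> Stab z" unfolding k_def by (rule Stab_comp[OF S(2) l(1)])
  have kM: "lin k ` M = M"
    using l(3)[of M'] S(3,4) unfolding k_def lin_Stab_comp[OF S(2) l(1)] image_comp[symmetric] by simp
  have kg: "act k (act g u) = act g' u"
    by (simp add: k_def act_comp[OF Stab_W[OF S(2)] Stab_W[OF l(1)]] l(2))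
  let ?v = "z + cproj M (act g u - z)"
  have "act k ?v = z + map_prod (lin k) (lin k) (cproj M (act g u - z))"
    using Stab_diff[OF k, of ?v] by (metis add.commute add_diff_cancel_left' diff_add_cancel)
  also have "map_prod (lin k) (lin k) (cproj M (act g u - z)) = cproj M (map_prod (lin k) (lin k) (act g u - z))"
    using cproj_image[OF lin_Stab[OF k] M_subspace, of "act g u - z"] kM by simp
  also have "\<dots> = cproj M (act g' u - z)" using Stab_diff[OF k, of "act g u"] kg by simp
  finally have "act k ?v = z + cproj M (act g' u - z)" .
  moreover have "h (act k ?v) = h ?v"
    using inv[OF k kM cball_proj proj_complexify] Stab_ball[OF S(1)] u by simp
  ultimately show ?thesis using g by (auto simp: transport_def g'_def)
qed

lemma transport_M: "u \<in> ball z e \<Longrightarrow> u - z \<in> M \<times> M \<Longrightarrow> transport h M u = h u"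
  using transport_eq[OF conjugator_id] cproj_id[OF M_subspace, of "u - z"] by (simp add: complex_action_id)

lemma transport_invariant:
  assumes k: "k \<in> Stab z" and u: "u \<in> ball z e"
  shows "transport h (lin k ` M') (act k u) = transport h M' u"
proof (cases "\<exists>g. conjugator (lin k ` M') g")
  case True
  then obtain g where g: "conjugator (lin k ` M') g" by blast
  then have gS: "g \<in> Stab z" by (simp add: conjugator_def)
  have "act k u \<in> ball z e" using Stab_ball[OF k] u by simp
  then show ?thesis
    using transport_eq[OF g, of "act k u"] transport_eq[OF conjugator_comp[OF k g] u]
    by (simp add: act_comp[OF Stab_W[OF gS] Stab_W[OF k]])
next
  case False
  obtain l where l: "l \<in> Stab z" "\<And>A. lin l ` lin k ` A = A" by (rule Stab_inverse[OF k]) blast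
  have "\<not> conjugator M' g" for g
    using False conjugator_comp[OF l(1), of "lin k ` M'" g] l(2)[of M'] by auto
  then show ?thesis using False by (simp add: transport_def)
qed

lemma hol_transport: "holomorphic_EC (transport h M') (ball z e)"
proof (cases "\<exists>g. conjugator M' g")
  case True
  then obtain g where g: "conjugator M' g" by blast
  then have gS: "g \<in> Stab z" by (simp add: conjugator_def)
  have h1: "holomorphic_EC (\<lambda>u. h (z + cproj M (u - z))) (ball z e)"
    using holomorphic_EC_compose[OF hol_map_linear[OF linear_proj, of z M z] hol] cball_proj
    unfolding cproj_def by blast
  have h2: "holomorphic_EC (\<lambda>u. h (z + cproj M (act g u - z))) (ball z e)"
    by (rule holomorphic_EC_compose[OF hol_map_complex_action[OF W_aff_iso[OF Stab_W[OF gS]]] h1])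
      (simp only: Stab_ball[OF gS])
  show ?thesis by (rule holomorphic_EC_cong[OF open_ball _ h2]) (simp only: transport_eq[OF g])
next
  case False
  then have "transport h M' = (\<lambda>u. 0)" by (simp add: transport_def fun_eq_iff)
  then show ?thesis by simp
qed

text \<open>On the sheet \<open>M'\<close> only the summand \<open>P M'\<close> of \<open>b\<close>
  survives, so there \<open>a / b\<close> is the transported function, a root of the monic
  polynomial formed from all transported functions. Numerator, denominator and coefficients are
  invariant and give germs on the stratum; normality then makes the quotient a germ
  \<open>r\<close>, with ambient representative \<open>g\<close>.\<close>

theorem extension:
  assumes normal: "integrally_closed_domain (local_ring X Sh (refl_orbit \<H> z))"
  obtains N r d g where "openin X N" "refl_orbit \<H> z \<in> N" "r \<in> Sh N" "d > 0" "d \<le> e"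
    "holomorphic_EC g (ball z d)"
    "\<And>u. u \<in> ball z d \<Longrightarrow> u \<in> translates \<H> L \<Longrightarrow> refl_orbit \<H> u \<in> N \<and> r (refl_orbit \<H> u) = g u"
    "\<And>M' u. M' \<in> Ms \<Longrightarrow> u \<in> ball z d \<Longrightarrow> u - z \<in> M' \<times> M' \<Longrightarrow> g u = transport h M' u"
proof -
  let ?p = "refl_orbit \<H> z" and ?h = "transport h" and ?n = "card Ms" and ?B = "ball z e"
  interpret germ_ring X Sh ?p
    by (rule germ_ring_stratum) (use z_translates in \<open>simp add: topspace_stratum\<close>)
  define b a c where "b = (\<lambda>u. \<Sum>M'\<in>Ms. P M' u)" and "a = (\<lambda>u. \<Sum>M'\<in>Ms. ?h M' u * P M' u)"
    and "c = (\<lambda>i u. coeff (\<Prod>M'\<in>Ms. [:- ?h M' u, 1:]) i)"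
  have hb: "holomorphic_EC b ?B" unfolding b_def by (intro holomorphic_EC_sum hol_P)
  have ha: "holomorphic_EC a ?B" unfolding a_def by (intro holomorphic_EC_sum holomorphic_EC_mult hol_P hol_transport)
  have hc: "holomorphic_EC (c i) ?B" for i unfolding c_def by (rule holomorphic_EC_coeff_prod[OF Ms_finite hol_transport])
  have ib: "b (act k u) = b u" if k: "k \<in> Stab z" for k u
    using sum.reindex_bij_betw[OF Stab_bij_Ms[OF k], of "\<lambda>M'. P M' (act k u)"]
    by (simp add: b_def P_invariant[OF k])
  have ia: "a (act k u) = a u" if k: "k \<in> Stab z" and u: "u \<in> ?B" for k u
    using sum.reindex_bij_betw[OF Stab_bij_Ms[OF k], of "\<lambda>M'. ?h M' (act k u) * P M' (act k u)"]
    by (simp add: a_def P_invariant[OF k] transport_invariant[OF k u])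
  have ic: "c i (act k u) = c i u" if k: "k \<in> Stab z" and u: "u \<in> ?B" for k u i
    using prod.reindex_bij_betw[OF Stab_bij_Ms[OF k], of "\<lambda>M'. [:- ?h M' (act k u), 1:]"]
    by (simp add: c_def transport_invariant[OF k u])
  have sb: "b u = P M' u" if "M' \<in> Ms" "u - z \<in> M' \<times> M'" for M' u
  proof -
    have "b u = (\<Sum>M''\<in>{M'}. P M'' u)"
      unfolding b_def by (rule sum.mono_neutral_right) (use that Ms_finite P_sheet[OF that(1) _ that(2)] in auto)
    then show ?thesis by simp
  qed
  have sa: "a u = ?h M' u * b u" if "M' \<in> Ms" "u - z \<in> M' \<times> M'" for M' u
  proof -
    have "a u = (\<Sum>M''\<in>{M'}. ?h M'' u * P M'' u)"
      unfolding a_def by (rule sum.mono_neutral_right) (use that Ms_finite P_sheet[OF that(1) _ that(2)] in auto)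
    then show ?thesis using sb[OF that] by simp
  qed
  let ?N = "refl_orbit \<H> ` (translates \<H> L \<inter> ?B)"
  have N: "openin X ?N" "?p \<in> ?N" using orbit_nhd_open orbit_nhd_mem[OF z_translates e] by blast+
  obtain B where B: "B \<in> Sh ?N" "\<And>u. u \<in> ?B \<Longrightarrow> B (refl_orbit \<H> u) = b u"
    by (rule invariant_descends[OF slice1 hb ib]) blast+
  obtain A where A: "A \<in> Sh ?N" "\<And>u. u \<in> ?B \<Longrightarrow> A (refl_orbit \<H> u) = a u"
    by (rule invariant_descends[OF slice1 ha ia]) blast+
  have "\<exists>C. C \<in> Sh ?N \<and> (\<forall>u\<in>?B. C (refl_orbit \<H> u) = c i u)" for i
    by (rule invariant_descends[OF slice1 hc[of i] ic]) blast+
  then obtain C where C: "\<And>i. C i \<in> Sh ?N" "\<And>i u. u \<in> ?B \<Longrightarrow> C i (refl_orbit \<H> u) = c i u"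
    by metis
  have car: "f \<in> carrier R" if "f \<in> Sh ?N" for f using that N unfolding R_carrier by blast
  \<comment> \<open>On the sheet \<open>M\<close> there are points arbitrarily close to
    \<open>z\<close> at which \<open>b\<close> is nonzero.\<close>
  have "B \<notin> I"
  proof
    assume "B \<in> I"
    then obtain U where U: "openin X U" "?p \<in> U" "\<forall>x\<in>U. B x = 0" by (auto simp: vanishing_nhd)
    have "(\<lambda>x. 0) \<in> Sh U" using F_const[OF U(1)] .
    then obtain d g where d: "d > 0" "holomorphic_EC g (ball z d)"
      "\<And>u. u \<in> ball z d \<Longrightarrow> u \<in> translates \<H> L \<Longrightarrow> refl_orbit \<H> u \<in> U \<and> 0 = g u"
      by (rule sheaf_germ[OF _ U(2) z_translates U(1)]) blast
    have "min d e > 0" using d e by simp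
    from P_nonzero[OF M_Ms this] obtain u where u: "u \<in> ball z (min d e)" "u - z \<in> M \<times> M" "P M u \<noteq> 0" .
    have "u \<in> translates \<H> L" using u M_Ms slice_translates[of u] by auto
    then have "B (refl_orbit \<H> u) = 0" using U(3) d(3)[of u] u(1) by auto
    then show False using B(2)[of u] u sb[OF M_Ms u(2)] by simp
  qed
  moreover have "(\<lambda>x. A x ^ ?n + (\<Sum>i<?n. C i x * A x ^ i * B x ^ (?n - i))) \<in> I"
    unfolding vanishing_nhd
  proof (intro exI[of _ ?N] conjI N ballI)
    fix x assume "x \<in> ?N"
    then obtain u where u: "x = refl_orbit \<H> u" "u \<in> translates \<H> L" "u \<in> ?B" by blast
    from slice_translates[OF u(3)] u(2) obtain M' where M': "M' \<in> Ms" "u - z \<in> M' \<times> M'" by auto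
    show "A x ^ ?n + (\<Sum>i<?n. C i x * A x ^ i * B x ^ (?n - i)) = 0"
      using monic_prod_eq_0[OF Ms_finite M'(1), of "\<lambda>M'. ?h M' u" "?h M' u" "b u"]
      by (simp only: u(1) A(2)[OF u(3)] B(2)[OF u(3)] C(2)[OF u(3)] sa[OF M'] c_def)
  qed
  ultimately have "\<exists>r\<in>carrier R. (\<lambda>x. A x - r x * B x) \<in> I"
    by (rule integrally_closedD[OF normal car[OF A(1)] car[OF B(1)] _ car[OF C(1)]])
  then obtain r where r0: "r \<in> carrier R" "(\<lambda>x. A x - r x * B x) \<in> I" by (rule bexE)
  obtain N1 where r1: "openin X N1" "?p \<in> N1" "r \<in> Sh N1" using r0(1) unfolding R_carrier by (elim exE conjE)
  obtain N2 where r2: "openin X N2" "?p \<in> N2" "\<forall>x\<in>N2. A x - r x * B x = 0"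
    using r0(2) unfolding vanishing_nhd by (elim exE conjE)
  note r = r1 r2
  have N12: "openin X (N1 \<inter> N2)" "?p \<in> N1 \<inter> N2" using r by auto
  have rS: "r \<in> Sh (N1 \<inter> N2)" by (rule F_restrict[OF r(3) N12(1)]) blast
  obtain d0 g where d0: "d0 > 0" "holomorphic_EC g (ball z d0)"
    "\<And>u. u \<in> ball z d0 \<Longrightarrow> u \<in> translates \<H> L \<Longrightarrow> refl_orbit \<H> u \<in> N1 \<inter> N2 \<and> r (refl_orbit \<H> u) = g u"
    by (rule sheaf_germ[OF rS N12(2) z_translates N12(1)]) blast
  define d where "d = min d0 e"
  have d: "d > 0" "d \<le> e" "ball z d \<subseteq> ball z d0" "ball z d \<subseteq> ?B" using d0 e by (auto simp: d_def)
  \<comment> \<open>The two sides agree where \<open>P M'\<close> does not vanish. Composing with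
    the projection to the sheet turns this into a product identity on a ball, where there are no
    zero divisors.\<close>
  have sheet: "g u = ?h M' u" if M': "M' \<in> Ms" and u: "u \<in> ball z d" "u - z \<in> M' \<times> M'" for M' u
  proof -
    let ?\<pi> = "\<lambda>u. z + cproj M' (u - z)"
    have pi_ball: "?\<pi> u \<in> ball z d" if "u \<in> ball z d" for u
      using norm_cproj_le(1)[OF Ms_subspace[OF M'], of "u - z"] that by (simp add: dist_norm norm_minus_commute)
    have pi_id: "?\<pi> u = u" if "u - z \<in> M' \<times> M'" for u using cproj_id[OF Ms_subspace[OF M'] that] by simp
    have hpi: "holomorphic_EC (\<lambda>u. f (?\<pi> u)) (ball z d)" if "holomorphic_EC f (ball z d)" for f
      using holomorphic_EC_compose[OF hol_map_linear[OF linear_proj, of z M' z] that] pi_ball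
      unfolding cproj_def by blast
    have h1: "holomorphic_EC (\<lambda>u. P M' (?\<pi> u)) (ball z d)" by (rule hpi[OF hol_P])
    have h2: "holomorphic_EC (\<lambda>u. ?h M' (?\<pi> u) - g (?\<pi> u)) (ball z d)"
      by (intro holomorphic_EC_diff hpi holomorphic_EC_subset[OF hol_transport d(4)] holomorphic_EC_subset[OF d0(2) d(3)])
    obtain u0 where u0: "u0 \<in> ball z d" "u0 - z \<in> M' \<times> M'" "P M' u0 \<noteq> 0"
      by (rule P_nonzero[OF M' d(1)])
    have 0: "P M' (?\<pi> u) * (?h M' (?\<pi> u) - g (?\<pi> u)) = 0" if "u \<in> ball z d" for u
    proof -
      let ?u = "?\<pi> u"
      have u: "?u \<in> ball z d" "?u - z \<in> M' \<times> M'" using pi_ball[OF that] cproj_mem[OF Ms_subspace[OF M']] by auto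
      have uB: "?u \<in> ?B" "?u \<in> ball z d0" using u(1) d by auto
      have "?u \<in> translates \<H> L" by (rule iffD2[OF slice_translates[OF uB(1)]]) (rule bexI, rule u(2), rule M')
      then have "refl_orbit \<H> ?u \<in> N2" "r (refl_orbit \<H> ?u) = g ?u" using d0(3)[OF uB(2)] by auto
      then have "a ?u - g ?u * b ?u = 0" using r(6) A(2)[OF uB(1)] B(2)[OF uB(1)] by auto
      then show ?thesis unfolding sa[OF M' u(2)] sb[OF M' u(2)] by (simp add: algebra_simps)
    qed
    have nz: "P M' (?\<pi> u0) \<noteq> 0" using pi_id[OF u0(2)] u0(3) by simp
    have "?h M' (?\<pi> u) - g (?\<pi> u) = 0"
      by (rule holomorphic_EC_no_zero_divisors[OF open_ball convex_ball h1 h2 0 u0(1) nz u(1)])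
    then show ?thesis using pi_id[OF u(2)] by simp
  qed
  show ?thesis
  proof (rule that[OF N12 rS d(1,2) holomorphic_EC_subset[OF d0(2) d(3)] _ sheet])
    show "refl_orbit \<H> u \<in> N1 \<inter> N2 \<and> r (refl_orbit \<H> u) = g u" if "u \<in> ball z d" "u \<in> translates \<H> L" for u
      using d0(3)[of u] that d(3) by blast
  qed
qed

end

text \<open>The constant function 1 on the sheet \<open>M\<close>, extended by 0 to the sheets not conjugate to it,
  is integral over the local ring.\<close>

corollary sheets_conjugate:
  assumes normal: "integrally_closed_domain (local_ring X Sh (refl_orbit \<H> z))" and M': "M' \<in> Ms"
  shows "\<exists>g\<in>Stab z. lin g ` M' = M"
proof -
  let ?h = "transport (\<lambda>u. 1)"
  obtain d g where d: "d > 0" "\<And>M' u. M' \<in> Ms \<Longrightarrow> u \<in> ball z d \<Longrightarrow> u - z \<in> M' \<times> M' \<Longrightarrow> g u = ?h M' u"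
    by (rule extension[OF holomorphic_EC_const[of 1] refl normal]) blast
  \<comment> \<open>All sheets pass through \<open>z\<close>, where \<open>g\<close> has a single
    value.\<close>
  have "?h M' z = ?h M z"
    using d(2)[OF M', of z] d(2)[OF M_Ms, of z] d(1) Ms_subspace[OF M'] M_subspace by (simp add: subspace_0 zero_prod_def)
  also have "\<dots> = 1" using conjugator_id by (auto simp: transport_def)
  finally show ?thesis by (auto simp: transport_def conjugator_def split: if_splits)
qed

end

section \<open>Reflections of the flat\<close>

lemma sep_affine_section:
  assumes "affine_hyperplane H" "affine_hyperplane H'" "x \<in> L" "y \<in> L"
    and aff: "\<And>s t :: real. s + t = 1 \<Longrightarrow> s *\<^sub>R x + t *\<^sub>R y \<in> L" and eq: "\<And>y. y \<in> L \<Longrightarrow> y \<in> H \<longleftrightarrow> y \<in> H'"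
  shows "sep H x y \<longleftrightarrow> sep H' x y"
proof -
  have "closed_segment x y \<subseteq> L"
    using aff by (auto simp: closed_segment_def)
  then have "closed_segment x y \<inter> H = closed_segment x y \<inter> H'" using eq by blast
  then show ?thesis using assms by (simp add: sep_def)
qed

lemma refl_fix_iff: "a \<noteq> 0 \<Longrightarrow> refl a x = x \<longleftrightarrow> a \<bullet> x = 0"
  by (simp add: refl_def)

lemma lin_orth_reflection:
  assumes "a \<noteq> 0" "H = {x. a \<bullet> x = b}" shows "lin (orth_reflection H) = refl a"
proof
  fix x
  have "affine_hyperplane H" using assms by (auto simp: affine_hyperplane_def)
  then obtain p where p: "p \<in> H" using affine_hyperplane_facts(3) by blast
  show "lin (orth_reflection H) x = refl a x"
    unfolding lin_def orth_reflection_refl[OF assms(1) p assms(2)]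
    by (simp add: refl_def inner_diff_right diff_divide_distrib algebra_simps)
qed

lemma (in coxeter) coxeter_subfamily: "coxeter {H \<in> \<H>. A \<subseteq> H}"
proof
  show "affine_hyperplane H" if "H \<in> {H \<in> \<H>. A \<subseteq> H}" for H using that hyper by blast
  show "orth_reflection H ` K \<in> {H \<in> \<H>. A \<subseteq> H}" if H: "H \<in> {H \<in> \<H>. A \<subseteq> H}" and K: "K \<in> {H \<in> \<H>. A \<subseteq> H}" for H K
  proof -
    have "A \<subseteq> orth_reflection H ` K"
    proof
      fix x assume "x \<in> A"
      then have "orth_reflection H x = x" "x \<in> K" using H K orth_reflection_fix[OF hyper, of H x] by auto
      then show "x \<in> orth_reflection H ` K" by (metis imageI)
    qed
    then show ?thesis using stable H K by blast
  qed
  show "finite {H \<in> {H \<in> \<H>. A \<subseteq> H}. H \<inter> cball x R \<noteq> {}}" for x R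
    by (rule finite_subset[OF _ loc_fin[of x R]]) blast
qed

context arrangement
begin

lemma not_sep_self: "\<not> sep H x x"
  by (auto simp: sep_def)

lemma point_stabilizer: assumes "w \<in> W" "w x = x" shows "w \<in> compositions (orth_reflection ` {H \<in> \<H>. x \<in> H})"
  by (rule stabilizer_generated[OF assms(1)]) (simp add: assms(2) not_sep_self)

text \<open>Fixing the point with real part \<open>x\<close> and imaginary part \<open>y\<close>
  means fixing \<open>x\<close> and \<open>x + y\<close>. The stabilizer theorem is applied first to
  the whole arrangement and then to the hyperplanes through \<open>x\<close>.\<close>

lemma Stab_generated:
  assumes w: "w \<in> Stab z"
  shows "w \<in> compositions (orth_reflection ` {H \<in> \<H>. {fst z, fst z + snd z} \<subseteq> H})"
proof -
  obtain x y where z: "z = (x, y)" by (cases z)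
  have wx: "w \<in> W" "w x = x" "lin w y = y" using w by (auto simp: Stab_def z complex_action_eq)
  have wxy: "w (x + y) = x + y" using lin_diff[OF W_aff_iso[OF wx(1)], of "x + y" x] wx by (simp add: algebra_simps)
  have "coxeter {H \<in> \<H>. {x} \<subseteq> H}" by (rule coxeter_subfamily)
  then interpret c: coxeter "{H \<in> \<H>. x \<in> H}" by simp
  have "w \<in> c.W" unfolding c.W_def by (rule point_stabilizer[OF wx(1,2)])
  then have "w \<in> compositions (orth_reflection ` {H \<in> {H \<in> \<H>. x \<in> H}. x + y \<in> H})"
    by (rule c.stabilizer_generated) (simp add: wxy not_sep_self)
  moreover have "{H \<in> {H \<in> \<H>. x \<in> H}. x + y \<in> H} = {H \<in> \<H>. {fst z, fst z + snd z} \<subseteq> H}"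
    by (auto simp: z)
  ultimately show ?thesis by simp
qed

lemma slice_point_exists:
  assumes "z \<in> complexify L" obtains e where "slice_point \<H> L z e"
proof -
  obtain e where e: "e > 0" "\<And>w u. w \<in> W \<Longrightarrow> u \<in> ball z e \<Longrightarrow> act w u \<in> ball z e \<Longrightarrow> w \<in> Stab z"
    "\<And>w u. w \<in> W \<Longrightarrow> u \<in> ball z e \<Longrightarrow> u \<in> act w ` complexify L \<Longrightarrow> z \<in> act w ` complexify L"
    by (rule slice[of z]) (rule that)
  have "slice_point \<H> L z e"
    unfolding slice_point_def slice_point_axioms_def using arrangement_axioms assms e by blast
  then show ?thesis by (rule that)
qed

text \<open>At a generic point \<open>b\<close> of \<open>L \<inter> H\<close> all elements of the stabilizer fix \<open>L \<inter> H\<close>. If none of them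
  reflected \<open>L\<close>, the coordinate \<open>\<nu>\<close> normal to \<open>L \<inter> H\<close> would be invariant, and would extend to an
  analytic function \<open>g\<close> near \<open>b\<close> whose derivative at \<open>b\<close> along the orbit of \<open>\<nu>\<close> is constant and nonzero.
  But the sum of that orbit is zero.\<close>

theorem L_reflection:
  assumes normal: "normal_variety X Sh" and H: "H \<in> \<H>" "L \<inter> H \<noteq> {}" "\<not> L \<subseteq> H"
  obtains \<nu> \<beta> w where "\<nu> \<in> M" "\<nu> \<noteq> 0" "w \<in> W" "\<And>y. y \<in> L \<Longrightarrow> y \<in> H \<longleftrightarrow> \<nu> \<bullet> y = \<beta>"
    "\<And>y. y \<in> L \<Longrightarrow> w y = orth_reflection {y. \<nu> \<bullet> y = \<beta>} y"
proof (rule ccontr)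
  assume "\<not> thesis"
  then have neg: "\<not> (w \<in> W \<and> \<nu> \<in> M \<and> \<nu> \<noteq> 0 \<and> (\<forall>y\<in>L. y \<in> H \<longleftrightarrow> \<nu> \<bullet> y = \<beta>) \<and>
    (\<forall>y\<in>L. w y = orth_reflection {y. \<nu> \<bullet> y = \<beta>} y))" for \<nu> \<beta> w
    using that by blast
  obtain a c where ac: "a \<noteq> 0" "H = {x. a \<bullet> x = c}" using hyper[OF H(1)] by (auto simp: affine_hyperplane_def)
  obtain b0 where b0: "b0 \<in> L" "b0 \<in> H" using H by blast
  \<comment> \<open>The normal of \<open>L \<inter> H\<close> inside \<open>L\<close>; it is nonzero
    since \<open>H\<close> meets \<open>L\<close> without containing it.\<close>
  define \<nu> where "\<nu> = proj M a"
  have \<nu>M: "\<nu> \<in> M" unfolding \<nu>_def by (rule proj_mem[OF M_subspace])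
  have am: "a \<bullet> m = \<nu> \<bullet> m" if "m \<in> M" for m
    using inner_diff_proj[OF M_subspace that, of a] by (simp add: \<nu>_def inner_diff_right inner_commute)
  have LH: "y \<in> H \<longleftrightarrow> \<nu> \<bullet> y = \<nu> \<bullet> b0" if "y \<in> L" for y
  proof -
    have "y - b0 \<in> M" using L_translate[OF b0(1), of "y - b0"] that by simp
    then have "a \<bullet> y - a \<bullet> b0 = \<nu> \<bullet> y - \<nu> \<bullet> b0" using am[of "y - b0"] by (simp add: inner_diff_right)
    then show ?thesis using b0(2) ac(2) by auto
  qed
  have \<nu>0: "\<nu> \<noteq> 0" using LH H(3) by auto
  define K0 where "K0 = {m \<in> M. \<nu> \<bullet> m = 0}"
  have K0: "subspace K0" unfolding K0_def using M_subspace
    by (auto simp: subspace_def inner_add_right)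
  have K: "y \<in> L \<inter> H \<longleftrightarrow> y - k \<in> K0" if "k \<in> L" "k \<in> H" for y k
  proof -
    have "y \<in> L \<longleftrightarrow> y - k \<in> M" using L_translate[OF that(1), of "y - k"] by simp
    moreover have "y \<in> H \<longleftrightarrow> \<nu> \<bullet> (y - k) = 0" if "y \<in> L"
      using LH[OF that] LH[OF \<open>k \<in> L\<close>] \<open>k \<in> H\<close> by (simp add: inner_diff_right)
    ultimately show ?thesis unfolding K0_def by blast
  qed
  have "H' \<in> \<H> \<and> (\<exists>m\<in>K0. b0 + m \<notin> H')" if H': "H' \<in> {H' \<in> \<H>. \<not> L \<inter> H \<subseteq> H'}" for H'
  proof -
    obtain y where y: "y \<in> L \<inter> H" "y \<notin> H'" using H' by blast
    then show ?thesis using K[OF b0, of y] H' by (auto intro!: bexI[of _ "y - b0"])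
  qed
  then obtain k where k: "k \<in> K0" "norm k < 1" "\<And>H'. H' \<in> {H' \<in> \<H>. \<not> L \<inter> H \<subseteq> H'} \<Longrightarrow> b0 + k \<notin> H'"
    by (rule generic_flat_point[OF K0 zero_less_one, where \<G> = "{H' \<in> \<H>. \<not> L \<inter> H \<subseteq> H'}"]) (assumption, rule that)
  define b where "b = b0 + k"
  have b: "b \<in> L" "b \<in> H" using K[OF b0, of b] k(1) by (auto simp: b_def)
  have bH: "L \<inter> H \<subseteq> H'" if "H' \<in> \<H>" "b \<in> H'" for H' using k(3)[of H'] that by (auto simp: b_def)
  define z where "z = (b, 0::'a)"
  have zL: "z \<in> complexify L"
    using b(1) subspace_0[OF M_subspace] by (simp add: z_def complexify_def M_def[symmetric])
  obtain e where "slice_point \<H> L z e" by (rule slice_point_exists[OF zL])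
  then interpret slice_point \<H> L z e .
  have wb: "w b = b" if "w \<in> Stab z" for w using Stab_fix[OF that] by (simp add: z_def complex_action_eq)
  have wK: "w y = y" if w: "w \<in> Stab z" and y: "y \<in> L \<inter> H" for w y
  proof -
    have "w \<in> compositions (orth_reflection ` {H \<in> \<H>. b \<in> H})" by (rule point_stabilizer[OF Stab_W[OF w] wb[OF w]])
    moreover have "{H \<in> \<H>. b \<in> H} \<subseteq> {H \<in> \<H>. y \<in> H}" using bH y by blast
    ultimately have "w \<in> compositions (orth_reflection ` {H \<in> \<H>. y \<in> H})"
      by (rule compositions_mono[OF _ image_mono])
    then show ?thesis by (rule compositions_fix)
  qed
  have lK: "lin w m = m" if w: "w \<in> Stab z" and m: "m \<in> K0" for w m
  proof -
    have "b + m \<in> L \<inter> H" using K[OF b, of "b + m"] m by simp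
    then show ?thesis
      using lin_diff[OF W_aff_iso[OF Stab_W[OF w]], of "b + m" b] wb[OF w] wK[OF w] by simp
  qed
  \<comment> \<open>Such an element fixes \<open>K0\<close>, so it multiplies \<open>\<nu>\<close>
    by 1 or -1; with -1 it would be the reflection that \<open>neg\<close> excludes.\<close>
  have l\<nu>: "lin w \<nu> = \<nu>" if w: "w \<in> Stab z" "lin w ` M = M" for w
  proof (rule ccontr)
    assume ne: "lin w \<nu> \<noteq> \<nu>"
    note lin = orthogonal_transformation_linear[OF lin_Stab[OF w(1)]]
    have inn: "lin w x \<bullet> lin w y = x \<bullet> y" for x y using lin_Stab[OF w(1)] by (simp add: orthogonal_transformation_def)
    have lM: "lin w \<nu> \<in> M" using w(2) \<nu>M by blast
    define t where "t = (\<nu> \<bullet> lin w \<nu>) / (\<nu> \<bullet> \<nu>)"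
    define m where "m = lin w \<nu> - t *\<^sub>R \<nu>"
    have "m \<in> M" unfolding m_def using lM \<nu>M M_subspace by (simp add: subspace_diff subspace_scale)
    moreover have "\<nu> \<bullet> m = 0" using \<nu>0 by (simp add: m_def t_def inner_diff_right)
    ultimately have mK: "m \<in> K0" by (simp add: K0_def)
    have "m \<bullet> lin w \<nu> = m \<bullet> \<nu>" using inn[of m \<nu>] lK[OF w(1) mK] by simp
    then have "m \<bullet> m = 0" using \<open>\<nu> \<bullet> m = 0\<close>
      by (subst m_def) (simp add: inner_diff_right inner_diff_left inner_commute)
    then have lt: "lin w \<nu> = t *\<^sub>R \<nu>" by (simp add: m_def)
    have "t * t * (\<nu> \<bullet> \<nu>) = \<nu> \<bullet> \<nu>" using inn[of \<nu> \<nu>] by (simp add: lt)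
    then have "t * t = 1" using \<nu>0 by simp
    then have "t = 1 \<or> t = -1" by (simp add: square_eq_1_iff)
    then have lneg: "lin w \<nu> = - \<nu>" using lt ne by auto
    have "w y = orth_reflection {y. \<nu> \<bullet> y = \<nu> \<bullet> b0} y" if y: "y \<in> L" for y
    proof -
      define s where "s = (\<nu> \<bullet> (y - b)) / (\<nu> \<bullet> \<nu>)"
      have yM: "y - b \<in> M" using L_translate[OF b(1), of "y - b"] y by simp
      have "y - b - s *\<^sub>R \<nu> \<in> K0"
        using subspace_diff[OF M_subspace yM subspace_scale[OF M_subspace \<nu>M]] \<nu>0
        by (simp add: K0_def s_def inner_diff_right)
      then have "lin w (y - b - s *\<^sub>R \<nu>) = y - b - s *\<^sub>R \<nu>" by (rule lK[OF w(1)])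
      then have eq: "lin w (y - b) - s *\<^sub>R (- \<nu>) = y - b - s *\<^sub>R \<nu>"
        by (simp only: linear_diff[OF lin, of "y - b"] linear_scale[OF lin] lneg)
      have "(2 * s) *\<^sub>R \<nu> = s *\<^sub>R \<nu> + s *\<^sub>R \<nu>" by (metis mult_2 scaleR_add_left)
      then have "lin w (y - b) = y - b - (2 * s) *\<^sub>R \<nu>" using eq by (simp add: eq_diff_eq diff_eq_eq add.assoc)
      then have "w y = b + refl \<nu> (y - b)"
        using lin_diff[OF W_aff_iso[OF Stab_W[OF w(1)]], of y b] wb[OF w(1)] by (simp add: refl_def s_def algebra_simps)
      moreover have "b \<in> {y. \<nu> \<bullet> y = \<nu> \<bullet> b0}" using LH[OF b(1)] b(2) by simp
      then have "orth_reflection {y. \<nu> \<bullet> y = \<nu> \<bullet> b0} y = b + refl \<nu> (y - b)"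
        by (rule orth_reflection_refl[OF \<nu>0 _ refl])
      ultimately show ?thesis by simp
    qed
    then show False using neg[of w \<nu> "\<nu> \<bullet> b0"] Stab_W[OF w(1)] \<nu>M \<nu>0 LH by blast
  qed
  let ?h = "\<lambda>u. zeta \<nu> (u - z)"
  have hol: "holomorphic_EC ?h (ball z e)"
    by (simp only: linear_diff[OF zeta_linear]) (intro holomorphic_EC_diff holomorphic_EC_zeta holomorphic_EC_const)
  have inv: "?h (act w u) = ?h u" if w: "w \<in> Stab z" "lin w ` M = M" for w u
  proof -
    have "\<nu> \<bullet> lin w x = \<nu> \<bullet> x" for x
      using lin_Stab[OF w(1)] l\<nu>[OF w] by (metis orthogonal_transformation_def)
    then show ?thesis by (simp add: Stab_diff[OF w(1)] zeta_def)
  qed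
  have nz: "integrally_closed_domain (local_ring X Sh (refl_orbit \<H> z))"
    using normal z_translates by (simp add: normal_variety_def topspace_stratum)
  obtain N r d g where ext: "d > 0" "d \<le> e" "holomorphic_EC g (ball z d)"
    "\<And>u. u \<in> ball z d \<Longrightarrow> u \<in> translates \<H> L \<Longrightarrow> refl_orbit \<H> u \<in> N \<and> r (refl_orbit \<H> u) = g u"
    "\<And>M' u. M' \<in> Ms \<Longrightarrow> u \<in> ball z d \<Longrightarrow> u - z \<in> M' \<times> M' \<Longrightarrow> g u = transport ?h M' u"
    by (rule extension[OF hol inv nz]) (assumption+, rule that)
  have zd: "z \<in> ball z d" using ext(1) by simp
  \<comment> \<open>On the image of the sheet under \<open>w\<close> the function \<open>g\<close>
    repeats its values on the sheet of \<open>L\<close>, since both are values of \<open>r\<close>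
    at the same orbits.\<close>
  have deriv: "dir_deriv g z (lin w \<nu>, 0) = of_real (\<nu> \<bullet> \<nu>)" if w: "w \<in> Stab z" for w
  proof -
    let ?v = "(lin w \<nu>, 0::'a)"
    let ?S = "{t. z + cscale t ?v \<in> ball z d}"
    note lin = orthogonal_transformation_linear[OF lin_Stab[OF w]]
    have val: "g (z + cscale t ?v) = t * of_real (\<nu> \<bullet> \<nu>)" if t: "t \<in> ?S" for t
    proof -
      let ?u = "z + cscale t (\<nu>, 0)"
      have mem: "cscale t (\<nu>, 0) \<in> M \<times> M"
        using \<nu>M subspace_0[OF M_subspace] by (intro cscale_mem[OF M_subspace]) simp
      have au: "act w ?u = z + cscale t ?v"
      proof -
        have "act w ?u - z = map_prod (lin w) (lin w) (cscale t (\<nu>, 0))" using Stab_diff[OF w, of ?u] by simp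
        also have "\<dots> = cscale t ?v" by (simp only: map_prod_cscale[OF lin] map_prod_simp linear_0[OF lin])
        finally show ?thesis by (simp add: algebra_simps)
      qed
      have wu: "act w ?u \<in> ball z d" using t au by simp
      have ud: "?u \<in> ball z d" using iffD1[OF Stab_ball[OF w] wu] .
      have ut: "?u \<in> translates \<H> L" using LC_iff[OF zL, of ?u] mem LC_translates by auto
      have "g (act w ?u) = r (refl_orbit \<H> (act w ?u))"
        using ext(4)[OF wu] ut translates_act[OF Stab_W[OF w]] by simp
      also have "\<dots> = g ?u" using ext(4)[OF ud ut] orbit_act[OF Stab_W[OF w]] by simp
      also have "\<dots> = transport ?h M ?u" using ext(5)[OF M_Ms ud] mem by simp
      also have "\<dots> = ?h ?u"
        by (rule transport_M[OF hol inv]) (use ud ext(2) mem in auto)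
      also have "\<dots> = t * of_real (\<nu> \<bullet> \<nu>)" by (simp add: zeta_cscale) (simp add: zeta_def complex_eq_iff)
      finally show ?thesis using au by simp
    qed
    have "((\<lambda>t. g (z + cscale t ?v)) has_field_derivative dir_deriv g (z + cscale 0 ?v) ?v) (at 0)"
      by (rule holomorphic_EC_line_deriv[OF ext(3)]) (use ext(1) in \<open>simp add: cscale_def zero_prod_def[symmetric]\<close>)
    then have "((\<lambda>t. t * of_real (\<nu> \<bullet> \<nu>)) has_field_derivative dir_deriv g (z + cscale 0 ?v) ?v) (at 0)"
    proof (rule has_field_derivative_transform_within_open)
      show "open ?S" by (rule open_line_preimage[OF open_ball])
      show "0 \<in> ?S" using ext(1) by (simp add: cscale_def zero_prod_def[symmetric])
    qed (rule val)
    moreover have "((\<lambda>t. t * of_real (\<nu> \<bullet> \<nu>)) has_field_derivative of_real (\<nu> \<bullet> \<nu>)) (at (0::complex))"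
      by (auto intro!: derivative_eq_intros)
    ultimately show ?thesis using DERIV_unique by (fastforce simp: cscale_def zero_prod_def[symmetric])
  qed
  define S where "S = (\<Sum>w\<in>Stab z. lin w \<nu>)"
  have kS: "lin k S = S" if k: "k \<in> Stab z" for k
  proof -
    note lin = orthogonal_transformation_linear[OF lin_Stab[OF k]]
    obtain l where l: "l \<in> Stab z" "l \<circ> k = id" "k \<circ> l = id" by (rule Stab_inverse[OF k]) blast
    have bij: "bij_betw (\<lambda>w. k \<circ> w) (Stab z) (Stab z)"
      by (rule bij_betw_byWitness[of _ "\<lambda>w. l \<circ> w"]) (use l k Stab_comp in \<open>auto simp: o_assoc\<close>)
    have "lin k S = (\<Sum>w\<in>Stab z. lin (k \<circ> w) \<nu>)"
      unfolding S_def linear_sum[OF lin] by (rule sum.cong) (simp_all add: lin_Stab_comp[OF k])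
    also have "\<dots> = S" unfolding S_def by (rule sum.reindex_bij_betw[OF bij, of "\<lambda>w. lin w \<nu>"])
    finally show ?thesis .
  qed
  \<comment> \<open>The orbit sum is fixed by every reflection in a hyperplane through
    \<open>b\<close>, so it is parallel to each of these hyperplanes, and hence to \<open>L\<close>
    and to \<open>H\<close>.\<close>
  have SH: "b + S \<in> H'" if H': "H' \<in> \<H>" "b \<in> H'" for H'
  proof -
    obtain a' c' where a': "a' \<noteq> 0" "H' = {x. a' \<bullet> x = c'}" using hyper[OF H'(1)] by (auto simp: affine_hyperplane_def)
    have l: "lin (orth_reflection H') = refl a'" by (rule lin_orth_reflection[OF a'])
    have "orth_reflection H' b = b" using orth_reflection_fix[OF hyper[OF H'(1)]] H'(2) by simp
    then have "orth_reflection H' \<in> Stab z"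
      using W_refl[OF H'(1)] by (simp add: Stab_def z_def complex_action_eq l refl_def)
    from kS[OF this] have "a' \<bullet> S = 0" by (simp add: l refl_fix_iff[OF a'(1)])
    then show ?thesis using H'(2) a'(2) by (simp add: inner_add_right)
  qed
  have "b + S \<in> L"
  proof -
    obtain \<G> where "\<G> \<subseteq> \<H>" "L = \<Inter>\<G>" using fl unfolding flat_def by blast
    then show ?thesis using SH b(1) by blast
  qed
  then have "S \<in> K0" using K[OF b, of "b + S"] SH[OF H(1) b(2)] by simp
  \<comment> \<open>Lying in \<open>K0\<close>, the sum is fixed by \<open>w\<close> and orthogonal
    to \<open>\<nu>\<close>; so it is orthogonal to each of its own summands.\<close>
  have "S \<bullet> lin w \<nu> = 0" if w: "w \<in> Stab z" for w
  proof -
    have "S \<bullet> lin w \<nu> = lin w S \<bullet> lin w \<nu>" using lK[OF w \<open>S \<in> K0\<close>] by simp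
    also have "\<dots> = S \<bullet> \<nu>" using lin_Stab[OF w] by (simp add: orthogonal_transformation_def)
    finally show ?thesis using \<open>S \<in> K0\<close> by (simp add: K0_def inner_commute)
  qed
  then have "S \<bullet> S = 0" by (subst (2) S_def) (simp add: inner_sum_right)
  then have "S = 0" by simp
  note lg = linear_dir_deriv[OF ext(3) zd]
  have pair: "(\<Sum>w\<in>A. (lin w \<nu>, 0::'a)) = (\<Sum>w\<in>A. lin w \<nu>, 0)" for A
    by (induction A rule: infinite_finite_induct) (auto simp: zero_prod_def)
  have "0 = dir_deriv g z (\<Sum>w\<in>Stab z. (lin w \<nu>, 0))"
    using \<open>S = 0\<close> linear_0[OF lg] by (simp add: pair S_def zero_prod_def)
  also have "\<dots> = of_nat (card (Stab z)) * of_real (\<nu> \<bullet> \<nu>)"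
    using deriv by (simp add: linear_sum[OF lg])
  finally show False using \<nu>0 Stab_finite[of z] Stab_id by (auto simp: card_eq_0_iff)
qed

end

section \<open>The group induced on the flat\<close>

context slice_point
begin

definition mirrors :: "'a set set" where
  "mirrors = {H \<in> \<H>. {fst z, fst z + snd z} \<subseteq> H}"

lemma z_mem: "fst z \<in> L" "snd z \<in> M" "fst z + snd z \<in> L"
proof -
  show x: "fst z \<in> L" and y: "snd z \<in> M" using zL by (auto simp: complexify_def M_def)
  then show "fst z + snd z \<in> L" using L_translate by blast
qed

text \<open>Keeps the action of \<open>lin w\<close> on \<open>M\<close> and makes it trivial on the
  orthogonal complement, as \<open>finite_refl_group\<close> demands. Different \<open>w\<close> may
  give the same map.\<close>

definition ext :: "('a \<Rightarrow> 'a) \<Rightarrow> 'a \<Rightarrow> 'a" where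
  "ext w v = lin w (proj M v) + (v - proj M v)"

definition LStab :: "('a \<Rightarrow> 'a) set" where
  "LStab = {w \<in> Stab z. lin w ` M = M}"

lemma LStab: assumes "w \<in> LStab" shows "w \<in> Stab z" "lin w ` M = M" "\<And>m. m \<in> M \<Longrightarrow> lin w m \<in> M"
  using assms by (auto simp: LStab_def)

lemma LStab_comp: "v \<in> LStab \<Longrightarrow> w \<in> LStab \<Longrightarrow> v \<circ> w \<in> LStab"
  unfolding LStab_def using image_comp[of "lin v" "lin w" M] by (simp add: Stab_comp lin_Stab_comp)

lemma ext_M: "m \<in> M \<Longrightarrow> ext w m = lin w m"
  by (simp add: ext_def proj_id[OF M_subspace])

lemma proj_ext: assumes w: "w \<in> LStab" shows "proj M (ext w v) = lin w (proj M v)"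
proof (rule proj_unique[OF M_subspace])
  show "lin w (proj M v) \<in> M" by (rule LStab(3)[OF w proj_mem[OF M_subspace]])
  show "u \<bullet> (ext w v - lin w (proj M v)) = 0" if "u \<in> M" for u
    using inner_diff_proj[OF M_subspace that, of v] by (simp add: ext_def)
qed

lemma ext_comp: "v \<in> LStab \<Longrightarrow> w \<in> LStab \<Longrightarrow> ext (v \<circ> w) = ext v \<circ> ext w"
  by (auto simp: fun_eq_iff proj_ext ext_def[of v] ext_def[of "v \<circ> w"] lin_Stab_comp[OF LStab(1) LStab(1)])
    (simp add: ext_def)

lemma ext_id: "ext id = id"
  by (auto simp: fun_eq_iff ext_def lin_id)

lemma ext_orth: assumes w: "w \<in> LStab" shows "orthogonal_transformation (ext w)"
proof -
  note l = lin_Stab[OF LStab(1)[OF w]]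
  note lin = orthogonal_transformation_linear[OF l]
  have "linear (ext w)"
    unfolding ext_def[abs_def]
    by (intro linear_compose_add linear_compose_sub linear_compose[OF linear_proj lin, unfolded o_def] linear_proj linear_ident)
  moreover have "norm (ext w v) = norm v" for v
  proof -
    have "(norm (ext w v))\<^sup>2 = (norm (lin w (proj M v)))\<^sup>2 + (norm (v - proj M v))\<^sup>2"
      using norm_proj[OF M_subspace, of "ext w v"] by (simp add: proj_ext[OF w]) (simp add: ext_def)
    also have "\<dots> = (norm v)\<^sup>2"
      using norm_proj[OF M_subspace, of v] orthogonal_transformation_norm[OF l] by simp
    finally show ?thesis by simp
  qed
  ultimately show ?thesis by (simp add: orthogonal_transformation)
qed

lemma ext_refl:
  assumes "\<nu> \<in> M" "\<And>m. m \<in> M \<Longrightarrow> lin w m = refl \<nu> m" shows "ext w = refl \<nu>"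
proof
  fix v
  have "\<nu> \<bullet> proj M v = \<nu> \<bullet> v" using inner_diff_proj[OF M_subspace assms(1), of v] by (simp add: inner_diff_right)
  then show "ext w v = refl \<nu> v" using assms(2)[OF proj_mem[OF M_subspace]] by (simp add: ext_def refl_def)
qed

definition F :: "('a \<Rightarrow> 'a) set" where "F = ext ` LStab"

abbreviation RF where "RF \<equiv> {refl \<alpha> |\<alpha>. \<alpha> \<in> M \<and> \<alpha> \<noteq> 0 \<and> refl \<alpha> \<in> F}"

text \<open>The element that reflects \<open>L\<close> in \<open>L \<inter> H\<close> fixes
  \<open>fst z\<close> and \<open>fst z + snd z\<close>, which puts it into the stabilizer. The
  decrease of distance is recorded for the descent in \<open>F_generated\<close>.\<close>

lemma mirror_reflection:
  assumes normal: "normal_variety X Sh" and H: "H \<in> mirrors" "\<not> L \<subseteq> H"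
  obtains w where "w \<in> LStab" "ext w \<in> RF"
    "\<And>x y. x \<in> L \<Longrightarrow> y \<in> L \<Longrightarrow> sep H x y \<Longrightarrow> dist (w x) y < dist x y"
proof -
  have H': "H \<in> \<H>" "fst z \<in> H" "fst z + snd z \<in> H" using H(1) by (auto simp: mirrors_def)
  have "L \<inter> H \<noteq> {}" using z_mem H'(2) by blast
  then obtain \<nu> \<beta> w where
    \<nu>: "\<nu> \<in> M" "\<nu> \<noteq> 0" and w: "w \<in> W" and LH: "\<And>y. y \<in> L \<Longrightarrow> y \<in> H \<longleftrightarrow> \<nu> \<bullet> y = \<beta>"
    and wL: "\<And>y. y \<in> L \<Longrightarrow> w y = orth_reflection {y. \<nu> \<bullet> y = \<beta>} y"
    by (rule L_reflection[OF normal H'(1) _ H(2)]) (rule that)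
  let ?H = "{y. \<nu> \<bullet> y = \<beta>}"
  have hH: "affine_hyperplane ?H" using \<nu>(2) unfolding affine_hyperplane_def by blast
  have fixed: "w y = y" if "y \<in> L" "y \<in> H" for y
    using wL[OF that(1)] LH[OF that(1)] that(2) orth_reflection_fix[OF hH, of y] by simp
  have "lin w (snd z) = snd z"
    using lin_diff[OF W_aff_iso[OF w], of "fst z + snd z" "fst z"] fixed z_mem H' by simp
  then have wS: "w \<in> Stab z"
    using w fixed[OF z_mem(1) H'(2)] by (cases z) (simp add: Stab_def complex_action_eq)
  have lm: "lin w m = refl \<nu> m" if m: "m \<in> M" for m
  proof -
    have mL: "fst z + m \<in> L" using L_translate[OF z_mem(1)] m by blast
    have x: "fst z \<in> ?H" using LH[OF z_mem(1)] H'(2) by simp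
    have "w (fst z + m) = fst z + refl \<nu> m"
      using wL[OF mL] orth_reflection_refl[OF \<nu>(2) x refl, of "fst z + m"] by simp
    then show ?thesis using lin_diff[OF W_aff_iso[OF w], of "fst z + m" "fst z"] fixed[OF z_mem(1) H'(2)] by simp
  qed
  have sM: "refl \<nu> m \<in> M" if "m \<in> M" for m
    unfolding refl_def by (intro subspace_diff[OF M_subspace that] subspace_scale[OF M_subspace \<nu>(1)])
  have "lin w ` M = M"
  proof -
    have "m = lin w (refl \<nu> m)" if "m \<in> M" for m
      using lm[OF sM[OF that]] \<nu>(2) by (simp add: refl_def inner_diff_right)
    then show ?thesis using sM lm by (auto simp: image_iff intro!: bexI[of _ "refl \<nu> _"])
  qed
  then have wLS: "w \<in> LStab" using wS by (simp add: LStab_def)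
  moreover have e: "ext w = refl \<nu>" by (rule ext_refl[OF \<nu>(1) lm])
  have "ext w \<in> F" unfolding F_def using wLS by (rule imageI)
  then have "ext w \<in> RF" using \<nu> e by auto
  moreover have "dist (w x) y < dist x y" if "x \<in> L" "y \<in> L" "sep H x y" for x y
  proof -
    have "sep ?H x y"
      using sep_affine_section[OF hyper[OF H'(1)] hH that(1,2) L_affine[OF _ that(1,2)]] LH that(3) by simp
    then show ?thesis using sep_closer[OF hH, of x y] wL[OF that(1)] by simp
  qed
  ultimately show ?thesis by (rule that)
qed

text \<open>Descent on a distance: reflections of \<open>L\<close> are applied to \<open>w\<close>
  until the image of a generic point \<open>c\<close> of \<open>L\<close> is as close to
  \<open>c\<close> as possible. Then no mirror separates the two points, so what remains is a
  product of reflections in mirrors through \<open>c\<close>. By genericity these mirrors contain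
  \<open>L\<close>, and the remainder acts trivially on \<open>L\<close>.\<close>

lemma F_generated:
  assumes normal: "normal_variety X Sh" and w: "w \<in> LStab"
  shows "ext w \<in> compositions RF"
proof -
  have "H \<in> \<H> \<and> (\<exists>m\<in>M. fst z + m \<notin> H)" if H: "H \<in> {H \<in> mirrors. \<not> L \<subseteq> H}" for H
  proof -
    obtain y where "y \<in> L" "y \<notin> H" using H by blast
    then show ?thesis using H L_translate[OF z_mem(1), of "y - fst z"]
      by (auto simp: mirrors_def intro!: bexI[of _ "y - fst z"])
  qed
  then obtain m where m: "m \<in> M" "norm m < 1" "\<And>H. H \<in> {H \<in> mirrors. \<not> L \<subseteq> H} \<Longrightarrow> fst z + m \<notin> H"
    by (rule generic_flat_point[OF M_subspace zero_less_one, where \<G> = "{H \<in> mirrors. \<not> L \<subseteq> H}"]) (assumption, rule that)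
  define c where "c = fst z + m"
  have cL: "c \<in> L" unfolding c_def using L_translate[OF z_mem(1)] m(1) by blast
  have cH: "L \<subseteq> H" if "H \<in> mirrors" "c \<in> H" for H using m(3)[of H] that by (auto simp: c_def)
  have LL: "v x \<in> L" if "v \<in> LStab" "x \<in> L" for v x
    using Stab_L_iff[OF LStab(1)] LStab(2) that by blast
  \<comment> \<open>All elements reachable from \<open>w\<close> by reflections of \<open>L\<close>,
    with reachability recorded on the level of \<open>ext\<close>; finiteness of the stabilizer
    provides a minimum.\<close>
  define T where "T = {v \<in> LStab. \<exists>g\<in>compositions RF. ext v = g \<circ> ext w}"
  have "finite T" by (rule finite_subset[OF _ Stab_finite[of z]]) (auto simp: T_def LStab_def)
  moreover have "w \<in> T" unfolding T_def using w compositions.id[of RF] by (auto intro!: bexI[of _ id])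
  ultimately obtain v where v: "v \<in> T" "\<And>u. u \<in> T \<Longrightarrow> dist (v c) c \<le> dist (u c) c"
    using arg_min_if_finite[of T "\<lambda>u. dist (u c) c"] by (metis empty_iff not_le)
  obtain g where g: "g \<in> compositions RF" "ext v = g \<circ> ext w" and vL: "v \<in> LStab" using v(1) by (auto simp: T_def)
  have nosep: "\<not> sep H c (v c)" if H: "H \<in> mirrors" for H
  proof
    assume s: "sep H c (v c)"
    then have "\<not> L \<subseteq> H" using cL by (auto simp: sep_def)
    then obtain u where u: "u \<in> LStab" "ext u \<in> RF"
      "\<And>x y. x \<in> L \<Longrightarrow> y \<in> L \<Longrightarrow> sep H x y \<Longrightarrow> dist (u x) y < dist x y"
      by (rule mirror_reflection[OF normal H]) (rule that)
    have "ext (u \<circ> v) = (ext u \<circ> g) \<circ> ext w" using g(2) by (simp only: ext_comp[OF u(1) vL] o_assoc)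
    moreover have "ext u \<circ> g \<in> compositions RF" by (rule compositions.comp[OF u(2) g(1)])
    ultimately have "u \<circ> v \<in> T" unfolding T_def using LStab_comp[OF u(1) vL] by blast
    then have "dist (v c) c \<le> dist (u (v c)) c" using v(2)[of "u \<circ> v"] by simp
    moreover have "sep H (v c) c" using s by (simp add: sep_def closed_segment_commute)
    ultimately show False using u(3)[OF LL[OF vL cL] cL] by simp
  qed
  interpret c: coxeter mirrors unfolding mirrors_def by (rule coxeter_subfamily)
  have "v \<in> c.W" unfolding c.W_def unfolding mirrors_def by (rule Stab_generated[OF LStab(1)[OF vL]])
  then have vc: "v \<in> compositions (orth_reflection ` {H \<in> mirrors. c \<in> H})"
    by (rule c.stabilizer_generated) (rule nosep)
  have vfix: "v y = y" if "y \<in> L" for y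
  proof (rule c.compositions_fix)
    show "v \<in> compositions (orth_reflection ` {H \<in> mirrors. y \<in> H})"
      by (rule compositions_mono[OF vc image_mono]) (use cH that in blast)
  qed
  have "lin v m = m" if "m \<in> M" for m
  proof -
    have "fst z + m \<in> L" using L_translate[OF z_mem(1)] that by blast
    then show ?thesis
      using lin_diff[OF W_aff_iso[OF Stab_W[OF LStab(1)[OF vL]]], of "fst z + m" "fst z"] vfix z_mem(1) by simp
  qed
  then have "ext v = id" using proj_mem[OF M_subspace] by (simp add: ext_def fun_eq_iff)
  then have gw: "g \<circ> ext w = id" using g(2) by simp
  have "s \<circ> s = id" if "s \<in> RF" for s
    using that by (auto simp: refl_def fun_eq_iff inner_diff_right)
  then obtain g' where g': "g' \<in> compositions RF" "g' \<circ> g = id" using compositions_inverse[OF _ g(1)] by blast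
  have "ext w = g' \<circ> (g \<circ> ext w)" by (simp only: o_assoc g'(2) id_comp)
  then show ?thesis using gw g'(1) by simp
qed

lemma finite_refl_group_F:
  assumes normal: "normal_variety X Sh" shows "finite_refl_group M F"
proof
  show "subspace M" by (rule M_subspace)
  have "LStab \<subseteq> Stab z" by (auto simp: LStab_def)
  then show "finite F" unfolding F_def using Stab_finite finite_subset by blast
  have "id \<in> LStab" using Stab_id by (simp add: LStab_def lin_id)
  then show "id \<in> F" unfolding F_def using ext_id by (metis imageI)
  show "v \<circ> w \<in> F" if vw: "v \<in> F" "w \<in> F" for v w
  proof -
    obtain v' w' where *: "v' \<in> LStab" "v = ext v'" "w' \<in> LStab" "w = ext w'" using vw by (auto simp: F_def)
    have "ext (v' \<circ> w') \<in> F" unfolding F_def by (rule imageI[OF LStab_comp[OF *(1,3)]])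
    then show ?thesis by (simp only: ext_comp[OF *(1,3)] *(2,4))
  qed
  show "\<exists>v\<in>F. v \<circ> w = id \<and> w \<circ> v = id" if wF: "w \<in> F" for w
  proof -
    obtain u where u: "u \<in> LStab" "w = ext u" using wF by (auto simp: F_def)
    obtain k where k: "k \<in> Stab z" "k \<circ> u = id" "u \<circ> k = id" "\<And>A. lin k ` lin u ` A = A"
      by (rule Stab_inverse[OF LStab(1)[OF u(1)]]) blast
    have kL: "k \<in> LStab" using k(1) k(4)[of M] LStab(2)[OF u(1)] by (simp add: LStab_def)
    have "ext k \<circ> w = id" "w \<circ> ext k = id"
      by (simp_all only: u(2) ext_comp[OF kL u(1), symmetric] ext_comp[OF u(1) kL, symmetric] k(2,3) ext_id)
    then show ?thesis using kL by (auto simp: F_def)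
  qed
  show "orthogonal_transformation w" if "w \<in> F" for w using that ext_orth by (auto simp: F_def)
  show "w x \<in> M" if "w \<in> F" "x \<in> M" for w x using that ext_M LStab(3) by (auto simp: F_def)
  show "w x = x" if wF: "w \<in> F" and x: "\<And>y. y \<in> M \<Longrightarrow> y \<bullet> x = 0" for w x
  proof -
    obtain u where u: "u \<in> LStab" "w = ext u" using wF by (auto simp: F_def)
    have "proj M x = 0" by (rule proj_unique[OF M_subspace subspace_0[OF M_subspace]]) (simp add: x)
    then show ?thesis
      using linear_0[OF orthogonal_transformation_linear[OF lin_Stab[OF LStab(1)[OF u(1)]]]] by (simp add: u(2) ext_def)
  qed
  show "F \<subseteq> compositions RF"
  proof
    fix w assume "w \<in> F"
    then obtain u where "u \<in> LStab" "w = ext u" by (auto simp: F_def)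
    then show "w \<in> compositions RF" using F_generated[OF normal] by simp
  qed
qed

end

section \<open>The chart of a normal stratum\<close>

context slice_point
begin

lemma LC_zL: "u \<in> complexify L \<longleftrightarrow> u - z \<in> M \<times> M"
  by (rule LC_iff[OF zL])

text \<open>The coordinates of \<open>\<Phi>\<close> on the sheet of \<open>L\<close> are invariant
  under \<open>LStab\<close>, so \<open>extension\<close> realizes them by functions
  \<open>r b\<close> on the stratum with ambient representatives \<open>g b\<close>. The resulting
  \<open>\<phi>\<close> is analytic across all sheets, yet its values can be computed as those of
  \<open>\<Phi>\<close> on one sheet, because that sheet represents every orbit in
  \<open>U\<close>.\<close>

theorem local_chart:
  assumes normal: "normal_variety X Sh"
  shows "\<exists>U (M'::'a set) D (\<phi>::('a \<times> 'a) set \<Rightarrow> 'a \<times> 'a).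
        openin X U \<and> refl_orbit \<H> z \<in> U \<and>
        subspace M' \<and> openin (top_of_set (M' \<times> M')) D \<and>
        homeomorphic_map (subtopology X U) (top_of_set D) \<phi> \<and>
        (\<forall>N g. openin X N \<and> N \<subseteq> U \<longrightarrow>
           (analytic_fun (\<phi> ` N) g \<longleftrightarrow> (\<lambda>x. g (\<phi> x)) \<in> Sh N))"
proof -
  interpret G: finite_refl_group M F by (rule finite_refl_group_F[OF normal])
  obtain \<Phi> where \<Phi>: "hol_map \<Phi> UNIV" "\<And>w v. w \<in> F \<Longrightarrow> \<Phi> (map_prod w w v) = \<Phi> v"
    "\<And>v v'. \<Phi> v = \<Phi> v' \<Longrightarrow> \<exists>w\<in>F. v' = map_prod w w v" "\<And>v. \<Phi> (cproj M v) = cproj M (\<Phi> v)"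
    "surj \<Phi>" "\<And>G. open G \<Longrightarrow> open (\<Phi> ` G)"
    "\<And>D g. open D \<Longrightarrow> holomorphic_EC (\<lambda>v. g (\<Phi> v)) {v. \<Phi> v \<in> D} \<Longrightarrow> holomorphic_EC g D"
    by (rule G.quotient_chart) (rule that)
  have nz: "integrally_closed_domain (local_ring X Sh (refl_orbit \<H> z))"
    using normal z_translates by (simp add: normal_variety_def topspace_stratum)
  have extM: "map_prod (ext w) (ext w) v = map_prod (lin w) (lin w) v" if "v \<in> M \<times> M" for w v
    using that by (cases v) (simp add: ext_M)
  have \<Phi>lin: "\<Phi> (map_prod (lin w) (lin w) v) = \<Phi> v" if "w \<in> LStab" "v \<in> M \<times> M" for w v
    using \<Phi>(2)[of "ext w" v] extM[OF that(2)] that(1) by (simp add: F_def)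
  have \<Phi>M: "\<Phi> v \<in> M \<times> M" if "v \<in> M \<times> M" for v
    using \<Phi>(4)[of v] cproj_mem[OF M_subspace, of "\<Phi> v"] by (simp add: cproj_id[OF M_subspace that])
  define f where "f = (\<lambda>b u. zeta b (\<Phi> (u - z)))"
  have hshift: "hol_map (\<lambda>u. u - z) V" for V
    using hol_map_linear[OF linear_id, of 0 z V] by (simp add: map_prod.id[unfolded id_def] id_def)
  have holf: "holomorphic_EC (f b) V" for b V
    unfolding f_def
    by (rule holomorphic_EC_compose[OF hshift holomorphic_EC_compose[OF \<Phi>(1) holomorphic_EC_zeta[of b UNIV]]]) auto
  have invf: "f b (act w u) = f b u"
    if "w \<in> Stab z" "lin w ` M = M" "u \<in> ball z e" "u \<in> complexify L" for b w u
    using \<Phi>lin[of w "u - z"] that by (simp add: f_def Stab_diff LStab_def LC_zL)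
  have "\<exists>r N d g. openin X N \<and> refl_orbit \<H> z \<in> N \<and> d > 0 \<and> d \<le> e \<and> holomorphic_EC g (ball z d) \<and>
      (\<forall>u. u \<in> ball z d \<longrightarrow> u \<in> translates \<H> L \<longrightarrow> refl_orbit \<H> u \<in> N \<and> r (refl_orbit \<H> u) = g u) \<and>
      (\<forall>u. u \<in> ball z d \<longrightarrow> u \<in> complexify L \<longrightarrow> g u = f b u)" for b
  proof -
    obtain N r d g where ex: "openin X N" "refl_orbit \<H> z \<in> N" "r \<in> Sh N" "d > 0" "d \<le> e" "holomorphic_EC g (ball z d)"
      "\<And>u. u \<in> ball z d \<Longrightarrow> u \<in> translates \<H> L \<Longrightarrow> refl_orbit \<H> u \<in> N \<and> r (refl_orbit \<H> u) = g u"
      "\<And>M' u. M' \<in> Ms \<Longrightarrow> u \<in> ball z d \<Longrightarrow> u - z \<in> M' \<times> M' \<Longrightarrow> g u = transport (f b) M' u"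
      by (rule extension[OF holf invf nz]) (assumption+, rule that)
    have "g u = f b u" if "u \<in> ball z d" "u \<in> complexify L" for u
      using ex(8)[OF M_Ms that(1)] transport_M[OF holf invf, of u b] that ex(5) by (simp add: LC_zL)
    then show ?thesis using ex by blast
  qed
  then obtain r d g where rdg: "\<And>b. d b > 0" "\<And>b. d b \<le> e" "\<And>b. holomorphic_EC (g b) (ball z (d b))"
    "\<And>b u. u \<in> ball z (d b) \<Longrightarrow> u \<in> translates \<H> L \<Longrightarrow> r b (refl_orbit \<H> u) = g b u"
    "\<And>b u. u \<in> ball z (d b) \<Longrightarrow> u \<in> complexify L \<Longrightarrow> g b u = f b u"
    by metis
  \<comment> \<open>One radius for finitely many coordinates; inserting \<open>e\<close> covers the
    case that \<open>M\<close> is zero and there are none.\<close>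
  define \<epsilon> where "\<epsilon> = Min (insert e (d ` onb M))"
  have fin: "finite (onb M)" by (rule onb(6)[OF M_subspace])
  have \<epsilon>: "\<epsilon> > 0" "\<epsilon> \<le> e" "\<And>b. b \<in> onb M \<Longrightarrow> \<epsilon> \<le> d b" using fin e rdg(1) by (auto simp: \<epsilon>_def)
  \<comment> \<open>\<open>\<kappa>\<close> is the ambient holomorphic map and \<open>\<phi>\<close>
    the map on orbits; near \<open>z\<close> they agree on the translates of
    \<open>L\<close>.\<close>
  define \<kappa> where "\<kappa> = (\<lambda>u. \<Sum>b\<in>onb M. cscale (g b u) (b, 0::'a))"
  define \<phi> where "\<phi> = (\<lambda>p. \<Sum>b\<in>onb M. cscale (r b p) (b, 0::'a))"
  have h\<kappa>: "hol_map \<kappa> (ball z \<epsilon>)"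
    unfolding \<kappa>_def
  proof (intro hol_map_sum hol_map_cscale)
    fix b assume "b \<in> onb M"
    then show "holomorphic_EC (g b) (ball z \<epsilon>)" using \<epsilon>(3)[of b] by (intro holomorphic_EC_subset[OF rdg(3)] subset_ball)
  qed
  have \<phi>\<kappa>: "\<phi> (refl_orbit \<H> u) = \<kappa> u" if u: "u \<in> ball z \<epsilon>" "u \<in> translates \<H> L" for u
    unfolding \<phi>_def \<kappa>_def
  proof (rule sum.cong[OF refl])
    fix b assume "b \<in> onb M"
    then have "u \<in> ball z (d b)" using \<epsilon>(3)[of b] u(1) by simp
    then show "cscale (r b (refl_orbit \<H> u)) (b, 0) = cscale (g b u) (b, 0)" using rdg(4)[of u b] u(2) by simp
  qed
  have expand: "(\<Sum>b\<in>onb M. cscale (zeta b v) (b, 0)) = v" if "v \<in> M \<times> M" for v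
  proof -
    have "(\<Sum>b\<in>B. cscale (zeta b v) (b, 0::'a)) = (\<Sum>b\<in>B. (b \<bullet> fst v) *\<^sub>R b, \<Sum>b\<in>B. (b \<bullet> snd v) *\<^sub>R b)" for B
      by (induction B rule: infinite_finite_induct) (auto simp: zero_prod_def cscale_def zeta_def)
    then have "(\<Sum>b\<in>onb M. cscale (zeta b v) (b, 0)) = cproj M v"
      by (simp add: cproj_def proj_def map_prod_def split_beta)
    then show ?thesis using cproj_id[OF M_subspace that] by simp
  qed
  have \<kappa>\<Phi>: "\<kappa> u = \<Phi> (u - z)" if u: "u \<in> ball z \<epsilon>" "u \<in> complexify L" for u
  proof -
    have "\<kappa> u = (\<Sum>b\<in>onb M. cscale (zeta b (\<Phi> (u - z))) (b, 0))"
      unfolding \<kappa>_def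
    proof (rule sum.cong[OF refl])
      fix b assume "b \<in> onb M"
      then have "u \<in> ball z (d b)" using \<epsilon>(3)[of b] u(1) by simp
      then show "cscale (g b u) (b, 0) = cscale (zeta b (\<Phi> (u - z))) (b, 0)" using rdg(5)[of u b] u(2) by (simp add: f_def)
    qed
    also have "\<dots> = \<Phi> (u - z)" using u(2) by (intro expand \<Phi>M) (simp add: LC_zL)
    finally show ?thesis .
  qed
  have LCt: "u \<in> translates \<H> L" if "u \<in> complexify L" for u using LC_translates that by blast
  have \<phi>\<Phi>: "\<phi> (refl_orbit \<H> u) = \<Phi> (u - z)" if "u \<in> ball z \<epsilon>" "u \<in> complexify L" for u
    using \<phi>\<kappa>[OF that(1) LCt[OF that(2)]] \<kappa>\<Phi>[OF that] by simp
  define U where "U = refl_orbit \<H> ` (translates \<H> L \<inter> ball z \<epsilon>)"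
  have U: "openin X U" "refl_orbit \<H> z \<in> U"
    unfolding U_def by (rule orbit_nhd_open) (rule orbit_nhd_mem[OF z_translates \<epsilon>(1)])
  \<comment> \<open>Conjugacy of the sheets is used here: without it some orbits would miss the
    sheet of \<open>L\<close>.\<close>
  have rep: "\<exists>u. u \<in> ball z \<epsilon> \<and> u \<in> complexify L \<and> p = refl_orbit \<H> u" if p: "p \<in> U" for p
  proof -
    obtain u where u: "u \<in> translates \<H> L" "u \<in> ball z \<epsilon>" "p = refl_orbit \<H> u" using p by (auto simp: U_def)
    have "u \<in> ball z e" using u(2) \<epsilon>(2) by simp
    from slice_translates[OF this] u(1) obtain M' where M': "M' \<in> Ms" "u - z \<in> M' \<times> M'" by auto
    obtain k where k: "k \<in> Stab z" "lin k ` M' = M" using sheets_conjugate[OF nz M'(1)] by blast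
    have "act k u - z \<in> M \<times> M" using M'(2) k(2) by (cases "u - z") (auto simp: Stab_diff[OF k(1)])
    then show ?thesis
      using Stab_ball[OF k(1)] u orbit_act[OF Stab_W[OF k(1)]] by (intro exI[of _ "act k u"]) (simp add: LC_zL)
  qed
  define D where "D = \<Phi> ` ball 0 \<epsilon> \<inter> M \<times> M"
  have zdiff: "v \<in> ball 0 \<epsilon> \<Longrightarrow> z + cproj M v \<in> ball z \<epsilon>" for v
    using norm_cproj_le(1)[OF M_subspace, of v] by (simp add: dist_norm)
  \<comment> \<open>The part of the full space near 0 that lies over \<open>N\<close> by projection
    and orbit map. It is open, so its image under the open map \<open>\<Phi>\<close> is open and
    cuts out the image of \<open>N\<close> under \<open>\<phi>\<close> in M + iM.\<close>
  define G0 where "G0 = (\<lambda>N. {v \<in> ball 0 \<epsilon>. refl_orbit \<H> (z + cproj M v) \<in> N})"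
  have openG0: "open (G0 N)" if N: "openin X N" for N
  proof -
    have "openin (top_of_set (translates \<H> L)) {u \<in> translates \<H> L. refl_orbit \<H> u \<in> N}"
      using N by (simp add: openin_stratum)
    then obtain T where T: "open T" "{u \<in> translates \<H> L. refl_orbit \<H> u \<in> N} = translates \<H> L \<inter> T"
      by (auto simp: openin_open)
    have "G0 N = ball 0 \<epsilon> \<inter> (\<lambda>v. z + cproj M v) -` T"
    proof -
      have "refl_orbit \<H> u \<in> N \<longleftrightarrow> u \<in> T" if "u \<in> translates \<H> L" for u using T(2) that by blast
      from this[OF LCt[OF proj_complexify]] show ?thesis by (simp add: G0_def vimage_def Int_def)
    qed
    moreover have "open ((\<lambda>v. z + cproj M v) -` T)"
      by (rule open_vimage[OF T(1)]) (intro continuous_intros hol_map_continuous_on[OF hol_map_cproj])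
    ultimately show ?thesis by (simp add: open_Int)
  qed
  have \<phi>N: "\<phi> ` N = \<Phi> ` G0 N \<inter> M \<times> M" if N: "N \<subseteq> U" for N
  proof (intro equalityI subsetI)
    fix y assume "y \<in> \<phi> ` N"
    then obtain p where p: "p \<in> N" "y = \<phi> p" by blast
    from rep[OF subsetD[OF N p(1)]]
    obtain u where u: "u \<in> ball z \<epsilon>" "u \<in> complexify L" "p = refl_orbit \<H> u" by (elim exE conjE) (rule that)
    have v: "u - z \<in> M \<times> M" using u(2) by (simp add: LC_zL)
    have "u - z \<in> G0 N" using u p(1) cproj_id[OF M_subspace v] by (simp add: G0_def dist_norm norm_minus_commute)
    then show "y \<in> \<Phi> ` G0 N \<inter> M \<times> M" using \<phi>\<Phi>[OF u(1,2)] p(2) u(3) \<Phi>M[OF v] by auto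
  next
    fix y assume "y \<in> \<Phi> ` G0 N \<inter> M \<times> M"
    then obtain v where v: "v \<in> G0 N" "y = \<Phi> v" "y \<in> M \<times> M" by (elim IntE imageE) (rule that)
    have "\<phi> (refl_orbit \<H> (z + cproj M v)) = \<Phi> (cproj M v)"
      using \<phi>\<Phi>[OF zdiff proj_complexify, of v] v(1) by (simp add: G0_def)
    also have "\<dots> = y" using \<Phi>(4) cproj_id[OF M_subspace v(3)] v(2) by simp
    finally show "y \<in> \<phi> ` N" using v(1) by (auto simp: G0_def)
  qed
  have D\<phi>: "D = \<phi> ` U"
  proof -
    have "G0 U = ball 0 \<epsilon>" using zdiff LCt[OF proj_complexify] by (auto simp: G0_def U_def)
    then show ?thesis using \<phi>N[OF subset_refl] by (simp add: D_def)
  qed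
  have open\<phi>: "openin (top_of_set (M \<times> M)) (\<phi> ` N)" if "openin X N" "N \<subseteq> U" for N
    unfolding \<phi>N[OF that(2)] using \<Phi>(6)[OF openG0[OF that(1)]] by (metis Int_commute openin_open_Int)
  have inj: "inj_on \<phi> U"
  proof (rule inj_onI)
    fix p p' assume p: "p \<in> U" "p' \<in> U" and eq: "\<phi> p = \<phi> p'"
    from rep[OF p(1)] rep[OF p(2)] obtain u u' where
      u: "u \<in> ball z \<epsilon>" "u \<in> complexify L" "p = refl_orbit \<H> u"
      "u' \<in> ball z \<epsilon>" "u' \<in> complexify L" "p' = refl_orbit \<H> u'" by (elim exE conjE) (rule that)
    have "\<Phi> (u - z) = \<Phi> (u' - z)" using \<phi>\<Phi> u eq by simp
    from \<Phi>(3)[OF this] obtain w where w: "w \<in> F" "u' - z = map_prod w w (u - z)" by (rule bexE)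
    then obtain k where k: "k \<in> LStab" "w = ext k" by (auto simp: F_def)
    have "u' - z = act k u - z" using w(2) k(2) extM u(2) by (simp add: LC_zL Stab_diff[OF LStab(1)[OF k(1)]])
    then have "u' = act k u" by simp
    then show "p = p'" using u(3,6) orbit_act[OF Stab_W[OF LStab(1)[OF k(1)]]] by simp
  qed
  have local\<kappa>: "\<exists>w. w \<in> W \<and> act w u \<in> ball z \<epsilon>" if "refl_orbit \<H> u \<in> U" for u
    using that orbit_eqD unfolding U_def by (metis (no_types, lifting) IntD2 imageE)
  have \<phi>w: "\<phi> (refl_orbit \<H> u) = \<kappa> (act w u)" if "w \<in> W" "act w u \<in> ball z \<epsilon>" "u \<in> translates \<H> L" for w u
    using \<phi>\<kappa>[OF that(2)] translates_act[OF that(1)] that(3) orbit_act[OF that(1)] by simp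
  have open\<kappa>: "open {u. act w u \<in> ball z \<epsilon> \<and> \<kappa> (act w u) \<in> V}" if w: "w \<in> W" and V: "open V" for w V
  proof -
    have "open (ball z \<epsilon> \<inter> \<kappa> -` V)"
      by (rule continuous_open_preimage[OF hol_map_continuous_on[OF h\<kappa>] open_ball V])
    then have "open (act w -` (ball z \<epsilon> \<inter> \<kappa> -` V))"
      by (rule open_vimage) (rule hol_map_continuous_on[OF hol_map_complex_action[OF W_aff_iso[OF w]]])
    then show ?thesis by (simp add: vimage_def)
  qed
  have cont: "openin X {p \<in> U. \<phi> p \<in> V}" if V: "open V" for V
    unfolding openin_stratum
  proof
    have "{u \<in> translates \<H> L. refl_orbit \<H> u \<in> {p \<in> U. \<phi> p \<in> V}} =
        translates \<H> L \<inter> (\<Union>w\<in>W. {u. act w u \<in> ball z \<epsilon> \<and> \<kappa> (act w u) \<in> V})"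
    proof (intro equalityI subsetI)
      fix u assume "u \<in> {u \<in> translates \<H> L. refl_orbit \<H> u \<in> {p \<in> U. \<phi> p \<in> V}}"
      then have u: "u \<in> translates \<H> L" "refl_orbit \<H> u \<in> U" "\<phi> (refl_orbit \<H> u) \<in> V" by auto
      obtain w where "w \<in> W" "act w u \<in> ball z \<epsilon>" using local\<kappa>[OF u(2)] by blast
      then show "u \<in> translates \<H> L \<inter> (\<Union>w\<in>W. {u. act w u \<in> ball z \<epsilon> \<and> \<kappa> (act w u) \<in> V})"
        using \<phi>w u(1,3) by auto
    next
      fix u assume "u \<in> translates \<H> L \<inter> (\<Union>w\<in>W. {u. act w u \<in> ball z \<epsilon> \<and> \<kappa> (act w u) \<in> V})"
      then obtain w where w: "u \<in> translates \<H> L" "w \<in> W" "act w u \<in> ball z \<epsilon>" "\<kappa> (act w u) \<in> V" by blast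
      have "refl_orbit \<H> (act w u) \<in> U"
        unfolding U_def using w(3) translates_act[OF w(2)] w(1) by (intro imageI) simp
      then show "u \<in> {u \<in> translates \<H> L. refl_orbit \<H> u \<in> {p \<in> U. \<phi> p \<in> V}}"
        using \<phi>w[OF w(2,3,1)] w(1,4) orbit_act[OF w(2)] by simp
    qed
    moreover have "open (\<Union>w\<in>W. {u. act w u \<in> ball z \<epsilon> \<and> \<kappa> (act w u) \<in> V})" using open\<kappa>[OF _ V] by blast
    ultimately show "openin (top_of_set (translates \<H> L)) {u \<in> translates \<H> L. refl_orbit \<H> u \<in> {p \<in> U. \<phi> p \<in> V}}"
      by (simp add: openin_open_Int)
  qed (auto simp: U_def)
  have topU: "topspace (subtopology X U) = U" using openin_subset[OF U(1)] by (auto simp: topspace_subtopology)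
  have openD: "openin (top_of_set (M \<times> M)) D" unfolding D\<phi> by (rule open\<phi>[OF U(1)]) simp
  have hom: "homeomorphic_map (subtopology X U) (top_of_set D) \<phi>"
  proof (rule bijective_open_imp_homeomorphic_map)
    show "continuous_map (subtopology X U) (top_of_set D) \<phi>"
      unfolding continuous_map topU
    proof (intro conjI allI impI)
      show "\<phi> ` U \<subseteq> topspace (top_of_set D)" by (simp add: D\<phi>)
      fix V assume "openin (top_of_set D) V"
      then obtain T where T: "open T" "V = D \<inter> T" by (auto simp: openin_open)
      have "{p \<in> U. \<phi> p \<in> V} = {p \<in> U. \<phi> p \<in> T}" by (auto simp: T(2) D\<phi>)
      then show "openin (subtopology X U) {p \<in> U. \<phi> p \<in> V}"
        using cont[OF T(1)] by (auto simp: openin_open_subtopology[OF U(1)])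
    qed
    show "open_map (subtopology X U) (top_of_set D) \<phi>"
      unfolding open_map_def
    proof (intro allI impI)
      fix N assume "openin (subtopology X U) N"
      then have "openin X N" "N \<subseteq> U" by (auto simp: openin_open_subtopology[OF U(1)])
      then have "openin (top_of_set (M \<times> M)) (\<phi> ` N)" "\<phi> ` N \<subseteq> D" using open\<phi> D\<phi> by auto
      then show "openin (top_of_set D) (\<phi> ` N)"
        by (rule openin_subset_trans) (simp add: D_def)
    qed
    show "\<phi> ` topspace (subtopology X U) = topspace (top_of_set D)" by (simp only: topU D\<phi> topspace_euclidean_subtopology)
    show "inj_on \<phi> (topspace (subtopology X U))" by (simp only: topU inj)
  qed
  \<comment> \<open>Every point over \<open>N\<close> can be moved by the group into the ball, where
    \<open>\<phi>\<close> is given by the ambient holomorphic map \<open>\<kappa>\<close>.\<close>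
  have sheaf1: "(\<lambda>x. k (\<phi> x)) \<in> Sh N" if N: "openin X N" "N \<subseteq> U" and k: "analytic_fun (\<phi> ` N) k" for N k
    unfolding stratum_sheaf_def mem_Collect_eq analytic_fun_def
  proof
    let ?P = "{u \<in> translates \<H> L. refl_orbit \<H> u \<in> N}"
    fix u assume "u \<in> ?P"
    then have u: "u \<in> translates \<H> L" "refl_orbit \<H> u \<in> N" by auto
    obtain w where w: "w \<in> W" "act w u \<in> ball z \<epsilon>" using local\<kappa>[of u] u(2) N(2) by blast
    obtain V k' where V: "open V" "\<phi> (refl_orbit \<H> u) \<in> V" "holomorphic_EC k' V" "\<forall>y\<in>V \<inter> \<phi> ` N. k y = k' y"
      using k[unfolded analytic_fun_def] u(2) by blast
    let ?A = "{u. act w u \<in> ball z \<epsilon> \<and> \<kappa> (act w u) \<in> V}"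
    have "holomorphic_EC (\<lambda>u. k' (\<kappa> u)) (ball z \<epsilon> \<inter> \<kappa> -` V)"
      by (rule holomorphic_EC_compose[OF hol_map_subset[OF h\<kappa>] V(3)]) auto
    then have "holomorphic_EC (\<lambda>u. k' (\<kappa> (act w u))) ?A"
      by (rule holomorphic_EC_compose[OF hol_map_complex_action[OF W_aff_iso[OF w(1)]]]) auto
    moreover have "k (\<phi> (refl_orbit \<H> v)) = k' (\<kappa> (act w v))" if v: "v \<in> ?A \<inter> ?P" for v
    proof -
      have eq: "\<phi> (refl_orbit \<H> v) = \<kappa> (act w v)" using v \<phi>w[OF w(1), of v] by simp
      have "\<phi> (refl_orbit \<H> v) \<in> \<phi> ` N" using v by simp
      then show ?thesis using V(4) v by (simp add: eq)
    qed
    moreover have "u \<in> ?A" using \<phi>w[OF w u(1)] V(2) w(2) by simp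
    ultimately show "\<exists>A g. open A \<and> u \<in> A \<and> holomorphic_EC g A \<and> (\<forall>v\<in>A \<inter> ?P. k (\<phi> (refl_orbit \<H> v)) = g v)"
      using open\<kappa>[OF w(1) V(1)] by blast
  qed
  have sheaf2: "analytic_fun (\<phi> ` N) k" if N: "openin X N" "N \<subseteq> U" and k: "(\<lambda>x. k (\<phi> x)) \<in> Sh N" for N k
  proof -
    \<comment> \<open>The fibres of \<open>\<Phi>\<close> are orbits of isometries that commute with
      the projection and come from the stabilizer, so \<open>G0 N\<close> is a union of fibres and
      the descent property of \<open>\<Phi>\<close> can be applied to its image.\<close>
    have sat: "{v. \<Phi> v \<in> \<Phi> ` G0 N} = G0 N"
    proof (intro equalityI subsetI)
      fix v assume "v \<in> {v. \<Phi> v \<in> \<Phi> ` G0 N}"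
      then have "\<Phi> v \<in> \<Phi> ` G0 N" by simp
      then obtain v' where v': "\<Phi> v = \<Phi> v'" "v' \<in> G0 N" by (rule imageE)
      obtain l where l: "l \<in> LStab" "v = map_prod (ext l) (ext l) v'" using \<Phi>(3)[OF v'(1)[symmetric]] by (auto simp: F_def)
      have "norm v = norm v'"
        using orthogonal_transformation_norm[OF ext_orth[OF l(1)]] by (cases v') (simp add: l(2) norm_Pair)
      moreover have "cproj M v = map_prod (lin l) (lin l) (cproj M v')"
        by (cases v') (simp add: l(2) cproj_def proj_ext[OF l(1)])
      then have "z + cproj M v = act l (z + cproj M v')"
        using Stab_diff[OF LStab(1)[OF l(1)], of "z + cproj M v'"] by (simp add: algebra_simps)
      then have "refl_orbit \<H> (z + cproj M v) = refl_orbit \<H> (z + cproj M v')"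
        using orbit_act[OF Stab_W[OF LStab(1)[OF l(1)]]] by simp
      ultimately show "v \<in> G0 N" using v'(2) by (simp add: G0_def)
    qed blast
    \<comment> \<open>Pulled back along \<open>\<Phi>\<close>, the function becomes the given
      section evaluated on the sheet of \<open>L\<close>, where a local ambient representative is at
      hand.\<close>
    have hol: "holomorphic_EC (\<lambda>v. k (cproj M (\<Phi> v))) (G0 N)"
    proof (rule holomorphic_EC_locally)
      fix v assume v: "v \<in> G0 N"
      let ?P = "{u \<in> translates \<H> L. refl_orbit \<H> u \<in> N}"
      have P: "z + cproj M v \<in> ?P" if "v \<in> G0 N" for v
        using that LCt[OF proj_complexify] by (simp add: G0_def)
      have "analytic_fun ?P (\<lambda>u. k (\<phi> (refl_orbit \<H> u)))" using k by (simp add: stratum_sheaf_def)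
      then obtain \<delta> k' where k': "\<delta> > 0" "holomorphic_EC k' (ball (z + cproj M v) \<delta>)"
        "\<And>u. u \<in> ball (z + cproj M v) \<delta> \<Longrightarrow> u \<in> ?P \<Longrightarrow> k (\<phi> (refl_orbit \<H> u)) = k' u"
        by (rule analytic_funE[OF _ P[OF v]]) (rule that)
      let ?V = "G0 N \<inter> (\<lambda>v. z + cproj M v) -` ball (z + cproj M v) \<delta>"
      have "open ((\<lambda>v. z + cproj M v) -` ball (z + cproj M v) \<delta>)"
        by (rule open_vimage[OF open_ball]) (intro continuous_intros hol_map_continuous_on[OF hol_map_cproj])
      then have oV: "open ?V" using openG0[OF N(1)] by blast
      have "hol_map (\<lambda>v. z + cproj M v) ?V" by (intro hol_map_add hol_map_const hol_map_cproj)
      then have h: "holomorphic_EC (\<lambda>v. k' (z + cproj M v)) ?V"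
        by (rule holomorphic_EC_compose[OF _ k'(2)]) auto
      have eq: "k' (z + cproj M x) = k (cproj M (\<Phi> x))" if x: "x \<in> ?V" for x
      proof -
        have "k (\<phi> (refl_orbit \<H> (z + cproj M x))) = k' (z + cproj M x)" using x by (intro k'(3) P) auto
        moreover have "\<phi> (refl_orbit \<H> (z + cproj M x)) = cproj M (\<Phi> x)"
          using \<phi>\<Phi>[OF zdiff proj_complexify, of x] x \<Phi>(4) by (simp add: G0_def)
        ultimately show ?thesis by simp
      qed
      show "\<exists>V. v \<in> V \<and> holomorphic_EC (\<lambda>v. k (cproj M (\<Phi> v))) V"
      proof (intro exI[of _ ?V] conjI)
        show "v \<in> ?V" using v k'(1) by simp
        show "holomorphic_EC (\<lambda>v. k (cproj M (\<Phi> v))) ?V" by (rule holomorphic_EC_cong[OF oV eq h])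
      qed
    qed
    have o: "open (\<Phi> ` G0 N)" by (rule \<Phi>(6)[OF openG0[OF N(1)]])
    have "holomorphic_EC (\<lambda>y. k (cproj M y)) (\<Phi> ` G0 N)"
      by (rule \<Phi>(7)[OF o]) (use sat hol in simp)
    moreover have "k y = k (cproj M y)" if "y \<in> \<phi> ` N" for y
      using that cproj_id[OF M_subspace, of y] by (simp add: \<phi>N[OF N(2)])
    ultimately show ?thesis
      unfolding analytic_fun_def using o \<phi>N[OF N(2)] by (intro ballI exI[of _ "\<Phi> ` G0 N"] exI[of _ "\<lambda>y. k (cproj M y)"]) auto
  qed
  show ?thesis
    by (rule exI[of _ U], rule exI[of _ M], rule exI[of _ D], rule exI[of _ \<phi>])
      (intro conjI U M_subspace openD hom allI impI; elim conjE; intro iffI; (rule sheaf1 sheaf2; assumption))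
qed

end

theorem (in arrangement) normal_imp_smooth:
  assumes normal: "normal_variety X Sh" shows "smooth_variety X Sh"
  unfolding smooth_variety_def
proof
  fix p assume "p \<in> topspace X"
  then obtain u where u: "u \<in> translates \<H> L" "p = refl_orbit \<H> u" by (auto simp: topspace_stratum)
  then obtain w z where w: "w \<in> W" "z \<in> complexify L" "u = act w z" unfolding translates_iff by blast
  have p: "p = refl_orbit \<H> z" using u(2) w(3) orbit_act[OF w(1)] by simp
  obtain e where "slice_point \<H> L z e" by (rule slice_point_exists[OF w(2)])
  then interpret slice_point \<H> L z e .
  show "\<exists>U (M::'a set) D (\<phi>::('a \<times> 'a) set \<Rightarrow> 'a \<times> 'a).
        openin X U \<and> p \<in> U \<and>
        subspace M \<and> openin (top_of_set (M \<times> M)) D \<and>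
        homeomorphic_map (subtopology X U) (top_of_set D) \<phi> \<and>
        (\<forall>N g. openin X N \<and> N \<subseteq> U \<longrightarrow>
           (analytic_fun (\<phi> ` N) g \<longleftrightarrow> (\<lambda>x. g (\<phi> x)) \<in> Sh N))"
    unfolding p by (rule local_chart[OF normal])
qed

theorem corollary8p1:
  fixes \<H> :: "'a::euclidean_space set set" and L :: "'a set"
  assumes "admissible \<H>" and "flat \<H> L"
  shows "smooth_variety (stratum \<H> L) (stratum_sheaf \<H> L) \<longleftrightarrow>
         normal_variety (stratum \<H> L) (stratum_sheaf \<H> L)"
proof
  show "normal_variety (stratum \<H> L) (stratum_sheaf \<H> L)" if "smooth_variety (stratum \<H> L) (stratum_sheaf \<H> L)"
    using that by (rule smooth_imp_normal)
  interpret arrangement \<H> L using assms by unfold_locales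
  show "smooth_variety (stratum \<H> L) (stratum_sheaf \<H> L)" if "normal_variety (stratum \<H> L) (stratum_sheaf \<H> L)"
    using that by (rule normal_imp_smooth)
qed

end
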